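(* Let $\mathcal A$ be an irreducible Möbius net and let $Q=(\mathcal H_a,\mu,\iota)$ be a $C^*$-Frobenius algebra in $\mathrm{Rep}(\mathcal A)$. For each left $Q$-module $(\mathcal H_i,\mu_i)$, let $(\mathcal H_i,\pi_i)$ be the corresponding $(\mathcal B_Q,\mathcal A)$-module, characterized by $\pi_{i,\widetilde I}\big(\mu L(\xi,\widetilde I)|_{\mathcal H_a}\big)=\mu_i L(\xi,\widetilde I)|_{\mathcal H_i}$ for all $\widetilde I\in\widetilde{\mathcal J}$, $\xi\in\mathcal H_a(I)$. Then for any left $Q$-modules $\mathcal H_i,\mathcal H_j$ we have $\mathrm{Hom}^{\mathrm L}_Q(\mathcal H_i,\mathcal H_j)=\mathrm{Hom}_{\mathcal B_Q}(\mathcal H_i,\mathcal H_j)$. Therefore, the $*$-functor $\mathfrak F:\mathrm{Rep}^{\mathrm L}(Q)\to\mathrm{Rep}(\mathcal B_Q,\mathcal A)$ sending each object $(\mathcal H_i,\mu_i)$ to $(\mathcal H_i,\pi_i)$ and each morphism $T\in\mathrm{Hom}^{\mathrm L}_Q(\mathcal H_i,\mathcal H_j)$ to $T\in\mathrm{Hom}_{\mathcal B_Q}(\mathcal H_i,\mathcal H_j)$ is an isomorphism of $C^*$-categories.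
   Context: Conventions. Hilbert spaces are separable; $\mathrm{Hom}(\mathcal H,\mathcal K)$ is the set of bounded operators. A square of bounded operators $C:P\to R_1$, $A:P\to R_2$, $B:R_1\to S$, $D:R_2\to S$ commutes adjointly if $DA=BC$ and $CA^*=B^*D$. Nets. $\mathcal J$ is the set of non-empty non-dense open intervals of $\mathbb S^1$; for $I\in\mathcal J$, $I'$ is the interior of its complement. A Möbius net $\mathcal A$ assigns to each $I\in\mathcal J$ a von Neumann algebra $\mathcal A(I)$ on a fixed Hilbert space $\mathcal H_0$ such that: $I_1\subset I_2$ implies $\mathcal A(I_1)\subset\mathcal A(I_2)$; $\mathcal A(I_1),\mathcal A(I_2)$ commute if $I_1\cap I_2=\emptyset$; there is a strongly continuous unitary representation $U$ of $\mathrm{PSU}(1,1)$ on $\mathcal H_0$ with $U(g)\mathcal A(I)U(g)^*=\mathcal A(gI)$; the generator of the rotation subgroup is positive; there is a $\mathrm{PSU}(1,1)$-invariant unit vector $\Omega$ (the vacuum vector) cyclic for $\bigvee_I\mathcal A(I)$. It is irreducible if only scalars commute with all $\mathcal A(I)$. $\mathcal A$ is a fixed irreducible Möbius net. Modules. An $\mathcal A$-module is a Hilbert space $\mathcal H_i$ with normal unital representations $\pi_{i,I}$ of $\mathcal A(I)$ ($I\in\mathcal J$) such that $\pi_{i,J}|_{\mathcal A(I)}=\pi_{i,I}$ if $I\subset J$; we write $x\xi=\pi_{i,I}(x)\xi$. $\mathcal H_0$ is an $\mathcal A$-module. $\mathrm{Hom}_{\mathcal A}(\mathcal H_i,\mathcal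 H_j)$ is the set of bounded operators intertwining all actions of $\mathcal A(I)$, $I\in\mathcal J$. $\mathrm{Rep}(\mathcal A)$ is the $C^*$-category of $\mathcal A$-modules. $\mathcal H_i(I)=\mathrm{Hom}_{\mathcal A(I')}(\mathcal H_0,\mathcal H_i)\Omega$, where $\mathrm{Hom}_{\mathcal A(I')}$ denotes bounded operators intertwining $\mathcal A(I')$. Arg-valued intervals. $\widetilde{\mathcal J}$ is the set of pairs $\widetilde I=(I,\arg_I)$ with $I\in\mathcal J$ and $\arg_I:I\to\mathbb R$ a continuous argument function. $\widetilde I\subset\widetilde J$ means $I\subset J$ and $\arg_J|_I=\arg_I$. $\widetilde J$ is clockwise to $\widetilde I$ (and $\widetilde I$ anticlockwise to $\widetilde J$) if $\arg_I(z)-2\pi<\arg_J(\zeta)<\arg_I(z)$ for all $z\in I,\zeta\in J$. $\widetilde I'$ is the largest arg-valued interval clockwise to $\widetilde I$. Fusion. $\mathrm{Rep}(\mathcal A)$ is equipped with its (unique up to equivalence) braided $C^*$-tensor structure $(\boxtimes,\beta)$ given by Connes fusion, with associators and unitors suppressed, together with the operators of the categorical extension: for all modules $\mathcal H_i,\mathcal H_k$, $\widetilde I\in\widetilde{\mathcal J}$, $\xi\in\mathcal H_i(I)$, bounded operators $L(\xi,\widetilde I)\in\mathrm{Hom}_{\mathcal A(I')}(\mathcal H_k,\mathcal H_i\boxtimes\mathcal H_k)$ and $R(\xi,\widetilde I)\in\mathrm{Hom}_{\mathcal A(I')}(\mathcal H_k,\mathcal H_k\boxtimes\mathcal H_i)$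 satisfying: (isotony) they are unchanged when $\widetilde I$ is replaced by a larger arg-valued interval; (functoriality) $(\mathbf 1_i\boxtimes G)L(\xi,\widetilde I)\eta=L(\xi,\widetilde I)G\eta$, $(G\boxtimes\mathbf 1_i)R(\xi,\widetilde I)\eta=R(\xi,\widetilde I)G\eta$ for morphisms $G$; (state-field) $L(\xi,\widetilde I)\Omega=R(\xi,\widetilde I)\Omega=\xi$; (density) $L(\mathcal H_i(I),\widetilde I)\mathcal H_k$ and $R(\mathcal H_i(I),\widetilde I)\mathcal H_k$ span dense subspaces of $\mathcal H_i\boxtimes\mathcal H_k$, $\mathcal H_k\boxtimes\mathcal H_i$; (locality) if $\widetilde J$ is clockwise to $\widetilde I$, $\xi\in\mathcal H_i(I)$, $\eta\in\mathcal H_j(J)$, then the square formed by $L(\xi,\widetilde I)$ and $R(\eta,\widetilde J)$ from $\mathcal H_k$ to $\mathcal H_i\boxtimes\mathcal H_k\boxtimes\mathcal H_j$ commutes adjointly; (braiding) $\beta_{i,j}L(\xi,\widetilde I)\eta=R(\xi,\widetilde I)\eta$ for $\xi\in\mathcal H_i(I),\eta\in\mathcal H_j$, where $\beta_{i,j}:\mathcal H_i\boxtimes\mathcal H_j\to\mathcal H_j\boxtimes\mathcal H_i$ is the unitary braiding. $C^*$-Frobenius algebras. A $C^*$-Frobenius algebra in $\mathrm{Rep}(\mathcal A)$ is $Q=(\mathcal H_a,\mu,\iota)$ with $\mathcal H_a$ an $\mathcal A$-module, $\mu\in\mathrm{Hom}_{\mathcal A}(\mathcal H_a\boxtimes\mathcal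 H_a,\mathcal H_a)$, $\iota\in\mathrm{Hom}_{\mathcal A}(\mathcal H_0,\mathcal H_a)$, $\mu(\iota\boxtimes\mathbf 1_a)=\mathbf 1_a=\mu(\mathbf 1_a\boxtimes\iota)$, such that the square with sides $\mathbf 1_a\boxtimes\mu$, $\mu\boxtimes\mathbf 1_a$, $\mu$, $\mu$ (from $\mathcal H_a^{\boxtimes 3}$ to $\mathcal H_a$) commutes adjointly. A left $Q$-module is $(\mathcal H_i,\mu_i)$ with $\mathcal H_i$ an $\mathcal A$-module, $\mu_i\in\mathrm{Hom}_{\mathcal A}(\mathcal H_a\boxtimes\mathcal H_i,\mathcal H_i)$, $\mu_i(\iota\boxtimes\mathbf 1_i)=\mathbf 1_i$, such that the square with sides $\mathbf 1_a\boxtimes\mu_i$, $\mu\boxtimes\mathbf 1_i$, $\mu_i$, $\mu_i$ (from $\mathcal H_a\boxtimes\mathcal H_a\boxtimes\mathcal H_i$ to $\mathcal H_i$) commutes adjointly. $\mathrm{Rep}^{\mathrm L}(Q)$ is the $C^*$-category of left $Q$-modules with morphism spaces $\mathrm{Hom}_Q^{\mathrm L}(\mathcal H_i,\mathcal H_j)=\{T\in\mathrm{Hom}_{\mathcal A}(\mathcal H_i,\mathcal H_j):T\mu_i=\mu_j(\mathbf 1_a\boxtimes T)\}$. Extensions. A (non-local) extension of $\mathcal A$ is $(\mathcal H_a,\mathcal B,\iota)$ with $\mathcal H_a$ an $\mathcal A$-module, $\iota\in\mathrm{Hom}_{\mathcal A}(\mathcal H_0,\mathcal H_a)$, and $\mathcal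 B$ assigning to each $\widetilde I\in\widetilde{\mathcal J}$ a von Neumann algebra $\mathcal B(\widetilde I)$ on $\mathcal H_a$ such that: $\pi_{a,I}(\mathcal A(I))\subset\mathcal B(\widetilde I)$; $\widetilde I\subset\widetilde J$ implies $\mathcal B(\widetilde I)\subset\mathcal B(\widetilde J)$; $\iota\Omega$ is cyclic and separating for each $\mathcal B(\widetilde I)$; $[\mathcal B(\widetilde I),\pi_{a,I'}(\mathcal A(I'))]=0$. For a $C^*$-Frobenius algebra $Q$, it is known that $\mathcal B_Q(\widetilde I)=\{\mu L(\xi,\widetilde I)|_{\mathcal H_a}:\xi\in\mathcal H_a(I)\}$ defines an extension $(\mathcal H_a,\mathcal B_Q,\iota)$ of $\mathcal A$. $(\mathcal B,\mathcal A)$-modules. A $(\mathcal B,\mathcal A)$-module is an $\mathcal A$-module $\mathcal H_i$ with normal representations $\pi_{i,\widetilde I}$ of $\mathcal B(\widetilde I)$ on $\mathcal H_i$ for all $\widetilde I\in\widetilde{\mathcal J}$ such that $\pi_{i,I}=\pi_{i,\widetilde I}\circ\pi_{a,I}$ on $\mathcal A(I)$, and $\pi_{i,\widetilde J}|_{\mathcal B(\widetilde I)}=\pi_{i,\widetilde I}$ if $\widetilde I\subset\widetilde J$. $\mathrm{Rep}(\mathcal B,\mathcal A)$ is the $C^*$-category of $(\mathcal B,\mathcal A)$-modules, with morphism spaces $\mathrm{Hom}_{\mathcal B}(\mathcal H_i,\mathcal H_j)$ the bounded operators $T$ with $T\pi_{i,\widetilde I}(X)=\pi_{j,\widetilde I}(X)T$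 for all $\widetilde I$ and $X\in\mathcal B(\widetilde I)$. *)

theory Defs
  imports "HOL-Analysis.Analysis"
begin

section \<open>Hilbert spaces and bounded operators\<close>

text \<open>Hilbert spaces are structures on a subset of a universe type, so that one can quantify over
  all modules of a net. The universe is an arbitrary type variable. Inner products are
  conjugate-linear in the first argument.\<close>

record 'v hilb =
  carr :: "'v set"
  hzero :: 'v
  hadd :: "'v \<Rightarrow> 'v \<Rightarrow> 'v"
  hscale :: "complex \<Rightarrow> 'v \<Rightarrow> 'v"
  hip :: "'v \<Rightarrow> 'v \<Rightarrow> complex"

definition hdiff :: "('v, 'a) hilb_scheme \<Rightarrow> 'v \<Rightarrow> 'v \<Rightarrow> 'v" where
  "hdiff H x y = hadd H x (hscale H (-1) y)"

definition hnorm :: "('v, 'a) hilb_scheme \<Rightarrow> 'v \<Rightarrow> real" where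
  "hnorm H x = sqrt (Re (hip H x x))"

definition hdense :: "('v, 'a) hilb_scheme \<Rightarrow> 'v set \<Rightarrow> bool" where
  "hdense H D \<longleftrightarrow> D \<subseteq> carr H \<and> (\<forall>x\<in>carr H. \<forall>e>0. \<exists>d\<in>D. hnorm H (hdiff H x d) < e)"

definition complex_inner_product_space :: "('v, 'a) hilb_scheme \<Rightarrow> bool" where
  "complex_inner_product_space H \<longleftrightarrow>
     hzero H \<in> carr H \<and>
     (\<forall>x\<in>carr H. \<forall>y\<in>carr H. hadd H x y \<in> carr H) \<and>
     (\<forall>c. \<forall>x\<in>carr H. hscale H c x \<in> carr H) \<and>
     (\<forall>x\<in>carr H. \<forall>y\<in>carr H. \<forall>z\<in>carr H. hadd H (hadd H x y) z = hadd H x (hadd H y z)) \<and>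
     (\<forall>x\<in>carr H. \<forall>y\<in>carr H. hadd H x y = hadd H y x) \<and>
     (\<forall>x\<in>carr H. hadd H (hzero H) x = x) \<and>
     (\<forall>x\<in>carr H. hdiff H x x = hzero H) \<and>
     (\<forall>c. \<forall>x\<in>carr H. \<forall>y\<in>carr H. hscale H c (hadd H x y) = hadd H (hscale H c x) (hscale H c y)) \<and>
     (\<forall>c d. \<forall>x\<in>carr H. hscale H (c + d) x = hadd H (hscale H c x) (hscale H d x)) \<and>
     (\<forall>c d. \<forall>x\<in>carr H. hscale H (c * d) x = hscale H c (hscale H d x)) \<and>
     (\<forall>x\<in>carr H. hscale H 1 x = x) \<and>
     (\<forall>x\<in>carr H. \<forall>y\<in>carr H. hip H x y = cnj (hip H y x)) \<and>
     (\<forall>x\<in>carr H. \<forall>y\<in>carr H. \<forall>z\<in>carr H. hip H x (hadd H y z) = hip H x y + hip H x z) \<and>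
     (\<forall>c. \<forall>x\<in>carr H. \<forall>y\<in>carr H. hip H x (hscale H c y) = c * hip H x y) \<and>
     (\<forall>x\<in>carr H. hip H x x \<in> \<real>\<^sub>\<ge>\<^sub>0) \<and>
     (\<forall>x\<in>carr H. hip H x x = 0 \<longrightarrow> x = hzero H)"

definition hilbert_space :: "('v, 'a) hilb_scheme \<Rightarrow> bool" where
  "hilbert_space H \<longleftrightarrow>
     complex_inner_product_space H \<and>
     (\<forall>X :: nat \<Rightarrow> 'v. (\<forall>n. X n \<in> carr H) \<and>
        (\<forall>e>0. \<exists>N. \<forall>m\<ge>N. \<forall>n\<ge>N. hnorm H (hdiff H (X m) (X n)) < e) \<longrightarrow>
        (\<exists>x\<in>carr H. (\<lambda>n. hnorm H (hdiff H (X n) x)) \<longlonglongrightarrow> 0)) \<and>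
     (\<exists>D. countable D \<and> hdense H D)"

inductive_set hspan :: "('v, 'a) hilb_scheme \<Rightarrow> 'v set \<Rightarrow> 'v set"
  for H :: "('v, 'a) hilb_scheme" and S :: "'v set" where
  zero: "hzero H \<in> hspan H S"
| step: "x \<in> S \<Longrightarrow> y \<in> hspan H S \<Longrightarrow> hadd H (hscale H c x) y \<in> hspan H S"

text \<open>Operators are extensional functions (undefined outside the carrier of the domain), so that
  equality of operators is equality of functions and composition is
  \<^const>\<open>compose\<close> on the carrier of the domain.\<close>

definition bdd_ops :: "('v, 'a) hilb_scheme \<Rightarrow> ('v, 'b) hilb_scheme \<Rightarrow> ('v \<Rightarrow> 'v) set" where
  "bdd_ops H K = {T \<in> carr H \<rightarrow>\<^sub>E carr K.
     (\<forall>x\<in>carr H. \<forall>y\<in>carr H. T (hadd H x y) = hadd K (T x) (T y)) \<and>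
     (\<forall>c. \<forall>x\<in>carr H. T (hscale H c x) = hscale K c (T x)) \<and>
     (\<exists>C. \<forall>x\<in>carr H. hnorm K (T x) \<le> C * hnorm H x)}"

definition op_id :: "('v, 'a) hilb_scheme \<Rightarrow> 'v \<Rightarrow> 'v" where
  "op_id H = (\<lambda>x\<in>carr H. x)"

definition op_zero :: "('v, 'a) hilb_scheme \<Rightarrow> ('v, 'b) hilb_scheme \<Rightarrow> 'v \<Rightarrow> 'v" where
  "op_zero H K = (\<lambda>x\<in>carr H. hzero K)"

definition op_add ::
    "('v, 'a) hilb_scheme \<Rightarrow> ('v, 'b) hilb_scheme \<Rightarrow> ('v \<Rightarrow> 'v) \<Rightarrow> ('v \<Rightarrow> 'v) \<Rightarrow> 'v \<Rightarrow> 'v" where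
  "op_add H K S T = (\<lambda>x\<in>carr H. hadd K (S x) (T x))"

definition op_scale ::
    "('v, 'a) hilb_scheme \<Rightarrow> ('v, 'b) hilb_scheme \<Rightarrow> complex \<Rightarrow> ('v \<Rightarrow> 'v) \<Rightarrow> 'v \<Rightarrow> 'v" where
  "op_scale H K c T = (\<lambda>x\<in>carr H. hscale K c (T x))"

definition op_norm :: "('v, 'a) hilb_scheme \<Rightarrow> ('v, 'b) hilb_scheme \<Rightarrow> ('v \<Rightarrow> 'v) \<Rightarrow> real" where
  "op_norm H K T = (SUP x\<in>{x\<in>carr H. hnorm H x \<le> 1}. hnorm K (T x))"

definition adj ::
    "('v, 'a) hilb_scheme \<Rightarrow> ('v, 'b) hilb_scheme \<Rightarrow> ('v \<Rightarrow> 'v) \<Rightarrow> 'v \<Rightarrow> 'v" where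
  "adj H K T = (THE S. S \<in> bdd_ops K H \<and>
     (\<forall>x\<in>carr H. \<forall>y\<in>carr K. hip K y (T x) = hip H (S y) x))"

definition unitary_op ::
    "('v, 'a) hilb_scheme \<Rightarrow> ('v, 'b) hilb_scheme \<Rightarrow> ('v \<Rightarrow> 'v) \<Rightarrow> bool" where
  "unitary_op H K T \<longleftrightarrow> T \<in> bdd_ops H K \<and>
     compose (carr H) (adj H K T) T = op_id H \<and> compose (carr K) T (adj H K T) = op_id K"

text \<open>The square \<open>C : P \<rightarrow> R1\<close>, \<open>A : P \<rightarrow> R2\<close>, \<open>B : R1 \<rightarrow> S\<close>, \<open>D : R2 \<rightarrow> S\<close>.\<close>

definition commutes_adjointly ::
    "('v, 'a) hilb_scheme \<Rightarrow> ('v, 'b) hilb_scheme \<Rightarrow> ('v, 'c) hilb_scheme \<Rightarrow> ('v, 'd) hilb_scheme \<Rightarrow>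
     ('v \<Rightarrow> 'v) \<Rightarrow> ('v \<Rightarrow> 'v) \<Rightarrow> ('v \<Rightarrow> 'v) \<Rightarrow> ('v \<Rightarrow> 'v) \<Rightarrow> bool" where
  "commutes_adjointly P R1 R2 S C A B D \<longleftrightarrow>
     compose (carr P) D A = compose (carr P) B C \<and>
     compose (carr R2) C (adj P R2 A) = compose (carr R2) (adj R1 S B) D"


section \<open>Von Neumann algebras and normal representations\<close>

definition commutant :: "('v, 'a) hilb_scheme \<Rightarrow> ('v \<Rightarrow> 'v) set \<Rightarrow> ('v \<Rightarrow> 'v) set" where
  "commutant H M = {T \<in> bdd_ops H H. \<forall>S\<in>M. compose (carr H) S T = compose (carr H) T S}"

definition von_neumann_algebra :: "('v, 'a) hilb_scheme \<Rightarrow> ('v \<Rightarrow> 'v) set \<Rightarrow> bool" where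
  "von_neumann_algebra H M \<longleftrightarrow>
     M \<subseteq> bdd_ops H H \<and> (\<forall>S\<in>M. adj H H S \<in> M) \<and> commutant H (commutant H M) = M"

definition self_adjoint_ops :: "('v, 'a) hilb_scheme \<Rightarrow> ('v \<Rightarrow> 'v) set" where
  "self_adjoint_ops H = {T \<in> bdd_ops H H. adj H H T = T}"

definition op_le :: "('v, 'a) hilb_scheme \<Rightarrow> ('v \<Rightarrow> 'v) \<Rightarrow> ('v \<Rightarrow> 'v) \<Rightarrow> bool" where
  "op_le H S T \<longleftrightarrow> (\<forall>x\<in>carr H. Re (hip H x (S x)) \<le> Re (hip H x (T x)))"

definition op_lub :: "('v, 'a) hilb_scheme \<Rightarrow> ('v \<Rightarrow> 'v) set \<Rightarrow> ('v \<Rightarrow> 'v) \<Rightarrow> bool" where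
  "op_lub H D X \<longleftrightarrow> X \<in> self_adjoint_ops H \<and> (\<forall>S\<in>D. op_le H S X) \<and>
     (\<forall>Y\<in>self_adjoint_ops H. (\<forall>S\<in>D. op_le H S Y) \<longrightarrow> op_le H X Y)"

text \<open>Normality: suprema of bounded increasing nets of self-adjoint elements are preserved.\<close>

definition normal_rep ::
    "('v, 'a) hilb_scheme \<Rightarrow> ('v \<Rightarrow> 'v) set \<Rightarrow> ('v, 'b) hilb_scheme \<Rightarrow>
     (('v \<Rightarrow> 'v) \<Rightarrow> ('v \<Rightarrow> 'v)) \<Rightarrow> bool" where
  "normal_rep H M K p \<longleftrightarrow>
     p \<in> M \<rightarrow>\<^sub>E bdd_ops K K \<and>
     (\<forall>S\<in>M. \<forall>T\<in>M. p (op_add H H S T) = op_add K K (p S) (p T)) \<and>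
     (\<forall>c. \<forall>S\<in>M. p (op_scale H H c S) = op_scale K K c (p S)) \<and>
     (\<forall>S\<in>M. \<forall>T\<in>M. p (compose (carr H) S T) = compose (carr K) (p S) (p T)) \<and>
     (\<forall>S\<in>M. p (adj H H S) = adj K K (p S)) \<and>
     p (op_id H) = op_id K \<and>
     (\<forall>D X. D \<noteq> {} \<and> D \<subseteq> M \<inter> self_adjoint_ops H \<and>
        (\<forall>S\<in>D. \<forall>T\<in>D. \<exists>W\<in>D. op_le H S W \<and> op_le H T W) \<and>
        X \<in> M \<and> op_lub H D X \<longrightarrow> op_lub K (p ` D) (p X))"


section \<open>Intervals of the circle and the group PSU(1,1)\<close>

abbreviation circle :: "complex set" where
  "circle \<equiv> sphere 0 1"

definition intervals :: "complex set set" where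
  "intervals = {I. (\<exists>a b. a < b \<and> I = cis ` {a<..<b}) \<and> \<not> circle \<subseteq> closure I}"

definition iopp :: "complex set \<Rightarrow> complex set" where
  "iopp I = (top_of_set circle) interior_of (circle - I)"

text \<open>Argument functions are extensional on their interval.\<close>

type_synonym argint = "complex set \<times> (complex \<Rightarrow> real)"

definition arg_intervals :: "argint set" where
  "arg_intervals = {(I, f). I \<in> intervals \<and> f \<in> extensional I \<and> continuous_on I f \<and>
     (\<forall>z\<in>I. z = cis (f z))}"

definition arg_sub :: "argint \<Rightarrow> argint \<Rightarrow> bool" where
  "arg_sub I J \<longleftrightarrow> fst I \<subseteq> fst J \<and> (\<forall>z\<in>fst I. snd J z = snd I z)"

definition clockwise_to :: "argint \<Rightarrow> argint \<Rightarrow> bool" where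
  "clockwise_to J I \<longleftrightarrow>
     (\<forall>z\<in>fst I. \<forall>w\<in>fst J. snd I z - 2 * pi < snd J w \<and> snd J w < snd I z)"

definition SU11 :: "(complex^2^2) set" where
  "SU11 = {g. g$2$2 = cnj (g$1$1) \<and> g$2$1 = cnj (g$1$2) \<and> det g = 1}"

definition moebius :: "complex^2^2 \<Rightarrow> complex \<Rightarrow> complex" where
  "moebius g z = (g$1$1 * z + g$1$2) / (g$2$1 * z + g$2$2)"

text \<open>\<open>rotation t\<close> acts as \<open>z \<mapsto> cis t * z\<close>; the half angle comes from the double
  cover SU(1,1) of PSU(1,1).\<close>

definition rotation :: "real \<Rightarrow> complex^2^2" where
  "rotation t = vector [vector [cis (t / 2), 0], vector [0, cis (- t / 2)]]"


section \<open>Moebius nets and their modules\<close>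

record 'v net = "'v hilb" +
  alg :: "complex set \<Rightarrow> ('v \<Rightarrow> 'v) set"
  Omega :: 'v

text \<open>A representation of PSU(1,1) is a representation of SU(1,1) with \<open>U (- g) = U g\<close>.\<close>

definition PSU11_rep :: "('v, 'a) hilb_scheme \<Rightarrow> (complex^2^2 \<Rightarrow> 'v \<Rightarrow> 'v) \<Rightarrow> bool" where
  "PSU11_rep H U \<longleftrightarrow>
     (\<forall>g\<in>SU11. unitary_op H H (U g) \<and> U (- g) = U g) \<and>
     (\<forall>g\<in>SU11. \<forall>h\<in>SU11. U (g ** h) = compose (carr H) (U g) (U h)) \<and>
     (\<forall>x\<in>carr H. \<forall>g\<in>SU11.
        ((\<lambda>h. hnorm H (hdiff H (U h x) (U g x))) \<longlongrightarrow> 0) (at g within SU11))"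

text \<open>The generator \<open>L\<close> is defined by \<open>U (rotation t) = exp (\<i> t L)\<close>: a vector \<open>x\<close> is in its
  domain, with \<open>L x = y\<close>, iff \<open>t \<mapsto> U (rotation t) x\<close> has derivative \<open>\<i> y\<close> at \<open>0\<close>.\<close>

definition rotation_generator_positive ::
    "('v, 'a) hilb_scheme \<Rightarrow> (complex^2^2 \<Rightarrow> 'v \<Rightarrow> 'v) \<Rightarrow> bool" where
  "rotation_generator_positive H U \<longleftrightarrow>
     (\<forall>x\<in>carr H. \<forall>y\<in>carr H.
        ((\<lambda>t. hnorm H (hdiff H (hscale H (1 / of_real t) (hdiff H (U (rotation t) x) x))
                               (hscale H \<i> y))) \<longlongrightarrow> 0) (at 0)
        \<longrightarrow> hip H x y \<in> \<real>\<^sub>\<ge>\<^sub>0)"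

definition moebius_net :: "'v net \<Rightarrow> bool" where
  "moebius_net N \<longleftrightarrow>
     hilbert_space N \<and>
     (\<forall>I\<in>intervals. von_neumann_algebra N (alg N I)) \<and>
     (\<forall>I\<in>intervals. \<forall>J\<in>intervals. I \<subseteq> J \<longrightarrow> alg N I \<subseteq> alg N J) \<and>
     (\<forall>I\<in>intervals. \<forall>J\<in>intervals. I \<inter> J = {} \<longrightarrow>
        (\<forall>S\<in>alg N I. \<forall>T\<in>alg N J. compose (carr N) S T = compose (carr N) T S)) \<and>
     Omega N \<in> carr N \<and> hnorm N (Omega N) = 1 \<and>
     hdense N {T (Omega N) |T. T \<in> commutant N (commutant N (\<Union>I\<in>intervals. alg N I))} \<and>
     (\<exists>U. PSU11_rep N U \<and> rotation_generator_positive N U \<and>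
        (\<forall>g\<in>SU11. U g (Omega N) = Omega N) \<and>
        (\<forall>g\<in>SU11. \<forall>I\<in>intervals.
           (\<lambda>S. compose (carr N) (U g) (compose (carr N) S (adj N N (U g)))) ` alg N I
             = alg N (moebius g ` I)))"

definition irreducible_moebius_net :: "'v net \<Rightarrow> bool" where
  "irreducible_moebius_net N \<longleftrightarrow> moebius_net N \<and>
     commutant N (\<Union>I\<in>intervals. alg N I) = {op_scale N N c (op_id N) |c. True}"

record 'v amod = "'v hilb" +
  act :: "complex set \<Rightarrow> ('v \<Rightarrow> 'v) \<Rightarrow> ('v \<Rightarrow> 'v)"

definition A_module :: "'v net \<Rightarrow> 'v amod \<Rightarrow> bool" where
  "A_module N M \<longleftrightarrow> hilbert_space M \<and>
     (\<forall>I\<in>intervals. normal_rep N (alg N I) M (act M I)) \<and>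
     (\<forall>I\<in>intervals. \<forall>J\<in>intervals. I \<subseteq> J \<longrightarrow> (\<forall>S\<in>alg N I. act M J S = act M I S))"

definition vac :: "'v net \<Rightarrow> 'v amod" where
  "vac N = \<lparr>carr = carr N, hzero = hzero N, hadd = hadd N, hscale = hscale N, hip = hip N,
            act = (\<lambda>I. \<lambda>S\<in>alg N I. S)\<rparr>"

definition Hom_loc :: "'v net \<Rightarrow> complex set \<Rightarrow> 'v amod \<Rightarrow> 'v amod \<Rightarrow> ('v \<Rightarrow> 'v) set" where
  "Hom_loc N I i j = {T \<in> bdd_ops i j.
     \<forall>S\<in>alg N I. compose (carr i) T (act i I S) = compose (carr i) (act j I S) T}"

definition Hom_A :: "'v net \<Rightarrow> 'v amod \<Rightarrow> 'v amod \<Rightarrow> ('v \<Rightarrow> 'v) set" where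
  "Hom_A N i j = {T \<in> bdd_ops i j. \<forall>I\<in>intervals. T \<in> Hom_loc N I i j}"

definition bdd_vecs :: "'v net \<Rightarrow> 'v amod \<Rightarrow> complex set \<Rightarrow> 'v set" where
  "bdd_vecs N i I = {T (Omega N) |T. T \<in> Hom_loc N (iopp I) (vac N) i}"


section \<open>Fusion and the categorical extension\<close>

text \<open>As operators do not record the modules between which they are considered, the tensor product
  \<open>tmap E i i' j j' F G\<close> of \<open>F : i \<rightarrow> i'\<close> and \<open>G : j \<rightarrow> j'\<close> is indexed by all four of them.
  Furthermore \<open>Lop E i k \<xi> I : k \<rightarrow> i \<boxtimes> k\<close>, \<open>Rop E i k \<xi> I : k \<rightarrow> k \<boxtimes> i\<close>,
  \<open>assoc E i j k : (i \<boxtimes> j) \<boxtimes> k \<rightarrow> i \<boxtimes> (j \<boxtimes> k)\<close>, \<open>lunit E i : \<H>\<^sub>0 \<boxtimes> i \<rightarrow> i\<close> and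
  \<open>runit E i : i \<boxtimes> \<H>\<^sub>0 \<rightarrow> i\<close>. Associators and unitors are explicit; no strictness is assumed.\<close>

record 'v cat_ext =
  tens :: "'v amod \<Rightarrow> 'v amod \<Rightarrow> 'v amod"  (infixl \<open>\<boxtimes>\<index>\<close> 70)
  tmap :: "'v amod \<Rightarrow> 'v amod \<Rightarrow> 'v amod \<Rightarrow> 'v amod \<Rightarrow> ('v \<Rightarrow> 'v) \<Rightarrow> ('v \<Rightarrow> 'v) \<Rightarrow> 'v \<Rightarrow> 'v"
  assoc :: "'v amod \<Rightarrow> 'v amod \<Rightarrow> 'v amod \<Rightarrow> 'v \<Rightarrow> 'v"
  lunit :: "'v amod \<Rightarrow> 'v \<Rightarrow> 'v"
  runit :: "'v amod \<Rightarrow> 'v \<Rightarrow> 'v"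
  braid :: "'v amod \<Rightarrow> 'v amod \<Rightarrow> 'v \<Rightarrow> 'v"
  Lop :: "'v amod \<Rightarrow> 'v amod \<Rightarrow> 'v \<Rightarrow> argint \<Rightarrow> 'v \<Rightarrow> 'v"
  Rop :: "'v amod \<Rightarrow> 'v amod \<Rightarrow> 'v \<Rightarrow> argint \<Rightarrow> 'v \<Rightarrow> 'v"

definition lwhisk ::
    "'v cat_ext \<Rightarrow> 'v amod \<Rightarrow> 'v amod \<Rightarrow> 'v amod \<Rightarrow> ('v \<Rightarrow> 'v) \<Rightarrow> 'v \<Rightarrow> 'v" where
  "lwhisk E i j j' G = tmap E i i j j' (op_id i) G"

definition rwhisk ::
    "'v cat_ext \<Rightarrow> 'v amod \<Rightarrow> 'v amod \<Rightarrow> ('v \<Rightarrow> 'v) \<Rightarrow> 'v amod \<Rightarrow> 'v \<Rightarrow> 'v" where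
  "rwhisk E i i' F j = tmap E i i' j j F (op_id j)"

definition tensor_bifunctor :: "'v net \<Rightarrow> 'v cat_ext \<Rightarrow> bool" where
  "tensor_bifunctor N E \<longleftrightarrow>
     (\<forall>i j. A_module N i \<and> A_module N j \<longrightarrow>
        A_module N (i \<boxtimes>\<^bsub>E\<^esub> j) \<and>
        tmap E i i j j (op_id i) (op_id j) = op_id (i \<boxtimes>\<^bsub>E\<^esub> j)) \<and>
     (\<forall>i i' j j'. A_module N i \<and> A_module N i' \<and> A_module N j \<and> A_module N j' \<longrightarrow>
        (\<forall>F\<in>Hom_A N i i'. \<forall>G\<in>Hom_A N j j'.
           tmap E i i' j j' F G \<in> Hom_A N (i \<boxtimes>\<^bsub>E\<^esub> j) (i' \<boxtimes>\<^bsub>E\<^esub> j') \<and>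
           adj (i \<boxtimes>\<^bsub>E\<^esub> j) (i' \<boxtimes>\<^bsub>E\<^esub> j') (tmap E i i' j j' F G)
             = tmap E i' i j' j (adj i i' F) (adj j j' G) \<and>
           (\<forall>c. tmap E i i' j j' (op_scale i i' c F) G
                  = op_scale (i \<boxtimes>\<^bsub>E\<^esub> j) (i' \<boxtimes>\<^bsub>E\<^esub> j') c (tmap E i i' j j' F G) \<and>
                tmap E i i' j j' F (op_scale j j' c G)
                  = op_scale (i \<boxtimes>\<^bsub>E\<^esub> j) (i' \<boxtimes>\<^bsub>E\<^esub> j') c (tmap E i i' j j' F G)) \<and>
           (\<forall>F'\<in>Hom_A N i i'. tmap E i i' j j' (op_add i i' F F') G
              = op_add (i \<boxtimes>\<^bsub>E\<^esub> j) (i' \<boxtimes>\<^bsub>E\<^esub> j') (tmap E i i' j j' F G) (tmap E i i' j j' F' G)) \<and>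
           (\<forall>G'\<in>Hom_A N j j'. tmap E i i' j j' F (op_add j j' G G')
              = op_add (i \<boxtimes>\<^bsub>E\<^esub> j) (i' \<boxtimes>\<^bsub>E\<^esub> j') (tmap E i i' j j' F G) (tmap E i i' j j' F G')))) \<and>
     (\<forall>i i' i'' j j' j''. A_module N i \<and> A_module N i' \<and> A_module N i'' \<and>
          A_module N j \<and> A_module N j' \<and> A_module N j'' \<longrightarrow>
        (\<forall>F\<in>Hom_A N i i'. \<forall>F'\<in>Hom_A N i' i''. \<forall>G\<in>Hom_A N j j'. \<forall>G'\<in>Hom_A N j' j''.
           tmap E i i'' j j'' (compose (carr i) F' F) (compose (carr j) G' G)
             = compose (carr (i \<boxtimes>\<^bsub>E\<^esub> j)) (tmap E i' i'' j' j'' F' G') (tmap E i i' j j' F G)))"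

definition associativity_constraints :: "'v net \<Rightarrow> 'v cat_ext \<Rightarrow> bool" where
  "associativity_constraints N E \<longleftrightarrow>
     (\<forall>i j k. A_module N i \<and> A_module N j \<and> A_module N k \<longrightarrow>
        assoc E i j k \<in> Hom_A N ((i \<boxtimes>\<^bsub>E\<^esub> j) \<boxtimes>\<^bsub>E\<^esub> k) (i \<boxtimes>\<^bsub>E\<^esub> (j \<boxtimes>\<^bsub>E\<^esub> k)) \<and>
        unitary_op ((i \<boxtimes>\<^bsub>E\<^esub> j) \<boxtimes>\<^bsub>E\<^esub> k) (i \<boxtimes>\<^bsub>E\<^esub> (j \<boxtimes>\<^bsub>E\<^esub> k)) (assoc E i j k)) \<and>
     (\<forall>i i' j j' k k'. A_module N i \<and> A_module N i' \<and> A_module N j \<and> A_module N j' \<and>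
          A_module N k \<and> A_module N k' \<longrightarrow>
        (\<forall>F\<in>Hom_A N i i'. \<forall>G\<in>Hom_A N j j'. \<forall>H\<in>Hom_A N k k'.
           compose (carr ((i \<boxtimes>\<^bsub>E\<^esub> j) \<boxtimes>\<^bsub>E\<^esub> k)) (assoc E i' j' k')
               (tmap E (i \<boxtimes>\<^bsub>E\<^esub> j) (i' \<boxtimes>\<^bsub>E\<^esub> j') k k' (tmap E i i' j j' F G) H)
             = compose (carr ((i \<boxtimes>\<^bsub>E\<^esub> j) \<boxtimes>\<^bsub>E\<^esub> k))
                 (tmap E i i' (j \<boxtimes>\<^bsub>E\<^esub> k) (j' \<boxtimes>\<^bsub>E\<^esub> k') F (tmap E j j' k k' G H)) (assoc E i j k))) \<and>
     (\<forall>i j k l. A_module N i \<and> A_module N j \<and> A_module N k \<and> A_module N l \<longrightarrow>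
        compose (carr (((i \<boxtimes>\<^bsub>E\<^esub> j) \<boxtimes>\<^bsub>E\<^esub> k) \<boxtimes>\<^bsub>E\<^esub> l))
            (assoc E i j (k \<boxtimes>\<^bsub>E\<^esub> l)) (assoc E (i \<boxtimes>\<^bsub>E\<^esub> j) k l)
          = compose (carr (((i \<boxtimes>\<^bsub>E\<^esub> j) \<boxtimes>\<^bsub>E\<^esub> k) \<boxtimes>\<^bsub>E\<^esub> l))
              (lwhisk E i ((j \<boxtimes>\<^bsub>E\<^esub> k) \<boxtimes>\<^bsub>E\<^esub> l) (j \<boxtimes>\<^bsub>E\<^esub> (k \<boxtimes>\<^bsub>E\<^esub> l)) (assoc E j k l))
              (compose (carr (((i \<boxtimes>\<^bsub>E\<^esub> j) \<boxtimes>\<^bsub>E\<^esub> k) \<boxtimes>\<^bsub>E\<^esub> l))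
                (assoc E i (j \<boxtimes>\<^bsub>E\<^esub> k) l)
                (rwhisk E ((i \<boxtimes>\<^bsub>E\<^esub> j) \<boxtimes>\<^bsub>E\<^esub> k) (i \<boxtimes>\<^bsub>E\<^esub> (j \<boxtimes>\<^bsub>E\<^esub> k)) (assoc E i j k) l)))"

definition unit_constraints :: "'v net \<Rightarrow> 'v cat_ext \<Rightarrow> bool" where
  "unit_constraints N E \<longleftrightarrow>
     (\<forall>i. A_module N i \<longrightarrow>
        lunit E i \<in> Hom_A N (vac N \<boxtimes>\<^bsub>E\<^esub> i) i \<and> unitary_op (vac N \<boxtimes>\<^bsub>E\<^esub> i) i (lunit E i) \<and>
        runit E i \<in> Hom_A N (i \<boxtimes>\<^bsub>E\<^esub> vac N) i \<and> unitary_op (i \<boxtimes>\<^bsub>E\<^esub> vac N) i (runit E i)) \<and>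
     (\<forall>i j. A_module N i \<and> A_module N j \<longrightarrow> (\<forall>F\<in>Hom_A N i j.
        compose (carr (vac N \<boxtimes>\<^bsub>E\<^esub> i)) (lunit E j) (lwhisk E (vac N) i j F)
          = compose (carr (vac N \<boxtimes>\<^bsub>E\<^esub> i)) F (lunit E i) \<and>
        compose (carr (i \<boxtimes>\<^bsub>E\<^esub> vac N)) (runit E j) (rwhisk E i j F (vac N))
          = compose (carr (i \<boxtimes>\<^bsub>E\<^esub> vac N)) F (runit E i))) \<and>
     (\<forall>i j. A_module N i \<and> A_module N j \<longrightarrow>
        compose (carr ((i \<boxtimes>\<^bsub>E\<^esub> vac N) \<boxtimes>\<^bsub>E\<^esub> j))
            (lwhisk E i (vac N \<boxtimes>\<^bsub>E\<^esub> j) j (lunit E j)) (assoc E i (vac N) j)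
          = rwhisk E (i \<boxtimes>\<^bsub>E\<^esub> vac N) i (runit E i) j)"

text \<open>The inverse of the (unitary) associator appears as its adjoint in the second hexagon.\<close>

definition braiding_constraints :: "'v net \<Rightarrow> 'v cat_ext \<Rightarrow> bool" where
  "braiding_constraints N E \<longleftrightarrow>
     (\<forall>i j. A_module N i \<and> A_module N j \<longrightarrow>
        braid E i j \<in> Hom_A N (i \<boxtimes>\<^bsub>E\<^esub> j) (j \<boxtimes>\<^bsub>E\<^esub> i) \<and>
        unitary_op (i \<boxtimes>\<^bsub>E\<^esub> j) (j \<boxtimes>\<^bsub>E\<^esub> i) (braid E i j)) \<and>
     (\<forall>i i' j j'. A_module N i \<and> A_module N i' \<and> A_module N j \<and> A_module N j' \<longrightarrow>
        (\<forall>F\<in>Hom_A N i i'. \<forall>G\<in>Hom_A N j j'.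
           compose (carr (i \<boxtimes>\<^bsub>E\<^esub> j)) (braid E i' j') (tmap E i i' j j' F G)
             = compose (carr (i \<boxtimes>\<^bsub>E\<^esub> j)) (tmap E j j' i i' G F) (braid E i j))) \<and>
     (\<forall>i j k. A_module N i \<and> A_module N j \<and> A_module N k \<longrightarrow>
        compose (carr ((i \<boxtimes>\<^bsub>E\<^esub> j) \<boxtimes>\<^bsub>E\<^esub> k)) (assoc E j k i)
            (compose (carr ((i \<boxtimes>\<^bsub>E\<^esub> j) \<boxtimes>\<^bsub>E\<^esub> k)) (braid E i (j \<boxtimes>\<^bsub>E\<^esub> k)) (assoc E i j k))
          = compose (carr ((i \<boxtimes>\<^bsub>E\<^esub> j) \<boxtimes>\<^bsub>E\<^esub> k))
              (lwhisk E j (i \<boxtimes>\<^bsub>E\<^esub> k) (k \<boxtimes>\<^bsub>E\<^esub> i) (braid E i k))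
              (compose (carr ((i \<boxtimes>\<^bsub>E\<^esub> j) \<boxtimes>\<^bsub>E\<^esub> k)) (assoc E j i k)
                (rwhisk E (i \<boxtimes>\<^bsub>E\<^esub> j) (j \<boxtimes>\<^bsub>E\<^esub> i) (braid E i j) k)) \<and>
        compose (carr (i \<boxtimes>\<^bsub>E\<^esub> (j \<boxtimes>\<^bsub>E\<^esub> k)))
            (adj ((k \<boxtimes>\<^bsub>E\<^esub> i) \<boxtimes>\<^bsub>E\<^esub> j) (k \<boxtimes>\<^bsub>E\<^esub> (i \<boxtimes>\<^bsub>E\<^esub> j)) (assoc E k i j))
            (compose (carr (i \<boxtimes>\<^bsub>E\<^esub> (j \<boxtimes>\<^bsub>E\<^esub> k))) (braid E (i \<boxtimes>\<^bsub>E\<^esub> j) k)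
              (adj ((i \<boxtimes>\<^bsub>E\<^esub> j) \<boxtimes>\<^bsub>E\<^esub> k) (i \<boxtimes>\<^bsub>E\<^esub> (j \<boxtimes>\<^bsub>E\<^esub> k)) (assoc E i j k)))
          = compose (carr (i \<boxtimes>\<^bsub>E\<^esub> (j \<boxtimes>\<^bsub>E\<^esub> k)))
              (rwhisk E (i \<boxtimes>\<^bsub>E\<^esub> k) (k \<boxtimes>\<^bsub>E\<^esub> i) (braid E i k) j)
              (compose (carr (i \<boxtimes>\<^bsub>E\<^esub> (j \<boxtimes>\<^bsub>E\<^esub> k)))
                (adj ((i \<boxtimes>\<^bsub>E\<^esub> k) \<boxtimes>\<^bsub>E\<^esub> j) (i \<boxtimes>\<^bsub>E\<^esub> (k \<boxtimes>\<^bsub>E\<^esub> j)) (assoc E i k j))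
                (lwhisk E i (j \<boxtimes>\<^bsub>E\<^esub> k) (k \<boxtimes>\<^bsub>E\<^esub> j) (braid E j k))))"

definition braided_cstar_tensor :: "'v net \<Rightarrow> 'v cat_ext \<Rightarrow> bool" where
  "braided_cstar_tensor N E \<longleftrightarrow> tensor_bifunctor N E \<and> associativity_constraints N E \<and>
     unit_constraints N E \<and> braiding_constraints N E"

definition ext_operators :: "'v net \<Rightarrow> 'v cat_ext \<Rightarrow> bool" where
  "ext_operators N E \<longleftrightarrow>
     (\<forall>i k. A_module N i \<and> A_module N k \<longrightarrow>
        (\<forall>I\<in>arg_intervals. \<forall>\<xi>\<in>bdd_vecs N i (fst I).
           Lop E i k \<xi> I \<in> Hom_loc N (iopp (fst I)) k (i \<boxtimes>\<^bsub>E\<^esub> k) \<and>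
           Rop E i k \<xi> I \<in> Hom_loc N (iopp (fst I)) k (k \<boxtimes>\<^bsub>E\<^esub> i)))"

definition ext_isotony :: "'v net \<Rightarrow> 'v cat_ext \<Rightarrow> bool" where
  "ext_isotony N E \<longleftrightarrow>
     (\<forall>i k. A_module N i \<and> A_module N k \<longrightarrow>
        (\<forall>I\<in>arg_intervals. \<forall>J\<in>arg_intervals. arg_sub I J \<longrightarrow>
           (\<forall>\<xi>\<in>bdd_vecs N i (fst I).
              Lop E i k \<xi> J = Lop E i k \<xi> I \<and> Rop E i k \<xi> J = Rop E i k \<xi> I)))"

definition ext_functoriality :: "'v net \<Rightarrow> 'v cat_ext \<Rightarrow> bool" where
  "ext_functoriality N E \<longleftrightarrow>
     (\<forall>i k k'. A_module N i \<and> A_module N k \<and> A_module N k' \<longrightarrow>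
        (\<forall>G\<in>Hom_A N k k'. \<forall>I\<in>arg_intervals. \<forall>\<xi>\<in>bdd_vecs N i (fst I). \<forall>\<eta>\<in>carr k.
           lwhisk E i k k' G (Lop E i k \<xi> I \<eta>) = Lop E i k' \<xi> I (G \<eta>) \<and>
           rwhisk E k k' G i (Rop E i k \<xi> I \<eta>) = Rop E i k' \<xi> I (G \<eta>)))"

definition ext_state_field :: "'v net \<Rightarrow> 'v cat_ext \<Rightarrow> bool" where
  "ext_state_field N E \<longleftrightarrow>
     (\<forall>i. A_module N i \<longrightarrow> (\<forall>I\<in>arg_intervals. \<forall>\<xi>\<in>bdd_vecs N i (fst I).
        runit E i (Lop E i (vac N) \<xi> I (Omega N)) = \<xi> \<and>
        lunit E i (Rop E i (vac N) \<xi> I (Omega N)) = \<xi>))"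

definition ext_density :: "'v net \<Rightarrow> 'v cat_ext \<Rightarrow> bool" where
  "ext_density N E \<longleftrightarrow>
     (\<forall>i k. A_module N i \<and> A_module N k \<longrightarrow> (\<forall>I\<in>arg_intervals.
        hdense (i \<boxtimes>\<^bsub>E\<^esub> k) (hspan (i \<boxtimes>\<^bsub>E\<^esub> k)
          {Lop E i k \<xi> I \<eta> |\<xi> \<eta>. \<xi> \<in> bdd_vecs N i (fst I) \<and> \<eta> \<in> carr k}) \<and>
        hdense (k \<boxtimes>\<^bsub>E\<^esub> i) (hspan (k \<boxtimes>\<^bsub>E\<^esub> i)
          {Rop E i k \<xi> I \<eta> |\<xi> \<eta>. \<xi> \<in> bdd_vecs N i (fst I) \<and> \<eta> \<in> carr k})))"

definition ext_locality :: "'v net \<Rightarrow> 'v cat_ext \<Rightarrow> bool" where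
  "ext_locality N E \<longleftrightarrow>
     (\<forall>i j k. A_module N i \<and> A_module N j \<and> A_module N k \<longrightarrow>
        (\<forall>I\<in>arg_intervals. \<forall>J\<in>arg_intervals. clockwise_to J I \<longrightarrow>
           (\<forall>\<xi>\<in>bdd_vecs N i (fst I). \<forall>\<eta>\<in>bdd_vecs N j (fst J).
              commutes_adjointly k (k \<boxtimes>\<^bsub>E\<^esub> j) (i \<boxtimes>\<^bsub>E\<^esub> k) (i \<boxtimes>\<^bsub>E\<^esub> (k \<boxtimes>\<^bsub>E\<^esub> j))
                (Rop E j k \<eta> J)
                (Lop E i k \<xi> I)
                (Lop E i (k \<boxtimes>\<^bsub>E\<^esub> j) \<xi> I)
                (compose (carr (i \<boxtimes>\<^bsub>E\<^esub> k)) (assoc E i k j) (Rop E j (i \<boxtimes>\<^bsub>E\<^esub> k) \<eta> J)))))"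

definition ext_braiding :: "'v net \<Rightarrow> 'v cat_ext \<Rightarrow> bool" where
  "ext_braiding N E \<longleftrightarrow>
     (\<forall>i j. A_module N i \<and> A_module N j \<longrightarrow>
        (\<forall>I\<in>arg_intervals. \<forall>\<xi>\<in>bdd_vecs N i (fst I). \<forall>\<eta>\<in>carr j.
           braid E i j (Lop E i j \<xi> I \<eta>) = Rop E i j \<xi> I \<eta>))"

definition categorical_extension :: "'v net \<Rightarrow> 'v cat_ext \<Rightarrow> bool" where
  "categorical_extension N E \<longleftrightarrow>
     braided_cstar_tensor N E \<and> ext_operators N E \<and> ext_isotony N E \<and> ext_functoriality N E \<and>
     ext_state_field N E \<and> ext_density N E \<and> ext_locality N E \<and> ext_braiding N E"


section \<open>C*-Frobenius algebras and left modules\<close>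

record 'v frob =
  fobj :: "'v amod"
  fmu :: "'v \<Rightarrow> 'v"
  fiota :: "'v \<Rightarrow> 'v"

definition cstar_frobenius_algebra :: "'v net \<Rightarrow> 'v cat_ext \<Rightarrow> 'v frob \<Rightarrow> bool" where
  "cstar_frobenius_algebra N E Q \<longleftrightarrow>
     (let a = fobj Q; \<mu> = fmu Q; \<iota> = fiota Q in
        A_module N a \<and> \<mu> \<in> Hom_A N (a \<boxtimes>\<^bsub>E\<^esub> a) a \<and> \<iota> \<in> Hom_A N (vac N) a \<and>
        compose (carr (vac N \<boxtimes>\<^bsub>E\<^esub> a)) \<mu> (rwhisk E (vac N) a \<iota> a) = lunit E a \<and>
        compose (carr (a \<boxtimes>\<^bsub>E\<^esub> vac N)) \<mu> (lwhisk E a (vac N) a \<iota>) = runit E a \<and>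
        commutes_adjointly ((a \<boxtimes>\<^bsub>E\<^esub> a) \<boxtimes>\<^bsub>E\<^esub> a) (a \<boxtimes>\<^bsub>E\<^esub> a) (a \<boxtimes>\<^bsub>E\<^esub> a) a
          (rwhisk E (a \<boxtimes>\<^bsub>E\<^esub> a) a \<mu> a)
          (compose (carr ((a \<boxtimes>\<^bsub>E\<^esub> a) \<boxtimes>\<^bsub>E\<^esub> a)) (lwhisk E a (a \<boxtimes>\<^bsub>E\<^esub> a) a \<mu>) (assoc E a a a))
          \<mu> \<mu>)"

definition left_modules :: "'v net \<Rightarrow> 'v cat_ext \<Rightarrow> 'v frob \<Rightarrow> ('v amod \<times> ('v \<Rightarrow> 'v)) set" where
  "left_modules N E Q = {(i, \<mu>i).
     (let a = fobj Q; \<mu> = fmu Q; \<iota> = fiota Q in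
        A_module N i \<and> \<mu>i \<in> Hom_A N (a \<boxtimes>\<^bsub>E\<^esub> i) i \<and>
        compose (carr (vac N \<boxtimes>\<^bsub>E\<^esub> i)) \<mu>i (rwhisk E (vac N) a \<iota> i) = lunit E i \<and>
        commutes_adjointly ((a \<boxtimes>\<^bsub>E\<^esub> a) \<boxtimes>\<^bsub>E\<^esub> i) (a \<boxtimes>\<^bsub>E\<^esub> i) (a \<boxtimes>\<^bsub>E\<^esub> i) i
          (rwhisk E (a \<boxtimes>\<^bsub>E\<^esub> a) a \<mu> i)
          (compose (carr ((a \<boxtimes>\<^bsub>E\<^esub> a) \<boxtimes>\<^bsub>E\<^esub> i)) (lwhisk E a (a \<boxtimes>\<^bsub>E\<^esub> i) i \<mu>i) (assoc E a a i))
          \<mu>i \<mu>i)}"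

definition Hom_left ::
    "'v net \<Rightarrow> 'v cat_ext \<Rightarrow> 'v frob \<Rightarrow> 'v amod \<times> ('v \<Rightarrow> 'v) \<Rightarrow> 'v amod \<times> ('v \<Rightarrow> 'v) \<Rightarrow>
     ('v \<Rightarrow> 'v) set" where
  "Hom_left N E Q = (\<lambda>(i, \<mu>i) (j, \<mu>j). {T \<in> Hom_A N i j.
     compose (carr (fobj Q \<boxtimes>\<^bsub>E\<^esub> i)) T \<mu>i
       = compose (carr (fobj Q \<boxtimes>\<^bsub>E\<^esub> i)) \<mu>j (lwhisk E (fobj Q) i j T)})"


section \<open>Modules of non-local extensions\<close>

type_synonym 'v bact = "argint \<Rightarrow> ('v \<Rightarrow> 'v) \<Rightarrow> ('v \<Rightarrow> 'v)"

definition BA_modules ::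
    "'v net \<Rightarrow> 'v amod \<Rightarrow> (argint \<Rightarrow> ('v \<Rightarrow> 'v) set) \<Rightarrow> ('v amod \<times> 'v bact) set" where
  "BA_modules N a B = {(i, p). A_module N i \<and> p \<in> extensional arg_intervals \<and>
     (\<forall>I\<in>arg_intervals. normal_rep a (B I) i (p I)) \<and>
     (\<forall>I\<in>arg_intervals. \<forall>S\<in>alg N (fst I). act i (fst I) S = p I (act a (fst I) S)) \<and>
     (\<forall>I\<in>arg_intervals. \<forall>J\<in>arg_intervals. arg_sub I J \<longrightarrow> (\<forall>X\<in>B I. p J X = p I X))}"

definition Hom_BA ::
    "(argint \<Rightarrow> ('v \<Rightarrow> 'v) set) \<Rightarrow> 'v amod \<times> 'v bact \<Rightarrow> 'v amod \<times> 'v bact \<Rightarrow> ('v \<Rightarrow> 'v) set" where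
  "Hom_BA B = (\<lambda>(i, p) (j, q). {T \<in> bdd_ops i j. \<forall>I\<in>arg_intervals. \<forall>X\<in>B I.
     compose (carr i) T (p I X) = compose (carr i) (q I X) T})"

definition BQ :: "'v net \<Rightarrow> 'v cat_ext \<Rightarrow> 'v frob \<Rightarrow> argint \<Rightarrow> ('v \<Rightarrow> 'v) set" where
  "BQ N E Q I = {compose (carr (fobj Q)) (fmu Q) (Lop E (fobj Q) (fobj Q) \<xi> I) |\<xi>.
     \<xi> \<in> bdd_vecs N (fobj Q) (fst I)}"

definition corresponds ::
    "'v net \<Rightarrow> 'v cat_ext \<Rightarrow> 'v frob \<Rightarrow> 'v amod \<times> ('v \<Rightarrow> 'v) \<Rightarrow> 'v bact \<Rightarrow> bool" where
  "corresponds N E Q = (\<lambda>(i, \<mu>i) p. (i, p) \<in> BA_modules N (fobj Q) (BQ N E Q) \<and>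
     (\<forall>I\<in>arg_intervals. \<forall>\<xi>\<in>bdd_vecs N (fobj Q) (fst I).
        p I (compose (carr (fobj Q)) (fmu Q) (Lop E (fobj Q) (fobj Q) \<xi> I))
          = compose (carr i) \<mu>i (Lop E (fobj Q) i \<xi> I)))"

definition BA_of_left ::
    "'v net \<Rightarrow> 'v cat_ext \<Rightarrow> 'v frob \<Rightarrow> 'v amod \<times> ('v \<Rightarrow> 'v) \<Rightarrow> 'v amod \<times> 'v bact" where
  "BA_of_left N E Q X = (fst X, THE p. corresponds N E Q X p)"


section \<open>C*-categories\<close>

text \<open>\<open>ccomp C a b c g f\<close> is the composite of \<open>f : a \<rightarrow> b\<close> and \<open>g : b \<rightarrow> c\<close>.\<close>

record ('o, 'm) star_cat =
  cobj :: "'o set"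
  chom :: "'o \<Rightarrow> 'o \<Rightarrow> 'm set"
  cid :: "'o \<Rightarrow> 'm"
  ccomp :: "'o \<Rightarrow> 'o \<Rightarrow> 'o \<Rightarrow> 'm \<Rightarrow> 'm \<Rightarrow> 'm"
  czero :: "'o \<Rightarrow> 'o \<Rightarrow> 'm"
  cadd :: "'o \<Rightarrow> 'o \<Rightarrow> 'm \<Rightarrow> 'm \<Rightarrow> 'm"
  cscale :: "'o \<Rightarrow> 'o \<Rightarrow> complex \<Rightarrow> 'm \<Rightarrow> 'm"
  cstar :: "'o \<Rightarrow> 'o \<Rightarrow> 'm \<Rightarrow> 'm"
  cnorm :: "'o \<Rightarrow> 'o \<Rightarrow> 'm \<Rightarrow> real"

definition category_axioms :: "('o, 'm) star_cat \<Rightarrow> bool" where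
  "category_axioms C \<longleftrightarrow>
     (\<forall>a\<in>cobj C. cid C a \<in> chom C a a) \<and>
     (\<forall>a\<in>cobj C. \<forall>b\<in>cobj C. \<forall>f\<in>chom C a b.
        ccomp C a a b f (cid C a) = f \<and> ccomp C a b b (cid C b) f = f) \<and>
     (\<forall>a\<in>cobj C. \<forall>b\<in>cobj C. \<forall>c\<in>cobj C. \<forall>f\<in>chom C a b. \<forall>g\<in>chom C b c.
        ccomp C a b c g f \<in> chom C a c) \<and>
     (\<forall>a\<in>cobj C. \<forall>b\<in>cobj C. \<forall>c\<in>cobj C. \<forall>d\<in>cobj C.
        \<forall>f\<in>chom C a b. \<forall>g\<in>chom C b c. \<forall>h\<in>chom C c d.
        ccomp C a b d (ccomp C b c d h g) f = ccomp C a c d h (ccomp C a b c g f))"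

definition hom_banach_space :: "('o, 'm) star_cat \<Rightarrow> 'o \<Rightarrow> 'o \<Rightarrow> bool" where
  "hom_banach_space C a b \<longleftrightarrow>
     (let V = chom C a b; plus = cadd C a b; scale = cscale C a b; zero = czero C a b;
          nrm = cnorm C a b in
        zero \<in> V \<and>
        (\<forall>f\<in>V. \<forall>g\<in>V. plus f g \<in> V) \<and>
        (\<forall>c. \<forall>f\<in>V. scale c f \<in> V) \<and>
        (\<forall>f\<in>V. \<forall>g\<in>V. \<forall>h\<in>V. plus (plus f g) h = plus f (plus g h)) \<and>
        (\<forall>f\<in>V. \<forall>g\<in>V. plus f g = plus g f) \<and>
        (\<forall>f\<in>V. plus zero f = f) \<and>
        (\<forall>f\<in>V. plus f (scale (-1) f) = zero) \<and>
        (\<forall>c. \<forall>f\<in>V. \<forall>g\<in>V. scale c (plus f g) = plus (scale c f) (scale c g)) \<and>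
        (\<forall>c d. \<forall>f\<in>V. scale (c + d) f = plus (scale c f) (scale d f)) \<and>
        (\<forall>c d. \<forall>f\<in>V. scale (c * d) f = scale c (scale d f)) \<and>
        (\<forall>f\<in>V. scale 1 f = f) \<and>
        (\<forall>f\<in>V. 0 \<le> nrm f \<and> (nrm f = 0 \<longrightarrow> f = zero)) \<and>
        (\<forall>c. \<forall>f\<in>V. nrm (scale c f) = cmod c * nrm f) \<and>
        (\<forall>f\<in>V. \<forall>g\<in>V. nrm (plus f g) \<le> nrm f + nrm g) \<and>
        (\<forall>X :: nat \<Rightarrow> 'm. (\<forall>n. X n \<in> V) \<and>
           (\<forall>e>0. \<exists>N. \<forall>m\<ge>N. \<forall>n\<ge>N. nrm (plus (X m) (scale (-1) (X n))) < e) \<longrightarrow>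
           (\<exists>f\<in>V. (\<lambda>n. nrm (plus (X n) (scale (-1) f))) \<longlonglongrightarrow> 0)))"

text \<open>Positivity of an endomorphism: self-adjoint with spectrum in the non-negative reals.\<close>

definition positive_endo :: "('o, 'm) star_cat \<Rightarrow> 'o \<Rightarrow> 'm \<Rightarrow> bool" where
  "positive_endo C a h \<longleftrightarrow> h \<in> chom C a a \<and> cstar C a a h = h \<and>
     (\<forall>z. z \<notin> \<real>\<^sub>\<ge>\<^sub>0 \<longrightarrow>
        (\<exists>g\<in>chom C a a.
           ccomp C a a a g (cadd C a a h (cscale C a a (- z) (cid C a))) = cid C a \<and>
           ccomp C a a a (cadd C a a h (cscale C a a (- z) (cid C a))) g = cid C a))"

definition cstar_category :: "('o, 'm) star_cat \<Rightarrow> bool" where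
  "cstar_category C \<longleftrightarrow>
     category_axioms C \<and>
     (\<forall>a\<in>cobj C. \<forall>b\<in>cobj C. hom_banach_space C a b) \<and>
     (\<forall>a\<in>cobj C. \<forall>b\<in>cobj C. \<forall>c\<in>cobj C. \<forall>f\<in>chom C a b. \<forall>g\<in>chom C b c.
        (\<forall>f'\<in>chom C a b. ccomp C a b c g (cadd C a b f f')
           = cadd C a c (ccomp C a b c g f) (ccomp C a b c g f')) \<and>
        (\<forall>g'\<in>chom C b c. ccomp C a b c (cadd C b c g g') f
           = cadd C a c (ccomp C a b c g f) (ccomp C a b c g' f)) \<and>
        (\<forall>z. ccomp C a b c g (cscale C a b z f) = cscale C a c z (ccomp C a b c g f) \<and>
             ccomp C a b c (cscale C b c z g) f = cscale C a c z (ccomp C a b c g f)) \<and>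
        cnorm C a c (ccomp C a b c g f) \<le> cnorm C b c g * cnorm C a b f \<and>
        cstar C a c (ccomp C a b c g f) = ccomp C c b a (cstar C a b f) (cstar C b c g)) \<and>
     (\<forall>a\<in>cobj C. \<forall>b\<in>cobj C. \<forall>f\<in>chom C a b.
        cstar C a b f \<in> chom C b a \<and>
        cstar C b a (cstar C a b f) = f \<and>
        (\<forall>g\<in>chom C a b. cstar C a b (cadd C a b f g)
           = cadd C b a (cstar C a b f) (cstar C a b g)) \<and>
        (\<forall>z. cstar C a b (cscale C a b z f) = cscale C b a (cnj z) (cstar C a b f)) \<and>
        cnorm C a a (ccomp C a b a (cstar C a b f) f) = (cnorm C a b f)\<^sup>2 \<and>
        positive_endo C a (ccomp C a b a (cstar C a b f) f))"

definition star_functor ::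
    "('o, 'm) star_cat \<Rightarrow> ('p, 'n) star_cat \<Rightarrow> ('o \<Rightarrow> 'p) \<Rightarrow> ('o \<Rightarrow> 'o \<Rightarrow> 'm \<Rightarrow> 'n) \<Rightarrow> bool" where
  "star_functor C D Fo Fm \<longleftrightarrow>
     (\<forall>a\<in>cobj C. Fo a \<in> cobj D \<and> Fm a a (cid C a) = cid D (Fo a)) \<and>
     (\<forall>a\<in>cobj C. \<forall>b\<in>cobj C. \<forall>c\<in>cobj C. \<forall>f\<in>chom C a b. \<forall>g\<in>chom C b c.
        Fm a c (ccomp C a b c g f) = ccomp D (Fo a) (Fo b) (Fo c) (Fm b c g) (Fm a b f)) \<and>
     (\<forall>a\<in>cobj C. \<forall>b\<in>cobj C. \<forall>f\<in>chom C a b.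
        Fm a b f \<in> chom D (Fo a) (Fo b) \<and>
        (\<forall>g\<in>chom C a b. Fm a b (cadd C a b f g) = cadd D (Fo a) (Fo b) (Fm a b f) (Fm a b g)) \<and>
        (\<forall>z. Fm a b (cscale C a b z f) = cscale D (Fo a) (Fo b) z (Fm a b f)) \<and>
        Fm b a (cstar C a b f) = cstar D (Fo a) (Fo b) (Fm a b f))"

definition cstar_category_iso ::
    "('o, 'm) star_cat \<Rightarrow> ('p, 'n) star_cat \<Rightarrow> ('o \<Rightarrow> 'p) \<Rightarrow> ('o \<Rightarrow> 'o \<Rightarrow> 'm \<Rightarrow> 'n) \<Rightarrow> bool" where
  "cstar_category_iso C D Fo Fm \<longleftrightarrow>
     cstar_category C \<and> cstar_category D \<and> star_functor C D Fo Fm \<and>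
     (\<exists>Go Gm. star_functor D C Go Gm \<and>
        (\<forall>a\<in>cobj C. Go (Fo a) = a) \<and> (\<forall>p\<in>cobj D. Fo (Go p) = p) \<and>
        (\<forall>a\<in>cobj C. \<forall>b\<in>cobj C. \<forall>f\<in>chom C a b. Gm (Fo a) (Fo b) (Fm a b f) = f) \<and>
        (\<forall>p\<in>cobj D. \<forall>q\<in>cobj D. \<forall>g\<in>chom D p q. Fm (Go p) (Go q) (Gm p q g) = g))"

text \<open>Categories of Hilbert spaces with additional structure, all operations being those of
  bounded operators.\<close>

definition operator_category ::
    "('v amod \<times> 's) set \<Rightarrow> ('v amod \<times> 's \<Rightarrow> 'v amod \<times> 's \<Rightarrow> ('v \<Rightarrow> 'v) set) \<Rightarrow>
     ('v amod \<times> 's, 'v \<Rightarrow> 'v) star_cat" where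
  "operator_category Ob Hm =
     \<lparr>cobj = Ob, chom = Hm, cid = (\<lambda>X. op_id (fst X)),
      ccomp = (\<lambda>X Y Z S T. compose (carr (fst X)) S T),
      czero = (\<lambda>X Y. op_zero (fst X) (fst Y)),
      cadd = (\<lambda>X Y. op_add (fst X) (fst Y)),
      cscale = (\<lambda>X Y. op_scale (fst X) (fst Y)),
      cstar = (\<lambda>X Y. adj (fst X) (fst Y)),
      cnorm = (\<lambda>X Y. op_norm (fst X) (fst Y))\<rparr>"

definition Rep_left ::
    "'v net \<Rightarrow> 'v cat_ext \<Rightarrow> 'v frob \<Rightarrow> ('v amod \<times> ('v \<Rightarrow> 'v), 'v \<Rightarrow> 'v) star_cat" where
  "Rep_left N E Q = operator_category (left_modules N E Q) (Hom_left N E Q)"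

definition Rep_BA ::
    "'v net \<Rightarrow> 'v amod \<Rightarrow> (argint \<Rightarrow> ('v \<Rightarrow> 'v) set) \<Rightarrow> ('v amod \<times> 'v bact, 'v \<Rightarrow> 'v) star_cat" where
  "Rep_BA N a B = operator_category (BA_modules N a B) (Hom_BA B)"

end

theory Submission
  imports Defs "HOL-Complex_Analysis.Complex_Analysis"
begin

text \<open>
  A left module \<open>(i, m)\<close> and the module \<open>(i, p)\<close> of the extension determine each other by
  \<open>m L(\<xi>) = p(b\<^sub>\<xi>)\<close>, where \<open>b\<^sub>\<xi> = \<mu> L(\<xi>)\<close> is the field of the localised vector \<open>\<xi>\<close>. Since the vectors
  \<open>L(\<xi>) \<psi>\<close> are total, morphisms agree and \<open>m\<close> is determined by \<open>p\<close> (\<open>Hom_left_eq_Hom_BA\<close>). Two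
  existence statements remain.

  From \<open>m\<close> to \<open>p\<close>: the assignment \<open>b\<^sub>\<xi> \<mapsto> m L(\<xi>)\<close> is multiplicative and respects adjoints because products
  \<open>L(\<xi>) L(\<eta>)\<close> and \<open>L(\<eta>)\<^sup>* L(\<zeta>)\<close> are again of the form \<open>L\<close> (\<open>L_of_L\<close>, \<open>L_of_adj_L\<close>), where the Frobenius
  relation handles the adjoint (\<open>field_adj\<close>). Multiplication from the right with a vector \<open>\<eta>\<close> of \<open>i\<close>
  localised in the complement intertwines the orbits of the vacuum and of \<open>\<eta>\<close>. This makes \<open>p\<close> normal
  (\<open>star_rep_normal\<close>, by Vigier's theorem), and for \<open>i = a\<close> it shows that \<open>BQ\<close> is a commutant
  (\<open>BQ_commutant\<close>).

  From \<open>p\<close> to \<open>m\<close>: one has to bound \<open>\<Sum>\<^sub>k p(b\<^sub>k) \<psi>\<^sub>k\<close> by \<open>\<Sum>\<^sub>k L(\<xi>\<^sub>k) \<psi>\<^sub>k\<close>. The Gram operators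
  \<open>L(\<xi>\<^sub>k)\<^sup>* L(\<xi>\<^sub>l)\<close> lie in the local algebra and act alike on all modules (\<open>L_adj_L\<close>), so the bound of \<open>\<mu>\<close> on
  \<open>a\<close> is the positivity of a matrix over \<open>BQ\<close>, and \<open>p\<close> is completely positive
  (\<open>star_rep_completely_positive\<close>, \<open>multiplication_exists_locally\<close>). The resulting \<open>m\<close> does not depend on the
  interval and satisfies the module axioms (\<open>multiplication_left_module\<close>).

  All this needs localised vectors to be dense and local algebras to have the vacuum as a cyclic vector. The
  latter is the Reeh-Schlieder property, proved here from positivity of the energy: a matrix coefficient
  of the rotations has a one-sided Fourier series, so it is zero once it vanishes on an interval. Together
  with locality it gives Haag duality and the exchange of \<open>L\<close> and \<open>R\<close> on localised vectors, from which the
  calculus of the operators \<open>L\<close> follows.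

  Both categories are categories of operators intertwining a family closed under adjoints, and such
  categories are C*-categories (\<open>cstar_category_intertwiners\<close>).
\<close>

abbreviation \<J> :: "argint set" where "\<J> \<equiv> arg_intervals"

abbreviation hdist :: "('v, 'a) hilb_scheme \<Rightarrow> 'v \<Rightarrow> 'v \<Rightarrow> real" where
 "hdist H x y \<equiv> hnorm H (hdiff H x y)"

section \<open>Geometry of Hilbert space structures\<close>

definition complete_ips :: "('v, 'a) hilb_scheme \<Rightarrow> bool" where
 "complete_ips H \<longleftrightarrow> complex_inner_product_space H \<and>
  (\<forall>X :: nat \<Rightarrow> 'v. (\<forall>n. X n \<in> carr H) \<and>
    (\<forall>e>0. \<exists>N. \<forall>m\<ge>N. \<forall>n\<ge>N. hdist H (X m) (X n) < e) \<longrightarrow>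
    (\<exists>x\<in>carr H. (\<lambda>n. hdist H (X n) x) \<longlonglongrightarrow> 0))"

lemma hilbert_space_complete: "hilbert_space H ==> complete_ips H"
 by (simp add: hilbert_space_def complete_ips_def)

lemma complete_ips_cip: "complete_ips H ==> complex_inner_product_space H"
 by (simp add: complete_ips_def)

lemma carr_closed [simp, intro]:
 assumes "complete_ips H"
 shows "hzero H \<in> carr H"
  and "x \<in> carr H ==> y \<in> carr H ==> hadd H x y \<in> carr H"
  and "x \<in> carr H ==> hscale H c x \<in> carr H"
  and "x \<in> carr H ==> y \<in> carr H ==> hdiff H x y \<in> carr H"
proof -
 have c: "hzero H : carr H" "ALL x:carr H. ALL y:carr H. hadd H x y : carr H"
  "ALL c. ALL x:carr H. hscale H c x : carr H"
  by (insert complete_ips_cip[OF assms, unfolded complex_inner_product_space_def]; elim conjE; assumption)+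
 show "hzero H : carr H"
  and "x : carr H ==> y : carr H ==> hadd H x y : carr H"
  and "x : carr H ==> hscale H c x : carr H"
  and "x : carr H ==> y : carr H ==> hdiff H x y : carr H"
  using c by (simp_all add: hdiff_def)
qed

lemma hip_cnj:
 assumes "complete_ips H" "x \<in> carr H" "y \<in> carr H"
 shows "cnj (hip H x y) = hip H y x"
proof -
 have "ALL x:carr H. ALL y:carr H. hip H x y = cnj (hip H y x)"
  by (insert complete_ips_cip[OF assms(1), unfolded complex_inner_product_space_def]; elim conjE; assumption)+
 then have "hip H y x = cnj (hip H x y)"
  using assms(2,3) by blast
 then show ?thesis by (rule sym)
qed

lemma hip_right [simp]:
 assumes "complete_ips H" "x \<in> carr H" "y \<in> carr H"
 shows "z \<in> carr H ==> hip H x (hadd H y z) = hip H x y + hip H x z"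
  and "hip H x (hscale H c y) = c * hip H x y"
  and "z \<in> carr H ==> hip H x (hdiff H y z) = hip H x y - hip H x z"
proof -
 have c: "ALL x:carr H. ALL y:carr H. ALL z:carr H. hip H x (hadd H y z) = hip H x y + hip H x z"
  "ALL c. ALL x:carr H. ALL y:carr H. hip H x (hscale H c y) = c * hip H x y"
  by (insert complete_ips_cip[OF assms(1), unfolded complex_inner_product_space_def]; elim conjE; assumption)+
 show "z : carr H ==> hip H x (hadd H y z) = hip H x y + hip H x z"
  and "hip H x (hscale H c y) = c * hip H x y"
  and "z : carr H ==> hip H x (hdiff H y z) = hip H x y - hip H x z"
  using c assms by (simp_all add: hdiff_def)
qed

lemma hip_left [simp]:
 assumes "complete_ips H" "x \<in> carr H" "y \<in> carr H"
 shows "z \<in> carr H ==> hip H (hadd H y z) x = hip H y x + hip H z x"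
  and "hip H (hscale H c y) x = cnj c * hip H y x"
  and "z \<in> carr H ==> hip H (hdiff H y z) x = hip H y x - hip H z x"
 by (simp_all add: assms hip_cnj[OF assms(1), of x, symmetric])

lemma hip_self_eq_0:
 assumes "complete_ips H" "x \<in> carr H" "hip H x x = 0"
 shows "x = hzero H"
 using complete_ips_cip[OF assms(1)] assms(2,3) unfolding complex_inner_product_space_def by blast

lemma hzero_eq_scale: "complete_ips H ==> hscale H 0 (hzero H) = hzero H"
 by (rule hip_self_eq_0) simp_all

lemma hip_zero [simp]:
 assumes "complete_ips H" "x \<in> carr H"
 shows "hip H x (hzero H) = 0" "hip H (hzero H) x = 0"
proof -
 have "hip H x (hscale H 0 (hzero H)) = 0" "hip H (hscale H 0 (hzero H)) x = 0"
  using assms by simp_all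
 then show "hip H x (hzero H) = 0" "hip H (hzero H) x = 0"
  unfolding hzero_eq_scale[OF assms(1)] by auto
qed

lemma hip_self:
 assumes "complete_ips H" "x \<in> carr H"
 shows "hip H x x = complex_of_real ((hnorm H x)\<^sup>2)" "Re (hip H x x) = (hnorm H x)\<^sup>2" "0 \<le> hnorm H x"
proof -
 have "hip H x x : \<real>\<^sub>\<ge>\<^sub>0"
  using complete_ips_cip[OF assms(1)] assms(2) unfolding complex_inner_product_space_def by blast
 then have "Re (hip H x x) >= 0" "Im (hip H x x) = 0"
  by (auto simp: complex_nonneg_Reals_iff)
 then show "hip H x x = complex_of_real ((hnorm H x)\<^sup>2)" "Re (hip H x x) = (hnorm H x)\<^sup>2" "0 <= hnorm H x"
  by (auto simp: hnorm_def complex_eq_iff)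
qed

lemma hnorm_eq_0: "complete_ips H ==> x \<in> carr H ==> hnorm H x = 0 \<longleftrightarrow> x = hzero H"
 using hip_self(1)[of H x] hip_self_eq_0[of H x] hip_zero(1)[of H "hzero H"] by fastforce

lemma hnorm_zero [simp]: "complete_ips H ==> hnorm H (hzero H) = 0"
 by (simp add: hnorm_eq_0)

lemma hdiff_eq_0:
 assumes "complete_ips H" "x \<in> carr H" "y \<in> carr H" "hdiff H x y = hzero H"
 shows "x = y"
proof -
 have c: "ALL x:carr H. ALL y:carr H. ALL z:carr H. hadd H (hadd H x y) z = hadd H x (hadd H y z)"
  "ALL x:carr H. ALL y:carr H. hadd H x y = hadd H y x" "ALL x:carr H. hadd H (hzero H) x = x"
  "ALL x:carr H. hdiff H x x = hzero H"
  by (insert complete_ips_cip[OF assms(1), unfolded complex_inner_product_space_def]; elim conjE; assumption)+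
 have s: "hscale H (-1) y : carr H" using assms by simp
 have "hadd H (hdiff H x y) y = hadd H x (hadd H y (hscale H (-1) y))"
  using c(1,2) s assms(2,3) by (simp add: hdiff_def)
 also have "hadd H y (hscale H (-1) y) = hzero H"
  using c(4) assms(3) by (simp add: hdiff_def)
 also have "hadd H x (hzero H) = x"
  using c(2,3) assms(1,2) carr_closed(1)[OF assms(1)] by simp
 finally show ?thesis
  using c(3) assms(3,4) by simp
qed

text \<open>Vector identities are checked on inner products, where they become identities of complex
  numbers.\<close>

lemma hip_ext:
 assumes "complete_ips H" "x \<in> carr H" "y \<in> carr H" "!!z. z \<in> carr H ==> hip H z x = hip H z y"
 shows "x = y"
 using hip_self_eq_0[OF assms(1), of "hdiff H x y"] hdiff_eq_0[of H x y] assms by simp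

lemma hnorm_scale:
 assumes "complete_ips H" "x \<in> carr H"
 shows "hnorm H (hscale H c x) = cmod c * hnorm H x"
proof -
 have "complex_of_real ((hnorm H (hscale H c x))\<^sup>2) = complex_of_real ((cmod c * hnorm H x)\<^sup>2)"
  using assms hip_self(1)[OF assms]
  by (simp add: hip_self(1)[symmetric] power_mult_distrib complex_norm_square del: of_real_power)
 then have "(hnorm H (hscale H c x))\<^sup>2 = (cmod c * hnorm H x)\<^sup>2"
  using of_real_eq_iff by blast
 then show ?thesis
  using assms by (simp add: hip_self(3) power2_eq_iff_nonneg)
qed

lemma hnorm_sq_add:
 assumes "complete_ips H" "x \<in> carr H" "y \<in> carr H"
 shows "(hnorm H (hadd H x y))\<^sup>2 = (hnorm H x)\<^sup>2 + (hnorm H y)\<^sup>2 + 2 * Re (hip H x y)"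
  "(hdist H x y)\<^sup>2 = (hnorm H x)\<^sup>2 + (hnorm H y)\<^sup>2 - 2 * Re (hip H x y)"
proof -
 have "Re (hip H y x) = Re (hip H x y)"
  using hip_cnj[OF assms] by (metis complex_cnj(1) complex_surj complex.sel(1))
 then show "(hnorm H (hadd H x y))\<^sup>2 = (hnorm H x)\<^sup>2 + (hnorm H y)\<^sup>2 + 2 * Re (hip H x y)"
  "(hdist H x y)\<^sup>2 = (hnorm H x)\<^sup>2 + (hnorm H y)\<^sup>2 - 2 * Re (hip H x y)"
  using assms by (simp_all add: hip_self(2)[symmetric])
qed

lemma Cauchy_Schwarz:
 assumes H: "complete_ips H" and x: "x \<in> carr H" and y: "y \<in> carr H"
 shows "cmod (hip H x y) \<le> hnorm H x * hnorm H y"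
proof (cases "hnorm H y = 0")
 case True
 then show ?thesis using assms by (simp add: hnorm_eq_0)
next
 case False
 then have p: "hnorm H y > 0" using hip_self(3)[OF H y] by simp
 define c where "c = hip H y x / complex_of_real ((hnorm H y)\<^sup>2)"
 have "hip H (hdiff H x (hscale H c y)) (hdiff H x (hscale H c y)) =
   hip H x x - c * hip H x y - cnj c * (hip H y x - c * hip H y y)"
  using assms by (simp add: algebra_simps)
 also have "hip H y x - c * hip H y y = 0"
  using p by (simp add: c_def hip_self(1)[OF H y])
 also have "c * hip H x y = complex_of_real ((cmod (hip H x y))\<^sup>2 / (hnorm H y)\<^sup>2)"
  by (simp only: c_def of_real_divide complex_norm_square hip_cnj[OF H x y]) (simp add: mult.commute)
 finally have "hip H (hdiff H x (hscale H c y)) (hdiff H x (hscale H c y))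
   = complex_of_real ((hnorm H x)\<^sup>2 - (cmod (hip H x y))\<^sup>2 / (hnorm H y)\<^sup>2)"
  using H x by (simp only: hip_self(1) mult_zero_right diff_zero of_real_diff)
 then have "(hdist H x (hscale H c y))\<^sup>2
   = (hnorm H x)\<^sup>2 - (cmod (hip H x y))\<^sup>2 / (hnorm H y)\<^sup>2"
  using H x y by (simp only: hip_self(1) carr_closed of_real_eq_iff)
 then have "(cmod (hip H x y))\<^sup>2 / (hnorm H y)\<^sup>2 <= (hnorm H x)\<^sup>2"
  using zero_le_power2 by (metis diff_ge_0_iff_ge)
 then have "(cmod (hip H x y))\<^sup>2 <= (hnorm H x * hnorm H y)\<^sup>2"
  using p by (simp add: divide_simps power_mult_distrib)
 then show ?thesis
  using assms by (meson hip_self(3) mult_nonneg_nonneg power2_le_imp_le)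
qed

lemma hnorm_triangle:
 assumes "complete_ips H" "x \<in> carr H" "y \<in> carr H"
 shows "hnorm H (hadd H x y) \<le> hnorm H x + hnorm H y"
proof (rule power2_le_imp_le)
 have "Re (hip H x y) <= hnorm H x * hnorm H y"
  using Cauchy_Schwarz[OF assms] complex_Re_le_cmod order_trans by blast
 then show "(hnorm H (hadd H x y))\<^sup>2 <= (hnorm H x + hnorm H y)\<^sup>2"
  using hnorm_sq_add[OF assms] by (simp add: power2_sum)
qed (insert assms, simp add: hip_self(3))

lemma hdiff_chain:
 assumes "complete_ips H" "x \<in> carr H" "y \<in> carr H" "z \<in> carr H"
 shows "hdiff H x z = hadd H (hdiff H x y) (hdiff H y z)"
 using assms by (intro hip_ext[of H]) auto

lemma hdiff_swap: "complete_ips H ==> x \<in> carr H ==> y \<in> carr H ==> hdiff H x y = hscale H (-1) (hdiff H y x)"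
 by (intro hip_ext[of H]) auto

lemma hnorm_swap: "complete_ips H ==> x \<in> carr H ==> y \<in> carr H ==> hdist H x y = hdist H y x"
 by (subst hdiff_swap) (simp_all add: hnorm_scale)

lemma hnorm_triangle_diff:
 assumes "complete_ips H" "x \<in> carr H" "y \<in> carr H" "z \<in> carr H"
 shows "hdist H x z \<le> hdist H x y + hdist H y z"
 using hdiff_chain[OF assms] hnorm_triangle[of H] assms by simp

lemma hnorm_le_diff:
 assumes "complete_ips H" "x \<in> carr H" "y \<in> carr H"
 shows "hnorm H x \<le> hnorm H y + hdist H x y"
proof -
 have "x = hadd H y (hdiff H x y)" using assms by (intro hip_ext[of H]) auto
 then show ?thesis using hnorm_triangle[of H y "hdiff H x y"] assms by simp
qed

lemma hip_tendsto:
 assumes H: "complete_ips H" and X: "!!n. X n \<in> carr H" and x: "x \<in> carr H" and z: "z \<in> carr H"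
  and lim: "((\<lambda>n. hdist H (X n) x) \<longlongrightarrow> 0) F"
 shows "((\<lambda>n. hip H z (X n)) \<longlongrightarrow> hip H z x) F" "((\<lambda>n. hip H (X n) z) \<longlongrightarrow> hip H x z) F"
proof -
 have "((\<lambda>n. hip H z (X n) - hip H z x) \<longlongrightarrow> 0) F"
 proof (rule Lim_null_comparison)
  have "norm (hip H z (X n) - hip H z x) <= hnorm H z * hdist H (X n) x" for n
   using Cauchy_Schwarz[OF H z, of "hdiff H (X n) x"] H X[of n] x z by simp
  then show "\<forall>\<^sub>F n in F. norm (hip H z (X n) - hip H z x) <= hnorm H z * hdist H (X n) x"
   by (intro always_eventually allI)
  show "((\<lambda>n. hnorm H z * hdist H (X n) x) \<longlongrightarrow> 0) F"
   using tendsto_mult_right_zero[OF lim] by simp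
 qed
 then show *: "((\<lambda>n. hip H z (X n)) \<longlongrightarrow> hip H z x) F"
  by (rule LIM_zero_cancel)
 show "((\<lambda>n. hip H (X n) z) \<longlongrightarrow> hip H x z) F"
  using tendsto_cnj[OF *] by (simp add: hip_cnj H X x z)
qed

lemma hnorm_tendsto:
 assumes H: "complete_ips H" and X: "!!n. X n \<in> carr H" and x: "x \<in> carr H"
  and lim: "((\<lambda>n. hdist H (X n) x) \<longlongrightarrow> 0) F"
 shows "((\<lambda>n. hnorm H (X n)) \<longlongrightarrow> hnorm H x) F"
proof -
 have "((\<lambda>n. hnorm H (X n) - hnorm H x) \<longlongrightarrow> 0) F"
 proof (rule Lim_null_comparison[OF always_eventually lim], rule allI)
  fix n
  show "norm (hnorm H (X n) - hnorm H x) <= hdist H (X n) x"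
   using hnorm_le_diff[OF H X[of n] x] hnorm_le_diff[OF H x X[of n]] hnorm_swap[OF H x X[of n]]
   by simp
 qed
 then show ?thesis by (rule LIM_zero_cancel)
qed

text \<open>The minimum of the real functional \<open>B x x - 2 Re (f x)\<close> is attained: the parallelogram
  law makes every minimising sequence Cauchy. The vanishing of the first variation at the
  minimum is the asserted representation. The case of the inner product itself is the
  Riesz representation theorem.\<close>

lemma hermitian_Lax_Milgram:
 fixes H :: "('v, 'a) hilb_scheme"
 assumes H: "complete_ips H"
  and B_add: "!!x y z. x \<in> carr H ==> y \<in> carr H ==> z \<in> carr H ==> B x (hadd H y z) = B x y + B x z"
  and B_scale: "!!x y c. x \<in> carr H ==> y \<in> carr H ==> B x (hscale H c y) = c * B x y"
  and B_cnj: "!!x y. x \<in> carr H ==> y \<in> carr H ==> B x y = cnj (B y x)"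
  and B_coercive: "0 < \<delta>" "!!x. x \<in> carr H ==> \<delta> * (hnorm H x)\<^sup>2 \<le> Re (B x x)"
  and B_bdd: "!!x y. x \<in> carr H ==> y \<in> carr H ==> cmod (B x y) \<le> D * (hnorm H x * hnorm H y)"
  and f_add: "!!x y. x \<in> carr H ==> y \<in> carr H ==> f (hadd H x y) = f x + f y"
  and f_scale: "!!x c. x \<in> carr H ==> f (hscale H c x) = cnj c * f x"
  and f_bdd: "!!x. x \<in> carr H ==> cmod (f x) \<le> C * hnorm H x"
 obtains x where "x \<in> carr H" "!!y. y \<in> carr H ==> B y x = f y"
proof -
 have B_addl: "B (hadd H y z) x = B y x + B z x" if "x : carr H" "y : carr H" "z : carr H" for x y z
  by (subst (1 2 3) B_cnj) (insert that H, auto simp: B_add)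
 have B_scalel: "B (hscale H c y) x = cnj c * B y x" if "x : carr H" "y : carr H" for x y c
  by (subst (1 2) B_cnj) (insert that H, auto simp: B_scale)
 have Re_sym: "Re (B y x) = Re (B x y)" if "x : carr H" "y : carr H" for x y
  using B_cnj[OF that] by simp
 define J where "J x = Re (B x x) - 2 * Re (f x)" for x
 have J_var: "J (hadd H x (hscale H t y)) = J x + 2 * Re (cnj t * (B y x - f y)) + (cmod t)\<^sup>2 * Re (B y y)"
  if x: "x : carr H" and y: "y : carr H" for x y t
 proof -
  have y': "hscale H t y : carr H" using H y by simp
  have Bxy: "B x (hscale H t y) = cnj (cnj t * B y x)"
   using B_scale[OF x y] B_cnj[OF x y] by simp
  have re: "Re (p + cnj q + (q + complex_of_real r * s)) = Re p + 2 * Re q + r * Re s" for p q r s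
   by simp
  have "B (hadd H x (hscale H t y)) (hadd H x (hscale H t y))
    = B x x + B x (hscale H t y) + (B (hscale H t y) x + B (hscale H t y) (hscale H t y))"
   using x y' H by (simp add: B_add B_addl)
  also have "B (hscale H t y) x = cnj t * B y x" by (rule B_scalel[OF x y])
  also have "B (hscale H t y) (hscale H t y) = complex_of_real ((cmod t)\<^sup>2) * B y y"
   using B_scale[OF y' y] B_scalel[OF y y] by (simp only: complex_norm_square mult.assoc)
  finally have "Re (B (hadd H x (hscale H t y)) (hadd H x (hscale H t y)))
    = Re (B x x) + 2 * Re (cnj t * B y x) + (cmod t)\<^sup>2 * Re (B y y)"
   unfolding Bxy by (simp only: re)
  then show ?thesis
   using x y y' by (simp add: J_def f_add f_scale algebra_simps)
 qed
 have J_lower: "- (C\<^sup>2 / \<delta>) <= J x" if x: "x : carr H" for x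
 proof -
  have "Re (f x) <= C * hnorm H x"
   using f_bdd[OF x] complex_Re_le_cmod order_trans by blast
  then have "J x >= \<delta> * (hnorm H x)\<^sup>2 - 2 * (C * hnorm H x)"
   using B_coercive(2)[OF x] by (simp add: J_def)
  moreover have "\<delta> * (hnorm H x)\<^sup>2 - 2 * (C * hnorm H x) = \<delta> * (hnorm H x - C / \<delta>)\<^sup>2 - C\<^sup>2 / \<delta>"
   using B_coercive(1) by (simp add: power2_eq_square field_simps)
  moreover have "\<delta> * (hnorm H x - C / \<delta>)\<^sup>2 >= 0"
   using B_coercive(1) by simp
  ultimately show ?thesis by linarith
 qed
 define m where "m = Inf (J ` carr H)"
 have bdd: "bdd_below (J ` carr H)" using J_lower by (auto intro!: bdd_belowI2)
 have m_le: "m <= J x" if "x : carr H" for x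
  unfolding m_def using bdd that by (auto intro: cInf_lower)
 have ne: "J ` carr H ~= {}" using carr_closed(1)[OF H] by blast
 have "EX x:carr H. J x < m + 1 / real (Suc n)" for n
  using cInf_lessD[OF ne, of "m + 1 / real (Suc n)"] unfolding m_def by fastforce
 then obtain X where X: "!!n. X n : carr H" "!!n. J (X n) < m + 1 / real (Suc n)" by metis
 have par: "\<delta> / 2 * (hdist H x y)\<^sup>2 <= J x + J y - 2 * m" if x: "x : carr H" and y: "y : carr H" for x y
 proof -
  define d where "d = hdiff H y x"
  define h where "h = hadd H x (hscale H (1/2) d)"
  have d: "d : carr H" and h: "h : carr H" using x y H by (auto simp: d_def h_def)
  have y_eq: "y = hadd H x (hscale H 1 d)"
   using x y H by (intro hip_ext[of H]) (auto simp: d_def)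
  have "J y = J x + 2 * Re (B d x - f d) + Re (B d d)"
   using J_var[OF x d, of 1] y_eq by simp
  moreover have "J h = J x + Re (B d x - f d) + Re (B d d) / 4"
   using J_var[OF x d, of "1/2"] unfolding h_def by (simp add: power2_eq_square)
  moreover have "m <= J h" using m_le[OF h] .
  moreover have "hdist H x y = hnorm H d" using hnorm_swap[OF H x y] d_def by simp
  ultimately show ?thesis using B_coercive(2)[OF d] by simp
 qed
 have "EX N. ALL i>=N. ALL j>=N. hdist H (X i) (X j) < e" if e: "e > 0" for e
 proof -
  have "\<delta> * e\<^sup>2 / 4 > 0" using e B_coercive(1) by simp
  then obtain N :: nat where N: "1 / real (Suc N) < \<delta> * e\<^sup>2 / 4"
   using nat_approx_posE by metis
  have "hdist H (X i) (X j) < e" if "i >= N" "j >= N" for i j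
  proof -
   have "1 / real (Suc i) <= 1 / real (Suc N)" "1 / real (Suc j) <= 1 / real (Suc N)"
    using that by (auto simp: divide_simps)
   then have "\<delta> / 2 * (hdist H (X i) (X j))\<^sup>2 < \<delta> / 2 * e\<^sup>2"
    using par[OF X(1) X(1), of i j] X(2)[of i] X(2)[of j] N by linarith
   then have "(hdist H (X i) (X j))\<^sup>2 < e\<^sup>2" using B_coercive(1) by simp
   then show ?thesis using e power2_less_imp_less by force
  qed
  then show ?thesis by blast
 qed
 then obtain x where x: "x : carr H" and lim: "(\<lambda>n. hdist H (X n) x) \<longlonglongrightarrow> 0"
  using H X(1) unfolding complete_ips_def by blast
 have J_lim: "(\<lambda>n. J (X n)) \<longlonglongrightarrow> J x"
 proof -
  let ?d = "\<lambda>n. hdiff H (X n) x"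
  have d: "?d n : carr H" for n using H X(1) x by simp
  have eq: "X n = hadd H x (hscale H 1 (?d n))" for n
   using x X(1) H by (intro hip_ext[of H]) auto
  have JX: "J (X n) - J x = 2 * Re (B (?d n) x - f (?d n)) + Re (B (?d n) (?d n))" for n
   by (subst eq, subst J_var[OF x d]) simp
  have "(\<lambda>n. J (X n) - J x) \<longlonglongrightarrow> 0"
  proof (rule Lim_null_comparison)
   have "norm (J (X n) - J x) <= 2 * (D * hnorm H x + C) * hnorm H (?d n) + D * (hnorm H (?d n) * hnorm H (?d n))" for n
   proof -
    have "\<bar>Re (B (?d n) x - f (?d n))\<bar> <= cmod (B (?d n) x) + cmod (f (?d n))"
     using abs_Re_le_cmod norm_triangle_ineq4 order_trans by blast
    also have "... <= D * (hnorm H (?d n) * hnorm H x) + C * hnorm H (?d n)"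
     using B_bdd[OF d x] f_bdd[OF d] by (rule add_mono)
    finally have "\<bar>Re (B (?d n) x - f (?d n))\<bar> <= (D * hnorm H x + C) * hnorm H (?d n)"
     by (simp add: algebra_simps)
    moreover have "\<bar>Re (B (?d n) (?d n))\<bar> <= D * (hnorm H (?d n) * hnorm H (?d n))"
     using B_bdd[OF d d, of n n] abs_Re_le_cmod order_trans by blast
    moreover have "norm (2 * a + b) <= 2 * p + q" if "\<bar>a\<bar> <= p" "\<bar>b\<bar> <= q" for a b p q :: real
     using that unfolding real_norm_def by linarith
    ultimately show ?thesis unfolding JX mult.assoc by blast
   qed
   then show "\<forall>\<^sub>F n in sequentially. norm (J (X n) - J x) <=
     2 * (D * hnorm H x + C) * hnorm H (?d n) + D * (hnorm H (?d n) * hnorm H (?d n))"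
    by simp
   show "(\<lambda>n. 2 * (D * hnorm H x + C) * hnorm H (?d n) + D * (hnorm H (?d n) * hnorm H (?d n))) \<longlonglongrightarrow> 0"
    by (rule tendsto_eq_intros lim refl | simp)+
  qed
  then show ?thesis by (rule LIM_zero_cancel)
 qed
 have "J x <= m"
 proof (rule LIMSEQ_le[OF J_lim])
  show "(\<lambda>n. m + 1 / real (Suc n)) \<longlonglongrightarrow> m"
   using tendsto_add[OF tendsto_const LIMSEQ_inverse_real_of_nat, of m] by (simp add: inverse_eq_divide)
  show "EX N. ALL n>=N. J (X n) <= m + 1 / real (Suc n)"
   using X(2) less_imp_le by blast
 qed
 have "B y x = f y" if y: "y : carr H" for y
 proof (rule ccontr)
  assume ne: "B y x ~= f y"
  define w where "w = B y x - f y"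
  define K where "K = \<bar>Re (B y y)\<bar> + 1"
  have K: "K > 0" "Re (B y y) < K" by (auto simp: K_def)
  define t where "t = - w / complex_of_real K"
  have "m <= J (hadd H x (hscale H t y))" using x y H by (intro m_le) simp
  then have *: "0 <= 2 * Re (cnj t * w) + (cmod t)\<^sup>2 * Re (B y y)"
   using J_var[OF x y, of t] \<open>J x <= m\<close> by (simp add: w_def)
  have "cnj t * w = - complex_of_real ((cmod w)\<^sup>2 / K)"
   by (simp only: t_def of_real_divide complex_norm_square) simp
  moreover have "(cmod t)\<^sup>2 = (cmod w)\<^sup>2 / K\<^sup>2"
   using K by (simp add: t_def norm_divide power_divide)
  ultimately have "0 <= 2 * - ((cmod w)\<^sup>2 / K) + (cmod w)\<^sup>2 / K\<^sup>2 * Re (B y y)"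
   using * by (simp only: uminus_complex.sel Re_complex_of_real)
  also have "... = (cmod w)\<^sup>2 / K\<^sup>2 * (Re (B y y) - 2 * K)"
   using K by (simp add: field_simps power2_eq_square)
  finally have "0 <= (cmod w)\<^sup>2 / K\<^sup>2 * (Re (B y y) - 2 * K)" .
  moreover have "(cmod w)\<^sup>2 / K\<^sup>2 > 0" using ne K by (simp add: w_def)
  ultimately show False
   using K mult_pos_neg[of "(cmod w)\<^sup>2 / K\<^sup>2" "Re (B y y) - 2 * K"] by linarith
 qed
 then show ?thesis using x that by blast
qed

lemma Riesz_representation:
 assumes H: "complete_ips H"
  and "!!x y. x \<in> carr H ==> y \<in> carr H ==> f (hadd H x y) = f x + f y"
  and "!!x c. x \<in> carr H ==> f (hscale H c x) = cnj c * f x"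
  and "!!x. x \<in> carr H ==> cmod (f x) \<le> C * hnorm H x"
 obtains x where "x \<in> carr H" "!!y. y \<in> carr H ==> hip H y x = f y"
 by (rule hermitian_Lax_Milgram[OF H, of "hip H" 1 1 f C])
  (insert assms, auto simp: hip_cnj hip_self(2) Cauchy_Schwarz)

section \<open>Bounded operators and adjoints\<close>

lemma bdd_opsD:
 assumes "T \<in> bdd_ops H K"
 shows "x \<in> carr H ==> T x \<in> carr K"
  and "x \<notin> carr H ==> T x = undefined"
  and "x \<in> carr H ==> y \<in> carr H ==> T (hadd H x y) = hadd K (T x) (T y)"
  and "x \<in> carr H ==> T (hscale H c x) = hscale K c (T x)"
 using assms by (auto simp: bdd_ops_def PiE_def extensional_def)

lemmas op_carr = bdd_opsD(1)

lemma bdd_ops_extensional: "T \<in> bdd_ops H K ==> T \<in> extensional (carr H)"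
 by (auto simp: bdd_ops_def PiE_def)

lemma bdd_ops_diff:
 assumes "complete_ips H" "T \<in> bdd_ops H K" "x \<in> carr H" "y \<in> carr H"
 shows "T (hdiff H x y) = hdiff K (T x) (T y)"
 using assms by (simp add: hdiff_def bdd_opsD)

lemma bdd_ops_zero:
 assumes "complete_ips H" "complete_ips K" "T \<in> bdd_ops H K"
 shows "T (hzero H) = hzero K"
proof -
 have "T (hzero H) = hscale K 0 (T (hzero H))"
  using bdd_opsD(4)[OF assms(3) carr_closed(1)[OF assms(1)], of 0] hzero_eq_scale[OF assms(1)] by simp
 also have "... = hzero K"
  using assms op_carr[OF assms(3) carr_closed(1)[OF assms(1)]] by (intro hip_ext[of K]) simp_all
 finally show ?thesis .
qed

lemma bdd_ops_bound:
 assumes "complete_ips H" "T \<in> bdd_ops H K"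
 obtains C where "C \<ge> 0" "!!x. x \<in> carr H ==> hnorm K (T x) \<le> C * hnorm H x"
proof -
 obtain C where C: "!!x. x : carr H ==> hnorm K (T x) <= C * hnorm H x"
  using assms(2) unfolding bdd_ops_def by blast
 have "hnorm K (T x) <= max C 0 * hnorm H x" if "x : carr H" for x
  using C[OF that] mult_right_mono[OF max.cobounded1[of C 0] hip_self(3)[OF assms(1) that]] by linarith
 then show ?thesis using that[of "max C 0"] by simp
qed

lemma bdd_opsI:
 assumes "T \<in> extensional (carr H)" "!!x. x \<in> carr H ==> T x \<in> carr K"
  and "!!x y. x \<in> carr H ==> y \<in> carr H ==> T (hadd H x y) = hadd K (T x) (T y)"
  and "!!x c. x \<in> carr H ==> T (hscale H c x) = hscale K c (T x)"
  and "!!x. x \<in> carr H ==> hnorm K (T x) \<le> C * hnorm H x"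
 shows "T \<in> bdd_ops H K"
 using assms(1-4) unfolding bdd_ops_def by (auto simp: PiE_def intro!: exI[of _ C] assms(5))

lemma op_eqI:
 assumes "S \<in> bdd_ops H K" "T \<in> bdd_ops H K" "!!x. x \<in> carr H ==> S x = T x"
 shows "S = T"
 using assms by (intro extensionalityI[of _ "carr H"]) (auto simp: bdd_ops_extensional)

lemma bdd_ops_compose:
 assumes "complete_ips H" "complete_ips K" "complete_ips L" "T \<in> bdd_ops H K" "S \<in> bdd_ops K L"
 shows "compose (carr H) S T \<in> bdd_ops H L"
proof -
 obtain C where C: "C >= 0" "!!x. x : carr H ==> hnorm K (T x) <= C * hnorm H x"
  using bdd_ops_bound[OF assms(1,4)] by blast
 obtain D where D: "D >= 0" "!!x. x : carr K ==> hnorm L (S x) <= D * hnorm K x"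
  using bdd_ops_bound[OF assms(2,5)] by blast
 have "hnorm L (S (T x)) <= (D * C) * hnorm H x" if "x : carr H" for x
  using D(2)[OF op_carr[OF assms(4) that]] mult_left_mono[OF C(2)[OF that] D(1)] by simp
 then show ?thesis
  using assms by (intro bdd_opsI[where C = "D * C"]) (auto simp: compose_def bdd_opsD)
qed

lemma op_id_bdd: "complete_ips H ==> op_id H \<in> bdd_ops H H"
 by (rule bdd_opsI[where C = 1]) (auto simp: op_id_def)

lemma op_zero_bdd: "complete_ips H ==> complete_ips K ==> op_zero H K \<in> bdd_ops H K"
 by (rule bdd_opsI[where C = 0]) (auto simp: op_zero_def intro!: hip_ext[of K])

lemma op_add_bdd:
 assumes "complete_ips H" "complete_ips K" "S \<in> bdd_ops H K" "T \<in> bdd_ops H K"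
 shows "op_add H K S T \<in> bdd_ops H K"
proof -
 obtain C where C: "C >= 0" "!!x. x : carr H ==> hnorm K (S x) <= C * hnorm H x"
  using bdd_ops_bound[OF assms(1,3)] by blast
 obtain D where D: "D >= 0" "!!x. x : carr H ==> hnorm K (T x) <= D * hnorm H x"
  using bdd_ops_bound[OF assms(1,4)] by blast
 have "hnorm K (hadd K (S x) (T x)) <= (C + D) * hnorm H x" if "x : carr H" for x
  using hnorm_triangle[OF assms(2), of "S x" "T x"] C(2)[OF that] D(2)[OF that] assms that
  by (simp add: bdd_opsD distrib_right)
 then show ?thesis
  using assms by (intro bdd_opsI[where C = "C + D"])
   (auto simp: op_add_def bdd_opsD intro!: hip_ext[of K] simp: algebra_simps)
qed

lemma op_scale_bdd:
 assumes "complete_ips H" "complete_ips K" "T \<in> bdd_ops H K"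
 shows "op_scale H K c T \<in> bdd_ops H K"
proof -
 obtain D where D: "D >= 0" "!!x. x : carr H ==> hnorm K (T x) <= D * hnorm H x"
  using bdd_ops_bound[OF assms(1,3)] by blast
 have "hnorm K (hscale K c (T x)) <= (cmod c * D) * hnorm H x" if "x : carr H" for x
  using hnorm_scale[OF assms(2) op_carr[OF assms(3) that]] mult_left_mono[OF D(2)[OF that], of "cmod c"]
  by simp
 then show ?thesis
  using assms by (intro bdd_opsI[where C = "cmod c * D"])
   (auto simp: op_scale_def bdd_opsD intro!: hip_ext[of K] simp: algebra_simps)
qed

lemma adj_exists:
 assumes H: "complete_ips H" and K: "complete_ips K" and T: "T \<in> bdd_ops H K"
 shows "\<exists>S. S \<in> bdd_ops K H \<and> (\<forall>x\<in>carr H. \<forall>y\<in>carr K. hip K y (T x) = hip H (S y) x)"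
proof -
 obtain C where C: "C >= 0" "!!x. x : carr H ==> hnorm K (T x) <= C * hnorm H x"
  using bdd_ops_bound[OF H T] by blast
 have "EX z:carr H. ALL x:carr H. hip H x z = hip K (T x) y" if y: "y : carr K" for y
 proof (rule Riesz_representation[OF H, of "\<lambda>x. hip K (T x) y" "C * hnorm K y"])
  fix x assume x: "x : carr H"
  show "cmod (hip K (T x) y) <= C * hnorm K y * hnorm H x"
   using Cauchy_Schwarz[OF K op_carr[OF T x] y] mult_right_mono[OF C(2)[OF x] hip_self(3)[OF K y]]
   by (simp add: mult_ac)
 qed (insert K y T, auto simp: bdd_opsD)
 then obtain S where S: "!!y. y : carr K ==> S y : carr H"
  "!!x y. y : carr K ==> x : carr H ==> hip H x (S y) = hip K (T x) y" by metis
 have S': "hip H (S y) x = hip K y (T x)" if "y : carr K" "x : carr H" for x y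
  using S(2)[OF that] hip_cnj[OF H that(2) S(1)[OF that(1)]] hip_cnj[OF K op_carr[OF T that(2)] that(1)]
  by simp
 have "restrict S (carr K) : bdd_ops K H"
 proof (rule bdd_opsI[where C = C])
  fix y assume y: "y : carr K"
  have "(hnorm H (S y))\<^sup>2 = Re (hip K (T (S y)) y)"
   using S(2)[OF y S(1)[OF y]] hip_self(2)[OF H S(1)[OF y]] by simp
  also have "... <= hnorm K (T (S y)) * hnorm K y"
   using Cauchy_Schwarz[OF K op_carr[OF T S(1)[OF y]] y] complex_Re_le_cmod order_trans by blast
  also have "... <= C * hnorm H (S y) * hnorm K y"
   using mult_right_mono[OF C(2)[OF S(1)[OF y]] hip_self(3)[OF K y]] by simp
  finally have "hnorm H (S y) * hnorm H (S y) <= (C * hnorm K y) * hnorm H (S y)"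
   by (simp add: power2_eq_square mult_ac)
  then have "hnorm H (S y) <= C * hnorm K y"
   using C(1) hip_self(3)[OF H S(1)[OF y]] hip_self(3)[OF K y]
   by (metis mult_nonneg_nonneg mult_right_le_imp_le order_le_less)
  then show "hnorm H (restrict S (carr K) y) <= C * hnorm K y" using y by simp
 qed (insert H K S T, auto intro!: hip_ext[of H] simp: bdd_opsD algebra_simps)
 then show ?thesis using S' by (intro exI[of _ "restrict S (carr K)"]) auto
qed

lemma adj_unique:
 assumes H: "complete_ips H" and K: "complete_ips K" and T: "T \<in> bdd_ops H K"
  and S: "S \<in> bdd_ops K H" "!!x y. x \<in> carr H ==> y \<in> carr K ==> hip K y (T x) = hip H (S y) x"
 shows "adj H K T = S"
 unfolding adj_def
proof (rule the_equality)
 fix R assume R: "R : bdd_ops K H & (ALL x:carr H. ALL y:carr K. hip K y (T x) = hip H (R y) x)"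
 show "R = S"
 proof (rule op_eqI[of _ K H])
  fix y assume y: "y : carr K"
  have "hip H z (R y) = hip H z (S y)" if z: "z : carr H" for z
   using R S(2)[OF z y] z y hip_cnj[OF H _ z, of "R y"] hip_cnj[OF H _ z, of "S y"] S(1)
   by (metis op_carr)
  then show "R y = S y" using R S y by (intro hip_ext[OF H]) (auto simp: bdd_opsD)
 qed (use R S in auto)
qed (use S in auto)

lemma adj_bdd:
 assumes "complete_ips H" "complete_ips K" "T \<in> bdd_ops H K"
 shows "adj H K T \<in> bdd_ops K H"
 using adj_exists[OF assms] adj_unique[OF assms] by metis

lemma adj_left:
 assumes "complete_ips H" "complete_ips K" "T \<in> bdd_ops H K" "x \<in> carr H" "y \<in> carr K"
 shows "hip H (adj H K T y) x = hip K y (T x)"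
 using adj_exists[OF assms(1-3)] adj_unique[OF assms(1-3)] assms(4,5) by metis

lemma adj_right:
 assumes "complete_ips H" "complete_ips K" "T \<in> bdd_ops H K" "x \<in> carr H" "y \<in> carr K"
 shows "hip H x (adj H K T y) = hip K (T x) y"
 using adj_left[OF assms] hip_cnj[OF assms(1) _ assms(4), of "adj H K T y"]
  hip_cnj[OF assms(2,5), of "T x"] assms adj_bdd[OF assms(1-3)] by (simp add: bdd_opsD)

lemma adj_adj:
 assumes "complete_ips H" "complete_ips K" "T \<in> bdd_ops H K"
 shows "adj K H (adj H K T) = T"
 using assms by (intro adj_unique) (auto simp: adj_bdd adj_right)

lemma adj_compose:
 assumes "complete_ips H" "complete_ips K" "complete_ips L" "T \<in> bdd_ops H K" "S \<in> bdd_ops K L"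
 shows "adj H L (compose (carr H) S T) = compose (carr L) (adj H K T) (adj K L S)"
 using assms by (intro adj_unique bdd_ops_compose[of L K H] bdd_ops_compose[of H K L] adj_bdd)
  (auto simp: compose_eq adj_left op_carr op_carr[OF adj_bdd])

lemma adj_id: "complete_ips H ==> adj H H (op_id H) = op_id H"
 by (intro adj_unique op_id_bdd) (auto simp: op_id_def)

lemma adj_add:
 assumes "complete_ips H" "complete_ips K" "S \<in> bdd_ops H K" "T \<in> bdd_ops H K"
 shows "adj H K (op_add H K S T) = op_add K H (adj H K S) (adj H K T)"
 using assms by (intro adj_unique op_add_bdd adj_bdd)
  (auto simp: op_add_def adj_left op_carr op_carr[OF adj_bdd])

lemma adj_scale:
 assumes "complete_ips H" "complete_ips K" "T \<in> bdd_ops H K"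
 shows "adj H K (op_scale H K c T) = op_scale K H (cnj c) (adj H K T)"
 using assms by (intro adj_unique op_scale_bdd adj_bdd)
  (auto simp: op_scale_def adj_left op_carr op_carr[OF adj_bdd])

subsection \<open>Density\<close>

lemma op_eq_on_dense:
 assumes H: "complete_ips H" and K: "complete_ips K" and S: "S \<in> bdd_ops H K" and T: "T \<in> bdd_ops H K"
  and D: "hdense H D" and eq: "!!x. x \<in> D ==> S x = T x"
 shows "S = T"
proof (rule op_eqI[OF S T])
 fix x assume x: "x : carr H"
 obtain C where C: "C >= 0" "!!x. x : carr H ==> hnorm K (S x) <= C * hnorm H x"
  using bdd_ops_bound[OF H S] by blast
 obtain E where E: "E >= 0" "!!x. x : carr H ==> hnorm K (T x) <= E * hnorm H x"
  using bdd_ops_bound[OF H T] by blast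
 have "hdist K (S x) (T x) <= 0 + e" if e: "e > 0" for e
 proof -
  obtain d where d: "d : D" "hdist H x d < e / (C + E + 1)"
   using D x e C(1) E(1) unfolding hdense_def by (metis add_nonneg_nonneg add_nonneg_pos divide_pos_pos zero_less_one)
  have d': "d : carr H" using D d unfolding hdense_def by blast
  have "hdist K (S x) (T x) <= hdist K (S x) (S d) + hdist K (T d) (T x)"
   using hnorm_triangle_diff[OF K, of "S x" "S d" "T x"] eq[OF d(1)] S T x d' by (simp add: bdd_opsD)
  also have "hdiff K (S x) (S d) = S (hdiff H x d)" using bdd_ops_diff[OF H S x d'] by simp
  also have "hdiff K (T d) (T x) = T (hdiff H d x)" using bdd_ops_diff[OF H T d' x] by simp
  also have "hnorm K (S (hdiff H x d)) <= C * hdist H x d" using C x d' H by simp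
  also have "hnorm K (T (hdiff H d x)) <= E * hdist H x d" using E x d' H hnorm_swap[OF H x d'] by simp
  finally have "hdist K (S x) (T x) <= (C + E) * hdist H x d"
   by (simp add: distrib_right)
  also have "... <= (C + E + 1) * hdist H x d"
   using hip_self(3)[OF H, of "hdiff H x d"] x d' H by (intro mult_right_mono) auto
  also have "... <= e" using d(2) C(1) E(1) by (simp add: pos_less_divide_eq mult.commute)
  finally show ?thesis by simp
 qed
 then have "hdist K (S x) (T x) <= 0" using field_le_epsilon by blast
 then have "hdiff K (S x) (T x) = hzero K"
  using hip_self(3)[OF K, of "hdiff K (S x) (T x)"] K S T x hnorm_eq_0[OF K, of "hdiff K (S x) (T x)"]
  by (simp add: bdd_opsD)
 then show "S x = T x" using hdiff_eq_0[OF K] S T x by (simp add: bdd_opsD)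
qed

lemma hspan_carr:
 assumes "complete_ips H" "S \<subseteq> carr H" "x \<in> hspan H S"
 shows "x \<in> carr H"
 using assms(3) by (induction rule: hspan.induct) (insert assms(1,2), auto simp: subset_eq)

lemma op_eq_on_hspan:
 assumes H: "complete_ips H" and K: "complete_ips K" and S: "S \<in> bdd_ops H K" and T: "T \<in> bdd_ops H K"
  and D: "D \<subseteq> carr H" and eq: "!!x. x \<in> D ==> S x = T x" and x: "x \<in> hspan H D"
 shows "S x = T x"
 using x
proof (induction rule: hspan.induct)
 case zero
 then show ?case using bdd_ops_zero[OF H K S] bdd_ops_zero[OF H K T] by simp
next
 case (step x y c)
 then have "x : carr H" "y : carr H" using D hspan_carr[OF H D] by auto
 then show ?case using step S T H eq by (simp add: bdd_opsD)
qed

lemma op_eq_on_total: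
 assumes H: "complete_ips H" and K: "complete_ips K" and S: "S \<in> bdd_ops H K" and T: "T \<in> bdd_ops H K"
  and D: "hdense H (hspan H D)" "D \<subseteq> carr H" and eq: "!!x. x \<in> D ==> S x = T x"
 shows "S = T"
 by (rule op_eq_on_dense[OF H K S T D(1)]) (rule op_eq_on_hspan[OF H K S T D(2) eq])

lemma orthogonal_to_dense:
 assumes H: "complete_ips H" and D: "hdense H D" and x: "x \<in> carr H"
  and orth: "!!d. d \<in> D ==> hip H d x = 0"
 shows "x = hzero H"
proof (rule ccontr)
 assume "x ~= hzero H"
 then have p: "hnorm H x > 0" using hip_self(3)[OF H x] hnorm_eq_0[OF H x] by simp
 then obtain d where d: "d : D" "hdist H x d < hnorm H x" using D x unfolding hdense_def by blast
 have d': "d : carr H" using D d unfolding hdense_def by blast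
 have "(hnorm H x)\<^sup>2 = Re (hip H (hdiff H x d) x)"
  using orth[OF d(1)] x d' H by (simp add: hip_self(2))
 also have "... <= hdist H x d * hnorm H x"
  using Cauchy_Schwarz[OF H, of "hdiff H x d" x] x d' H complex_Re_le_cmod order_trans by fastforce
 also have "... < hnorm H x * hnorm H x" using d(2) p by simp
 finally show False by (simp add: power2_eq_square)
qed

lemma orthogonal_to_hspan:
 assumes H: "complete_ips H" and D: "D \<subseteq> carr H" and x: "x \<in> carr H"
  and orth: "!!d. d \<in> D ==> hip H d x = 0" and y: "y \<in> hspan H D"
 shows "hip H y x = 0"
 using y
proof (induction rule: hspan.induct)
 case (step z y c)
 then show ?case using H D x orth hspan_carr[OF H D step(2)] by (auto simp: subset_eq)
qed (use H x in simp)

text \<open>A closed subspace is itself complete, so the Riesz representation of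
  \<open>n \<mapsto> hip n x\<close> inside the subspace is the orthogonal projection of \<open>x\<close>.\<close>

lemma projection_exists:
 fixes H :: "('v, 'a) hilb_scheme"
 assumes H: "complete_ips H" and N: "N \<subseteq> carr H" "hzero H \<in> N"
  and Nadd: "!!x y. x \<in> N ==> y \<in> N ==> hadd H x y \<in> N"
  and Nscale: "!!x c. x \<in> N ==> hscale H c x \<in> N"
  and Ncl: "!!X x. (!!n::nat. X n \<in> N) ==> x \<in> carr H ==> (\<lambda>n. hdist H (X n) x) \<longlonglongrightarrow> 0 ==> x \<in> N"
 obtains P where "P \<in> bdd_ops H H" "!!x. x \<in> carr H ==> P x \<in> N"
  "!!x n. x \<in> carr H ==> n \<in> N ==> hip H n (P x) = hip H n x"
proof -
 define M where "M = H\<lparr>carr := N\<rparr>"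
 have M: "carr M = N" "hzero M = hzero H" "hadd M = hadd H" "hscale M = hscale H" "hip M = hip H"
  "hdiff M = hdiff H" "hnorm M = hnorm H"
  by (auto simp: M_def hdiff_def hnorm_def fun_eq_iff)
 have "complex_inner_product_space M"
  using complete_ips_cip[OF H] unfolding complex_inner_product_space_def M(1-6)
  by (elim conjE, intro conjI) (insert N Nadd Nscale, (assumption | meson subsetD)+)
 moreover have "EX x:N. (\<lambda>n. hdist H (X n) x) \<longlonglongrightarrow> 0"
  if X: "ALL n. X n : N" "ALL e>0. EX K. ALL m>=K. ALL n>=K. hdist H (X m) (X n) < e" for X :: "nat => 'v"
 proof -
  have "ALL n. X n : carr H" using X N by blast
  then obtain x where "x : carr H" "(\<lambda>n. hdist H (X n) x) \<longlonglongrightarrow> 0"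
   using H X(2) unfolding complete_ips_def by blast
  then show ?thesis using Ncl X by blast
 qed
 ultimately have Mc: "complete_ips M"
  unfolding complete_ips_def M by blast
 have sub: "n : carr H" if "n : N" for n using N that by blast
 have "EX p:N. ALL n:N. hip H n p = hip H n x" if x: "x : carr H" for x
  by (rule Riesz_representation[OF Mc, of "\<lambda>n. hip H n x" "hnorm H x", unfolded M])
   (insert x sub H Cauchy_Schwarz[OF H _ x], auto simp: mult.commute)
 then obtain P where P: "!!x. x : carr H ==> P x : N"
  "!!x n. x : carr H ==> n : N ==> hip H n (P x) = hip H n x" by metis
 have ext: "p = q" if "p : N" "q : N" "!!n. n : N ==> hip H n p = hip H n q" for p q
  using hip_ext[OF Mc, unfolded M] that by blast
 have "restrict P (carr H) : bdd_ops H H"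
 proof (rule bdd_opsI[where C = 1])
  fix x assume x: "x : carr H"
  have "(hnorm H (P x))\<^sup>2 = Re (hip H (P x) x)"
   using P(2)[OF x P(1)[OF x]] hip_self(2)[OF H sub[OF P(1)[OF x]]] by simp
  also have "... <= hnorm H (P x) * hnorm H x"
   using Cauchy_Schwarz[OF H sub[OF P(1)[OF x]] x] complex_Re_le_cmod order_trans by blast
  finally have "hnorm H (P x) * hnorm H (P x) <= hnorm H x * hnorm H (P x)"
   by (simp add: power2_eq_square mult_ac)
  then have "hnorm H (P x) <= hnorm H x"
   using hip_self(3)[OF H sub[OF P(1)[OF x]]] hip_self(3)[OF H x]
   by (metis mult_right_le_imp_le order_le_less)
  then show "hnorm H (restrict P (carr H) x) <= 1 * hnorm H x" using x by simp
 next
  fix x y assume x: "x : carr H" and y: "y : carr H"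
  have "P (hadd H x y) = hadd H (P x) (P y)"
   by (rule ext) (use x y P sub Nadd H in auto)
  then show "restrict P (carr H) (hadd H x y) = hadd H (restrict P (carr H) x) (restrict P (carr H) y)"
   using x y H by simp
 next
  fix x c assume x: "x : carr H"
  have "P (hscale H c x) = hscale H c (P x)"
   by (rule ext) (use x P sub Nscale H in auto)
  then show "restrict P (carr H) (hscale H c x) = hscale H c (restrict P (carr H) x)"
   using x H by simp
 qed (use P sub in auto)
 then show ?thesis using P that[of "restrict P (carr H)"] by simp
qed

lemma hdense_of_total_subspace:
 fixes H :: "('v, 'a) hilb_scheme"
 assumes H: "complete_ips H" and D: "D \<subseteq> carr H" "hzero H \<in> D"
  and Dadd: "!!x y. x \<in> D ==> y \<in> D ==> hadd H x y \<in> D"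
  and Dscale: "!!x c. x \<in> D ==> hscale H c x \<in> D"
  and total: "!!x. x \<in> carr H ==> (!!d. d \<in> D ==> hip H d x = 0) ==> x = hzero H"
 shows "hdense H D"
proof -
 define N where "N = {x : carr H. ALL e>0. EX d:D. hdist H x d < e}"
 have DN: "D <= N" using D H by (auto simp: N_def hdiff_def subset_eq) (metis D(1) H carr_closed(1,4) hdiff_def hdiff_eq_0 hip_ext hip_right(3) hip_zero(1) hnorm_zero subsetD diff_self)
 obtain P where P: "P : bdd_ops H H" "!!x. x : carr H ==> P x : N"
  "!!x n. x : carr H ==> n : N ==> hip H n (P x) = hip H n x"
 proof (rule projection_exists[OF H])
  show "N <= carr H" by (auto simp: N_def)
  show "hzero H : N" using DN D by blast
  fix x y assume x: "x : N" and y: "y : N"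
  have "EX d:D. hdist H (hadd H x y) d < e" if e: "e > 0" for e
  proof -
   obtain d f where d: "d : D" "hdist H x d < e/2" "f : D" "hdist H y f < e/2"
    using x y half_gt_zero[OF e] unfolding N_def by blast
   have c: "x : carr H" "y : carr H" "d : carr H" "f : carr H" using x y d D by (auto simp: N_def)
   have "hdiff H (hadd H x y) (hadd H d f) = hadd H (hdiff H x d) (hdiff H y f)"
    using c H by (intro hip_ext[OF H]) auto
   then have "hdist H (hadd H x y) (hadd H d f) < e"
    using hnorm_triangle[OF H, of "hdiff H x d" "hdiff H y f"] c H d by simp
   then show ?thesis using Dadd d by blast
  qed
  then show "hadd H x y : N" using x y H by (simp add: N_def)
 next
  fix x c assume x: "x : N"
  have "EX d:D. hdist H (hscale H c x) d < e" if e: "e > 0" for e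
  proof -
   have "e / (cmod c + 1) > 0" using e by (simp add: add_nonneg_pos)
   then obtain d where d: "d : D" "hdist H x d < e / (cmod c + 1)"
    using x unfolding N_def by blast
   have cc: "x : carr H" "d : carr H" using x d D by (auto simp: N_def)
   have "hdiff H (hscale H c x) (hscale H c d) = hscale H c (hdiff H x d)"
    using cc H by (intro hip_ext[OF H]) (auto simp: algebra_simps)
   then have "hdist H (hscale H c x) (hscale H c d) = cmod c * hdist H x d"
    using hnorm_scale[OF H, of "hdiff H x d"] cc H by simp
   also have "... <= (cmod c + 1) * hdist H x d"
    using hip_self(3)[OF H, of "hdiff H x d"] cc H by (intro mult_right_mono) auto
   also have "... < e" using d(2) by (simp add: pos_less_divide_eq add_nonneg_pos mult.commute)
   finally show ?thesis using Dscale d by blast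
  qed
  then show "hscale H c x : N" using x H by (simp add: N_def)
 next
  fix X :: "nat => 'v" and x
  assume X: "!!n. X n : N" and x: "x : carr H" and lim: "(\<lambda>n. hdist H (X n) x) \<longlonglongrightarrow> 0"
  have "EX d:D. hdist H x d < e" if e: "e > 0" for e
  proof -
   have "\<forall>\<^sub>F n in sequentially. hdist H (X n) x < e/2"
    using lim half_gt_zero[OF e] by (rule order_tendstoD)
   then obtain n where n: "hdist H (X n) x < e/2" by (auto simp: eventually_sequentially)
   obtain d where d: "d : D" "hdist H (X n) d < e/2"
    using X[of n] half_gt_zero[OF e] unfolding N_def by blast
   have c: "X n : carr H" "d : carr H" using X[of n] d D by (auto simp: N_def)
   have "hdist H x d < e"
    using hnorm_triangle_diff[OF H x c] hnorm_swap[OF H x c(1)] n d by simp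
   then show ?thesis using d by blast
  qed
  then show "x : N" using x by (simp add: N_def)
 qed blast
 have "x : N" if x: "x : carr H" for x
 proof -
  have px: "P x : carr H" using P(1) x by (simp add: bdd_opsD)
  have "hdiff H x (P x) = hzero H"
  proof (rule total)
   fix d assume d: "d : D"
   then show "hip H d (hdiff H x (P x)) = 0"
    using P(3)[OF x, of d] DN D px x H by (auto simp: subset_eq)
  qed (use x px H in simp)
  then have "x = P x" using hdiff_eq_0[OF H x px] by simp
  then show ?thesis using P(2)[OF x] by simp
 qed
 then show ?thesis using D unfolding hdense_def N_def by blast
qed

section \<open>C*-categories of intertwiners\<close>

lemma op_norm_upper:
 assumes H: "complete_ips H" and K: "complete_ips K" and T: "T \<in> bdd_ops H K" and x: "x \<in> carr H"
 shows "hnorm K (T x) \<le> op_norm H K T * hnorm H x"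
proof -
 obtain C where C: "C >= 0" "!!x. x : carr H ==> hnorm K (T x) <= C * hnorm H x"
  using bdd_ops_bound[OF H T] by blast
 have "hnorm K (T y) <= C" if "y : carr H" "hnorm H y <= 1" for y
  using C(2)[OF that(1)] mult_left_mono[OF that(2) C(1)] by simp
 then have bdd: "bdd_above ((\<lambda>x. hnorm K (T x)) ` {x : carr H. hnorm H x <= 1})"
  by (intro bdd_aboveI2[where M = C]) auto
 show ?thesis
 proof (cases "hnorm H x = 0")
  case True
  then show ?thesis using hnorm_eq_0[OF H x] bdd_ops_zero[OF H K T] K by simp
 next
  case False
  then have p: "hnorm H x > 0" using hip_self(3)[OF H x] by simp
  define y where "y = hscale H (complex_of_real (1 / hnorm H x)) x"
  have y: "y : carr H" "hnorm H y <= 1"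
   using x H p hnorm_scale[OF H x] by (auto simp: y_def norm_divide)
  have "hnorm K (T y) <= op_norm H K T"
   unfolding op_norm_def by (rule cSUP_upper[OF _ bdd]) (use y in simp)
  moreover have "hnorm K (T y) = hnorm K (T x) / hnorm H x"
   unfolding y_def using hnorm_scale[OF K op_carr[OF T x]] bdd_opsD(4)[OF T x] p
   by (simp add: norm_divide)
  ultimately show ?thesis using p by (simp add: divide_simps)
 qed
qed

lemma op_norm_least:
 assumes H: "complete_ips H" and C: "C \<ge> 0" "!!x. x \<in> carr H ==> hnorm K (T x) \<le> C * hnorm H x"
 shows "op_norm H K T \<le> C"
 unfolding op_norm_def
proof (rule cSUP_least)
 show "{x : carr H. hnorm H x <= 1} ~= {}" using H carr_closed(1)[OF H] by force
 fix x assume "x : {x : carr H. hnorm H x <= 1}"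
 then show "hnorm K (T x) <= C" using C(2)[of x] mult_left_mono[of "hnorm H x" 1 C] C(1) by auto
qed

lemma op_norm_nonneg:
 assumes H: "complete_ips H" and K: "complete_ips K" and T: "T \<in> bdd_ops H K"
 shows "0 \<le> op_norm H K T"
proof -
 obtain C where C: "C >= 0" "!!x. x : carr H ==> hnorm K (T x) <= C * hnorm H x"
  using bdd_ops_bound[OF H T] by blast
 have "hnorm K (T y) <= C" if "y : carr H" "hnorm H y <= 1" for y
  using C(2)[OF that(1)] mult_left_mono[OF that(2) C(1)] by simp
 then have bdd: "bdd_above ((\<lambda>x. hnorm K (T x)) ` {x : carr H. hnorm H x <= 1})"
  by (intro bdd_aboveI2[where M = C]) auto
 have "hnorm K (T (hzero H)) <= op_norm H K T"
  unfolding op_norm_def by (rule cSUP_upper[OF _ bdd]) (use H in simp)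
 then show ?thesis using bdd_ops_zero[OF H K T] K by simp
qed

lemma op_norm_eq_0:
 assumes H: "complete_ips H" and K: "complete_ips K" and T: "T \<in> bdd_ops H K" and 0: "op_norm H K T = 0"
 shows "T = op_zero H K"
proof (rule op_eqI[OF T op_zero_bdd[OF H K]])
 fix x assume x: "x : carr H"
 have "hnorm K (T x) = 0"
  using op_norm_upper[OF H K T x] 0 hip_self(3)[OF K op_carr[OF T x]] by simp
 then show "T x = op_zero H K x" using hnorm_eq_0[OF K op_carr[OF T x]] x by (simp add: op_zero_def)
qed

lemma op_norm_scale:
 assumes H: "complete_ips H" and K: "complete_ips K" and T: "T \<in> bdd_ops H K"
 shows "op_norm H K (op_scale H K c T) = cmod c * op_norm H K T"
proof -
 have le: "op_norm H K (op_scale H K c T) <= cmod c * op_norm H K T" if T: "T : bdd_ops H K" for c T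
 proof (rule op_norm_least[OF H])
  show "0 <= cmod c * op_norm H K T" using op_norm_nonneg[OF H K T] by simp
  fix x assume x: "x : carr H"
  show "hnorm K (op_scale H K c T x) <= cmod c * op_norm H K T * hnorm H x"
   using hnorm_scale[OF K op_carr[OF T x], of c] mult_left_mono[OF op_norm_upper[OF H K T x], of "cmod c"] x
   by (simp add: op_scale_def mult.assoc)
 qed
 show ?thesis
 proof (cases "c = 0")
  case True
  then show ?thesis using le[OF T, of c] op_norm_nonneg[OF H K op_scale_bdd[OF H K T], of c] by simp
 next
  case False
  have eq: "op_scale H K (inverse c) (op_scale H K c T) = T"
   using False H K T by (intro op_eqI[of _ H K] op_scale_bdd)
    (auto simp: op_scale_def bdd_opsD intro!: hip_ext[OF K])
  have "cmod c * op_norm H K T <= cmod c * (cmod (inverse c) * op_norm H K (op_scale H K c T))"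
   using mult_left_mono[OF le[OF op_scale_bdd[OF H K T], of "inverse c" c], of "cmod c"] unfolding eq by simp
  also have "... = op_norm H K (op_scale H K c T)" using False by (simp add: norm_inverse)
  finally show ?thesis using le[OF T, of c] by simp
 qed
qed

lemma op_norm_triangle:
 assumes H: "complete_ips H" and K: "complete_ips K" and S: "S \<in> bdd_ops H K" and T: "T \<in> bdd_ops H K"
 shows "op_norm H K (op_add H K S T) \<le> op_norm H K S + op_norm H K T"
proof (rule op_norm_least[OF H])
 show "0 <= op_norm H K S + op_norm H K T" using op_norm_nonneg[OF H K] S T by simp
 fix x assume x: "x : carr H"
 show "hnorm K (op_add H K S T x) <= (op_norm H K S + op_norm H K T) * hnorm H x"
  using hnorm_triangle[OF K op_carr[OF S x] op_carr[OF T x]] op_norm_upper[OF H K S x] op_norm_upper[OF H K T x] x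
  by (simp add: op_add_def distrib_right)
qed

lemma op_norm_compose:
 assumes H: "complete_ips H" and K: "complete_ips K" and L: "complete_ips L"
  and T: "T \<in> bdd_ops H K" and S: "S \<in> bdd_ops K L"
 shows "op_norm H L (compose (carr H) S T) \<le> op_norm K L S * op_norm H K T"
proof (rule op_norm_least[OF H])
 show "0 <= op_norm K L S * op_norm H K T" using op_norm_nonneg[OF H K T] op_norm_nonneg[OF K L S] by simp
 fix x assume x: "x : carr H"
 show "hnorm L (compose (carr H) S T x) <= op_norm K L S * op_norm H K T * hnorm H x"
  using op_norm_upper[OF K L S op_carr[OF T x]] x
   mult_left_mono[OF op_norm_upper[OF H K T x] op_norm_nonneg[OF K L S]]
  by (simp add: compose_eq mult.assoc)
qed

lemma op_norm_adj_le:
 assumes H: "complete_ips H" and K: "complete_ips K" and T: "T \<in> bdd_ops H K"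
 shows "op_norm K H (adj H K T) \<le> op_norm H K T"
proof (rule op_norm_least[OF K op_norm_nonneg[OF H K T]])
 fix y assume y: "y : carr K"
 let ?z = "adj H K T y"
 have z: "?z : carr H" using adj_bdd[OF H K T] y by (simp add: bdd_opsD)
 have "(hnorm H ?z)\<^sup>2 = Re (hip K y (T ?z))"
  using adj_left[OF H K T z y] hip_self(2)[OF H z] by simp
 also have "... <= hnorm K y * hnorm K (T ?z)"
  using Cauchy_Schwarz[OF K y op_carr[OF T z]] complex_Re_le_cmod order_trans by blast
 also have "... <= hnorm K y * (op_norm H K T * hnorm H ?z)"
  using op_norm_upper[OF H K T z] hip_self(3)[OF K y] by (intro mult_left_mono)
 finally have "hnorm H ?z * hnorm H ?z <= (op_norm H K T * hnorm K y) * hnorm H ?z"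
  by (simp add: power2_eq_square mult_ac)
 then show "hnorm H ?z <= op_norm H K T * hnorm K y"
  using hip_self(3)[OF H z] hip_self(3)[OF K y] op_norm_nonneg[OF H K T]
  by (metis mult_nonneg_nonneg mult_right_le_imp_le order_le_less)
qed

lemma op_norm_cstar:
 assumes H: "complete_ips H" and K: "complete_ips K" and T: "T \<in> bdd_ops H K"
 shows "op_norm H H (compose (carr H) (adj H K T) T) = (op_norm H K T)\<^sup>2"
proof (rule antisym)
 note T' = adj_bdd[OF H K T]
 let ?A = "compose (carr H) (adj H K T) T"
 have A: "?A : bdd_ops H H" by (rule bdd_ops_compose[OF H K H T T'])
 show "op_norm H H ?A <= (op_norm H K T)\<^sup>2"
  using op_norm_compose[OF H K H T T'] mult_right_mono[OF op_norm_adj_le[OF H K T] op_norm_nonneg[OF H K T]]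
  by (simp add: power2_eq_square)
 have "op_norm H K T <= sqrt (op_norm H H ?A)"
 proof (rule op_norm_least[OF H])
  show "0 <= sqrt (op_norm H H ?A)" using op_norm_nonneg[OF H H A] by simp
  fix x assume x: "x : carr H"
  note Tx = op_carr[OF T x]
  have "(hnorm K (T x))\<^sup>2 = Re (hip H (?A x) x)"
   using adj_left[OF H K T x Tx] hip_self(2)[OF K Tx] x by (simp add: compose_eq)
  also have "... <= hnorm H (?A x) * hnorm H x"
   using Cauchy_Schwarz[OF H op_carr[OF A x] x] complex_Re_le_cmod order_trans by blast
  also have "... <= op_norm H H ?A * hnorm H x * hnorm H x"
   using op_norm_upper[OF H H A x] hip_self(3)[OF H x] by (intro mult_right_mono)
  also have "... = (sqrt (op_norm H H ?A) * hnorm H x)\<^sup>2"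
   using op_norm_nonneg[OF H H A] by (simp add: power_mult_distrib power2_eq_square)
  finally show "hnorm K (T x) <= sqrt (op_norm H H ?A) * hnorm H x"
   by (rule power2_le_imp_le) (use op_norm_nonneg[OF H H A] hip_self(3)[OF H x] in simp)
 qed
 then show "(op_norm H K T)\<^sup>2 <= op_norm H H ?A"
  using op_norm_nonneg[OF H K T] op_norm_nonneg[OF H H A] by (metis real_le_rsqrt real_sqrt_le_iff real_sqrt_pow2 power_mono)
qed

lemma op_norm_complete:
 fixes H :: "('v, 'a) hilb_scheme" and K :: "('v, 'b) hilb_scheme" and X :: "nat \<Rightarrow> 'v \<Rightarrow> 'v"
 assumes H: "complete_ips H" and K: "complete_ips K" and X: "!!n. X n \<in> bdd_ops H K"
  and Cauchy: "!!e. e > 0 ==> \<exists>N. \<forall>m\<ge>N. \<forall>n\<ge>N. op_norm H K (op_add H K (X m) (op_scale H K (-1) (X n))) < e"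
 obtains T where "T \<in> bdd_ops H K" "!!x. x \<in> carr H ==> (\<lambda>n. hdist K (X n x) (T x)) \<longlonglongrightarrow> 0"
  "(\<lambda>n. op_norm H K (op_add H K (X n) (op_scale H K (-1) T))) \<longlonglongrightarrow> 0"
proof -
 let ?d = "\<lambda>S T. op_add H K S (op_scale H K (-1) T)"
 have d_bdd: "?d S T : bdd_ops H K" if "S : bdd_ops H K" "T : bdd_ops H K" for S T
  using that by (intro op_add_bdd op_scale_bdd H K)
 have d_eq: "?d S T x = hdiff K (S x) (T x)" if "x : carr H" for S T x
  using that by (simp add: op_add_def op_scale_def hdiff_def)
 have Xx: "X n x : carr K" if "x : carr H" for n x by (rule op_carr[OF X that])
 have C2: "EX N. ALL m>=N. ALL n>=N. hdist K (X m x) (X n x) <= e * hnorm H x"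
  if e: "e > 0" and "x : carr H" for e x
 proof -
  obtain N where N: "ALL m>=N. ALL n>=N. op_norm H K (?d (X m) (X n)) < e"
   using Cauchy[OF e] by blast
  have "hdist K (X m x) (X n x) <= e * hnorm H x" if mn: "m >= N" "n >= N" for m n
  proof -
   have "hnorm K (?d (X m) (X n) x) <= op_norm H K (?d (X m) (X n)) * hnorm H x"
    by (rule op_norm_upper[OF H K d_bdd[OF X X] \<open>x : carr H\<close>])
   also have "... <= e * hnorm H x"
    using N mn hip_self(3)[OF H \<open>x : carr H\<close>] by (intro mult_right_mono) (auto intro: less_imp_le)
   finally show ?thesis by (simp only: d_eq[OF \<open>x : carr H\<close>])
  qed
  then show ?thesis by blast
 qed
 have "EX y:carr K. (\<lambda>n. hdist K (X n x) y) \<longlonglongrightarrow> 0" if x: "x : carr H" for x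
 proof -
  have "EX N. ALL m>=N. ALL n>=N. hdist K (X m x) (X n x) < e" if e: "e > 0" for e
  proof -
   have p: "e / (hnorm H x + 1) > 0" using e hip_self(3)[OF H x] by simp
   have "e / (hnorm H x + 1) * hnorm H x < e"
    using e hip_self(3)[OF H x] by (simp add: divide_simps)
   then show ?thesis using C2[OF p x] by (meson le_less_trans)
  qed
  then show ?thesis using K Xx[OF x] unfolding complete_ips_def by (elim conjE allE[of _ "\<lambda>n. X n x"]) simp
 qed
 then obtain T where T: "!!x. x : carr H ==> T x : carr K"
  "!!x. x : carr H ==> (\<lambda>n. hdist K (X n x) (T x)) \<longlonglongrightarrow> 0" by metis
 have lim: "(\<lambda>n. hip K z (X n x)) \<longlonglongrightarrow> hip K z (T x)" if "x : carr H" "z : carr K" for x z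
  using hip_tendsto(1)[OF K Xx T(1) that(2) T(2)] that by blast
 have close: "EX N. ALL n>=N. ALL x:carr H. hdist K (X n x) (T x) <= e * hnorm H x" if e: "e > 0" for e
 proof -
  obtain N where N: "ALL m>=N. ALL n>=N. op_norm H K (?d (X m) (X n)) < e" using Cauchy[OF e] by blast
  have "hdist K (X n x) (T x) <= e * hnorm H x" if n: "n >= N" and x: "x : carr H" for n x
  proof (rule LIMSEQ_le_const2)
   have d: "hdiff K (hdiff K (X n x) (X m x)) (hdiff K (X n x) (T x)) = hdiff K (T x) (X m x)" for m
    using K Xx[OF x] T(1)[OF x] by (intro hip_ext[OF K]) auto
   have "(\<lambda>m. hdist K (T x) (X m x)) \<longlonglongrightarrow> 0"
    using T(2)[OF x] hnorm_swap[OF K Xx[OF x] T(1)[OF x]] by simp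
   then show "(\<lambda>m. hdist K (X n x) (X m x)) \<longlonglongrightarrow> hdist K (X n x) (T x)"
    by (intro hnorm_tendsto[OF K]) (insert K Xx[OF x] T(1)[OF x], auto simp: d)
   have "hdist K (X n x) (X m x) <= e * hnorm H x" if m: "m >= N" for m
   proof -
    have "hnorm K (?d (X n) (X m) x) <= op_norm H K (?d (X n) (X m)) * hnorm H x"
     by (rule op_norm_upper[OF H K d_bdd[OF X X] x])
    also have "... <= e * hnorm H x"
     using N n m hip_self(3)[OF H x] by (intro mult_right_mono) (auto intro: less_imp_le)
    finally show ?thesis by (simp only: d_eq[OF x])
   qed
   then show "EX M. ALL m>=M. hdist K (X n x) (X m x) <= e * hnorm H x" by blast
  qed
  then show ?thesis by blast
 qed
 obtain N1 where N1: "ALL n>=N1. ALL x:carr H. hdist K (X n x) (T x) <= 1 * hnorm H x"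
  using close[of 1] by auto
 obtain C where C: "!!x. x : carr H ==> hnorm K (X N1 x) <= C * hnorm H x"
  using bdd_ops_bound[OF H X] by metis
 have Tb: "restrict T (carr H) : bdd_ops H K"
 proof (rule bdd_opsI[where C = "C + 1"])
  fix x assume x: "x : carr H"
  have "hnorm K (T x) <= hnorm K (X N1 x) + hdist K (T x) (X N1 x)"
   by (rule hnorm_le_diff[OF K T(1)[OF x] Xx[OF x]])
  also have "... <= C * hnorm H x + 1 * hnorm H x"
   using C[OF x] N1 x hnorm_swap[OF K T(1)[OF x] Xx[OF x, of N1]] by (intro add_mono) auto
  finally show "hnorm K (restrict T (carr H) x) <= (C + 1) * hnorm H x" using x by (simp add: distrib_right)
 next
  fix x y assume x: "x : carr H" and y: "y : carr H"
  have "T (hadd H x y) = hadd K (T x) (T y)"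
  proof (rule hip_ext[OF K])
   fix z assume z: "z : carr K"
   have "(\<lambda>n. hip K z (X n x) + hip K z (X n y)) \<longlonglongrightarrow> hip K z (T (hadd H x y))"
    using lim[of "hadd H x y" z] x y z H K Xx[OF x] Xx[OF y] by (simp add: bdd_opsD(3)[OF X x y])
   then show "hip K z (T (hadd H x y)) = hip K z (hadd K (T x) (T y))"
    using LIMSEQ_unique[OF _ tendsto_add[OF lim[OF x z] lim[OF y z]]] T(1) x y z K by simp
  qed (use x y H K T(1) in auto)
  then show "restrict T (carr H) (hadd H x y) = hadd K (restrict T (carr H) x) (restrict T (carr H) y)"
   using x y H by simp
 next
  fix x c assume x: "x : carr H"
  have "T (hscale H c x) = hscale K c (T x)"
  proof (rule hip_ext[OF K])
   fix z assume z: "z : carr K"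
   have "(\<lambda>n. c * hip K z (X n x)) \<longlonglongrightarrow> hip K z (T (hscale H c x))"
    using lim[of "hscale H c x" z] x z H K Xx[OF x] by (simp add: bdd_opsD(4)[OF X x])
   then show "hip K z (T (hscale H c x)) = hip K z (hscale K c (T x))"
    using LIMSEQ_unique[OF _ tendsto_mult_left[OF lim[OF x z], of c]] T(1) x z K by simp
  qed (use x H K T(1) in auto)
  then show "restrict T (carr H) (hscale H c x) = hscale K c (restrict T (carr H) x)"
   using x H by simp
 qed (use T(1) in auto)
 have "(\<lambda>n. op_norm H K (?d (X n) (restrict T (carr H)))) \<longlonglongrightarrow> 0"
 proof (rule LIMSEQ_I)
  fix r :: real assume r: "r > 0"
  obtain N where N: "ALL n>=N. ALL x:carr H. hdist K (X n x) (T x) <= r/2 * hnorm H x"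
   using close half_gt_zero[OF r] by blast
  have "norm (op_norm H K (?d (X n) (restrict T (carr H))) - 0) < r" if "n >= N" for n
  proof -
   have "op_norm H K (?d (X n) (restrict T (carr H))) <= r/2"
    by (rule op_norm_least[OF H]) (insert N that r, auto simp: d_eq)
   then show ?thesis using op_norm_nonneg[OF H K d_bdd[OF X Tb], of n] r by simp
  qed
  then show "EX N. ALL n>=N. norm (op_norm H K (?d (X n) (restrict T (carr H))) - 0) < r" by blast
 qed
 then show ?thesis using that[OF Tb] T(2) by simp
qed

text \<open>Solve \<open>B x = y\<close> by the Lax-Milgram theorem for the form \<open>\<langle>x, B z\<rangle>\<close>.\<close>

lemma coercive_inverse:
 assumes H: "complete_ips H" and B: "B \<in> bdd_ops H H" and sym: "adj H H B = B"
  and \<delta>: "\<delta> > 0" "!!x. x \<in> carr H ==> \<delta> * (hnorm H x)\<^sup>2 \<le> Re (hip H x (B x))"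
 obtains G where "G \<in> bdd_ops H H" "!!x. x \<in> carr H ==> B (G x) = x" "!!x. x \<in> carr H ==> G (B x) = x"
proof -
 obtain D where D: "D >= 0" "!!x. x : carr H ==> hnorm H (B x) <= D * hnorm H x"
  using bdd_ops_bound[OF H B] by blast
 have "EX x:carr H. B x = y" if y: "y : carr H" for y
 proof (rule hermitian_Lax_Milgram[OF H, of "\<lambda>x z. hip H x (B z)" \<delta> D "\<lambda>x. hip H x y" "hnorm H y"])
  fix x assume x: "x : carr H" "!!z. z : carr H ==> hip H z (B x) = hip H z y"
  then show ?thesis using y B by (intro bexI[of _ x] hip_ext[OF H]) (auto simp: bdd_opsD)
 next
  fix x z assume x: "x : carr H" and z: "z : carr H"
  show "hip H x (B z) = cnj (hip H z (B x))"
   using adj_left[OF H H B z x] sym hip_cnj[OF H z, of "B x"] x B by (simp add: bdd_opsD)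
  show "cmod (hip H x (B z)) <= D * (hnorm H x * hnorm H z)"
   using Cauchy_Schwarz[OF H x op_carr[OF B z]] mult_left_mono[OF D(2)[OF z] hip_self(3)[OF H x]]
   by (simp add: mult_ac)
 qed (insert H y B \<delta>, auto simp: bdd_opsD Cauchy_Schwarz mult.commute)
 then obtain G where G: "!!y. y : carr H ==> G y : carr H" "!!y. y : carr H ==> B (G y) = y" by metis
 have below: "\<delta> * hnorm H x <= hnorm H (B x)" if x: "x : carr H" for x
 proof -
  have "(\<delta> * hnorm H x) * hnorm H x <= Re (hip H x (B x))" using \<delta>(2)[OF x] by (simp add: power2_eq_square)
  also have "... <= hnorm H (B x) * hnorm H x"
   using Cauchy_Schwarz[OF H x op_carr[OF B x]] complex_Re_le_cmod order_trans by (simp add: mult.commute) blast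
  finally show ?thesis
   using hip_self(3)[OF H x] hip_self(3)[OF H op_carr[OF B x]]
   by (metis mult_right_le_imp_le order_le_less mult_zero_right)
 qed
 have inj: "x = y" if x: "x : carr H" and y: "y : carr H" and e: "B x = B y" for x y
 proof (rule hdiff_eq_0[OF H x y])
  have d: "hdiff H x y : carr H" using H x y by simp
  have "B (hdiff H x y) = hzero H"
   using bdd_ops_diff[OF H B x y] e hip_ext[OF H, of "hdiff H (B y) (B y)" "hzero H"] H op_carr[OF B y] by simp
  then have "hdist H x y = 0"
   using below[OF d] H \<delta>(1) hip_self(3)[OF H d] by (simp add: mult_le_0_iff)
  then show "hdiff H x y = hzero H" using hnorm_eq_0[OF H d] by simp
 qed
 have "restrict G (carr H) : bdd_ops H H"
 proof (rule bdd_opsI[where C = "1 / \<delta>"])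
  fix x assume x: "x : carr H"
  show "hnorm H (restrict G (carr H) x) <= 1 / \<delta> * hnorm H x"
   using below[OF G(1)[OF x]] G(2)[OF x] \<delta>(1) x by (simp add: field_simps)
 next
  fix x y assume x: "x : carr H" and y: "y : carr H"
  have "G (hadd H x y) = hadd H (G x) (G y)"
   by (rule inj) (insert x y G H B, auto simp: bdd_opsD)
  then show "restrict G (carr H) (hadd H x y) = hadd H (restrict G (carr H) x) (restrict G (carr H) y)"
   using x y H by simp
 next
  fix x c assume x: "x : carr H"
  have "G (hscale H c x) = hscale H c (G x)"
   by (rule inj) (insert x G H B, auto simp: bdd_opsD)
  then show "restrict G (carr H) (hscale H c x) = hscale H c (restrict G (carr H) x)"
   using x H by simp
 qed (use G in auto)
 moreover have "G (B x) = x" if "x : carr H" for x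
  using inj[of "G (B x)" x] G that B by (simp add: bdd_opsD)
 ultimately show ?thesis using that[of "restrict G (carr H)"] G B by (simp add: bdd_opsD)
qed

text \<open>\<open>A = T* T - z\<close> is normal, and \<open>A* A\<close> is bounded below by the squared distance of \<open>z\<close> to
  the non-negative reals; hence \<open>(A* A)\<^sup>-\<^sup>1 A*\<close> inverts \<open>A\<close>.\<close>

lemma resolvent_of_positive:
 assumes H: "complete_ips H" and K: "complete_ips K" and T: "T \<in> bdd_ops H K" and z: "z \<notin> \<real>\<^sub>\<ge>\<^sub>0"
 defines "A \<equiv> op_add H H (compose (carr H) (adj H K T) T) (op_scale H H (- z) (op_id H))"
 obtains R where "R \<in> bdd_ops H H" "!!x. x \<in> carr H ==> A (R x) = x" "!!x. x \<in> carr H ==> R (A x) = x"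
proof -
 note T' = adj_bdd[OF H K T]
 let ?h = "compose (carr H) (adj H K T) T"
 have h: "?h : bdd_ops H H" by (rule bdd_ops_compose[OF H K H T T'])
 have h_adj: "adj H H ?h = ?h" using adj_compose[OF H K H T T'] adj_adj[OF H K T] by simp
 have A: "A : bdd_ops H H" unfolding A_def by (intro op_add_bdd op_scale_bdd op_id_bdd H h)
 note A' = adj_bdd[OF H H A]
 have Ax: "A x = hadd H (?h x) (hscale H (- z) x)" if "x : carr H" for x
  using that by (simp add: A_def op_add_def op_scale_def op_id_def)
 have "adj H H A = op_add H H ?h (op_scale H H (cnj (- z)) (op_id H))"
  unfolding A_def using H h by (simp only: adj_add adj_scale adj_id op_scale_bdd op_id_bdd h_adj)
 then have A'x: "adj H H A x = hadd H (?h x) (hscale H (- cnj z) x)" if "x : carr H" for x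
  using that by (simp add: op_add_def op_scale_def op_id_def)
 have normal: "A (adj H H A x) = adj H H A (A x)" if x: "x : carr H" for x
  using x H h by (intro hip_ext[OF H]) (simp_all add: Ax A'x bdd_opsD algebra_simps)
 define d where "d = (if Im z = 0 then - Re z else \<bar>Im z\<bar>)"
 have d: "d > 0" using z by (auto simp: d_def complex_nonneg_Reals_iff)
 have below: "d * hnorm H x <= hnorm H (A x)" if x: "x : carr H" for x
 proof -
  have "hip H x (A x) = complex_of_real ((hnorm K (T x))\<^sup>2) - z * complex_of_real ((hnorm H x)\<^sup>2)"
   using x H K T T' adj_right[OF H K T x op_carr[OF T x]] hip_self(1)[OF H x] hip_self(1)[OF K op_carr[OF T x]]
   by (simp add: Ax compose_eq bdd_opsD)
  then have "d * (hnorm H x)\<^sup>2 <= cmod (hip H x (A x))"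
  proof (cases "Im z = 0")
   case True
   assume e: "hip H x (A x) = complex_of_real ((hnorm K (T x))\<^sup>2) - z * complex_of_real ((hnorm H x)\<^sup>2)"
   have "d * (hnorm H x)\<^sup>2 <= Re (hip H x (A x))" using True by (simp add: e d_def)
   then show ?thesis using complex_Re_le_cmod order_trans by blast
  next
   case False
   assume e: "hip H x (A x) = complex_of_real ((hnorm K (T x))\<^sup>2) - z * complex_of_real ((hnorm H x)\<^sup>2)"
   have "d * (hnorm H x)\<^sup>2 = \<bar>Im (hip H x (A x))\<bar>" using False by (simp add: e d_def abs_mult)
   then show ?thesis using abs_Im_le_cmod by simp
  qed
  also have "... <= hnorm H (A x) * hnorm H x"
   using Cauchy_Schwarz[OF H x op_carr[OF A x]] by (simp add: mult.commute)
  finally have "(d * hnorm H x) * hnorm H x <= hnorm H (A x) * hnorm H x"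
   by (simp add: power2_eq_square)
  then show ?thesis
   using hip_self(3)[OF H x] hip_self(3)[OF H op_carr[OF A x]]
   by (metis mult_right_le_imp_le order_le_less mult_zero_right)
 qed
 let ?B = "compose (carr H) (adj H H A) A"
 have B: "?B : bdd_ops H H" by (rule bdd_ops_compose[OF H H H A A'])
 have B_adj: "adj H H ?B = ?B" using adj_compose[OF H H H A A'] adj_adj[OF H H A] by simp
 obtain G where G: "G : bdd_ops H H" "!!x. x : carr H ==> ?B (G x) = x" "!!x. x : carr H ==> G (?B x) = x"
 proof (rule coercive_inverse[OF H B B_adj, of "d\<^sup>2"])
  fix x assume x: "x : carr H"
  have "hip H x (?B x) = hip H (A x) (A x)"
   using adj_right[OF H H A x op_carr[OF A x]] x by (simp add: compose_eq)
  then have "Re (hip H x (?B x)) = (hnorm H (A x))\<^sup>2" using hip_self(2)[OF H op_carr[OF A x]] by simp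
  moreover have "(d * hnorm H x)\<^sup>2 <= (hnorm H (A x))\<^sup>2"
   using below[OF x] d hip_self(3)[OF H x] by (intro power_mono) auto
  ultimately show "d\<^sup>2 * (hnorm H x)\<^sup>2 <= Re (hip H x (?B x))" by (simp add: power_mult_distrib)
 qed (use d in auto)
 have GA: "G (A y) = A (G y)" if y: "y : carr H" for y
 proof -
  have Gy: "G y : carr H" using G y by (simp add: bdd_opsD)
  have AGy: "A (G y) : carr H" using A Gy by (simp add: bdd_opsD)
  have "A y = A (?B (G y))" using G y by simp
  also have "... = ?B (A (G y))" using normal[OF AGy] Gy AGy by (simp add: compose_eq)
  finally show ?thesis using G(3)[OF AGy] by simp
 qed
 show ?thesis
 proof (rule that)
  show "compose (carr H) G (adj H H A) : bdd_ops H H" by (rule bdd_ops_compose[OF H H H A' G(1)])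
  fix x assume x: "x : carr H"
  have A'x': "adj H H A x : carr H" using A' x by (simp add: bdd_opsD)
  show "A (compose (carr H) G (adj H H A) x) = x"
   using GA[OF A'x'] normal[OF x] G(3)[OF x] x by (simp add: compose_eq)
  show "compose (carr H) G (adj H H A) (A x) = x"
   using G(3)[OF x] x op_carr[OF A x] by (simp add: compose_eq)
 qed
qed

definition intertwiners ::
  "('v, 'a) hilb_scheme \<Rightarrow> ('v, 'b) hilb_scheme \<Rightarrow> 's set \<Rightarrow> ('s \<Rightarrow> 'v \<Rightarrow> 'v) \<Rightarrow> ('s \<Rightarrow> 'v \<Rightarrow> 'v) \<Rightarrow> ('v \<Rightarrow> 'v) set" where
 "intertwiners H K S \<rho> \<sigma> = {T \<in> bdd_ops H K. \<forall>s\<in>S. \<forall>x\<in>carr H. T (\<rho> s x) = \<sigma> s (T x)}"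

lemma intertwiners_adj:
 assumes H: "complete_ips H" and K: "complete_ips K"
  and \<rho>: "!!s. s \<in> S ==> \<rho> s \<in> bdd_ops H H" and \<sigma>: "!!s. s \<in> S ==> \<sigma> s \<in> bdd_ops K K"
  and star: "!!s. s \<in> S ==> star s \<in> S" "!!s. s \<in> S ==> \<rho> (star s) = adj H H (\<rho> s)"
   "!!s. s \<in> S ==> \<sigma> (star s) = adj K K (\<sigma> s)"
  and T: "T \<in> intertwiners H K S \<rho> \<sigma>"
 shows "adj H K T \<in> intertwiners K H S \<sigma> \<rho>"
proof -
 have Tb: "T : bdd_ops H K" using T by (simp add: intertwiners_def)
 note T' = adj_bdd[OF H K Tb]
 have "adj H K T (\<sigma> s y) = \<rho> s (adj H K T y)" if s: "s : S" and y: "y : carr K" for s y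
 proof (rule hip_ext[OF H])
  fix z assume z: "z : carr H"
  have r: "\<rho> (star s) z : carr H" using \<rho>[OF star(1)[OF s]] z by (simp add: bdd_opsD)
  have "hip H z (adj H K T (\<sigma> s y)) = hip K (T z) (\<sigma> s y)"
   using adj_right[OF H K Tb z, of "\<sigma> s y"] \<sigma>[OF s] y by (simp add: bdd_opsD)
  also have "... = hip K (\<sigma> (star s) (T z)) y"
   using adj_left[OF K K \<sigma>[OF s] y, of "T z"] star(3)[OF s] Tb z 
   by (simp add: bdd_opsD)
  also have "\<sigma> (star s) (T z) = T (\<rho> (star s) z)"
   using T star(1)[OF s] z by (simp add: intertwiners_def)
  also have "hip K (T (\<rho> (star s) z)) y = hip H (\<rho> (star s) z) (adj H K T y)"
   using adj_right[OF H K Tb r y] by simp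
  also have "... = hip H z (\<rho> s (adj H K T y))"
   using adj_left[OF H H \<rho>[OF s] _ z, of "adj H K T y"] star(2)[OF s] T' y by (simp add: bdd_opsD)
  finally show "hip H z (adj H K T (\<sigma> s y)) = hip H z (\<rho> s (adj H K T y))" .
 qed (insert T' \<rho>[OF s] \<sigma>[OF s] y, simp_all add: bdd_opsD)
 then show ?thesis using T' by (simp add: intertwiners_def)
qed

lemma intertwiners_compose:
 assumes "complete_ips H" "complete_ips K" "complete_ips L" "!!s. s \<in> S ==> \<rho> s \<in> bdd_ops H H"
  "T \<in> intertwiners H K S \<rho> \<sigma>" "R \<in> intertwiners K L S \<sigma> \<tau>"
 shows "compose (carr H) R T \<in> intertwiners H L S \<rho> \<tau>"
 using assms(5,6) bdd_ops_compose[OF assms(1-3)] op_carr[OF assms(4)]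
 by (auto simp: intertwiners_def compose_eq op_carr)

lemma intertwiners_linear:
 assumes H: "complete_ips H" and K: "complete_ips K"
  and \<rho>: "!!s. s \<in> S ==> \<rho> s \<in> bdd_ops H H" and \<sigma>: "!!s. s \<in> S ==> \<sigma> s \<in> bdd_ops K K"
 shows "op_zero H K \<in> intertwiners H K S \<rho> \<sigma>"
  and "T \<in> intertwiners H K S \<rho> \<sigma> ==> op_scale H K c T \<in> intertwiners H K S \<rho> \<sigma>"
  and "T \<in> intertwiners H K S \<rho> \<sigma> ==> R \<in> intertwiners H K S \<rho> \<sigma> ==>
   op_add H K T R \<in> intertwiners H K S \<rho> \<sigma>"
proof -
 have \<rho>x: "\<rho> s x : carr H" if "s : S" "x : carr H" for s x using op_carr[OF \<rho>[OF that(1)] that(2)] .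
 show "op_zero H K : intertwiners H K S \<rho> \<sigma>"
  using \<rho>x bdd_ops_zero[OF K K \<sigma>] op_zero_bdd[OF H K] by (auto simp: intertwiners_def op_zero_def)
 show "T : intertwiners H K S \<rho> \<sigma> ==> op_scale H K c T : intertwiners H K S \<rho> \<sigma>"
  using \<rho>x bdd_opsD(4)[OF \<sigma>] op_scale_bdd[OF H K]
  by (auto simp: intertwiners_def op_scale_def op_carr)
 show "T : intertwiners H K S \<rho> \<sigma> ==> R : intertwiners H K S \<rho> \<sigma> ==>
   op_add H K T R : intertwiners H K S \<rho> \<sigma>"
  using \<rho>x bdd_opsD(3)[OF \<sigma>] op_add_bdd[OF H K]
  by (auto simp: intertwiners_def op_add_def op_carr)
qed

lemma intertwiners_closed:
 assumes H: "complete_ips H" and K: "complete_ips K"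
  and \<rho>: "!!s. s \<in> S ==> \<rho> s \<in> bdd_ops H H" and \<sigma>: "!!s. s \<in> S ==> \<sigma> s \<in> bdd_ops K K"
  and star: "!!s. s \<in> S ==> star s \<in> S" "!!s. s \<in> S ==> \<sigma> (star s) = adj K K (\<sigma> s)"
  and X: "!!n. X n \<in> intertwiners H K S \<rho> \<sigma>" and T: "T \<in> bdd_ops H K"
  and lim: "!!x. x \<in> carr H ==> (\<lambda>n. hdist K (X n x) (T x)) \<longlonglongrightarrow> 0"
 shows "T \<in> intertwiners H K S \<rho> \<sigma>"
proof -
 have Xb: "X n : bdd_ops H K" for n using X[of n] by (simp add: intertwiners_def)
 have lim': "(\<lambda>n. hip K z (X n x)) \<longlonglongrightarrow> hip K z (T x)" if "x : carr H" "z : carr K" for x z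
  using hip_tendsto(1)[OF K op_carr[OF Xb that(1)] op_carr[OF T that(1)] that(2) lim[OF that(1)]] .
 have "T (\<rho> s x) = \<sigma> s (T x)" if s: "s : S" and x: "x : carr H" for s x
 proof (rule hip_ext[OF K])
  fix z assume z: "z : carr K"
  have r: "\<rho> s x : carr H" by (rule op_carr[OF \<rho>[OF s] x])
  have w: "\<sigma> (star s) z : carr K" by (rule op_carr[OF \<sigma>[OF star(1)[OF s]] z])
  have adj: "hip K z (\<sigma> s y) = hip K (\<sigma> (star s) z) y" if "y : carr K" for y
   using adj_left[OF K K \<sigma>[OF s] that z] star(2)[OF s] by simp
  have "hip K z (X n (\<rho> s x)) = hip K (\<sigma> (star s) z) (X n x)" for n
   using X[of n] s x adj[OF op_carr[OF Xb[of n] x]] by (simp add: intertwiners_def)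
  then have "(\<lambda>n. hip K (\<sigma> (star s) z) (X n x)) \<longlonglongrightarrow> hip K z (T (\<rho> s x))"
   using lim'[OF r z] by simp
  then have "hip K z (T (\<rho> s x)) = hip K (\<sigma> (star s) z) (T x)"
   using lim'[OF x w] LIMSEQ_unique by blast
  then show "hip K z (T (\<rho> s x)) = hip K z (\<sigma> s (T x))"
   using adj[OF op_carr[OF T x]] by simp
 next
  show "T (\<rho> s x) : carr K" by (rule op_carr[OF T op_carr[OF \<rho>[OF s] x]])
  show "\<sigma> s (T x) : carr K" by (rule op_carr[OF \<sigma>[OF s] op_carr[OF T x]])
 qed
 then show ?thesis using T by (simp add: intertwiners_def)
qed

lemma operator_category_simps:
 "cobj (operator_category Ob Hm) = Ob" "chom (operator_category Ob Hm) = Hm"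
 "cid (operator_category Ob Hm) X = op_id (fst X)"
 "ccomp (operator_category Ob Hm) X Y Z S T = compose (carr (fst X)) S T"
 "czero (operator_category Ob Hm) X Y = op_zero (fst X) (fst Y)"
 "cadd (operator_category Ob Hm) X Y = op_add (fst X) (fst Y)"
 "cscale (operator_category Ob Hm) X Y = op_scale (fst X) (fst Y)"
 "cstar (operator_category Ob Hm) X Y = adj (fst X) (fst Y)"
 "cnorm (operator_category Ob Hm) X Y = op_norm (fst X) (fst Y)"
 by (simp_all add: operator_category_def)

lemma op_vector_space:
 assumes H: "complete_ips H" and K: "complete_ips K"
  and f: "f \<in> bdd_ops H K" and g: "g \<in> bdd_ops H K" and h: "h \<in> bdd_ops H K"
 shows "op_add H K (op_add H K f g) h = op_add H K f (op_add H K g h)"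
  and "op_add H K f g = op_add H K g f"
  and "op_add H K (op_zero H K) f = f"
  and "op_add H K f (op_scale H K (- 1) f) = op_zero H K"
  and "op_scale H K c (op_add H K f g) = op_add H K (op_scale H K c f) (op_scale H K c g)"
  and "op_scale H K (c + d) f = op_add H K (op_scale H K c f) (op_scale H K d f)"
  and "op_scale H K (c * d) f = op_scale H K c (op_scale H K d f)"
  and "op_scale H K 1 f = f"
proof -
 have x: "f x : carr K" "g x : carr K" "h x : carr K" if "x : carr H" for x
  using that f g h by (auto simp: op_carr)
 have e: "f = g" if "f : bdd_ops H K" "g : bdd_ops H K"
  "!!x z. x : carr H ==> z : carr K ==> hip K z (f x) = hip K z (g x)" for f g
  using that by (intro op_eqI[OF that(1,2)] hip_ext[OF K]) (auto simp: op_carr)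
 note bb = op_add_bdd[OF H K] op_scale_bdd[OF H K] op_zero_bdd[OF H K] f g h
 note ev = op_add_def op_scale_def op_zero_def
 show "op_add H K (op_add H K f g) h = op_add H K f (op_add H K g h)"
  by (intro e bb) (simp_all add: ev x H K)
 show "op_add H K f g = op_add H K g f"
  by (intro e bb) (simp_all add: ev x H K)
 show "op_add H K (op_zero H K) f = f"
  by (intro e bb) (simp_all add: ev x H K)
 show "op_add H K f (op_scale H K (- 1) f) = op_zero H K"
  by (intro e bb) (simp_all add: ev x H K)
 show "op_scale H K c (op_add H K f g) = op_add H K (op_scale H K c f) (op_scale H K c g)"
  by (intro e bb) (simp_all add: ev x H K algebra_simps)
 show "op_scale H K (c + d) f = op_add H K (op_scale H K c f) (op_scale H K d f)"
  by (intro e bb) (simp_all add: ev x H K algebra_simps)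
 show "op_scale H K (c * d) f = op_scale H K c (op_scale H K d f)"
  by (intro e bb) (simp_all add: ev x H K)
 show "op_scale H K 1 f = f"
  by (intro e bb) (simp_all add: ev x H K)
qed

lemma cstar_category_intertwiners:
 fixes Ob :: "('v amod \<times> 'o) set" and \<rho> :: "'v amod \<times> 'o \<Rightarrow> 's \<Rightarrow> 'v \<Rightarrow> 'v"
 assumes Ob: "!!X. X \<in> Ob ==> complete_ips (fst X)"
  and \<rho>: "!!X s. X \<in> Ob ==> s \<in> S ==> \<rho> X s \<in> bdd_ops (fst X) (fst X)"
  and star: "!!s. s \<in> S ==> star s \<in> S"
   "!!X s. X \<in> Ob ==> s \<in> S ==> \<rho> X (star s) = adj (fst X) (fst X) (\<rho> X s)"
  and Hm: "!!X Y. X \<in> Ob ==> Y \<in> Ob ==> Hm X Y = intertwiners (fst X) (fst Y) S (\<rho> X) (\<rho> Y)"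
 shows "cstar_category (operator_category Ob Hm)"
proof -
 have HmD: "T : bdd_ops (fst X) (fst Y)" if "X : Ob" "Y : Ob" "T : Hm X Y" for X Y T
  using that by (simp add: Hm intertwiners_def)
 have Hm_comp: "compose (carr (fst X)) R T : Hm X Z"
  if o: "X : Ob" "Y : Ob" "Z : Ob" and T: "T : Hm X Y" "R : Hm Y Z" for X Y Z R T
  unfolding Hm[OF o(1,3)]
  by (rule intertwiners_compose[OF Ob[OF o(1)] Ob[OF o(2)] Ob[OF o(3)] \<rho>[OF o(1)] T(1)[unfolded Hm[OF o(1,2)]] T(2)[unfolded Hm[OF o(2,3)]]])
 have Hm_id: "op_id (fst X) : Hm X X" if "X : Ob" for X
  using op_id_bdd[OF Ob[OF that]] op_carr[OF \<rho>[OF that]] unfolding Hm[OF that that] intertwiners_def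
  by (simp add: op_id_def)
 have Hm_adj: "adj (fst X) (fst Y) T : Hm Y X" if o: "X : Ob" "Y : Ob" and T: "T : Hm X Y" for X Y T
  unfolding Hm[OF o(2,1)]
  by (rule intertwiners_adj[OF Ob[OF o(1)] Ob[OF o(2)] \<rho>[OF o(1)] \<rho>[OF o(2)] star(1) star(2)[OF o(1)] star(2)[OF o(2)] T[unfolded Hm[OF o]]])
 have lin: "op_zero (fst X) (fst Y) : Hm X Y"
  "T : Hm X Y ==> op_scale (fst X) (fst Y) c T : Hm X Y"
  "T : Hm X Y ==> R : Hm X Y ==> op_add (fst X) (fst Y) T R : Hm X Y"
  if o: "X : Ob" "Y : Ob" for X Y T R c
  unfolding Hm[OF o]
  by (rule intertwiners_linear[OF Ob[OF o(1)] Ob[OF o(2)] \<rho>[OF o(1)] \<rho>[OF o(2)]]; assumption)+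
 have cat: "category_axioms (operator_category Ob Hm)"
  unfolding category_axioms_def operator_category_simps
 proof (intro conjI ballI)
  fix X Y T assume XY: "X : Ob" "Y : Ob" "T : Hm X Y"
  note T = HmD[OF XY] and H = Ob[OF XY(1)] and K = Ob[OF XY(2)]
  show "compose (carr (fst X)) T (op_id (fst X)) = T"
   by (rule op_eqI[OF bdd_ops_compose[OF H H K op_id_bdd[OF H] T] T]) (simp add: compose_eq op_id_def)
  show "compose (carr (fst X)) (op_id (fst Y)) T = T"
   by (rule op_eqI[OF bdd_ops_compose[OF H K K T op_id_bdd[OF K]] T])
    (simp add: compose_eq op_id_def op_carr[OF T])
 next
  fix X Y Z W f g h assume o: "X : Ob" "Y : Ob" "Z : Ob" "W : Ob" "f : Hm X Y" "g : Hm Y Z" "h : Hm Z W"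
  show "compose (carr (fst X)) (compose (carr (fst Y)) h g) f = compose (carr (fst X)) h (compose (carr (fst X)) g f)"
   by (rule ext) (simp add: compose_def op_carr[OF HmD[OF o(1,2,5)]])
 next
  fix X assume "X : Ob"
  then show "op_id (fst X) : Hm X X" by (rule Hm_id)
 next
  fix X Y Z f g assume o: "X : Ob" "Y : Ob" "Z : Ob" "f : Hm X Y" "g : Hm Y Z"
  show "compose (carr (fst X)) g f : Hm X Z" by (rule Hm_comp[OF o])
 qed
 have ban: "hom_banach_space (operator_category Ob Hm) X Y" if X: "X : Ob" and Y: "Y : Ob" for X Y
 proof -
  note H = Ob[OF X] and K = Ob[OF Y] and b = HmD[OF X Y]
  have complete: "EX f:Hm X Y. (\<lambda>n. op_norm (fst X) (fst Y) (op_add (fst X) (fst Y) (F n) (op_scale (fst X) (fst Y) (-1) f))) \<longlonglongrightarrow> 0"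
   if F: "ALL n. F n : Hm X Y" and C: "ALL e>0. EX N. ALL m>=N. ALL n>=N. op_norm (fst X) (fst Y) (op_add (fst X) (fst Y) (F m) (op_scale (fst X) (fst Y) (-1) (F n))) < e"
   for F :: "nat => 'v => 'v"
  proof -
   have Fb: "!!n. F n : bdd_ops (fst X) (fst Y)" using F b by blast
   obtain T where T: "T : bdd_ops (fst X) (fst Y)"
    "!!x. x : carr (fst X) ==> (\<lambda>n. hnorm (fst Y) (hdiff (fst Y) (F n x) (T x))) \<longlonglongrightarrow> 0"
    "(\<lambda>n. op_norm (fst X) (fst Y) (op_add (fst X) (fst Y) (F n) (op_scale (fst X) (fst Y) (-1) T))) \<longlonglongrightarrow> 0"
    by (rule op_norm_complete[where X = F, OF H K Fb C[rule_format]]) blast+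
   have Fn: "!!n. F n : intertwiners (fst X) (fst Y) S (\<rho> X) (\<rho> Y)" using F Hm[OF X Y] by simp
   have "T : Hm X Y"
    unfolding Hm[OF X Y]
    by (rule intertwiners_closed[where star = star and X = F, OF H K \<rho>[OF X] \<rho>[OF Y] star(1) star(2)[OF Y] Fn T(1,2)])
   then show ?thesis using T(3) by blast
  qed
  show ?thesis
   unfolding hom_banach_space_def operator_category_simps Let_def
   by (intro conjI allI ballI impI)
    (assumption | rule op_vector_space[OF H K b b b] lin[OF X Y] op_norm_triangle[OF H K b b] op_norm_nonneg[OF H K b]
     op_norm_scale[OF H K b] op_norm_eq_0[OF H K b] | elim conjE complete)+
 qed
 have pos: "positive_endo (operator_category Ob Hm) X (compose (carr (fst X)) (adj (fst X) (fst Y) T) T)"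
  if X: "X : Ob" and Y: "Y : Ob" and T: "T : Hm X Y" for X Y T
  unfolding positive_endo_def operator_category_simps
 proof (intro conjI allI impI)
  note H = Ob[OF X] and K = Ob[OF Y] and b = HmD[OF X Y T]
  let ?h = "compose (carr (fst X)) (adj (fst X) (fst Y) T) T"
  show h: "?h : Hm X X" by (rule Hm_comp[OF X Y X T Hm_adj[OF X Y T]])
  show "adj (fst X) (fst X) ?h = ?h"
   using adj_compose[OF H K H b adj_bdd[OF H K b]] adj_adj[OF H K b] by simp
  fix z :: complex assume z: "z \<notin> \<real>\<^sub>\<ge>\<^sub>0"
  let ?A = "op_add (fst X) (fst X) ?h (op_scale (fst X) (fst X) (- z) (op_id (fst X)))"
  have A: "?A : Hm X X" by (rule lin(3)[OF X X h lin(2)[OF X X Hm_id[OF X]]])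
  obtain R where R: "R : bdd_ops (fst X) (fst X)" "!!x. x : carr (fst X) ==> ?A (R x) = x"
   "!!x. x : carr (fst X) ==> R (?A x) = x"
   using resolvent_of_positive[OF H K b z] by blast
  have "R (\<rho> X s x) = \<rho> X s (R x)" if s: "s : S" and x: "x : carr (fst X)" for s x
  proof -
   have Rx: "R x : carr (fst X)" by (rule op_carr[OF R(1) x])
   have "R (\<rho> X s x) = R (\<rho> X s (?A (R x)))" by (simp only: R(2)[OF x])
   also have "\<rho> X s (?A (R x)) = ?A (\<rho> X s (R x))"
    using A[unfolded Hm[OF X X] intertwiners_def] s Rx by fastforce
   also have "R ... = \<rho> X s (R x)" by (rule R(3)[OF op_carr[OF \<rho>[OF X s] Rx]])
   finally show ?thesis .
  qed
  then have "R : Hm X X" using R(1) unfolding Hm[OF X X] intertwiners_def by blast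
  moreover have "compose (carr (fst X)) R ?A = op_id (fst X)"
  proof (rule op_eqI[OF bdd_ops_compose[OF H H H HmD[OF X X A] R(1)] op_id_bdd[OF H]])
   fix x assume x: "x : carr (fst X)"
   show "compose (carr (fst X)) R ?A x = op_id (fst X) x"
    unfolding compose_eq[OF x] R(3)[OF x] using x by (simp add: op_id_def)
  qed
  moreover have "compose (carr (fst X)) ?A R = op_id (fst X)"
  proof (rule op_eqI[OF bdd_ops_compose[OF H H H R(1) HmD[OF X X A]] op_id_bdd[OF H]])
   fix x assume x: "x : carr (fst X)"
   show "compose (carr (fst X)) ?A R x = op_id (fst X) x"
    unfolding compose_eq[OF x] R(2)[OF x] using x by (simp add: op_id_def)
  qed
  ultimately show "EX g:Hm X X. compose (carr (fst X)) g ?A = op_id (fst X) & compose (carr (fst X)) ?A g = op_id (fst X)"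
   by blast
 qed
 show ?thesis
  unfolding cstar_category_def operator_category_simps
 proof (intro conjI ballI allI)
  fix X Y Z f g assume o: "X : Ob" "Y : Ob" "Z : Ob" "f : Hm X Y" "g : Hm Y Z"
  note H = Ob[OF o(1)] and K = Ob[OF o(2)] and L = Ob[OF o(3)] and f = HmD[OF o(1,2,4)] and g = HmD[OF o(2,3,5)]
  show "compose (carr (fst X)) g (op_add (fst X) (fst Y) f f') = op_add (fst X) (fst Z) (compose (carr (fst X)) g f) (compose (carr (fst X)) g f')"
   if "f' : Hm X Y" for f'
   using op_carr[OF f] op_carr[OF HmD[OF o(1,2) that]] bdd_opsD(3)[OF g]
   by (simp add: fun_eq_iff compose_def op_add_def)
  show "compose (carr (fst X)) (op_add (fst Y) (fst Z) g g') f = op_add (fst X) (fst Z) (compose (carr (fst X)) g f) (compose (carr (fst X)) g' f)"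
   for g'
   using op_carr[OF f] by (simp add: fun_eq_iff compose_def op_add_def)
  show "compose (carr (fst X)) g (op_scale (fst X) (fst Y) z f) = op_scale (fst X) (fst Z) z (compose (carr (fst X)) g f)" for z
   using op_carr[OF f] bdd_opsD(4)[OF g] by (simp add: fun_eq_iff compose_def op_scale_def)
  show "compose (carr (fst X)) (op_scale (fst Y) (fst Z) z g) f = op_scale (fst X) (fst Z) z (compose (carr (fst X)) g f)" for z
   using op_carr[OF f] by (simp add: fun_eq_iff compose_def op_scale_def)
  show "op_norm (fst X) (fst Z) (compose (carr (fst X)) g f) <= op_norm (fst Y) (fst Z) g * op_norm (fst X) (fst Y) f"
   by (rule op_norm_compose[OF H K L f g])
  show "adj (fst X) (fst Z) (compose (carr (fst X)) g f) = compose (carr (fst Z)) (adj (fst X) (fst Y) f) (adj (fst Y) (fst Z) g)"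
   by (rule adj_compose[OF H K L f g])
 next
  fix X Y f assume o: "X : Ob" "Y : Ob" "f : Hm X Y"
  note H = Ob[OF o(1)] and K = Ob[OF o(2)] and f = HmD[OF o]
  show "adj (fst X) (fst Y) f : Hm Y X" by (rule Hm_adj[OF o])
  show "adj (fst Y) (fst X) (adj (fst X) (fst Y) f) = f" by (rule adj_adj[OF H K f])
  show "adj (fst X) (fst Y) (op_add (fst X) (fst Y) f g) = op_add (fst Y) (fst X) (adj (fst X) (fst Y) f) (adj (fst X) (fst Y) g)"
   if "g : Hm X Y" for g by (rule adj_add[OF H K f HmD[OF o(1,2) that]])
  show "adj (fst X) (fst Y) (op_scale (fst X) (fst Y) z f) = op_scale (fst Y) (fst X) (cnj z) (adj (fst X) (fst Y) f)" for z
   by (rule adj_scale[OF H K f])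
  show "op_norm (fst X) (fst X) (compose (carr (fst X)) (adj (fst X) (fst Y) f) f) = (op_norm (fst X) (fst Y) f)\<^sup>2"
   by (rule op_norm_cstar[OF H K f])
  show "positive_endo (operator_category Ob Hm) X (compose (carr (fst X)) (adj (fst X) (fst Y) f) f)"
   by (rule pos[OF o])
 qed (rule cat ban; assumption)+
qed

section \<open>Arcs of the circle\<close>

lemma cis_eq_iff_int: "cis s = cis t \<longleftrightarrow> (\<exists>k::int. s = t + 2 * pi * of_int k)"
proof
 assume "cis s = cis t"
 then have "sin s = sin t & cos s = cos t" by (simp add: complex_eq_iff)
 then show "EX k::int. s = t + 2 * pi * of_int k" using sin_cos_eq_iff[of s t] by (auto simp: algebra_simps)
next
 assume "EX k::int. s = t + 2 * pi * of_int k"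
 then obtain k :: int where "s = t + 2 * pi * of_int k" by blast
 then have "sin s = sin t & cos s = cos t" using sin_cos_eq_iff[of s t] by (auto simp: algebra_simps)
 then show "cis s = cis t" by (simp add: complex_eq_iff)
qed

lemma cis_inj:
 assumes "cis s = cis t" "\<bar>s - t\<bar> < 2 * pi"
 shows "s = t"
proof -
 obtain k :: int where k: "s = t + 2 * pi * of_int k" using assms(1) cis_eq_iff_int by blast
 then have "\<bar>2 * pi * of_int k\<bar> < 2 * pi" using assms(2) by simp
 then have "\<bar>real_of_int k\<bar> < 1" by (simp add: abs_mult)
 then have "k = 0" by linarith
 then show ?thesis using k by simp
qed

lemma circle_arg_in:
 assumes "z \<in> circle"
 obtains t where "a \<le> t" "t < a + 2 * pi" "z = cis t"
proof -
 have z: "z = cis (Arg z)"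
  using assms cis_Arg_unique[of z "Arg z"] rcis_cmod_Arg[of z] by (simp add: rcis_def)
 define k where "k = \<lfloor>(a - Arg z) / (2 * pi)\<rfloor> + 1"
 define x where "x = (a - Arg z) / (2 * pi)"
 have "x < of_int k" "of_int k <= x + 1"
  using floor_correct[of x] unfolding k_def x_def[symmetric] by auto
 then have "2 * pi * x < 2 * pi * of_int k" "2 * pi * of_int k <= 2 * pi * (x + 1)"
  by (auto intro: mult_strict_left_mono mult_left_mono)
 moreover have "2 * pi * x = a - Arg z" by (simp add: x_def)
 ultimately have "a - Arg z < 2 * pi * of_int k" "2 * pi * of_int k <= a - Arg z + 2 * pi"
  by (auto simp: distrib_left)
 then have "a < Arg z + 2 * pi * of_int k" "Arg z + 2 * pi * of_int k <= a + 2 * pi" by linarith+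
 moreover have "z = cis (Arg z + 2 * pi * of_int k)" using z cis_eq_iff_int by metis
 moreover have "cis (a + 2 * pi) = cis a" using cis_eq_iff_int[of "a + 2*pi" a] by (auto intro: exI[of _ 1])
 ultimately show ?thesis
  using that[of "Arg z + 2 * pi * of_int k"] that[of a] by (cases "Arg z + 2 * pi * of_int k = a + 2 * pi") auto
qed

lemma continuous_cis: "continuous_on A cis"
 unfolding cis_conv_exp by (intro continuous_intros)

lemma intervals_iff: "I \<in> intervals \<longleftrightarrow> (\<exists>a b. a < b \<and> b < a + 2 * pi \<and> I = cis ` {a<..<b})"
proof
 assume "I : intervals"
 then obtain a b where ab: "a < b" "I = cis ` {a<..<b}" and nd: "\<not> circle <= closure I"
  unfolding intervals_def by blast
 have "b < a + 2 * pi"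
 proof (rule ccontr)
  assume "\<not> b < a + 2 * pi"
  then have b: "a + 2 * pi <= b" by simp
  have "z : closure I" if "z : circle" for z
  proof -
   obtain t where t: "a <= t" "t < a + 2 * pi" "z = cis t" using circle_arg_in[OF \<open>z : circle\<close>] by metis
   have "closure {a<..<b} = {a..b}" using ab(1) by simp
   then have "t : closure {a<..<b}" using t b by auto
   then have "cis t : closure (cis ` {a<..<b})"
    using closure_subset continuous_cis by (metis (no_types, lifting) closed_closure image_closure_subset image_subset_iff)
   then show ?thesis using t ab by simp
  qed
  then show False using nd by blast
 qed
 then show "EX a b. a < b & b < a + 2 * pi & I = cis ` {a<..<b}" using ab by blast
next
 assume "EX a b. a < b & b < a + 2 * pi & I = cis ` {a<..<b}"
 then obtain a b where ab: "a < b" "b < a + 2 * pi" "I = cis ` {a<..<b}" by blast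
 have "compact (cis ` {a..b})" by (intro compact_continuous_image continuous_cis) simp
 then have "closure I <= cis ` {a..b}"
  unfolding ab(3) by (intro closure_minimal compact_imp_closed) auto
 moreover define t where "t = (b + (a + 2 * pi)) / 2"
 moreover have "cis t \<notin> cis ` {a..b}"
 proof
  assume "cis t : cis ` {a..b}"
  then obtain s where s: "cis t = cis s" "a <= s" "s <= b" by auto
  then have "t = s" using ab by (intro cis_inj) (auto simp: t_def field_simps)
  then show False using s ab by (simp add: t_def)
 qed
 moreover have "cis t : circle" by simp
 ultimately have "\<not> circle <= closure I" by blast
 then show "I : intervals" unfolding intervals_def using ab by blast
qed

lemma arc_in_intervals: "a < b ==> b < a + 2 * pi ==> cis ` {a<..<b} \<in> intervals"
 using intervals_iff by blast

lemma arc_shift: "cis ` {a + 2 * pi * of_int k<..<b + 2 * pi * of_int k} = cis ` {a<..<b}"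
proof (intro equalityI subsetI)
 fix z assume "z : cis ` {a + 2 * pi * of_int k<..<b + 2 * pi * of_int k}"
 then obtain t where t: "z = cis t" "a + 2 * pi * of_int k < t" "t < b + 2 * pi * of_int k" by auto
 have "cis t = cis (t - 2 * pi * of_int k)" using cis_eq_iff_int[of t "t - 2 * pi * of_int k"] by auto
 then show "z : cis ` {a<..<b}" using t by (intro image_eqI[of _ _ "t - 2 * pi * of_int k"]) auto
next
 fix z assume "z : cis ` {a<..<b}"
 then obtain t where t: "z = cis t" "a < t" "t < b" by auto
 have "cis (t + 2 * pi * of_int k) = cis t" using cis_eq_iff_int[of "t + 2 * pi * of_int k" t] by auto
 then show "z : cis ` {a + 2 * pi * of_int k<..<b + 2 * pi * of_int k}"
  using t by (intro image_eqI[of _ _ "t + 2 * pi * of_int k"]) auto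
qed

lemma open_arc:
 assumes "a < b" "b < a + 2 * pi"
 shows "openin (top_of_set circle) (cis ` {a<..<b})"
proof -
 have "circle - cis ` {b..a + 2 * pi} = cis ` {a<..<b}"
 proof (intro equalityI subsetI)
  fix z assume z: "z : circle - cis ` {b..a + 2 * pi}"
  then obtain t where t: "a <= t" "t < a + 2 * pi" "z = cis t" using circle_arg_in by (metis DiffD1)
  have "cis (a + 2 * pi) = cis a" using cis_eq_iff_int[of "a + 2*pi" a] by (auto intro: exI[of _ 1])
  moreover have "cis (a + 2 * pi) : cis ` {b..a + 2 * pi}" using assms by (intro imageI) simp
  ultimately have "t ~= a" using z t(3) by auto
  moreover have "t < b" using z t by force
  ultimately show "z : cis ` {a<..<b}" using t by auto
 next
  fix z assume "z : cis ` {a<..<b}"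
  then obtain t where t: "z = cis t" "a < t" "t < b" by auto
  have "cis t \<notin> cis ` {b..a + 2 * pi}"
  proof
   assume "cis t : cis ` {b..a + 2 * pi}"
   then obtain s where "cis t = cis s" "b <= s" "s <= a + 2 * pi" by auto
   then have "t = s" using t by (intro cis_inj) auto
   then show False using \<open>b <= s\<close> t by simp
  qed
  then show "z : circle - cis ` {b..a + 2 * pi}" using t by simp
 qed
 moreover have "compact (cis ` {b..a + 2 * pi})" by (intro compact_continuous_image continuous_cis) simp
 then have "openin (top_of_set circle) (circle \<inter> - cis ` {b..a + 2 * pi})"
  by (intro openin_open_Int open_Compl compact_imp_closed)
 then have "openin (top_of_set circle) (circle - cis ` {b..a + 2 * pi})"
  by (simp add: Diff_eq)
 ultimately show ?thesis by simp
qed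

text \<open>The end points of the complementary closed arc are limits of points of the arc, so they are
  not interior.\<close>

lemma iopp_arc:
 assumes "a < b" "b < a + 2 * pi"
 shows "iopp (cis ` {a<..<b}) = cis ` {b<..<a + 2 * pi}"
proof -
 let ?I = "cis ` {a<..<b}" and ?J = "cis ` {b<..<a + 2 * pi}"
 have J: "openin (top_of_set circle) ?J" using assms by (intro open_arc) auto
 have disj: "?I \<inter> ?J = {}"
 proof (rule ccontr)
  assume "?I \<inter> ?J ~= {}"
  then obtain s t where "cis s = cis t" "a < s" "s < b" "b < t" "t < a + 2 * pi" by auto
  moreover then have "s = t" by (intro cis_inj) auto
  ultimately show False by simp
 qed
 have sub: "?J <= circle - ?I" using disj by auto
 show ?thesis
  unfolding iopp_def
 proof (rule equalityI)
  show "?J <= (top_of_set circle) interior_of (circle - ?I)"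
   by (rule interior_of_maximal[OF sub J])
  show "(top_of_set circle) interior_of (circle - ?I) <= ?J"
  proof
   fix z assume z: "z : (top_of_set circle) interior_of (circle - ?I)"
   then obtain U where U: "openin (top_of_set circle) U" "z : U" "U <= circle - ?I"
    unfolding interior_of_def by blast
   have zc: "z : circle" using U by blast
   obtain t where t: "b <= t" "t < b + 2 * pi" "z = cis t" using circle_arg_in[OF zc] by metis
   obtain W where W: "open W" "U = circle \<inter> W" using U(1) by (auto simp: openin_open)
   have op: "open (cis -` W)" using W(1) continuous_cis[of UNIV] by (simp add: continuous_on_open_vimage[OF open_UNIV])
   have tW: "t : cis -` W" using U(2) W t by auto
   obtain e where e: "e > 0" "!!s. \<bar>s - t\<bar> < e ==> cis s : W"
    using op tW unfolding open_dist dist_real_def by (auto simp: vimage_def)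
   have notI: "cis s \<notin> ?I" if "\<bar>s - t\<bar> < e" for s
   proof -
    have "cis s : U" using e(2)[OF that] W by simp
    then show ?thesis using U(3) by blast
   qed
   have "t ~= b"
   proof
    assume tb: "t = b"
    define s where "s = b - min (e/2) ((b-a)/2)"
    have "cis s \<notin> ?I" using e(1) assms by (intro notI) (auto simp: s_def tb min_def)
    moreover have "cis s : ?I" using e(1) assms by (intro imageI) (auto simp: s_def min_def field_simps)
    ultimately show False by blast
   qed
   moreover have "t < a + 2 * pi"
   proof (rule ccontr)
    assume "\<not> t < a + 2 * pi"
    define s where "s = t + min (e/2) ((b + 2 * pi - t)/2)"
    have n: "cis s \<notin> ?I" using e(1) t by (intro notI) (auto simp: s_def min_def)
    have c: "cis s = cis (s - 2 * pi)" using cis_eq_iff_int[of s "s - 2*pi"] by (auto intro: exI[of _ 1])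
    have "s > t" "s < b + 2 * pi" using e(1) t by (auto simp: s_def min_def field_simps)
    then have "cis (s - 2 * pi) : ?I" using \<open>\<not> t < a + 2 * pi\<close> by (intro imageI) auto
    then show False using n c by metis
   qed
   ultimately show "z : ?J" using t by auto
  qed
 qed
qed

lemma iopp_in_intervals: "I \<in> intervals ==> iopp I \<in> intervals"
 by (auto simp: intervals_iff[of I] iopp_arc intro!: arc_in_intervals)

lemma iopp_iopp: "I \<in> intervals ==> iopp (iopp I) = I"
proof -
 assume "I : intervals"
 then obtain a b where ab: "a < b" "b < a + 2 * pi" "I = cis ` {a<..<b}" using intervals_iff by blast
 have "iopp (iopp I) = cis ` {a + 2 * pi * of_int 1<..<b + 2 * pi * of_int 1}"
  using ab iopp_arc[of a b] iopp_arc[of b "a + 2 * pi"] by simp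
 also have "... = I" using arc_shift[of a 1 b] ab by simp
 finally show ?thesis .
qed

lemma iopp_disjoint: "I \<inter> iopp I = {}"
 unfolding iopp_def using interior_of_subset[of "top_of_set circle" "circle - I"] by blast

lemma iopp_antimono: "I \<subseteq> J ==> iopp J \<subseteq> iopp I"
 unfolding iopp_def by (intro interior_of_mono) auto

lemma intervals_openin: "I \<in> intervals ==> openin (top_of_set circle) I"
 using intervals_iff open_arc by metis

lemma subset_iopp_of_disjoint:
 assumes "I \<in> intervals" "J \<in> intervals" "I \<inter> J = {}"
 shows "J \<subseteq> iopp I"
 unfolding iopp_def
 using intervals_openin[OF assms(2)] assms(3) openin_imp_subset[OF intervals_openin[OF assms(2)]]
 by (intro interior_of_maximal) auto

subsection \<open>Arg-valued arcs\<close>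

definition arg_arc :: "real \<Rightarrow> real \<Rightarrow> argint" where
 "arg_arc a b = (cis ` {a<..<b}, \<lambda>z\<in>cis ` {a<..<b}. THE t. a < t \<and> t < b \<and> z = cis t)"

lemma fst_arg_arc [simp]: "fst (arg_arc a b) = cis ` {a<..<b}"
 by (simp add: arg_arc_def)

lemma snd_arg_arc:
 assumes "b < a + 2 * pi" "a < t" "t < b"
 shows "snd (arg_arc a b) (cis t) = t"
proof -
 have "(THE s. a < s & s < b & cis t = cis s) = t"
  by (rule the_equality) (insert assms, auto intro!: cis_inj)
 then show ?thesis using assms by (simp add: arg_arc_def)
qed

lemma arg_arc_in:
 assumes "a < b" "b < a + 2 * pi"
 shows "arg_arc a b \<in> \<J>"
proof -
 have "continuous_on (cis ` {a<..<b}) (snd (arg_arc a b))"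
 proof -
  have "homeomorphism {a..b} (cis ` {a..b}) cis (the_inv_into {a..b} cis)"
  proof -
   have "inj_on cis {a..b}" using assms by (intro inj_onI cis_inj) auto
   then obtain g where g: "homeomorphism {a..b} (cis ` {a..b}) cis g"
    using homeomorphism_compact[of "{a..b}" cis "cis ` {a..b}"] continuous_cis by blast
   show ?thesis
    by (rule homeomorphism_cong[OF g]) (insert \<open>inj_on cis {a..b}\<close> g, auto simp: the_inv_into_f_f homeomorphism_apply1)
  qed
  then have "continuous_on (cis ` {a..b}) (the_inv_into {a..b} cis)" by (rule homeomorphism_cont2)
  then have "continuous_on (cis ` {a<..<b}) (the_inv_into {a..b} cis)"
   by (rule continuous_on_subset) auto
  moreover have "snd (arg_arc a b) z = the_inv_into {a..b} cis z" if "z : cis ` {a<..<b}" for z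
  proof -
   obtain t where t: "z = cis t" "a < t" "t < b" using \<open>z : cis ` {a<..<b}\<close> by auto
   have "inj_on cis {a..b}" using assms by (intro inj_onI cis_inj) auto
   then show ?thesis using snd_arg_arc[OF assms(2) t(2,3)] t by (simp add: the_inv_into_f_f)
  qed
  ultimately show ?thesis using continuous_on_cong by (metis (no_types, lifting))
 qed
 moreover have "snd (arg_arc a b) : extensional (cis ` {a<..<b})" by (simp add: arg_arc_def)
 moreover have "z = cis (snd (arg_arc a b) z)" if "z : cis ` {a<..<b}" for z
  using that snd_arg_arc[OF assms(2)] by auto
 ultimately show ?thesis
  unfolding arg_intervals_def using arc_in_intervals[OF assms]
  by (simp add: case_prod_beta)
qed

text \<open>Two continuous argument functions on an arc differ by a constant multiple of \<open>2 pi\<close>.\<close>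

lemma arg_intervals_iff: "I \<in> \<J> \<longleftrightarrow> (\<exists>a b. a < b \<and> b < a + 2 * pi \<and> I = arg_arc a b)"
proof
 assume I: "I : \<J>"
 obtain J f where If: "I = (J, f)" by (cases I)
 have f: "J : intervals" "f : extensional J" "continuous_on J f" "ALL z:J. z = cis (f z)"
  using I If by (auto simp: arg_intervals_def)
 obtain a b where ab: "a < b" "b < a + 2 * pi" "J = cis ` {a<..<b}" using f(1) intervals_iff by blast
 define g where "g t = (f (cis t) - t) / (2 * pi)" for t
 have gZ: "g t : \<int>" if "t : {a<..<b}" for t
 proof -
  have "cis (f (cis t)) = cis t" using f(4) that ab by auto
  then obtain k :: int where "f (cis t) = t + 2 * pi * of_int k" using cis_eq_iff_int by blast
  then show ?thesis by (simp add: g_def)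
 qed
 have "continuous_on {a<..<b} g"
  unfolding g_def
  by (intro continuous_intros continuous_on_compose2[OF f(3)] continuous_cis) (use ab in auto)
 then have "g constant_on {a<..<b}"
 proof (rule continuous_discrete_range_constant[rotated])
  fix x assume x: "x : {a<..<b}"
  show "EX e>0. ALL y. y : {a<..<b} & g y ~= g x \<longrightarrow> e <= norm (g y - g x)"
  proof (intro exI[of _ 1] conjI allI impI)
   fix y assume y: "y : {a<..<b} & g y ~= g x"
   obtain m n where mn: "g y = real_of_int m" "g x = real_of_int n"
    using gZ x y by (metis Ints_cases)
   then have "m ~= n" using y by auto
   then have "1 <= \<bar>real_of_int (m - n)\<bar>" by linarith
   then show "1 <= norm (g y - g x)" by (simp add: mn)
  qed simp
 qed simp
 then obtain c where c: "!!t. t : {a<..<b} ==> g t = c" unfolding constant_on_def by blast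
 have "(a + b) / 2 : {a<..<b}" using ab by auto
 then obtain k where k: "c = of_int k" using gZ c by (metis Ints_cases)
 have fc: "f (cis t) = t + 2 * pi * of_int k" if "t : {a<..<b}" for t
  using c[OF that] k by (simp add: g_def field_simps)
 let ?a = "a + 2 * pi * of_int k" and ?b = "b + 2 * pi * of_int k"
 have J: "J = cis ` {?a<..<?b}" using ab arc_shift by simp
 have "f z = snd (arg_arc ?a ?b) z" for z
 proof (cases "z : J")
  case True
  then obtain t where t: "z = cis t" "a < t" "t < b" using ab by auto
  have "cis t = cis (t + 2 * pi * of_int k)" using cis_eq_iff_int[of "t + 2 * pi * of_int k" t] by auto
  then show ?thesis using snd_arg_arc[of ?b ?a "t + 2 * pi * of_int k"] ab t fc[of t] by simp
 next
  case False
  then show ?thesis using f(2) J by (simp add: extensional_def arg_arc_def)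
 qed
 then have "I = arg_arc ?a ?b" using If J by (simp add: prod_eq_iff fun_eq_iff)
 then show "EX a b. a < b & b < a + 2 * pi & I = arg_arc a b" using ab by (intro exI[of _ ?a] exI[of _ ?b]) auto
qed (auto intro: arg_arc_in)

lemma fst_arg_interval: "I \<in> \<J> ==> fst I \<in> intervals"
 by (auto simp: arg_intervals_def)

lemma arg_interval_exists:
 assumes "K \<in> intervals"
 obtains I where "I \<in> \<J>" "fst I = K"
 using assms intervals_iff arg_arc_in fst_arg_arc by metis

lemma arg_sub_arg_arc:
 assumes "a' \<le> a" "a < b" "b \<le> b'" "b' < a' + 2 * pi"
 shows "arg_sub (arg_arc a b) (arg_arc a' b')"
 unfolding arg_sub_def
proof (intro conjI ballI)
 show "fst (arg_arc a b) <= fst (arg_arc a' b')" using assms by auto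
 fix z assume "z : fst (arg_arc a b)"
 then obtain t where t: "z = cis t" "a < t" "t < b" by auto
 then show "snd (arg_arc a' b') z = snd (arg_arc a b) z"
  using snd_arg_arc[of b' a' t] snd_arg_arc[of b a t] assms by simp
qed

lemma clockwise_complement_exists:
 assumes "I \<in> \<J>"
 obtains J where "J \<in> \<J>" "clockwise_to J I" "fst J = iopp (fst I)"
proof -
 obtain a b where ab: "a < b" "b < a + 2 * pi" "I = arg_arc a b" using assms arg_intervals_iff by blast
 let ?J = "arg_arc (b - 2 * pi) a"
 have "clockwise_to ?J I"
  unfolding clockwise_to_def
  using ab snd_arg_arc[of b a] snd_arg_arc[of a "b - 2 * pi"] by auto
 moreover have "fst ?J = iopp (fst I)"
  using ab iopp_arc[of a b] arc_shift[of "b - 2 * pi" 1 a] by simp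
 ultimately show ?thesis using that[of ?J] arg_arc_in[of "b - 2 * pi" a] ab by simp
qed

text \<open>\<open>I\<close> is half of the gap left by \<open>K\<close>, and \<open>M\<close> spans \<open>K\<close> and \<open>I\<close>.\<close>

lemma disjoint_neighbour_exists:
 assumes "K \<in> intervals"
 obtains I M where "I \<in> \<J>" "M \<in> \<J>" "arg_sub I M" "K \<subseteq> fst M" "fst I \<inter> K = {}"
proof -
 obtain a b where ab: "a < b" "b < a + 2 * pi" "K = cis ` {a<..<b}" using assms intervals_iff by blast
 define c where "c = (b + (a + 2 * pi)) / 2"
 have c: "b < c" "c < a + 2 * pi" using ab by (auto simp: c_def)
 have "fst (arg_arc b c) <= iopp K" using ab c iopp_arc[of a b] by auto
 then have "fst (arg_arc b c) \<inter> K = {}" using iopp_disjoint[of K] by blast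
 moreover have "arg_sub (arg_arc b c) (arg_arc a c)" using ab c by (intro arg_sub_arg_arc) auto
 moreover have "K <= fst (arg_arc a c)" using ab c by auto
 ultimately show ?thesis
  using that[of "arg_arc b c" "arg_arc a c"] arg_arc_in[of b c] arg_arc_in[of a c] ab c by auto
qed

text \<open>Any two arg-valued intervals are joined by a chain of nested ones: the arcs \<open>(t, t + pi)\<close>
  can be moved along the real line.\<close>

lemma constant_on_arg_intervals:
 assumes step: "!!I J. I \<in> \<J> ==> J \<in> \<J> ==> arg_sub I J ==> \<phi> I = \<phi> J"
  and I: "I \<in> \<J>" and J: "J \<in> \<J>"
 shows "\<phi> I = \<phi> J"
proof -
 have nested: "\<phi> (arg_arc a b) = \<phi> (arg_arc a' b')"
  if "a' <= a" "a < b" "b <= b'" "b' < a' + 2 * pi" for a b a' b'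
  using that by (intro step arg_arc_in arg_sub_arg_arc) auto
 define g where "g t = \<phi> (arg_arc t (t + pi))" for t
 have to_g: "\<phi> (arg_arc a b) = g a" if "a < b" "b < a + 2 * pi" for a b
 proof -
  have "\<phi> (arg_arc a (min b (a + pi))) = \<phi> (arg_arc a b)" "\<phi> (arg_arc a (min b (a + pi))) = g a"
   unfolding g_def using that by (intro nested; simp add: min_def)+
  then show ?thesis by simp
 qed
 have near: "g t = g s" if "s <= t" "t < s + pi" for s t
 proof -
  have "\<phi> (arg_arc t (s + pi)) = g t" "\<phi> (arg_arc t (s + pi)) = g s"
   unfolding g_def using that by (intro nested; simp)+
  then show ?thesis by simp
 qed
 have "g (s + real n) = g s" for s n
 proof (induction n)
  case (Suc n)
  have "g (s + real n + 1) = g (s + real n)" by (rule near) (use pi_gt3 in auto)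
  then show ?case using Suc by (simp add: add_ac)
 qed simp
 then have far: "g t = g s" if "s <= t" for s t
 proof -
  assume shift: "!!s n. g (s + real n) = g s"
  define n where "n = nat \<lfloor>t - s\<rfloor>"
  have "s + real n <= t" "t < s + real n + 1" using that floor_correct[of "t - s"] by (simp_all add: n_def) linarith+
  then have "g t = g (s + real n)" using pi_gt3 by (intro near) auto
  then show ?thesis using shift by simp
 qed
 have "g s = g t" for s t using far[of s t] far[of t s] by (cases "s <= t") auto
 then show ?thesis using to_g I J unfolding arg_intervals_iff by metis
qed

section \<open>Continuous functions with one-sided Fourier series\<close>

lemma real_continuous_cis [continuous_intros]:
 "continuous_on A f ==> continuous_on A (\<lambda>x. cis (f x))"
 by (rule continuous_on_compose2[OF continuous_cis[of UNIV]]) auto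

definition cauchy_transform :: "real \<Rightarrow> real \<Rightarrow> (real \<Rightarrow> complex) \<Rightarrow> complex \<Rightarrow> complex" where
 "cauchy_transform a b f z = integral {a..b} (\<lambda>t. f t * (cis t / (cis t - z)))"

lemma cauchy_transform_holomorphic:
 assumes f: "continuous_on {a..b} f" and U: "convex U" "U \<inter> cis ` {a..b} = {}"
 shows "cauchy_transform a b f holomorphic_on U"
proof -
 have ne: "cis t - z ~= 0" if "z : U" "t : {a..b}" for z t
  using U(2) that by (auto simp: disjoint_iff)
 have "(\<lambda>z. integral (cbox a b) (\<lambda>t. f t * (cis t / (cis t - z)))) holomorphic_on U"
 proof (rule leibniz_rule_holomorphic[where fx = "\<lambda>z t. f t * (cis t / (cis t - z)^2)"])
  fix z t assume z: "z : U" and t: "t : cbox a b"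
  show "((\<lambda>z. f t * (cis t / (cis t - z))) has_field_derivative f t * (cis t / (cis t - z)\<^sup>2)) (at z within U)"
   using ne[OF z] t by (auto intro!: derivative_eq_intros simp: power2_eq_square)
 next
  fix z assume z: "z : U"
  show "(\<lambda>t. f t * (cis t / (cis t - z))) integrable_on cbox a b"
   using ne[OF z] f unfolding box_real
   by (intro integrable_continuous_interval continuous_intros) auto
 next
  have "continuous_on (U \<times> cbox a b) (\<lambda>p. f (snd p) * (cis (snd p) / (cis (snd p) - fst p)\<^sup>2))"
   using ne f by (intro continuous_intros continuous_on_compose2[OF f]) auto
  then show "continuous_on (U \<times> cbox a b) (\<lambda>(z, t). f t * (cis t / (cis t - z)\<^sup>2))"
   by (simp add: case_prod_beta')
 qed (rule U)
 then show ?thesis unfolding cauchy_transform_def[abs_def] by (simp add: box_real)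
qed

lemma cauchy_transform_outside:
 assumes ab: "a \<le> b" and f: "continuous_on {a..b} f" and z: "cmod z > 1"
  and coeff: "!!n::nat. integral {a..b} (\<lambda>t. f t * cis (real (Suc n) * t)) = 0"
 shows "cauchy_transform a b f z = 0"
proof -
 have ne: "cis t - z ~= 0" for t using z by (metis norm_cis eq_iff_diff_eq_0 less_irrefl)
 have z0: "z ~= 0" using z by auto
 have "compact (f ` {a..b})" using f by (intro compact_continuous_image) auto
 then obtain M where M: "!!t. t : {a..b} ==> cmod (f t) <= M"
  using compact_imp_bounded bounded_iff by (metis imageI)
 have M0: "M >= 0" using order_trans[OF norm_ge_zero M[of a]] ab by simp
 have iter: "cauchy_transform a b f z = integral {a..b} (\<lambda>t. f t * (cis t / (cis t - z)) * (cis t / z) ^ N)" for N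
 proof -
  have eq: "f t * (cis t / (cis t - z)) = f t * (cis t / (cis t - z)) * (cis t / z) ^ N
    - (\<Sum>n<N. (1 / z ^ Suc n) * (f t * cis (real (Suc n) * t)))" for t
  proof -
   have "cis t ~= z" using ne[of t] by auto
   then have r: "cis t / z ~= 1" using z0 by simp
   have "(\<Sum>n<N. (1 / z ^ Suc n) * (f t * cis (real (Suc n) * t))) = f t * (cis t / z) * (\<Sum>n<N. (cis t / z) ^ n)"
    unfolding sum_distrib_left
   proof (rule sum.cong[OF refl])
    fix n :: nat
    have "cis (real (Suc n) * t) = cis t ^ Suc n" by (rule Complex.DeMoivre[symmetric])
    then have "cis (real (Suc n) * t) = cis t * cis t ^ n" by (simp only: power_Suc)
    then show "(1 / z ^ Suc n) * (f t * cis (real (Suc n) * t)) = f t * (cis t / z) * (cis t / z) ^ n"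
     by (simp add: power_divide)
   qed
   also have "(\<Sum>n<N. (cis t / z) ^ n) = ((cis t / z) ^ N - 1) / (cis t / z - 1)"
    by (rule geometric_sum[OF r])
   also have "f t * (cis t / z) * (((cis t / z) ^ N - 1) / (cis t / z - 1))
     = f t * (cis t / (cis t - z)) * ((cis t / z) ^ N - 1)"
    using ne[of t] z0 r by (simp add: divide_simps)
   finally have "(\<Sum>n<N. (1 / z ^ Suc n) * (f t * cis (real (Suc n) * t)))
     = f t * (cis t / (cis t - z)) * ((cis t / z) ^ N - 1)" .
   moreover have "F = F * P - S" if "S = F * (P - 1)" for F P S :: complex
    using that by (simp add: algebra_simps)
   ultimately show ?thesis by blast
  qed
  have cont: "continuous_on {a..b} (\<lambda>t. f t * (cis t / (cis t - z)) * (cis t / z) ^ N)"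
   using ne z0 by (intro continuous_intros f) auto
  have cont2: "continuous_on {a..b} (\<lambda>t. (1 / z ^ Suc n) * (f t * cis (real (Suc n) * t)))" for n
   by (intro continuous_intros f)
  have "cauchy_transform a b f z = integral {a..b} (\<lambda>t. f t * (cis t / (cis t - z)) * (cis t / z) ^ N)
    - integral {a..b} (\<lambda>t. \<Sum>n<N. (1 / z ^ Suc n) * (f t * cis (real (Suc n) * t)))"
   unfolding cauchy_transform_def
   by (subst eq, rule integral_diff) (intro integrable_continuous_interval cont continuous_on_sum cont2)+
  also have "integral {a..b} (\<lambda>t. \<Sum>n<N. (1 / z ^ Suc n) * (f t * cis (real (Suc n) * t)))
    = (\<Sum>n<N. integral {a..b} (\<lambda>t. (1 / z ^ Suc n) * (f t * cis (real (Suc n) * t))))"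
   by (rule integral_sum[OF finite_lessThan]) (rule integrable_continuous_interval[OF cont2])
  also have "... = 0"
   by (intro sum.neutral ballI) (simp add: coeff del: of_nat_Suc power_Suc)
  finally show ?thesis by simp
 qed
 define B where "B = M * (1 / (cmod z - 1)) * (b - a)"
 have bound: "cmod (cauchy_transform a b f z) <= B * (1 / cmod z) ^ N" for N
 proof -
  have "cmod (f t * (cis t / (cis t - z)) * (cis t / z) ^ N) <= M * (1 / (cmod z - 1)) * (1 / cmod z) ^ N"
   if t: "t : {a..b}" for t
  proof -
   have "cmod z - 1 <= cmod (cis t - z)" using norm_triangle_ineq3[of z "cis t"] by (simp add: norm_minus_commute)
   then have "1 / cmod (cis t - z) <= 1 / (cmod z - 1)"
    using z by (intro divide_left_mono mult_pos_pos) linarith+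
   then have "cmod (f t) * (1 / cmod (cis t - z)) <= M * (1 / (cmod z - 1))"
    using M[OF t] M0 by (intro mult_mono) auto
   then have "cmod (f t) * (1 / cmod (cis t - z)) * (1 / cmod z) ^ N <= M * (1 / (cmod z - 1)) * (1 / cmod z) ^ N"
    by (intro mult_right_mono) auto
   then show ?thesis by (simp add: norm_mult norm_divide norm_power)
  qed
  moreover have "continuous_on {a..b} (\<lambda>t. f t * (cis t / (cis t - z)) * (cis t / z) ^ N)"
   using ne z0 by (intro continuous_intros f) auto
  ultimately have "cmod (cauchy_transform a b f z) <= M * (1 / (cmod z - 1)) * (1 / cmod z) ^ N * (b - a)"
   unfolding iter[of N] by (intro integral_bound[OF ab]) auto
  then show ?thesis by (simp add: B_def mult_ac)
 qed
 have "(\<lambda>N. B * (1 / cmod z) ^ N) \<longlonglongrightarrow> B * 0"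
  using z by (intro tendsto_mult_left LIMSEQ_power_zero) (simp add: divide_less_eq)
 then have "cmod (cauchy_transform a b f z) <= 0"
  by (intro LIMSEQ_le_const[of "\<lambda>N. B * (1 / cmod z) ^ N"]) (use bound in auto)
 then show ?thesis by simp
qed

text \<open>The Cauchy transform of a density on a proper arc is analytic off the arc. It vanishes outside
  the disc because the positive moments vanish, hence across the gap, hence inside the disc; its
  value at the origin is the mean of the density.\<close>

lemma mean_zero_of_positive_moments:
 assumes ab: "a \<le> b" "b < a + 2 * pi" and f: "continuous_on {a..b} f"
  and coeff: "!!n::nat. integral {a..b} (\<lambda>t. f t * cis (real (Suc n) * t)) = 0"
 shows "integral {a..b} f = 0"
proof -
 define q where "q = (b + (a + 2 * pi)) / 2"
 define p where "p = cis q"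
 have p_arc: "p \<notin> cis ` {a..b}"
 proof
  assume "p : cis ` {a..b}"
  then obtain s where s: "cis q = cis s" "a <= s" "s <= b" by (auto simp: p_def)
  then have "q = s" using ab by (intro cis_inj) (auto simp: q_def field_simps)
  then show False using s ab by (simp add: q_def field_simps)
 qed
 have "open (- cis ` {a..b})"
  by (intro open_Compl compact_imp_closed compact_continuous_image continuous_cis) simp
 then obtain r where r: "r > 0" "ball p r <= - cis ` {a..b}" using p_arc open_contains_ball by (metis ComplI)
 let ?C = "cauchy_transform a b f"
 have pn: "cmod p = 1" by (simp add: p_def)
 have out: "?C z = 0" if "cmod z > 1" for z by (rule cauchy_transform_outside[OF ab(1) f that coeff])
 have hol1: "?C holomorphic_on ball p r" by (rule cauchy_transform_holomorphic[OF f]) (use r in auto)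
 have hol2: "?C holomorphic_on ball 0 1" by (rule cauchy_transform_holomorphic[OF f]) auto
 have gap: "?C z = 0" if "z : ball p r" for z
 proof (rule analytic_continuation_open[OF _ open_ball _ _ _ hol1 holomorphic_on_const _ that])
  show "open (ball p r \<inter> {z. cmod z > 1})"
   by (intro open_Int open_ball open_Collect_less continuous_intros)
  have "cmod (p * of_real (1 + r/2)) = 1 + r/2" using r pn by (simp only: norm_mult norm_of_real; simp)
  moreover have "p - p * of_real (1 + r/2) = - (p * of_real (r/2))" by (simp add: algebra_simps)
  then have "dist p (p * of_real (1 + r/2)) = r/2"
   using r pn by (simp only: dist_norm norm_minus_cancel norm_mult norm_of_real; simp)
  ultimately have "p * of_real (1 + r/2) : ball p r \<inter> {z. cmod z > 1}" using r by simp
  then show "ball p r \<inter> {z. cmod z > 1} ~= {}" by blast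
 qed (use out in auto)
 have "?C 0 = 0"
 proof (rule analytic_continuation_open[OF _ open_ball _ _ _ hol2 holomorphic_on_const])
  show "open (ball p r \<inter> ball 0 1)" by (intro open_Int open_ball)
  define e where "e = min r 1 / 2"
  have e: "0 < e" "e < r" "e < 1" using r by (auto simp: e_def)
  have "cmod (p * of_real (1 - e)) < 1" using e pn by (simp add: norm_mult del: of_real_diff)
  moreover have "dist p (p * of_real (1 - e)) = e" using e pn by (simp add: dist_norm algebra_simps norm_mult)
  ultimately have "p * of_real (1 - e) : ball p r \<inter> ball 0 1" using e by simp
  then show "ball p r \<inter> ball 0 1 ~= {}" by blast
 qed (use gap in auto)
 then show ?thesis by (simp add: cauchy_transform_def)
qed

lemma all_moments_zero:
 assumes ab: "a \<le> b" "b < a + 2 * pi" and f: "continuous_on {a..b} f"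
  and coeff: "!!n::nat. integral {a..b} (\<lambda>t. f t * cis (real (Suc n) * t)) = 0"
 shows "integral {a..b} (\<lambda>t. f t * cis (of_int k * t)) = 0"
proof -
 have neg: "integral {a..b} (\<lambda>t. f t * cis (- real m * t)) = 0 &
   (ALL n::nat. integral {a..b} (\<lambda>t. (f t * cis (- real m * t)) * cis (real (Suc n) * t)) = 0)" for m
 proof (induction m)
  case 0
  then show ?case using mean_zero_of_positive_moments[OF ab f coeff] coeff by simp
 next
  case (Suc m)
  note IH = Suc
  have "integral {a..b} (\<lambda>t. (f t * cis (- real (Suc m) * t)) * cis (real (Suc n) * t)) = 0" for n
  proof (cases n)
   case 0
   have eq: "(\<lambda>t. (f t * cis (- real (Suc m) * t)) * cis (real (Suc 0) * t)) = (\<lambda>t. f t * cis (- real m * t))"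
    by (rule ext) (simp add: mult.assoc cis_mult algebra_simps)
   show ?thesis unfolding 0 eq using Suc by blast
  next
   case (Suc l)
   have eq: "(\<lambda>t. (f t * cis (- real (Suc m) * t)) * cis (real (Suc (Suc l)) * t)) = (\<lambda>t. (f t * cis (- real m * t)) * cis (real (Suc l) * t))"
    by (rule ext) (simp add: mult.assoc cis_mult algebra_simps)
   show ?thesis unfolding Suc eq using IH by blast
  qed
  note coeff_Suc = this
  have "integral {a..b} (\<lambda>t. f t * cis (- real (Suc m) * t)) = 0"
   by (rule mean_zero_of_positive_moments[OF ab _ coeff_Suc]) (intro continuous_intros f)
  then show ?case using coeff_Suc by blast
 qed
 show ?thesis
 proof (cases "k <= 0")
  case True
  then have "real_of_int k = - real (nat (- k))" by simp
  then show ?thesis using neg by metis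
 next
  case False
  then have "real_of_int k = real (Suc (nat (k - 1)))" by simp
  then show ?thesis using coeff by metis
 qed
qed

text \<open>On an arc the trigonometric polynomials separate points, so a continuous density is determined
  by its moments.\<close>

lemma zero_of_moments_zero:
 assumes ab: "a < b" "b < a + 2 * pi" and f: "continuous_on {a..b} f"
  and coeff: "!!k::int. integral {a..b} (\<lambda>t. f t * cis (of_int k * t)) = 0"
  and t: "t \<in> {a..b}"
 shows "f t = 0"
proof -
 (* V h says that f h is orthogonal to all characters; R is the ring of multipliers that
  preserve this property. It contains cos and sin, so Stone-Weierstrass applies to R. *)
 define V where "V h \<longleftrightarrow> continuous_on {a..b} h &
  (ALL k::int. integral {a..b} (\<lambda>t. f t * cis (of_int k * t) * of_real (h t)) = 0)" for h :: "real => real"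
 define R where "R = {g. continuous_on {a..b} g & (ALL h. V h \<longrightarrow> V (\<lambda>t. g t * h t))}"
 have int: "(\<lambda>t. f t * cis (of_int k * t) * of_real (h t)) integrable_on {a..b}"
  if "continuous_on {a..b} h" for k :: int and h :: "real => real"
  by (intro integrable_continuous_interval continuous_intros f that)
 have trig: "V (\<lambda>t. cos t * h t)" "V (\<lambda>t. sin t * h t)" if h: "V h" for h
 proof -
  have hc: "continuous_on {a..b} h" using h by (simp add: V_def)
  have sh: "integral {a..b} (\<lambda>t. f t * cis (of_int k * t) * of_real (h t)) = 0" for k :: int
   using h by (simp add: V_def)
  have hi: "((\<lambda>t. f t * cis (of_int k * t) * of_real (h t)) has_integral 0) {a..b}" for k :: int
   using integrable_integral[OF int[OF hc, of k]] sh[of k] by simp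
  have sp: "cis (of_int (k+1) * t) = cis (of_int k * t) * cis t" "cis (of_int (k-1) * t) = cis (of_int k * t) * cis (-t)"
   "complex_of_real (cos t) = (cis t + cis (-t)) * (1/2)" "complex_of_real (sin t) = (cis t - cis (-t)) * (1/(2*\<i>))"
   for k :: int and t
  proof -
   show "cis (of_int (k+1) * t) = cis (of_int k * t) * cis t" "cis (of_int (k-1) * t) = cis (of_int k * t) * cis (-t)"
    by (simp_all add: cis_mult algebra_simps)
   show "complex_of_real (cos t) = (cis t + cis (-t)) * (1/2)" by (simp add: complex_eq_iff)
   have "cis t - cis (-t) = complex_of_real (sin t) * (2*\<i>)" by (simp add: complex_eq_iff)
   then show "complex_of_real (sin t) = (cis t - cis (-t)) * (1/(2*\<i>))" by simp
  qed
  have c: "f t * cis (of_int k * t) * of_real (cos t * h t)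
   = (1/2) * (f t * cis (of_int (k+1) * t) * of_real (h t)) + (1/2) * (f t * cis (of_int (k-1) * t) * of_real (h t))" for k :: int and t
   unfolding of_real_mult sp by algebra
  have alg: "p * e * ((x - y) * d * w) = d * (p * (e * x) * w) + (- d) * (p * (e * y) * w)" for p e x y d w :: complex
   by (simp add: algebra_simps)
  have s: "f t * cis (of_int k * t) * of_real (sin t * h t)
   = (1/(2*\<i>)) * (f t * cis (of_int (k+1) * t) * of_real (h t)) + (- (1/(2*\<i>))) * (f t * cis (of_int (k-1) * t) * of_real (h t))" for k :: int and t
   unfolding of_real_mult sp by (rule alg)
  have "integral {a..b} (\<lambda>t. f t * cis (of_int k * t) * of_real (cos t * h t)) = 0" for k :: int
   using integral_unique[OF has_integral_add[OF has_integral_mult_right[OF hi[of "k+1"], of "1/2"] has_integral_mult_right[OF hi[of "k-1"], of "1/2"]]]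
   unfolding c by (simp only: mult_zero_right add_0_right)
  moreover have "integral {a..b} (\<lambda>t. f t * cis (of_int k * t) * of_real (sin t * h t)) = 0" for k :: int
   using integral_unique[OF has_integral_add[OF has_integral_mult_right[OF hi[of "k+1"], of "1/(2*\<i>)"] has_integral_mult_right[OF hi[of "k-1"], of "- (1/(2*\<i>))"]]]
   unfolding s by (simp only: mult_zero_right add_0_right)
  ultimately show "V (\<lambda>t. cos t * h t)" "V (\<lambda>t. sin t * h t)"
   unfolding V_def using hc by (auto intro!: continuous_intros)
 qed
 interpret function_ring_on R "{a..b}"
 proof
  show "compact {a..b}" by simp
  show "continuous_on {a..b} g" if "g : R" for g using that by (simp add: R_def)
  show "(\<lambda>x. g x + g' x) : R" if g: "g : R" "g' : R" for g g'
  proof -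
   have "V (\<lambda>t. (g t + g' t) * h t)" if h: "V h" for h
   proof -
    have V1: "V (\<lambda>t. g t * h t)" "V (\<lambda>t. g' t * h t)" using g h by (auto simp: R_def)
    have "f t * cis (of_int k * t) * of_real ((g t + g' t) * h t)
     = f t * cis (of_int k * t) * of_real (g t * h t) + f t * cis (of_int k * t) * of_real (g' t * h t)" for k :: int and t
     by (simp add: algebra_simps)
    moreover have "continuous_on {a..b} (\<lambda>t. (g t + g' t) * h t)"
     using g h by (auto simp: R_def V_def intro!: continuous_intros)
    ultimately show ?thesis
     using V1 unfolding V_def by (simp add: integral_add int del: of_real_mult of_real_add)
   qed
   then show ?thesis using g by (auto simp: R_def intro!: continuous_intros)
  qed
  show "(\<lambda>x. g x * g' x) : R" if g: "g : R" "g' : R" for g g'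
   using g by (auto simp: R_def mult.assoc intro!: continuous_intros)
  show "(\<lambda>_. c) : R" for c
  proof -
   have "V (\<lambda>t. c * h t)" if h: "V h" for h
   proof -
    have eq: "f t * cis (of_int k * t) * of_real (c * h t) = of_real c * (f t * cis (of_int k * t) * of_real (h t))" for k :: int and t
     by simp
    have "integral {a..b} (\<lambda>t. f t * cis (of_int k * t) * of_real (c * h t)) = 0" for k :: int
     using h unfolding eq integral_mult_right V_def by simp
    moreover have "continuous_on {a..b} (\<lambda>t. c * h t)"
     using h by (auto simp: V_def intro!: continuous_intros)
    ultimately show ?thesis by (simp add: V_def)
   qed
   then show ?thesis by (simp add: R_def)
  qed
  show "EX g:R. g x ~= g y" if xy: "x : {a..b}" "y : {a..b}" "x ~= y" for x y
  proof -
   have "cis x ~= cis y" using xy ab by (intro notI) (auto dest!: cis_inj)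
   then have "cos x ~= cos y \<or> sin x ~= sin y" by (auto simp: complex_eq_iff)
   moreover have "cos : R" "sin : R" using trig by (auto simp: R_def intro!: continuous_intros)
   ultimately show ?thesis by blast
  qed
 qed
 have V1: "V (\<lambda>_. 1)" using coeff by (simp add: V_def)
 have orth: "integral {a..b} (\<lambda>t. f t * of_real (g t)) = 0" if "g : R" for g
 proof -
  have "V (\<lambda>t. g t * 1)" using that V1 by (simp only: R_def mem_Collect_eq)
  then have "integral {a..b} (\<lambda>t. f t * cis (of_int 0 * t) * of_real (g t * 1)) = 0" unfolding V_def by blast
  then show ?thesis by simp
 qed
 have real_orth: "integral {a..b} (\<lambda>t. f t * of_real (u t)) = 0" if u: "continuous_on {a..b} u" for u :: "real => real"
 proof -
  obtain M where M: "!!t. t : {a..b} ==> cmod (f t) <= M"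
   using compact_imp_bounded[OF compact_continuous_image[OF f compact_Icc]] bounded_iff by (metis imageI)
  have M0: "M >= 0" using order_trans[OF norm_ge_zero M[of a]] ab(1) by simp
  have "cmod (integral {a..b} (\<lambda>t. f t * of_real (u t))) <= 0 + e" if e: "e > 0" for e
  proof -
   define d where "d = e / (M * (b - a) + 1)"
   have d: "d > 0" using e M0 ab by (simp add: d_def add_nonneg_pos)
   obtain F where F: "F : UNIV \<rightarrow> R" "LIM n sequentially. F n :> uniformly_on {a..b} u"
    using Stone_Weierstrass[OF u] by blast
   then have "\<forall>\<^sub>F n in sequentially. ALL t:{a..b}. dist (F n t) (u t) < d"
    using d uniform_limitD by blast
   then obtain n where n: "ALL t:{a..b}. dist (F n t) (u t) < d" by (auto simp: eventually_sequentially)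
   have Fn: "F n : R" using F by auto
   have Fc: "continuous_on {a..b} (F n)" using Fn by (simp add: R_def)
   have "integral {a..b} (\<lambda>t. f t * of_real (u t)) = integral {a..b} (\<lambda>t. f t * of_real (u t)) - integral {a..b} (\<lambda>t. f t * of_real (F n t))"
    using orth[OF Fn] by simp
   also have "... = integral {a..b} (\<lambda>t. f t * of_real (u t) - f t * of_real (F n t))"
    by (subst integral_diff) (auto intro!: integrable_continuous_interval continuous_intros f u Fc)
   also have "... = integral {a..b} (\<lambda>t. f t * of_real (u t - F n t))" by (simp add: algebra_simps)
   also have "cmod ... <= M * d * (b - a)"
   proof (rule integral_bound[OF less_imp_le[OF ab(1)]])
    show "continuous_on {a..b} (\<lambda>t. f t * of_real (u t - F n t))" by (intro continuous_intros f u Fc)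
    fix t assume t: "t : {a..b}"
    have "cmod (f t) * \<bar>u t - F n t\<bar> <= M * d"
     using n t M[OF t] M0 by (intro mult_mono) (auto simp: dist_real_def abs_minus_commute intro: less_imp_le)
    then show "cmod (f t * of_real (u t - F n t)) <= M * d" by (simp only: norm_mult norm_of_real)
   qed
   also have "... = d * (M * (b - a))" by simp
   also have "... <= d * (M * (b - a) + 1)" using d by (intro mult_left_mono) auto
   also have "... = e" using M0 ab by (simp add: d_def add_nonneg_pos less_imp_neq[symmetric])
   finally show ?thesis by simp
  qed
  then have "cmod (integral {a..b} (\<lambda>t. f t * of_real (u t))) <= 0" using field_le_epsilon by blast
  then show ?thesis by simp
 qed
 have c: "continuous_on {a..b} (\<lambda>t. Re (f t))" "continuous_on {a..b} (\<lambda>t. Im (f t))"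
  by (intro continuous_intros f)+
 have "integral {a..b} (\<lambda>t. f t * of_real (Re (f t))) + (- \<i>) * integral {a..b} (\<lambda>t. f t * of_real (Im (f t))) = 0"
  using real_orth[OF c(1)] real_orth[OF c(2)] by simp
 also have "integral {a..b} (\<lambda>t. f t * of_real (Re (f t))) + (- \<i>) * integral {a..b} (\<lambda>t. f t * of_real (Im (f t)))
  = integral {a..b} (\<lambda>t. f t * of_real (Re (f t)) + (- \<i>) * (f t * of_real (Im (f t))))"
  by (subst integral_add) (auto intro!: integrable_continuous_interval continuous_intros f)
 also have "(\<lambda>t. f t * of_real (Re (f t)) + (- \<i>) * (f t * of_real (Im (f t)))) = (\<lambda>t. complex_of_real ((cmod (f t))\<^sup>2))"
  by (rule ext, subst complex_norm_square) (simp add: complex_eq_iff algebra_simps)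
 finally have "integral {a..b} (\<lambda>t. complex_of_real ((cmod (f t))\<^sup>2)) = 0" .
 moreover have "((\<lambda>t. complex_of_real ((cmod (f t))\<^sup>2)) has_integral complex_of_real (integral {a..b} (\<lambda>t. (cmod (f t))\<^sup>2))) {a..b}"
  by (intro has_integral_of_real integrable_integral integrable_continuous_interval continuous_intros f)
 ultimately have "complex_of_real (integral {a..b} (\<lambda>t. (cmod (f t))\<^sup>2)) = 0"
  by (simp only: integral_unique)
 then have "integral {a..b} (\<lambda>t. (cmod (f t))\<^sup>2) = 0" by (simp only: of_real_eq_0_iff)
 moreover have cont: "continuous_on {a..b} (\<lambda>t. (cmod (f t))\<^sup>2)" by (intro continuous_intros f)
 ultimately have "((\<lambda>t. (cmod (f t))\<^sup>2) has_integral 0) {a..b}"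
  using integrable_integral[OF integrable_continuous_interval[OF cont]] by simp
 then have "(cmod (f t))\<^sup>2 = 0"
  using has_integral_0_cbox_imp_0[of a b "\<lambda>t. (cmod (f t))\<^sup>2" t] ab(1) t cont
  by (simp add: box_real)
 then show ?thesis by simp
qed

section \<open>Moebius transformations of arcs\<close>

definition cap :: "real \<Rightarrow> complex set" where
 "cap c = {z. cmod z = 1 \<and> c < Re z}"

definition boost :: "real \<Rightarrow> complex^2^2" where
 "boost k = vector [vector [of_real (1 / sqrt (1 - k\<^sup>2)), of_real (k / sqrt (1 - k\<^sup>2))],
          vector [of_real (k / sqrt (1 - k\<^sup>2)), of_real (1 / sqrt (1 - k\<^sup>2))]]"

lemma rotation_SU11: "rotation t \<in> SU11"
 by (simp add: rotation_def SU11_def det_2 vector_2 cis_mult cis_cnj)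

lemma moebius_rotation: "moebius (rotation t) z = cis t * z"
proof -
 have "cis (t / 2) = cis t * cis (- (t / 2))" by (simp add: cis_mult)
 then show ?thesis by (simp add: moebius_def rotation_def vector_2)
qed

lemma rotation_add: "rotation (s + t) = rotation s ** rotation t"
 by (simp add: rotation_def matrix_matrix_mult_def vec_eq_iff forall_2 sum_2 vector_2 cis_mult add_divide_distrib diff_divide_distrib)

lemma rotation_periodic: "rotation (t + 2 * pi) = - rotation t"
proof -
 have "cis ((t + 2 * pi) / 2) = - cis (t / 2)" "cis (- (t + 2 * pi) / 2) = - cis (- t / 2)"
  by (simp_all add: complex_eq_iff add_divide_distrib diff_divide_distrib)
 then show ?thesis by (simp add: rotation_def vec_eq_iff forall_2 vector_2)
qed

lemma boost_SU11: "\<bar>k\<bar> < 1 ==> boost k \<in> SU11"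
proof -
 assume "\<bar>k\<bar> < 1"
 then have p: "1 - k\<^sup>2 > 0" by (simp add: abs_square_less_1)
 have "complex_of_real (1 / sqrt (1 - k\<^sup>2)) * of_real (1 / sqrt (1 - k\<^sup>2))
   - of_real (k / sqrt (1 - k\<^sup>2)) * of_real (k / sqrt (1 - k\<^sup>2))
   = of_real ((1 - k\<^sup>2) / (sqrt (1 - k\<^sup>2) * sqrt (1 - k\<^sup>2)))"
  by (simp only: of_real_mult[symmetric] of_real_diff[symmetric]) (simp add: diff_divide_distrib power2_eq_square)
 also have "... = 1" using p by simp
 finally show ?thesis by (simp add: boost_def SU11_def det_2 vector_2)
qed

lemma moebius_boost: "\<bar>k\<bar> < 1 ==> moebius (boost k) z = (z + of_real k) / (of_real k * z + 1)"
proof -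
 assume "\<bar>k\<bar> < 1"
 then have p: "1 - k\<^sup>2 > 0" by (simp add: abs_square_less_1)
 define r where "r = complex_of_real (1 / sqrt (1 - k\<^sup>2))"
 have r: "r ~= 0" using p by (simp add: r_def)
 have "moebius (boost k) z = (r * z + of_real k * r) / (of_real k * r * z + r)"
  by (simp add: moebius_def boost_def vector_2 r_def)
 also have "... = (r * (z + of_real k)) / (r * (of_real k * z + 1))" by (simp add: algebra_simps)
 also have "... = (z + of_real k) / (of_real k * z + 1)" using r by simp
 finally show ?thesis .
qed

lemma boost_denom: "\<bar>k\<bar> < 1 ==> cmod z = 1 ==> of_real k * z + 1 \<noteq> 0"
proof
 assume k: "\<bar>k\<bar> < 1" and z: "cmod z = 1" and e: "of_real k * z + 1 = 0"
 then have "of_real k * z = -1" by (simp add: add_eq_0_iff2)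
 then have "cmod (of_real k * z) = 1" by simp
 then show False using k z by (simp add: norm_mult)
qed

lemma boost_circle:
 assumes k: "\<bar>k\<bar> < 1" and z: "cmod z = 1"
 shows "cmod (moebius (boost k) z) = 1"
  and "Re (moebius (boost k) z) = (Re z + 2 * k / (1 + k\<^sup>2)) / (1 + 2 * k / (1 + k\<^sup>2) * Re z)"
proof -
 have zz: "(Re z)\<^sup>2 + (Im z)\<^sup>2 = 1" using z by (simp add: cmod_power2[symmetric])
 let ?n = "z + of_real k" and ?d = "of_real k * z + 1"
 have n2: "(cmod ?n)\<^sup>2 = 1 + k\<^sup>2 + 2 * k * Re z" using zz by (simp add: cmod_power2 power2_sum algebra_simps)
 have "(cmod ?d)\<^sup>2 = k\<^sup>2 * ((Re z)\<^sup>2 + (Im z)\<^sup>2) + 1 + 2 * k * Re z"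
  by (simp add: cmod_power2 power2_sum power_mult_distrib algebra_simps)
 then have d2: "(cmod ?d)\<^sup>2 = 1 + k\<^sup>2 + 2 * k * Re z" using zz by simp
 then have "cmod ?n = cmod ?d" using n2 by (metis norm_ge_zero power2_eq_iff_nonneg)
 then show "cmod (moebius (boost k) z) = 1"
  using boost_denom[OF k z] by (simp add: moebius_boost[OF k] norm_divide)
 have dpos: "(cmod ?d)\<^sup>2 > 0" using boost_denom[OF k z] by simp
 have "Re (moebius (boost k) z) = Re (?n * cnj ?d) / (cmod ?d)\<^sup>2"
  unfolding moebius_boost[OF k] by (subst complex_div_cnj) (simp add: Re_divide_of_real del: of_real_power)
 also have "Re (?n * cnj ?d) = k * ((Re z)\<^sup>2 + (Im z)\<^sup>2) + Re z + k * (k * Re z) + k"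
  by (simp add: algebra_simps power2_eq_square)
 also have "... = (1 + k\<^sup>2) * Re z + 2 * k" using zz by (simp add: algebra_simps power2_eq_square)
 also have "... / (cmod ?d)\<^sup>2 = (Re z + 2 * k / (1 + k\<^sup>2)) / (1 + 2 * k / (1 + k\<^sup>2) * Re z)"
 proof -
  have q: "1 + k\<^sup>2 > 0" by (simp add: add_pos_nonneg)
  have "(1 + k\<^sup>2) * Re z + 2 * k = (1 + k\<^sup>2) * (Re z + 2 * k / (1 + k\<^sup>2))"
   "(cmod ?d)\<^sup>2 = (1 + k\<^sup>2) * (1 + 2 * k / (1 + k\<^sup>2) * Re z)"
   unfolding d2 using q by (simp_all add: field_simps)
  then show ?thesis using q by simp
 qed
 finally show "Re (moebius (boost k) z) = (Re z + 2 * k / (1 + k\<^sup>2)) / (1 + 2 * k / (1 + k\<^sup>2) * Re z)" .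
qed

lemma velocity_bound: "\<bar>k\<bar> < 1 ==> \<bar>2 * k / (1 + k\<^sup>2)\<bar> < (1::real)"
proof -
 assume k: "\<bar>k\<bar> < 1"
 have q: "1 + k\<^sup>2 > 0" by (simp add: add_pos_nonneg)
 have "(1 - \<bar>k\<bar>)\<^sup>2 > 0" using k by simp
 then have "2 * \<bar>k\<bar> < 1 + k\<^sup>2" by (simp add: power2_diff)
 then show ?thesis using q by (simp add: abs_mult)
qed

lemma addition_of_velocities:
 assumes "\<bar>\<tau>\<bar> < 1" "\<bar>c\<bar> \<le> 1" "\<bar>x\<bar> \<le> (1::real)"
 shows "(c + \<tau>) / (1 + \<tau> * c) < (x + \<tau>) / (1 + \<tau> * x) \<longleftrightarrow> c < x"
proof -
 have p: "1 + \<tau> * y > 0" if "\<bar>y\<bar> <= 1" for y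
 proof -
  have "\<bar>\<tau> * y\<bar> < 1" using assms(1) that
   by (metis abs_ge_zero abs_mult le_less_trans mult_left_le)
  then show ?thesis by linarith
 qed
 have "(c + \<tau>) / (1 + \<tau> * c) < (x + \<tau>) / (1 + \<tau> * x) \<longleftrightarrow> (c + \<tau>) * (1 + \<tau> * x) < (x + \<tau>) * (1 + \<tau> * c)"
  using p[OF assms(2)] p[OF assms(3)] by (simp add: divide_less_eq less_divide_eq mult.commute)
 also have "... \<longleftrightarrow> 0 < (1 - \<tau>\<^sup>2) * (x - c)" by (simp add: algebra_simps power2_eq_square)
 also have "... \<longleftrightarrow> c < x"
 proof -
  have "1 - \<tau>\<^sup>2 > 0" using assms(1) by (simp add: abs_square_less_1)
  then show ?thesis by (auto simp: zero_less_mult_iff)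
 qed
 finally show ?thesis .
qed

lemma boost_inverse:
 assumes k: "\<bar>k\<bar> < 1" and z: "cmod z = 1"
 shows "moebius (boost k) (moebius (boost (- k)) z) = z"
proof -
 have k': "\<bar>- k\<bar> < 1" using k by simp
 have d: "of_real (-k) * z + 1 ~= 0" by (rule boost_denom[OF k' z])
 have "k\<^sup>2 < 1" using k by (simp add: abs_square_less_1)
 then have "complex_of_real (1 - k\<^sup>2) ~= 0" by (simp only: of_real_eq_0_iff; simp)
 then have k2: "1 - complex_of_real k * complex_of_real k ~= 0" by (simp add: power2_eq_square)
 let ?d = "1 - of_real k * z" and ?k = "complex_of_real k"
 have d: "?d ~= 0" using d by simp
 have "moebius (boost k) (moebius (boost (- k)) z) = ((z - ?k) / ?d + ?k) / (?k * ((z - ?k) / ?d) + 1)"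
  unfolding moebius_boost[OF k] moebius_boost[OF k'] by simp
 also have "(z - ?k) / ?d + ?k = (1 - ?k * ?k) * z / ?d" using d by (simp add: field_simps)
 also have "?k * ((z - ?k) / ?d) + 1 = (1 - ?k * ?k) / ?d" using d by (simp add: field_simps)
 also have "(1 - ?k * ?k) * z / ?d / ((1 - ?k * ?k) / ?d) = z" using d k2 by simp
 finally show ?thesis .
qed

lemma boost_cap:
 assumes k: "\<bar>k\<bar> < 1" and c: "\<bar>c\<bar> < 1"
 shows "moebius (boost k) ` cap c = cap ((c + 2 * k / (1 + k\<^sup>2)) / (1 + 2 * k / (1 + k\<^sup>2) * c))"
proof -
 let ?\<tau> = "2 * k / (1 + k\<^sup>2)"
 have k': "\<bar>- k\<bar> < 1" using k by simp
 have iff: "moebius (boost k) z : cap ((c + ?\<tau>) / (1 + ?\<tau> * c)) \<longleftrightarrow> z : cap c" if z: "cmod z = 1" for z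
  using boost_circle[OF k z] addition_of_velocities[OF velocity_bound[OF k], of c "Re z"] c z abs_Re_le_cmod[of z]
  by (simp add: cap_def)
 show ?thesis
 proof (intro equalityI subsetI)
  fix w assume w: "w : cap ((c + ?\<tau>) / (1 + ?\<tau> * c))"
  then have n: "cmod w = 1" by (simp add: cap_def)
  have "moebius (boost (- k)) w : cap c"
   using iff[OF boost_circle(1)[OF k' n]] boost_inverse[OF k n] w by simp
  then show "w : moebius (boost k) ` cap c"
   using boost_inverse[OF k n] by (metis imageI)
 qed (insert iff, auto simp: cap_def)
qed

lemma boost_minus: "\<bar>k\<bar> < 1 ==> moebius (boost k) (- z) = - moebius (boost (- k)) z"
 by (simp add: moebius_boost) (metis (no_types, opaque_lifting) minus_divide_left minus_diff_eq uminus_add_conv_diff add.commute)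

lemma cap_arc: "\<bar>c\<bar> < 1 ==> cap c = cis ` {- arccos c<..<arccos c}"
proof (intro equalityI subsetI)
 assume c: "\<bar>c\<bar> < 1"
 fix z assume z: "z : cap c"
 then have n: "cmod z = 1" and r: "c < Re z" by (auto simp: cap_def)
 have "z : circle" using n by simp
 then obtain t where t: "- pi <= t" "t < - pi + 2 * pi" "z = cis t" by (rule circle_arg_in)
 have "cos \<bar>t\<bar> > cos (arccos c)" using r t c by simp
 then have "\<bar>t\<bar> < arccos c"
  using t c arccos_lbound[of c] arccos_ubound[of c] by (subst (asm) cos_mono_less_eq) auto
 then have "t : {- arccos c<..<arccos c}" by (auto simp: abs_less_iff)
 then show "z : cis ` {- arccos c<..<arccos c}" using t by blast
next
 assume c: "\<bar>c\<bar> < 1"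
 fix z assume "z : cis ` {- arccos c<..<arccos c}"
 then obtain t where t: "z = cis t" "\<bar>t\<bar> < arccos c" by (auto simp: abs_less_iff)
 have "arccos c < pi" using arccos_lt_bounded[of c] c by (auto simp: abs_less_iff)
 then have "cos \<bar>t\<bar> > cos (arccos c)"
  using t by (subst cos_mono_less_eq) auto
 then show "z : cap c" using t c by (simp add: cap_def)
qed

lemma rotated_arc: "(*) (cis t) ` (cis ` {a<..<b}) = cis ` {a + t<..<b + t}"
proof -
 have "(*) (cis t) ` (cis ` {a<..<b}) = cis ` ((\<lambda>s. s + t) ` {a<..<b})"
  by (simp add: image_image cis_mult add.commute)
 moreover have "(\<lambda>s. s + t) ` {a<..<b} = {a + t<..<b + t}"
 proof (intro equalityI subsetI)
  fix s assume "s : {a + t<..<b + t}"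
  then show "s : (\<lambda>s. s + t) ` {a<..<b}" by (intro image_eqI[of _ _ "s - t"]) auto
 qed auto
 ultimately show ?thesis by simp
qed

lemma arccos_range: "\<bar>c\<bar> < 1 ==> 0 < arccos c" "\<bar>c\<bar> < 1 ==> arccos c < pi"
 using arccos_lt_bounded[of c] by auto

lemma rotated_cap_interval: "\<bar>c\<bar> < 1 ==> (*) (cis t) ` cap c \<in> intervals"
 using arccos_range[of c] by (simp add: cap_arc rotated_arc arc_in_intervals)

lemma interval_rotated_cap:
 assumes "I \<in> intervals"
 obtains t c where "\<bar>c\<bar> < 1" "I = (*) (cis t) ` cap c"
proof -
 obtain a b where ab: "a < b" "b < a + 2 * pi" "I = cis ` {a<..<b}" using assms intervals_iff by blast
 define c where "c = cos ((b - a) / 2)"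
 have ac: "arccos c = (b - a) / 2" unfolding c_def using ab by (intro arccos_cos) auto
 have "c < 1"
 proof -
  have "cos ((b-a)/2) < cos 0" by (rule cos_monotone_0_pi) (use ab in auto)
  then show ?thesis by (simp add: c_def)
 qed
 moreover have "-1 < c"
 proof -
  have "cos pi < cos ((b-a)/2)" by (rule cos_monotone_0_pi) (use ab in auto)
  then show ?thesis by (simp add: c_def)
 qed
 ultimately have c: "\<bar>c\<bar> < 1" by simp
 have "I = (*) (cis ((a + b)/2)) ` cap c"
  unfolding cap_arc[OF c] rotated_arc ac ab(3) by (simp add: field_simps)
 then show ?thesis using that c by blast
qed

section \<open>Positive-energy representations of the circle\<close>

lemma integral_periodic_shift:
 fixes h :: "real \<Rightarrow> complex"
 assumes h: "continuous_on UNIV h" and per: "!!t. h (t + 2 * pi) = h t"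
 shows "integral {0..2 * pi} (\<lambda>t. h (t + s)) = integral {0..2 * pi} h"
proof -
 have c: "continuous_on A h" for A using h continuous_on_subset by blast
 define G where "G x = integral {0..x} h" for x
 have int: "h integrable_on A" if "A = {a..b}" for A a b
  using that by (auto intro: integrable_continuous_interval c)
 define \<Phi> where "\<Phi> s = integral {0..2 * pi} (\<lambda>t. h (t + s))" for s
 have shift: "\<Phi> s = integral {s..s + 2 * pi} h" for s
  unfolding \<Phi>_def using integral_shift_Icc_real[of 0 "2 * pi" h s] by (simp add: add.commute o_def)
 have step: "\<Phi> s = \<Phi> s'" if "s <= s'" "s' <= s + 2 * pi" for s s'
 proof -
  have "integral {s..s'} h + integral {s'..s + 2 * pi} h = integral {s..s + 2 * pi} h"
   by (rule Henstock_Kurzweil_Integration.integral_combine) (use that int in auto)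
  moreover have "integral {s'..s + 2 * pi} h + integral {s + 2 * pi..s' + 2 * pi} h = integral {s'..s' + 2 * pi} h"
   by (rule Henstock_Kurzweil_Integration.integral_combine) (use that int in auto)
  moreover have "integral {s + 2 * pi..s' + 2 * pi} h = integral {s..s'} h"
   using integral_shift_Icc_real[of s s' h "2 * pi"] per by (simp add: add.commute o_def)
  ultimately show ?thesis unfolding shift by (metis add.commute)
 qed
 have per2: "h (t + 2 * pi * of_int k) = h t" for t k
 proof (induction k rule: int_induct[where k = 0])
  case (step1 i)
  have "h (t + 2 * pi * of_int i + 2 * pi) = h t" using per step1 by simp
  then show ?case by (simp add: algebra_simps)
 next
  case (step2 i)
  have "h (t + 2 * pi * of_int (i - 1) + 2 * pi) = h (t + 2 * pi * of_int (i - 1))" by (rule per)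
  then show ?case using step2 by (simp add: algebra_simps)
 qed simp
 define k where "k = \<lfloor>s / (2 * pi)\<rfloor>"
 have k: "2 * pi * of_int k <= s" "s <= 2 * pi * of_int k + 2 * pi"
  using floor_correct[of "s / (2 * pi)"] unfolding k_def[symmetric] by (auto simp: field_simps)
 have "\<Phi> s = \<Phi> (2 * pi * of_int k)" using step k by (metis add.commute)
 also have "... = \<Phi> 0" by (simp add: \<Phi>_def per2)
 finally show ?thesis by (simp add: \<Phi>_def)
qed

text \<open>The Fourier components of a vector are eigenvectors of the generator, hence vanish at negative
  frequencies if the generator is positive. A matrix coefficient that vanishes on an open set of
  rotations therefore vanishes identically.\<close>

lemma positive_energy_matrix_coefficient:
 fixes H :: "('v, 'a) hilb_scheme"
 assumes H: "complete_ips H" and U: "PSU11_rep H U" and pos: "rotation_generator_positive H U"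
  and x: "x \<in> carr H" and y: "y \<in> carr H" and \<delta>: "\<delta> > 0"
  and zero: "!!t. \<bar>t\<bar> < \<delta> ==> hip H x (U (rotation t) y) = 0"
 shows "hip H x (U (rotation t) y) = 0"
proof -
 define V where "V t = U (rotation t)" for t
 have unit: "unitary_op H H (V t)" for t using U rotation_SU11 by (simp add: PSU11_rep_def V_def)
 have Vb: "V t : bdd_ops H H" for t using unit by (simp add: unitary_op_def)
 have Vc: "V t v : carr H" if "v : carr H" for t v by (rule op_carr[OF Vb that])
 have Vadd: "V (s + t) v = V s (V t v)" if "v : carr H" for s t v
  using U rotation_SU11[of s] rotation_SU11[of t] that
  by (simp add: PSU11_rep_def V_def rotation_add compose_eq)
 have Vper: "V (t + 2 * pi) = V t" for t
  using U rotation_SU11[of t] by (simp add: PSU11_rep_def V_def rotation_periodic)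
 have Viso: "hip H (V t u) (V t v) = hip H u v" if "u : carr H" "v : carr H" for t u v
 proof -
  have "adj H H (V t) (V t u) = u"
   using unit[of t] that by (auto simp: unitary_op_def compose_def op_id_def fun_eq_iff) (metis)
  then show ?thesis using adj_left[OF H H Vb[of t] that(2) op_carr[OF Vb[of t] that(1)]] by simp
 qed
 have Vnorm: "hnorm H (V t v) = hnorm H v" if "v : carr H" for t v using Viso[OF that that] by (simp add: hnorm_def)
 have V0: "V 0 v = v" if v: "v : carr H" for v
 proof (rule hip_ext[OF H])
  fix z assume z: "z : carr H"
  have V0z: "V 0 v : carr H" by (rule Vc[OF v])
  have "V 0 (V 0 v) = V 0 v" using Vadd[OF v, of 0 0] by simp
  then have "hip H (V 0 z) (V 0 (V 0 v)) = hip H (V 0 z) (V 0 v)" by simp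
  then show "hip H z (V 0 v) = hip H z v" using Viso[OF z V0z] Viso[OF z v] by simp
 qed (use Vc[OF v] v in auto)
 have Vcont: "((\<lambda>t. hdist H (V t v) (V s v)) \<longlongrightarrow> 0) (at s)" if v: "v : carr H" for s v
 proof -
  have lim: "((\<lambda>h. hdist H (U h v) (U (rotation s) v)) \<longlongrightarrow> 0) (at (rotation s) within SU11)"
   using U v rotation_SU11 by (simp add: PSU11_rep_def)
  have eq: "rotation = (\<lambda>t. \<chi> i j. if i = 1 then if j = 1 then cis (t / 2) else 0 else if j = 1 then 0 else cis (- t / 2))"
   by (simp add: fun_eq_iff rotation_def vec_eq_iff forall_2 vector_2)
  have cont: "continuous_on UNIV (\<lambda>t. if i = (1::2) then if j = (1::2) then cis (t / 2) else 0 else if j = 1 then 0 else cis (- t / 2))" for i j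
   by (cases "i = 1"; cases "j = 1"; simp; intro continuous_intros; simp)
  have "continuous_on UNIV rotation"
   unfolding eq by (intro continuous_on_vec_lambda cont)
  then have rs: "(rotation \<longlongrightarrow> rotation s) (at s)" by (simp add: continuous_on_def)
  define g where "g h = hdist H (U h v) (U (rotation s) v)" for h
  have "hdiff H (U (rotation s) v) (U (rotation s) v) = hzero H"
   using H Vc[OF v, of s] by (intro hip_ext[OF H]) (auto simp: V_def)
  then have g0: "g (rotation s) = 0" using H by (simp add: g_def)
  have "(g \<longlongrightarrow> 0) (at (rotation s) within SU11)" unfolding g_def[abs_def] by (rule lim)
  then have "(g \<longlongrightarrow> 0) (inf (nhds (rotation s)) (principal SU11))"
   using tendsto_at_iff_tendsto_nhds_within[of g "rotation s" 0 SU11] g0 by blast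
  moreover have "filterlim rotation (inf (nhds (rotation s)) (principal SU11)) (at s)"
   unfolding filterlim_inf filterlim_principal using rs rotation_SU11 by simp
  ultimately have "((\<lambda>t. g (rotation t)) \<longlongrightarrow> 0) (at s)" by (rule filterlim_compose)
  then show ?thesis by (simp only: g_def V_def)
 qed
 have mc: "continuous_on UNIV (\<lambda>t. hip H u (V t v))" if "u : carr H" "v : carr H" for u v
  unfolding continuous_on_def
 proof
  fix s
  show "((\<lambda>t. hip H u (V t v)) \<longlongrightarrow> hip H u (V s v)) (at s within UNIV)"
   by (rule hip_tendsto(1)[OF H op_carr[OF Vb that(2)] op_carr[OF Vb that(2)] that(1)]) (use Vcont[OF that(2)] in simp)
 qed
 define c where "c n u = integral {0..2 * pi} (\<lambda>t. cis (- real_of_int n * t) * hip H u (V t y))" for n u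
 have ci: "(\<lambda>t. cis (- real_of_int n * t) * hip H u (V t y)) integrable_on {0..2*pi}" if "u : carr H" for n u
  by (intro integrable_continuous_interval continuous_intros continuous_on_subset[OF mc[OF that y]]) auto
 have neg: "c n u = 0" if n: "n < 0" and u: "u : carr H" for n :: int and u
 proof -
  obtain w where w: "w : carr H" "!!u. u : carr H ==> hip H u w = c n u"
  proof (rule Riesz_representation[OF H, of "c n" "2 * pi * hnorm H y"])
   fix u v assume uv: "u : carr H" "v : carr H"
   then show "c n (hadd H u v) = c n u + c n v"
    unfolding c_def using H Vb[THEN op_carr, OF y] integral_add[OF ci[OF uv(1)] ci[OF uv(2)]]
    by (simp add: distrib_left)
  next
   fix u z assume u: "u : carr H"
   have "(\<lambda>t. cis (- real_of_int n * t) * hip H (hscale H z u) (V t y)) = (\<lambda>t. cnj z * (cis (- real_of_int n * t) * hip H u (V t y)))"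
    using H Vb[THEN op_carr, OF y] u by (simp add: fun_eq_iff)
   then show "c n (hscale H z u) = cnj z * c n u" unfolding c_def by (simp only: integral_mult_right)
  next
   fix u assume u: "u : carr H"
   have "cmod (c n u) <= (hnorm H u * hnorm H y) * (2 * pi - 0)"
    unfolding c_def
   proof (rule integral_bound)
    show "continuous_on {0..2 * pi} (\<lambda>t. cis (- real_of_int n * t) * hip H u (V t y))"
     by (intro continuous_intros continuous_on_subset[OF mc[OF u y]]) auto
    show "cmod (cis (- real_of_int n * t) * hip H u (V t y)) <= hnorm H u * hnorm H y" for t
     using Cauchy_Schwarz[OF H u op_carr[OF Vb y], of t] Vnorm[OF y] by (simp add: norm_mult)
   qed simp
   then show "cmod (c n u) <= 2 * pi * hnorm H y * hnorm H u" by (simp add: mult_ac)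
  qed blast
  have eig: "V s w = hscale H (cis (of_int n * s)) w" for s
  proof (rule hip_ext[OF H])
   fix u assume u: "u : carr H"
   define u' where "u' = V (- s) u"
   have u': "u' : carr H" "V s u' = u"
    using Vc[OF u] Vadd[OF u, of s "- s"] V0[OF u] by (auto simp: u'_def)
   have "hip H u (V s w) = c n u'" using Viso[OF u'(1) w(1), of s] u' w(2)[OF u'(1)] by simp
   also have "... = integral {0..2 * pi} (\<lambda>t. cis (of_int n * s) * (cis (- real_of_int n * (t + s)) * hip H u (V (t + s) y)))"
    unfolding c_def
   proof (rule arg_cong[where f = "integral _"], rule ext)
    fix t
    have "hip H u' (V t y) = hip H u (V (t + s) y)"
     using Viso[OF u'(1) op_carr[OF Vb y], of s t] u' Vadd[OF y, of s t] by (simp add: add.commute)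
    moreover have "cis (- real_of_int n * t) = cis (of_int n * s) * cis (- real_of_int n * (t + s))"
     by (simp add: cis_mult algebra_simps)
    ultimately show "cis (- real_of_int n * t) * hip H u' (V t y) = cis (of_int n * s) * (cis (- real_of_int n * (t + s)) * hip H u (V (t + s) y))"
     by simp
   qed
   also have "... = cis (of_int n * s) * integral {0..2 * pi} (\<lambda>t. cis (- real_of_int n * (t + s)) * hip H u (V (t + s) y))"
    by (simp only: integral_mult_right)
   also have "integral {0..2 * pi} (\<lambda>t. cis (- real_of_int n * (t + s)) * hip H u (V (t + s) y)) = c n u"
    unfolding c_def
   proof (rule integral_periodic_shift[of "\<lambda>t. cis (- real_of_int n * t) * hip H u (V t y)"])
    show "continuous_on UNIV (\<lambda>t. cis (- real_of_int n * t) * hip H u (V t y))"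
     by (intro continuous_intros mc[OF u y])
    fix t
    have "cis (- real_of_int n * (t + 2 * pi)) = cis (- real_of_int n * t)"
     unfolding cis_eq_iff_int by (intro exI[of _ "- n"]) (simp add: algebra_simps)
    then show "cis (- real_of_int n * (t + 2 * pi)) * hip H u (V (t + 2 * pi) y) = cis (- real_of_int n * t) * hip H u (V t y)"
     by (simp only: Vper)
   qed
   also have "c n u = hip H u w" using w(2)[OF u] by simp
   finally show "hip H u (V s w) = hip H u (hscale H (cis (of_int n * s)) w)" using H u w(1) by simp
  qed (use Vc[OF w(1)] w(1) H in auto)
  let ?z = "hscale H (of_int n) w"
  have quot: "hdiff H (hscale H (1 / of_real t) (hdiff H (V t w) w)) (hscale H \<i> ?z)
    = hscale H ((cis (of_int n * t) - 1) / of_real t - \<i> * of_int n) w" for t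
   using H w(1) unfolding eig by (intro hip_ext[OF H]) (auto simp: algebra_simps diff_divide_distrib)
  have "((\<lambda>z. exp (\<i> * of_int n * z)) has_field_derivative \<i> * of_int n) (at 0)"
   by (auto intro!: derivative_eq_intros)
  then have lim: "((\<lambda>z. (exp (\<i> * of_int n * z) - 1) / z) \<longlongrightarrow> \<i> * of_int n) (at 0)"
   by (simp add: has_field_derivative_iff)
  have "filterlim complex_of_real (at 0) (at 0)"
   by (auto simp: filterlim_at eventually_at_filter intro!: tendsto_eq_intros)
  from filterlim_compose[OF lim this]
  have "((\<lambda>t. (cis (of_int n * t) - 1) / of_real t) \<longlongrightarrow> \<i> * of_int n) (at 0)"
   by (simp add: cis_conv_exp mult.assoc)
  then have d: "((\<lambda>t. (cis (of_int n * t) - 1) / of_real t - \<i> * of_int n) \<longlongrightarrow> 0) (at 0)"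
   using LIM_zero by blast
  have "((\<lambda>t. hdist H (hscale H (1 / of_real t) (hdiff H (U (rotation t) w) w)) (hscale H \<i> ?z)) \<longlongrightarrow> 0) (at 0)"
   unfolding V_def[symmetric] quot hnorm_scale[OF H w(1)]
   using tendsto_mult_left_zero[OF tendsto_norm_zero[OF d], of "hnorm H w"] .
  then have "hip H w ?z : \<real>\<^sub>\<ge>\<^sub>0"
   by (rule pos[unfolded rotation_generator_positive_def, rule_format, OF w(1) carr_closed(3)[OF H w(1)]])
  then have "0 <= real_of_int n * (hnorm H w)\<^sup>2"
   using H w(1) by (simp add: hip_self(1) complex_nonneg_Reals_iff)
  then have "hnorm H w = 0" using n by (simp add: zero_le_mult_iff)
  then have "w = hzero H" using hnorm_eq_0[OF H w(1)] by simp
  then show ?thesis using w(2)[OF u] u H by simp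
 qed
 show ?thesis
 proof -
  define e where "e = min \<delta> pi / 2"
  have e: "0 < e" "e < \<delta>" "e < pi" using \<delta> by (auto simp: e_def min_def)
  define f where "f t = hip H x (V t y)" for t
  have fc: "continuous_on A f" for A unfolding f_def by (rule continuous_on_subset[OF mc[OF x y]]) simp
  have f0: "f t = 0" if "\<bar>t\<bar> <= e" for t using zero[of t] that e by (simp add: f_def V_def)
  have fper: "f (t + 2 * pi) = f t" for t by (simp add: f_def Vper)
  have f0': "f t = 0" if "\<bar>t - 2 * pi\<bar> <= e" for t using f0[OF that] fper[of "t - 2 * pi"] by simp
  have "integral {e..2 * pi - e} (\<lambda>t. f t * cis (real (Suc m) * t)) = 0" for m
  proof -
   let ?g = "\<lambda>t. f t * cis (real (Suc m) * t)"
   have gi: "?g integrable_on {a..b}" for a b by (intro integrable_continuous_interval continuous_intros fc)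
   have "integral {0..e} ?g = integral {0..e} (\<lambda>t. 0)" by (rule integral_cong) (simp add: f0)
   moreover have "integral {2 * pi - e..2 * pi} ?g = integral {2 * pi - e..2 * pi} (\<lambda>t. 0)" by (rule integral_cong) (simp add: f0')
   moreover have "integral {0..e} ?g + integral {e..2*pi} ?g = integral {0..2*pi} ?g"
    by (rule Henstock_Kurzweil_Integration.integral_combine) (use e gi in auto)
   moreover have "integral {e..2*pi-e} ?g + integral {2*pi-e..2*pi} ?g = integral {e..2*pi} ?g"
    by (rule Henstock_Kurzweil_Integration.integral_combine) (use e gi in auto)
   moreover have "integral {0..2*pi} ?g = c (- int (Suc m)) x"
    unfolding c_def f_def by (simp add: mult.commute add.commute)
   moreover have "c (- int (Suc m)) x = 0" by (rule neg[OF _ x]) simp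
   ultimately show ?thesis by simp
  qed
  then have f_mid: "f t = 0" if "t : {e..2 * pi - e}" for t
   using zero_of_moments_zero[of e "2 * pi - e" f t] all_moments_zero[of e "2 * pi - e" f] e fc that by simp
  have f_per2: "f t = 0" if "0 <= t" "t < 2 * pi" for t
   using f0[of t] f0'[of t] f_mid[of t] that by (cases "t < e"; cases "t > 2 * pi - e") auto
  have "circle ~= {}" by auto
  obtain s where s: "0 <= s" "s < 0 + 2 * pi" "cis t = cis s" by (rule circle_arg_in[of "cis t" 0]) simp_all
  obtain k :: int where k: "t = s + 2 * pi * of_int k" using s(3) cis_eq_iff_int by blast
  have "f (s + 2 * pi * of_int k) = f s"
  proof (induction k rule: int_induct[where k = 0])
   case (step1 i)
   have "f (s + 2 * pi * of_int i + 2 * pi) = f s" using fper step1 by simp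
   then show ?case by (simp add: algebra_simps)
  next
   case (step2 i)
   have "f (s + 2 * pi * of_int (i - 1) + 2 * pi) = f (s + 2 * pi * of_int (i - 1))" by (rule fper)
   then show ?case using step2 by (simp add: algebra_simps)
  qed simp
  then show ?thesis using f_per2[of s] s k by (simp add: f_def V_def)
 qed
qed

section \<open>The Reeh-Schlieder property\<close>

lemma moebius_netD:
 assumes "moebius_net N"
 shows "hilbert_space N"
  and "I \<in> intervals ==> von_neumann_algebra N (alg N I)"
  and "I \<in> intervals ==> J \<in> intervals ==> I \<subseteq> J ==> alg N I \<subseteq> alg N J"
  and "I \<in> intervals ==> J \<in> intervals ==> I \<inter> J = {} ==> S \<in> alg N I ==> T \<in> alg N J ==>
   compose (carr N) S T = compose (carr N) T S"
  and "Omega N \<in> carr N" "hnorm N (Omega N) = 1"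
proof -
 show "compose (carr N) S T = compose (carr N) T S"
  if "I : intervals" "J : intervals" "I \<inter> J = {}" "S : alg N I" "T : alg N J"
  using assms that unfolding moebius_net_def by blast
qed (insert assms, simp_all add: moebius_net_def)

lemma von_neumann_algebraD:
 assumes H: "complete_ips H" and M: "von_neumann_algebra H M"
 shows "S \<in> M ==> S \<in> bdd_ops H H"
  and "S \<in> M ==> adj H H S \<in> M"
  and "T \<in> bdd_ops H H ==> (!!R x. R \<in> commutant H M ==> x \<in> carr H ==> R (T x) = T (R x)) ==> T \<in> M"
  and "op_id H \<in> M"
  and "S \<in> M ==> T \<in> M ==> op_add H H S T \<in> M"
  and "S \<in> M ==> op_scale H H c S \<in> M"
  and "S \<in> M ==> T \<in> M ==> compose (carr H) S T \<in> M"
proof -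
 show b: "S : M ==> S : bdd_ops H H" for S using M by (auto simp: von_neumann_algebra_def)
 show "S : M ==> adj H H S : M" using M by (auto simp: von_neumann_algebra_def)
 have bb: "commutant H (commutant H M) = M" using M by (simp add: von_neumann_algebra_def)
 show I: "T : M" if "T : bdd_ops H H" "!!R x. R : commutant H M ==> x : carr H ==> R (T x) = T (R x)" for T
 proof -
  have "T : commutant H (commutant H M)"
   unfolding commutant_def[of H "commutant H M"] using that by (simp add: compose_def restrict_def fun_eq_iff)
  then show ?thesis using bb by simp
 qed
 have comm: "R (S x) = S (R x)" if "R : commutant H M" "S : M" "x : carr H" for R S x
 proof -
  have "compose (carr H) S R = compose (carr H) R S" using that by (simp add: commutant_def)
  then show ?thesis using that(3) by (metis compose_eq)
 qed
 have Rb: "R : bdd_ops H H" if "R : commutant H M" for R using that by (simp add: commutant_def)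
 have Rc: "R x : carr H" if "R : commutant H M" "x : carr H" for R x by (rule op_carr[OF Rb[OF that(1)] that(2)])
 have Sc: "S x : carr H" if "S : M" "x : carr H" for S x by (rule op_carr[OF b[OF that(1)] that(2)])
 show "op_id H : M"
 proof (rule I[OF op_id_bdd[OF H]])
  fix R x assume r: "R : commutant H M" "x : carr H"
  show "R (op_id H x) = op_id H (R x)" using r Rc[OF r] by (simp add: op_id_def)
 qed
 show "op_add H H S T : M" if S: "S : M" and T: "T : M"
 proof (rule I[OF op_add_bdd[OF H H b[OF S] b[OF T]]])
  fix R x assume r: "R : commutant H M" "x : carr H"
  show "R (op_add H H S T x) = op_add H H S T (R x)"
   using r Rc[OF r] comm[OF r(1) S r(2)] comm[OF r(1) T r(2)] bdd_opsD(3)[OF Rb[OF r(1)] Sc[OF S r(2)] Sc[OF T r(2)]]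
   by (simp add: op_add_def)
 qed
 show "op_scale H H c S : M" if S: "S : M"
 proof (rule I[OF op_scale_bdd[OF H H b[OF S]]])
  fix R x assume r: "R : commutant H M" "x : carr H"
  show "R (op_scale H H c S x) = op_scale H H c S (R x)"
   using r Rc[OF r] comm[OF r(1) S r(2)] bdd_opsD(4)[OF Rb[OF r(1)] Sc[OF S r(2)]]
   by (simp add: op_scale_def)
 qed
 show "compose (carr H) S T : M" if S: "S : M" and T: "T : M"
 proof (rule I[OF bdd_ops_compose[OF H H H b[OF T] b[OF S]]])
  fix R x assume r: "R : commutant H M" "x : carr H"
  show "R (compose (carr H) S T x) = compose (carr H) S T (R x)"
   using r Rc[OF r] comm[OF r(1) S Sc[OF T r(2)]] comm[OF r(1) T r(2)]
   by (simp add: compose_eq)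
 qed
qed

definition alg_annihilator :: "'v net \<Rightarrow> complex set \<Rightarrow> 'v set" where
 "alg_annihilator N I = {x \<in> carr N. \<forall>S\<in>alg N I. hip N x (S (Omega N)) = 0}"

lemma unitary_opD:
 assumes H: "complete_ips H" and U: "unitary_op H H T"
 shows "T \<in> bdd_ops H H" "adj H H T \<in> bdd_ops H H"
  and "x \<in> carr H ==> adj H H T (T x) = x" "x \<in> carr H ==> T (adj H H T x) = x"
  and "x \<in> carr H ==> y \<in> carr H ==> hip H (T x) (T y) = hip H x y"
proof -
 show T: "T : bdd_ops H H" using U by (simp add: unitary_op_def)
 show T': "adj H H T : bdd_ops H H" by (rule adj_bdd[OF H H T])
 show a: "adj H H T (T x) = x" if "x : carr H" for x
 proof -
  have "compose (carr H) (adj H H T) T x = op_id H x" using U by (simp add: unitary_op_def)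
  then show ?thesis using that by (simp add: compose_eq op_id_def)
 qed
 show "T (adj H H T x) = x" if "x : carr H" for x
 proof -
  have "compose (carr H) T (adj H H T) x = op_id H x" using U by (simp add: unitary_op_def)
  then show ?thesis using that by (simp add: compose_eq op_id_def)
 qed
 show "hip H (T x) (T y) = hip H x y" if "x : carr H" "y : carr H" for x y
  using adj_left[OF H H T that(2) op_carr[OF T that(1)]] a[OF that(1)] by simp
qed

text \<open>The annihilators of the spaces \<open>A(I) \<Omega>\<close> do not depend on \<open>I\<close>. Positivity of the energy shows
  that the annihilator of a cap is contained in that of every rotation of a smaller cap. Boosts shrink
  a cap around \<open>1\<close> and blow up a cap around \<open>-1\<close>, which removes the restriction on the sizes.\<close>

lemma alg_annihilator_independent:
 assumes N: "moebius_net N" and I: "I \<in> intervals" and J: "J \<in> intervals"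
 shows "alg_annihilator N I = alg_annihilator N J"
proof -
 note H = hilbert_space_complete[OF moebius_netD(1)[OF N]]
 let ?\<Omega> = "Omega N"
 note \<Omega> = moebius_netD(5)[OF N]
 have "EX U. PSU11_rep N U & rotation_generator_positive N U & (ALL g:SU11. U g ?\<Omega> = ?\<Omega>) &
   (ALL g:SU11. ALL I:intervals.
    (\<lambda>S. compose (carr N) (U g) (compose (carr N) S (adj N N (U g)))) ` alg N I = alg N (moebius g ` I))"
  using N unfolding moebius_net_def by (elim conjE)
 then obtain U where U': "PSU11_rep N U & rotation_generator_positive N U & (ALL g:SU11. U g ?\<Omega> = ?\<Omega>) &
   (ALL g:SU11. ALL I:intervals.
    (\<lambda>S. compose (carr N) (U g) (compose (carr N) S (adj N N (U g)))) ` alg N I = alg N (moebius g ` I))" ..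
 have U: "PSU11_rep N U" "rotation_generator_positive N U"
  "!!g. g : SU11 ==> U g ?\<Omega> = ?\<Omega>"
  "!!g I. g : SU11 ==> I : intervals ==>
   (\<lambda>S. compose (carr N) (U g) (compose (carr N) S (adj N N (U g)))) ` alg N I = alg N (moebius g ` I)"
  using U' by simp_all
 have unit: "unitary_op N N (U g)" if "g : SU11" for g using U(1) that by (simp add: PSU11_rep_def)
 note un = unitary_opD[OF H unit]
 have Sb: "S : bdd_ops N N" if "I : intervals" "S : alg N I" for S I
  using von_neumann_algebraD(1)[OF H moebius_netD(2)[OF N that(1)] that(2)] .
 have S\<Omega>: "S ?\<Omega> : carr N" if "I : intervals" "S : alg N I" for S I by (rule op_carr[OF Sb[OF that] \<Omega>])
 have adj\<Omega>: "adj N N (U g) ?\<Omega> = ?\<Omega>" if "g : SU11" for g using un(3)[OF that \<Omega>] U(3)[OF that] by simp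
 have moved: "x : alg_annihilator N (moebius g ` I) \<longleftrightarrow> x : carr N & (ALL S:alg N I. hip N x (U g (S ?\<Omega>)) = 0)"
  if "g : SU11" "I : intervals" for g I x
  unfolding alg_annihilator_def U(4)[OF that, symmetric]
  by (simp add: compose_eq \<Omega> adj\<Omega>[OF that(1)])
 have push: "U g x : alg_annihilator N (moebius g ` I) \<longleftrightarrow> x : alg_annihilator N I"
  if g: "g : SU11" and I: "I : intervals" and x: "x : carr N" for g I x
  unfolding moved[OF g I] using op_carr[OF un(1)[OF g] x] un(5)[OF g x S\<Omega>[OF I]] x
  by (simp add: alg_annihilator_def)
 let ?rot = "\<lambda>t c. (*) (cis t) ` cap c"
 have rot: "moebius (rotation t) ` A = (*) (cis t) ` A" for t A by (simp add: moebius_rotation)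
 have cap_int: "cap c : intervals" if "\<bar>c\<bar> < 1" for c using rotated_cap_interval[OF that, of 0] by simp
 have pull: "U (rotation t) x : alg_annihilator N (?rot (s + t) c) \<longleftrightarrow> x : alg_annihilator N (?rot s c)"
  if "x : carr N" "\<bar>c\<bar> < 1" for x s t c
 proof -
  have "moebius (rotation t) ` ?rot s c = ?rot (s + t) c"
   unfolding rot by (simp add: image_image cis_mult[symmetric] mult_ac)
  then show ?thesis using push[OF rotation_SU11 rotated_cap_interval[OF that(2)] that(1), of t s] by simp
 qed
 have carr: "x : carr N" if "x : alg_annihilator N I" for x I using that by (simp add: alg_annihilator_def)
 have positivity: "x : alg_annihilator N (?rot t c)"
  if x: "x : alg_annihilator N (cap c')" and c: "\<bar>c\<bar> < 1" "\<bar>c'\<bar> < 1" "c' < c" for x t c c'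
 proof -
  note xc = carr[OF x]
  have "hip N x (U (rotation t) (S ?\<Omega>)) = 0" if S: "S : alg N (cap c)" for S
  proof (rule positive_energy_matrix_coefficient[OF H U(1,2) xc S\<Omega>[OF cap_int[OF c(1)] S]])
   show "c - c' > 0" using c by simp
   fix s :: real assume s: "\<bar>s\<bar> < c - c'"
   have "?rot s c <= cap c'"
   proof
    fix z assume "z : ?rot s c"
    then obtain w where w: "z = cis s * w" "cmod w = 1" "c < Re w" by (auto simp: cap_def)
    have "z - w = (cis s - 1) * w" by (simp add: w(1) algebra_simps)
    then have "cmod (z - w) = cmod (cis s - 1)" by (simp add: norm_mult w(2))
    also have "... <= \<bar>s\<bar>"
     using dist_exp_i_1[of s] abs_sin_x_le_abs_x[of "s / 2"] by (simp add: cis_conv_exp)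
    finally have "Re w - Re z <= \<bar>s\<bar>" using abs_Re_le_cmod[of "z - w"] by simp
    then show "z : cap c'" using w s by (simp add: cap_def norm_mult)
   qed
   then have "alg N (?rot s c) <= alg N (cap c')"
    by (rule moebius_netD(3)[OF N rotated_cap_interval[OF c(1)] cap_int[OF c(2)]])
   then have "x : alg_annihilator N (?rot s c)" using x by (auto simp: alg_annihilator_def)
   then show "hip N x (U (rotation s) (S ?\<Omega>)) = 0"
    using moved[OF rotation_SU11 cap_int[OF c(1)], of x s] S unfolding rot by blast
  qed
  then show ?thesis using moved[OF rotation_SU11 cap_int[OF c(1)], of x t] xc unfolding rot by blast
 qed
 have opposite: "alg_annihilator N (?rot pi g) <= alg_annihilator N (cap b)" if b: "\<bar>b\<bar> < 1" and g: "\<bar>g\<bar> < 1" for b g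
 proof
  fix x assume x: "x : alg_annihilator N (?rot pi g)"
  define P where "P k = (g - b) * ((1 + k\<^sup>2)\<^sup>2 + 4 * k\<^sup>2) - 4 * k * (1 + k\<^sup>2) * (1 - g * b)" for k :: real
  have "(1 - g) * (1 + b) > 0" using b g by (intro mult_pos_pos) auto
  then have "P 1 < 0" by (simp add: P_def algebra_simps)
  moreover have "(P \<longlongrightarrow> P 1) (at_left 1)" unfolding P_def by (intro tendsto_intros)
  ultimately have "\<forall>\<^sub>F k in at_left 1. P k < 0" using order_tendstoD(2) by blast
  then obtain l where l: "l < 1" "!!k. l < k ==> k < 1 ==> P k < 0" unfolding eventually_at_left_field by blast
  define k where "k = (max l 0 + 1) / 2"
  have k: "l < k" "0 < k" "k < 1" using l(1) by (auto simp: k_def)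
  have k': "\<bar>k\<bar> < 1" "\<bar>- k\<bar> < 1" using k by auto
  define \<tau> where "\<tau> = 2 * k / (1 + k\<^sup>2)"
  have \<tau>: "\<bar>\<tau>\<bar> < 1" "0 < \<tau>" using velocity_bound[OF k'(1)] k by (auto simp: \<tau>_def add_pos_nonneg)
  define b' where "b' = (b + \<tau>) / (1 + \<tau> * b)"
  define g' where "g' = (g - \<tau>) / (1 - \<tau> * g)"
  have q: "1 + k\<^sup>2 > 0" by (simp add: add_pos_nonneg)
  have den: "1 + \<tau> * b > 0" "1 - \<tau> * g > 0"
  proof -
   have "\<bar>\<tau> * b\<bar> < 1" "\<bar>\<tau> * g\<bar> < 1" using \<tau>(1) b g by (simp_all add: abs_mult abs_mult_less)
    (metis abs_ge_zero abs_mult_less mult_1)+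
   then show "1 + \<tau> * b > 0" "1 - \<tau> * g > 0" by linarith+
  qed
  have "g' < b'"
  proof -
   have "P k < 0" using l(2) k by blast
   moreover have "P k = (1 + k\<^sup>2)\<^sup>2 * ((g - b) * (1 + \<tau>\<^sup>2) - 2 * \<tau> * (1 - g * b))"
   proof -
    have ts: "\<tau> * (1 + k\<^sup>2) = 2 * k" using q by (simp add: \<tau>_def)
    have "s\<^sup>2 * ((g - b) * (1 + \<tau>\<^sup>2) - 2 * \<tau> * (1 - g * b))
      = (g - b) * (s\<^sup>2 + (\<tau> * s)\<^sup>2) - 2 * (\<tau> * s) * s * (1 - g * b)" for s
     by (simp add: algebra_simps power2_eq_square)
    from this[of "1 + k\<^sup>2"] show ?thesis unfolding ts P_def by (simp add: power_mult_distrib)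
   qed
   ultimately have "(g - b) * (1 + \<tau>\<^sup>2) - 2 * \<tau> * (1 - g * b) < 0"
    using q by (simp add: mult_less_0_iff)
   then have "(g - \<tau>) * (1 + \<tau> * b) < (b + \<tau>) * (1 - \<tau> * g)"
    by (simp add: algebra_simps power2_eq_square)
   then show ?thesis using den by (simp add: g'_def b'_def divide_less_eq less_divide_eq mult_ac)
  qed
  have b'1: "\<bar>b'\<bar> < 1" and g'1: "\<bar>g'\<bar> < 1"
  proof -
   have "(- 1 + \<tau>) / (1 + \<tau> * (- 1)) < (b + \<tau>) / (1 + \<tau> * b)" "(b + \<tau>) / (1 + \<tau> * b) < (1 + \<tau>) / (1 + \<tau> * 1)"
    using b by (subst addition_of_velocities[OF \<tau>(1)]; simp)+
   moreover have "(- 1 + \<tau>) / (1 + \<tau> * (- 1)) = -1" using \<tau> by (simp add: divide_simps)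
   moreover have "(1 + \<tau>) / (1 + \<tau> * 1) = 1" using \<tau> by simp
   ultimately have "-1 < b' & b' < 1" unfolding b'_def by simp
   then show "\<bar>b'\<bar> < 1" by auto
   have t': "\<bar>- \<tau>\<bar> < 1" using \<tau>(1) by simp
   have "(- 1 + - \<tau>) / (1 + - \<tau> * (- 1)) < (g + - \<tau>) / (1 + - \<tau> * g)" "(g + - \<tau>) / (1 + - \<tau> * g) < (1 + - \<tau>) / (1 + - \<tau> * 1)"
    using g by (subst addition_of_velocities[OF t']; simp)+
   moreover have "(- 1 + - \<tau>) / (1 + - \<tau> * (- 1)) = -1" using \<tau> by (simp add: divide_simps)
   moreover have "(1 + - \<tau>) / (1 + - \<tau> * 1) = 1" using \<tau> by simp
   ultimately have "-1 < g' & g' < 1" unfolding g'_def by simp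
   then show "\<bar>g'\<bar> < 1" by auto
  qed
  have im_b: "moebius (boost k) ` cap b = cap b'"
   unfolding boost_cap[OF k'(1) b] b'_def \<tau>_def by simp
  have im_g: "moebius (boost k) ` ?rot pi g = ?rot pi g'"
  proof -
   have "moebius (boost k) ` ?rot pi g = uminus ` (moebius (boost (- k)) ` cap g)"
    by (simp add: image_image boost_minus[OF k'(1)])
   also have "moebius (boost (- k)) ` cap g = cap g'"
    unfolding boost_cap[OF k'(2) g] g'_def \<tau>_def by simp
   finally show ?thesis by (simp add: image_image)
  qed
  note bo = boost_SU11[OF k'(1)]
  have x1: "U (boost k) x : alg_annihilator N (?rot pi g')"
   using push[OF bo rotated_cap_interval[OF g] carr[OF x], of pi] x im_g by simp
  note x1c = carr[OF x1]
  have "x1 : alg_annihilator N (cap b')" if x1: "x1 : alg_annihilator N (?rot pi g')" for x1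
  proof -
   define x2 where "x2 = adj N N (U (rotation pi)) x1"
   have x2: "x2 : carr N" "U (rotation pi) x2 = x1"
    unfolding x2_def using un(4)[OF rotation_SU11 carr[OF x1]] op_carr[OF un(2)[OF rotation_SU11] carr[OF x1]] by auto
   have "x2 : alg_annihilator N (?rot 0 g')" using pull[OF x2(1) g'1, of pi 0] x2(2) x1 by simp
   then have "x2 : alg_annihilator N (?rot (- pi) b')" using positivity[OF _ b'1 g'1 \<open>g' < b'\<close>] by simp
   then show ?thesis using pull[OF x2(1) b'1, of pi "- pi"] x2(2) by simp
  qed
  then have "U (boost k) x : alg_annihilator N (moebius (boost k) ` cap b)" using x1 im_b by simp
  then show "x : alg_annihilator N (cap b)" using push[OF bo cap_int[OF b] carr[OF x]] by simp
 qed
 have same: "alg_annihilator N (cap b) <= alg_annihilator N (cap g)" if b: "\<bar>b\<bar> < 1" and g: "\<bar>g\<bar> < 1" for b g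
 proof
  fix x assume x: "x : alg_annihilator N (cap b)"
  have e: "?rot (pi + pi) c = cap c" for c by (simp add: cis_mult[symmetric])
  have "U (rotation pi) x : alg_annihilator N (?rot pi b)" using pull[OF carr[OF x] b, of pi 0] x by simp
  then have "U (rotation pi) x : alg_annihilator N (cap g)" using opposite[OF g b] by blast
  then have "U (rotation pi) x : alg_annihilator N (?rot (pi + pi) g)" using e by simp
  then have "x : alg_annihilator N (?rot pi g)" using pull[OF carr[OF x] g, of pi pi] by simp
  then show "x : alg_annihilator N (cap g)" using opposite[OF g g] by blast
 qed
 have sub: "alg_annihilator N (cap b) <= alg_annihilator N (?rot t c)" if b: "\<bar>b\<bar> < 1" and c: "\<bar>c\<bar> < 1" for b c t
 proof -
  define c' where "c' = (c - 1) / 2"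
  have c': "\<bar>c'\<bar> < 1" "c' < c" using c by (auto simp: c'_def)
  show ?thesis using same[OF b c'(1)] positivity[OF _ c c'] by blast
 qed
 have sup: "alg_annihilator N (?rot t c) <= alg_annihilator N (cap b)" if b: "\<bar>b\<bar> < 1" and c: "\<bar>c\<bar> < 1" for b c t
 proof
  fix x assume x: "x : alg_annihilator N (?rot t c)"
  have "U (rotation (- t)) x : alg_annihilator N (?rot 0 c)" using pull[OF carr[OF x] c, of "- t" t] x by simp
  then have "U (rotation (- t)) x : alg_annihilator N (?rot (- t) b)" using sub[OF c b, of "- t"] by auto
  then show "x : alg_annihilator N (cap b)" using pull[OF carr[OF x] b, of "- t" 0] by simp
 qed
 have "alg_annihilator N I' = alg_annihilator N (cap 0)" if I': "I' : intervals" for I'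
 proof -
  obtain t c where "\<bar>c\<bar> < 1" "I' = ?rot t c" using interval_rotated_cap[OF I'] by blast
  then show ?thesis using sub[of 0 c t] sup[of 0 c t] by auto
 qed
 then show ?thesis using I J by simp
qed

text \<open>The common annihilator is invariant under all local algebras, so the projection onto it is a
  scalar; as it kills the vacuum, it is zero.\<close>

theorem Reeh_Schlieder:
 assumes irr: "irreducible_moebius_net N" and I: "I \<in> intervals"
  and x: "x \<in> carr N" and orth: "!!S. S \<in> alg N I ==> hip N (S (Omega N)) x = 0"
 shows "x = hzero N"
proof -
 have N: "moebius_net N" using irr by (simp add: irreducible_moebius_net_def)
 note H = hilbert_space_complete[OF moebius_netD(1)[OF N]]
 let ?\<Omega> = "Omega N"
 note \<Omega> = moebius_netD(5)[OF N]
 note vn = von_neumann_algebraD[OF H moebius_netD(2)[OF N]]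
 have S\<Omega>: "S ?\<Omega> : carr N" if "J : intervals" "S : alg N J" for S J by (rule op_carr[OF vn(1)[OF that] \<Omega>])
 define A where "A = alg_annihilator N I"
 have A_eq: "A = alg_annihilator N J" if "J : intervals" for J
  unfolding A_def by (rule alg_annihilator_independent[OF N I that])
 have Ac: "a : carr N" if "a : A" for a using that by (simp add: A_def alg_annihilator_def)
 have A0: "hip N a (S ?\<Omega>) = 0" if "a : A" "S : alg N I" for a S using that by (simp add: A_def alg_annihilator_def)
 have AI: "a : A" if "a : carr N" "!!S. S : alg N I ==> hip N a (S ?\<Omega>) = 0" for a
  using that by (simp add: A_def alg_annihilator_def)
 have inv: "T a : A" if J: "J : intervals" and T: "T : alg N J" and a: "a : A" for J T a
 proof -
  note Tb = vn(1)[OF J T]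
  have "hip N (T a) (S ?\<Omega>) = 0" if S: "S : alg N J" for S
  proof -
   have "hip N (T a) (S ?\<Omega>) = hip N a (compose (carr N) (adj N N T) S ?\<Omega>)"
    using adj_right[OF H H Tb Ac[OF a] S\<Omega>[OF J S]] \<Omega> by (simp add: compose_eq)
   also have "... = 0"
    using a vn(7)[OF J vn(2)[OF J T] S] unfolding A_eq[OF J] alg_annihilator_def by blast
   finally show ?thesis .
  qed
  then show ?thesis unfolding A_eq[OF J] alg_annihilator_def using op_carr[OF Tb Ac[OF a]] by blast
 qed
 obtain P where P: "P : bdd_ops N N" "!!v. v : carr N ==> P v : A"
  "!!v a. v : carr N ==> a : A ==> hip N a (P v) = hip N a v"
 proof (rule projection_exists[OF H])
  show "A <= carr N" using Ac by blast
  show "hzero N : A" using H S\<Omega>[OF I] by (intro AI) auto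
  show "hadd N a b : A" if "a : A" "b : A" for a b
   using H S\<Omega>[OF I] that Ac A0 by (intro AI) auto
  show "hscale N c a : A" if "a : A" for a c
   using H S\<Omega>[OF I] that Ac A0 by (intro AI) auto
  fix X and v assume X: "!!n::nat. X n : A" and v: "v : carr N" and lim: "(\<lambda>n. hdist N (X n) v) \<longlonglongrightarrow> 0"
  show "v : A"
  proof (rule AI[OF v])
   fix S assume S: "S : alg N I"
   have "(\<lambda>n. hip N (X n) (S ?\<Omega>)) \<longlonglongrightarrow> hip N v (S ?\<Omega>)"
    by (rule hip_tendsto(2)[OF H Ac[OF X] v S\<Omega>[OF I S] lim])
   then show "hip N v (S ?\<Omega>) = 0" using A0[OF X S] LIMSEQ_unique[OF _ tendsto_const] by simp
  qed
 qed blast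
 note Pc = op_carr[OF P(1)]
 have A_ext: "a = b" if "a : A" "b : A" "!!d. d : A ==> hip N d a = hip N d b" for a b
 proof -
  have ab: "a : carr N" "b : carr N" using that Ac by auto
  have "hdiff N a b : A" using H S\<Omega>[OF I] that Ac A0 by (intro AI) auto
  then have "hip N (hdiff N a b) (hdiff N a b) = 0" using that(3)[of "hdiff N a b"] ab H Ac by simp
  then show ?thesis using hip_self_eq_0[OF H, of "hdiff N a b"] hdiff_eq_0[OF H ab] ab H by simp
 qed
 have comm: "S (P v) = P (S v)" if J: "J : intervals" and S: "S : alg N J" and v: "v : carr N" for J S v
 proof (rule A_ext[OF inv[OF J S P(2)[OF v]] P(2)[OF op_carr[OF vn(1)[OF J S] v]]])
  fix d assume d: "d : A"
  note Sb = vn(1)[OF J S]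
  have Sd: "adj N N S d : A" by (rule inv[OF J vn(2)[OF J S] d])
  have "hip N d (S (P v)) = hip N (adj N N S d) (P v)" using adj_left[OF H H Sb Pc[OF v] Ac[OF d]] by simp
  also have "... = hip N (adj N N S d) v" by (rule P(3)[OF v Sd])
  also have "... = hip N d (S v)" using adj_left[OF H H Sb v Ac[OF d]] by simp
  also have "... = hip N d (P (S v))" using P(3)[OF op_carr[OF Sb v] d] by simp
  finally show "hip N d (S (P v)) = hip N d (P (S v))" .
 qed
 have "P : commutant N (\<Union>I\<in>intervals. alg N I)"
  unfolding commutant_def using P(1) comm by (auto simp: compose_def restrict_def fun_eq_iff)
 then obtain c where c: "P = op_scale N N c (op_id N)"
  using irr unfolding irreducible_moebius_net_def by blast
 have P\<Omega>: "P ?\<Omega> = hzero N"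
 proof -
  have "hip N (P ?\<Omega>) ?\<Omega> = 0"
   using A0[OF P(2)[OF \<Omega>] vn(4)[OF I]] \<Omega> by (simp add: op_id_def)
  then have "hip N (P ?\<Omega>) (P ?\<Omega>) = 0" using P(3)[OF \<Omega> P(2)[OF \<Omega>]] by simp
  then show ?thesis by (rule hip_self_eq_0[OF H Pc[OF \<Omega>]])
 qed
 have "hnorm N (P ?\<Omega>) = cmod c" using c \<Omega> hnorm_scale[OF H \<Omega>] moebius_netD(6)[OF N] by (simp add: op_scale_def op_id_def)
 then have "c = 0" using P\<Omega> H by simp
 have xA: "x : A"
 proof (rule AI[OF x])
  fix S assume S: "S : alg N I"
  show "hip N x (S ?\<Omega>) = 0" using orth[OF S] hip_cnj[OF H S\<Omega>[OF I S] x] by simp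
 qed
 have "hip N x x = hip N x (P x)" using P(3)[OF x xA] by simp
 also have "... = 0" using H x by (simp add: c \<open>c = 0\<close> op_scale_def op_id_def)
 finally show ?thesis by (rule hip_self_eq_0[OF H x])
qed

section \<open>Modules of a Moebius net\<close>

lemma A_module_complete: "A_module N i ==> complete_ips i"
 by (simp add: A_module_def hilbert_space_complete)

lemma normal_repD:
 assumes "normal_rep H M K p"
 shows "p \<in> M \<rightarrow>\<^sub>E bdd_ops K K"
  and "S \<in> M ==> T \<in> M ==> p (op_add H H S T) = op_add K K (p S) (p T)"
  and "S \<in> M ==> p (op_scale H H c S) = op_scale K K c (p S)"
  and "S \<in> M ==> T \<in> M ==> p (compose (carr H) S T) = compose (carr K) (p S) (p T)"
  and "S \<in> M ==> p (adj H H S) = adj K K (p S)"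
  and "p (op_id H) = op_id K"
proof -
 have c: "p : M \<rightarrow>\<^sub>E bdd_ops K K"
  "ALL S:M. ALL T:M. p (op_add H H S T) = op_add K K (p S) (p T)"
  "ALL c. ALL S:M. p (op_scale H H c S) = op_scale K K c (p S)"
  "ALL S:M. ALL T:M. p (compose (carr H) S T) = compose (carr K) (p S) (p T)"
  "ALL S:M. p (adj H H S) = adj K K (p S)" "p (op_id H) = op_id K"
  by (insert assms[unfolded normal_rep_def]; elim conjE; assumption)+
 show "p : M \<rightarrow>\<^sub>E bdd_ops K K" by (rule c(1))
 show "S : M ==> T : M ==> p (op_add H H S T) = op_add K K (p S) (p T)" using c(2) by blast
 show "S : M ==> p (op_scale H H c S) = op_scale K K c (p S)" using c(3) by blast
 show "S : M ==> T : M ==> p (compose (carr H) S T) = compose (carr K) (p S) (p T)" using c(4) by blast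
 show "S : M ==> p (adj H H S) = adj K K (p S)" using c(5) by blast
 show "p (op_id H) = op_id K" by (rule c(6))
qed

lemma A_module_act:
 assumes i: "A_module N i" and I: "I \<in> intervals" and S: "S \<in> alg N I"
 shows "act i I S \<in> bdd_ops i i"
  and "act i I (adj N N S) = adj i i (act i I S)"
  and "J \<in> intervals ==> I \<subseteq> J ==> act i J S = act i I S"
proof -
 have n: "normal_rep N (alg N I) i (act i I)" using i I by (simp add: A_module_def)
 show "act i I S : bdd_ops i i" by (rule PiE_mem[OF normal_repD(1)[OF n] S])
 show "act i I (adj N N S) = adj i i (act i I S)" by (rule normal_repD(5)[OF n S])
 show "J : intervals ==> I <= J ==> act i J S = act i I S"
  using i I S unfolding A_module_def by blast
qed

lemma vac_simps [simp]:
 "carr (vac N) = carr N" "hzero (vac N) = hzero N" "hadd (vac N) = hadd N" "hscale (vac N) = hscale N"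
 "hip (vac N) = hip N" "hdiff (vac N) = hdiff N" "hnorm (vac N) = hnorm N"
 "bdd_ops (vac N) K = bdd_ops N K" "bdd_ops K (vac N) = bdd_ops K N"
 "adj (vac N) K T = adj N K T" "adj K (vac N) T = adj K N T"
 by (simp_all add: vac_def hdiff_def hnorm_def fun_eq_iff bdd_ops_def adj_def)

lemma vac_act: "S \<in> alg N I ==> act (vac N) I S = S"
 by (simp add: vac_def)

lemma complete_ips_vac [simp]: "complete_ips (vac N) = complete_ips N"
 by (simp only: complete_ips_def complex_inner_product_space_def vac_simps)

lemma hilbert_space_vac [simp]: "hilbert_space (vac N) = hilbert_space N"
 by (simp only: hilbert_space_def complex_inner_product_space_def hdense_def vac_simps)

lemma vac_A_module:
 assumes N: "moebius_net N"
 shows "A_module N (vac N)"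
proof -
 note H = hilbert_space_complete[OF moebius_netD(1)[OF N]]
 have "normal_rep N (alg N I) (vac N) (act (vac N) I)" if I: "I : intervals" for I
 proof -
  note vn = von_neumann_algebraD[OF H moebius_netD(2)[OF N I]]
  have eq: "act (vac N) I = (\<lambda>S\<in>alg N I. S)" by (simp add: vac_def)
  have ops: "op_add (vac N) (vac N) = op_add N N" "op_scale (vac N) (vac N) = op_scale N N"
   "op_id (vac N) = op_id N" "op_lub (vac N) = op_lub N"
   by (simp_all add: op_add_def op_scale_def op_id_def op_lub_def op_le_def self_adjoint_ops_def fun_eq_iff)
  have img: "(\<lambda>S\<in>alg N I. S) ` D = D" if "D <= alg N I \<inter> self_adjoint_ops N" for D using that by (auto simp: image_iff)
  show ?thesis
   unfolding normal_rep_def eq ops vac_simps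
  proof (intro conjI ballI allI impI)
   fix D X
   assume "D ~= {} & D <= alg N I \<inter> self_adjoint_ops N &
    (ALL S:D. ALL T:D. EX W:D. op_le N S W & op_le N T W) & X : alg N I & op_lub N D X"
   then show "op_lub N ((\<lambda>S\<in>alg N I. S) ` D) ((\<lambda>S\<in>alg N I. S) X)" using img[of D] by simp
  qed (insert vn, simp_all add: PiE_def)
 qed
 moreover have "act (vac N) J S = act (vac N) I S" if "I : intervals" "J : intervals" "I <= J" "S : alg N I" for I J S
  using that moebius_netD(3)[OF N that(1-3)] by (auto simp: vac_def)
 ultimately show ?thesis using moebius_netD(1)[OF N] unfolding A_module_def hilbert_space_vac by blast
qed

lemma Hom_loc_iff:
 assumes i: "A_module N i" and I: "I \<in> intervals"
 shows "T \<in> Hom_loc N I i j \<longleftrightarrow>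
  T \<in> bdd_ops i j \<and> (\<forall>S\<in>alg N I. \<forall>x\<in>carr i. T (act i I S x) = act j I S (T x))"
 by (auto simp: Hom_loc_def compose_def restrict_def fun_eq_iff) 

lemma Hom_A_iff: "T \<in> Hom_A N i j \<longleftrightarrow> T \<in> bdd_ops i j \<and> (\<forall>I\<in>intervals. T \<in> Hom_loc N I i j)"
 by (simp add: Hom_A_def)

lemma Hom_loc_bdd: "T \<in> Hom_loc N I i j ==> T \<in> bdd_ops i j"
 by (simp add: Hom_loc_def)

lemma Hom_A_bdd: "T \<in> Hom_A N i j ==> T \<in> bdd_ops i j"
 by (simp add: Hom_A_def)

lemma Hom_A_loc: "T \<in> Hom_A N i j ==> I \<in> intervals ==> T \<in> Hom_loc N I i j"
 by (simp add: Hom_A_def)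

lemma Hom_loc_act:
 assumes "A_module N i" "I \<in> intervals" "T \<in> Hom_loc N I i j" "S \<in> alg N I" "x \<in> carr i"
 shows "T (act i I S x) = act j I S (T x)"
 using assms Hom_loc_iff by blast

text \<open>All intertwiner spaces are instances of intertwiners of a family closed under adjoints.\<close>

lemma Hom_loc_intertwiners:
 assumes "A_module N i" "I \<in> intervals"
 shows "Hom_loc N I i j = intertwiners i j (alg N I) (act i I) (act j I)"
 using Hom_loc_iff[OF assms] by (auto simp: intertwiners_def)

lemma Hom_loc_adj:
 assumes N: "moebius_net N" and i: "A_module N i" and j: "A_module N j" and I: "I \<in> intervals"
  and T: "T \<in> Hom_loc N I i j"
 shows "adj i j T \<in> Hom_loc N I j i"
 unfolding Hom_loc_intertwiners[OF j I]
proof (rule intertwiners_adj[where star = "adj N N"])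
 show "adj N N S : alg N I" if "S : alg N I" for S
  using von_neumann_algebraD(2)[OF hilbert_space_complete[OF moebius_netD(1)[OF N]] moebius_netD(2)[OF N I] that] .
 show "T : intertwiners i j (alg N I) (act i I) (act j I)" using T Hom_loc_intertwiners[OF i I] by blast
qed (use A_module_complete[OF i] A_module_complete[OF j] A_module_act[OF i I] A_module_act[OF j I] in auto)

lemma Hom_A_adj:
 assumes "moebius_net N" "A_module N i" "A_module N j" "T \<in> Hom_A N i j"
 shows "adj i j T \<in> Hom_A N j i"
 using assms Hom_loc_adj[OF assms(1-3)] adj_bdd[OF A_module_complete[OF assms(2)] A_module_complete[OF assms(3)]]
 by (auto simp: Hom_A_iff)

lemma Hom_loc_compose:
 assumes i: "A_module N i" and j: "A_module N j" and k: "A_module N k" and I: "I \<in> intervals"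
  and T: "T \<in> Hom_loc N I i j" and S: "S \<in> Hom_loc N I j k"
 shows "compose (carr i) S T \<in> Hom_loc N I i k"
 unfolding Hom_loc_intertwiners[OF i I]
 by (rule intertwiners_compose[OF A_module_complete[OF i] A_module_complete[OF j] A_module_complete[OF k]
   A_module_act(1)[OF i I] T[unfolded Hom_loc_intertwiners[OF i I]] S[unfolded Hom_loc_intertwiners[OF j I]]])

lemma Hom_A_id:
 assumes i: "A_module N i"
 shows "op_id i \<in> Hom_A N i i"
proof -
 have "op_id i (act i I S x) = act i I S (op_id i x)" if "I : intervals" "S : alg N I" "x : carr i" for I S x
  using op_carr[OF A_module_act(1)[OF i that(1,2)] that(3)] that(3) by (simp add: op_id_def)
 then show ?thesis
  using op_id_bdd[OF A_module_complete[OF i]] by (simp add: Hom_A_iff Hom_loc_iff[OF i])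
qed

lemma Hom_loc_mono:
 assumes N: "moebius_net N" and i: "A_module N i" and j: "A_module N j" and I: "I \<in> intervals" "J \<in> intervals" "I \<subseteq> J"
  and T: "T \<in> Hom_loc N J i j"
 shows "T \<in> Hom_loc N I i j"
 using T moebius_netD(3)[OF N I] A_module_act(3)[OF i I(1) _ I(2,3)] A_module_act(3)[OF j I(1) _ I(2,3)]
 unfolding Hom_loc_iff[OF i I(1)] Hom_loc_iff[OF i I(2)] by (metis subsetD)

lemma bdd_vecsI: "T \<in> Hom_loc N (iopp I) (vac N) i ==> T (Omega N) \<in> bdd_vecs N i I"
 by (auto simp: bdd_vecs_def)

lemma bdd_vecsE:
 assumes "\<xi> \<in> bdd_vecs N i I"
 obtains T where "T \<in> Hom_loc N (iopp I) (vac N) i" "\<xi> = T (Omega N)"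
 using assms by (auto simp: bdd_vecs_def)

lemma bdd_vecs_carr:
 assumes "moebius_net N" "\<xi> \<in> bdd_vecs N i I"
 shows "\<xi> \<in> carr i"
proof -
 obtain T where T: "T : Hom_loc N (iopp I) (vac N) i" "\<xi> = T (Omega N)" using assms(2) by (rule bdd_vecsE)
 show ?thesis using op_carr[OF Hom_loc_bdd[OF T(1)]] moebius_netD(5)[OF assms(1)] by (simp add: T(2))
qed

lemma bdd_vecs_map:
 assumes N: "moebius_net N" and i: "A_module N i" and j: "A_module N j" and I: "I \<in> intervals"
  and T: "T \<in> Hom_loc N (iopp I) i j" and \<xi>: "\<xi> \<in> bdd_vecs N i I"
 shows "T \<xi> \<in> bdd_vecs N j I"
proof -
 obtain S where S: "S : Hom_loc N (iopp I) (vac N) i" "\<xi> = S (Omega N)" using \<xi> by (rule bdd_vecsE)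
 have "compose (carr (vac N)) T S : Hom_loc N (iopp I) (vac N) j"
  by (rule Hom_loc_compose[OF vac_A_module[OF N] i j iopp_in_intervals[OF I] S(1) T])
 then have "compose (carr (vac N)) T S (Omega N) : bdd_vecs N j I" by (rule bdd_vecsI)
 then show ?thesis using S(2) moebius_netD(5)[OF N] by (simp add: compose_eq)
qed

lemma bdd_vecs_subspace:
 assumes N: "moebius_net N" and i: "A_module N i" and I: "I \<in> intervals"
 shows "hzero i \<in> bdd_vecs N i I"
  and "\<xi> \<in> bdd_vecs N i I ==> \<eta> \<in> bdd_vecs N i I ==> hadd i \<xi> \<eta> \<in> bdd_vecs N i I"
  and "\<xi> \<in> bdd_vecs N i I ==> hscale i c \<xi> \<in> bdd_vecs N i I"
proof -
 note v = vac_A_module[OF N] and I' = iopp_in_intervals[OF I] and \<Omega> = moebius_netD(5)[OF N]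
 note lin = intertwiners_linear[where S = "alg N (iopp I)" and \<rho> = "act (vac N) (iopp I)" and \<sigma> = "act i (iopp I)",
   OF A_module_complete[OF v] A_module_complete[OF i] A_module_act(1)[OF v I'] A_module_act(1)[OF i I'],
   folded Hom_loc_intertwiners[OF v I']]
 show "hzero i : bdd_vecs N i I"
  using bdd_vecsI[OF lin(1)] \<Omega> by (simp add: op_zero_def)
 show "hadd i \<xi> \<eta> : bdd_vecs N i I" if \<xi>: "\<xi> : bdd_vecs N i I" and \<eta>: "\<eta> : bdd_vecs N i I"
 proof -
  obtain S where S: "S : Hom_loc N (iopp I) (vac N) i" "\<xi> = S (Omega N)" using \<xi> by (rule bdd_vecsE)
  obtain T where T: "T : Hom_loc N (iopp I) (vac N) i" "\<eta> = T (Omega N)" using \<eta> by (rule bdd_vecsE)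
  show ?thesis using bdd_vecsI[OF lin(3)[OF _ _ S(1) T(1)]] \<Omega> by (simp add: op_add_def S(2) T(2))
 qed
 show "hscale i c \<xi> : bdd_vecs N i I" if \<xi>: "\<xi> : bdd_vecs N i I"
 proof -
  obtain S where S: "S : Hom_loc N (iopp I) (vac N) i" "\<xi> = S (Omega N)" using \<xi> by (rule bdd_vecsE)
  show ?thesis using bdd_vecsI[OF lin(2)[OF _ _ S(1), of c]] \<Omega> by (simp add: op_scale_def S(2))
 qed
qed

lemma alg_bdd_vec:
 assumes N: "moebius_net N" and I: "I \<in> intervals" and S: "S \<in> alg N I"
 shows "S \<in> Hom_loc N (iopp I) (vac N) (vac N)" and "S (Omega N) \<in> bdd_vecs N (vac N) I"
proof -
 note H = hilbert_space_complete[OF moebius_netD(1)[OF N]]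
 note vn = von_neumann_algebraD[OF H moebius_netD(2)[OF N]]
 have "S (T x) = T (S x)" if T: "T : alg N (iopp I)" and x: "x : carr N" for T x
  using moebius_netD(4)[OF N I iopp_in_intervals[OF I] iopp_disjoint S T] x by (metis compose_eq)
 then show *: "S : Hom_loc N (iopp I) (vac N) (vac N)"
  unfolding Hom_loc_iff[OF vac_A_module[OF N] iopp_in_intervals[OF I]]
  using vn(1)[OF I S] by (simp add: vac_act)
 show "S (Omega N) : bdd_vecs N (vac N) I" by (rule bdd_vecsI[OF *])
qed

text \<open>The vacuum is cyclic for the local algebra by the Reeh-Schlieder property.\<close>

lemma Hom_loc_vacuum_separating:
 assumes irr: "irreducible_moebius_net N" and i: "A_module N i" and I: "I \<in> intervals"
  and S: "S \<in> Hom_loc N I (vac N) i" and T: "T \<in> Hom_loc N I (vac N) i" and eq: "S (Omega N) = T (Omega N)"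
 shows "S = T"
proof -
 have N: "moebius_net N" using irr by (simp add: irreducible_moebius_net_def)
 note v = vac_A_module[OF N] and \<Omega> = moebius_netD(5)[OF N]
 note H = hilbert_space_complete[OF moebius_netD(1)[OF N]]
 note vn = von_neumann_algebraD[OF H moebius_netD(2)[OF N I]]
 have Sb: "S : bdd_ops N i" and Tb: "T : bdd_ops N i" using Hom_loc_bdd[OF S] Hom_loc_bdd[OF T] by auto
 let ?D = "{X (Omega N) |X. X : alg N I}"
 have "hdense N ?D"
 proof (rule hdense_of_total_subspace[OF H])
  show "?D <= carr N" using op_carr[OF vn(1) \<Omega>] by auto
  have "op_scale N N 0 (op_id N) (Omega N) : ?D" using vn(4,6) by blast
  moreover have "op_scale N N 0 (op_id N) (Omega N) = hzero N"
   using H \<Omega> by (intro hip_ext[OF H]) (auto simp: op_scale_def op_id_def)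
  ultimately show "hzero N : ?D" by simp
  show "hadd N x y : ?D" if xy: "x : ?D" "y : ?D" for x y
  proof -
   obtain X Y where X: "X : alg N I" "x = X (Omega N)" "Y : alg N I" "y = Y (Omega N)" using xy by blast
   then show ?thesis using vn(5)[OF X(1,3)] \<Omega> by (auto simp: op_add_def intro!: exI[of _ "op_add N N X Y"])
  qed
  show "hscale N c x : ?D" if x: "x : ?D" for x c
  proof -
   obtain X where X: "X : alg N I" "x = X (Omega N)" using x by blast
   then show ?thesis using vn(6)[OF X(1)] \<Omega> by (auto simp: op_scale_def intro!: exI[of _ "op_scale N N c X"])
  qed
  show "x = hzero N" if "x : carr N" "!!d. d : ?D ==> hip N d x = 0" for x
   by (rule Reeh_Schlieder[OF irr I that(1)]) (use that(2) in blast)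
 qed
 then show ?thesis
 proof (rule op_eq_on_dense[OF H A_module_complete[OF i] Sb Tb])
  fix x assume "x : ?D"
  then obtain X where X: "X : alg N I" "x = X (Omega N)" by blast
  show "S x = T x"
   using Hom_loc_act[OF v I S X(1)] Hom_loc_act[OF v I T X(1)] \<Omega> eq X by (simp add: vac_act)
 qed
qed

section \<open>Calculus of the categorical extension\<close>

locale moebius_extension =
 fixes N :: "'v net" and E :: "'v cat_ext"
 assumes irr: "irreducible_moebius_net N" and ext: "categorical_extension N E"
begin

abbreviation fusion (infixl "\<otimes>" 70) where "i \<otimes> j \<equiv> i \<boxtimes>\<^bsub>E\<^esub> j"
abbreviation \<H> where "\<H> i I \<equiv> bdd_vecs N i (fst I)"

lemma N: "moebius_net N" using irr by (simp add: irreducible_moebius_net_def)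

lemmas \<Omega> = moebius_netD(5)[OF N]
lemmas H0 = hilbert_space_complete[OF moebius_netD(1)[OF N]]
lemmas vac_mod = vac_A_module[OF N]
lemmas cmp = A_module_complete[of N]

lemma ext_parts:
 "tensor_bifunctor N E" "associativity_constraints N E" "unit_constraints N E"
 "ext_operators N E" "ext_isotony N E" "ext_functoriality N E"
 "ext_state_field N E" "ext_density N E" "ext_locality N E"
 using ext by (simp_all add: categorical_extension_def braided_cstar_tensor_def)

lemma tens_mod:
 assumes "A_module N i" "A_module N j"
 shows "A_module N (i \<otimes> j)"
proof -
 have "ALL i j. A_module N i & A_module N j \<longrightarrow> A_module N (i \<otimes> j) & tmap E i i j j (op_id i) (op_id j) = op_id (i \<otimes> j)"
  by (insert ext_parts(1)[unfolded tensor_bifunctor_def]; elim conjE; assumption)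
 then show ?thesis using assms by blast
qed

lemma tmap_Hom:
 assumes "A_module N i" "A_module N i'" "A_module N j" "A_module N j'" "F \<in> Hom_A N i i'" "G \<in> Hom_A N j j'"
 shows "tmap E i i' j j' F G \<in> Hom_A N (i \<otimes> j) (i' \<otimes> j')"
  and "adj (i \<otimes> j) (i' \<otimes> j') (tmap E i i' j j' F G) = tmap E i' i j' j (adj i i' F) (adj j j' G)"
proof -
 have "ALL i i' j j'. A_module N i & A_module N i' & A_module N j & A_module N j' \<longrightarrow>
    (ALL F:Hom_A N i i'. ALL G:Hom_A N j j'.
     tmap E i i' j j' F G : Hom_A N (i \<otimes> j) (i' \<otimes> j') &
     adj (i \<otimes> j) (i' \<otimes> j') (tmap E i i' j j' F G)
      = tmap E i' i j' j (adj i i' F) (adj j j' G))"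
  using ext_parts(1) unfolding tensor_bifunctor_def by blast
 then show "tmap E i i' j j' F G : Hom_A N (i \<otimes> j) (i' \<otimes> j')"
  and "adj (i \<otimes> j) (i' \<otimes> j') (tmap E i i' j j' F G) = tmap E i' i j' j (adj i i' F) (adj j j' G)"
  using assms by blast+
qed

lemma lwhisk_Hom:
 assumes "A_module N i" "A_module N j" "A_module N j'" "G \<in> Hom_A N j j'"
 shows "lwhisk E i j j' G \<in> Hom_A N (i \<otimes> j) (i \<otimes> j')"
  and "adj (i \<otimes> j) (i \<otimes> j') (lwhisk E i j j' G) = lwhisk E i j' j (adj j j' G)"
 unfolding lwhisk_def
 using tmap_Hom[OF assms(1,1,2,3) Hom_A_id[OF assms(1)] assms(4)] adj_id[OF cmp[OF assms(1)]] by simp_all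

lemma rwhisk_Hom:
 assumes "A_module N i" "A_module N i'" "A_module N j" "F \<in> Hom_A N i i'"
 shows "rwhisk E i i' F j \<in> Hom_A N (i \<otimes> j) (i' \<otimes> j)"
  and "adj (i \<otimes> j) (i' \<otimes> j) (rwhisk E i i' F j) = rwhisk E i' i (adj i i' F) j"
 unfolding rwhisk_def
 using tmap_Hom[OF assms(1,2,3,3) assms(4) Hom_A_id[OF assms(3)]] adj_id[OF cmp[OF assms(3)]] by simp_all

lemma assoc_Hom:
 assumes "A_module N i" "A_module N j" "A_module N k"
 shows "assoc E i j k \<in> Hom_A N ((i \<otimes> j) \<otimes> k) (i \<otimes> (j \<otimes> k))"
  and "unitary_op ((i \<otimes> j) \<otimes> k) (i \<otimes> (j \<otimes> k)) (assoc E i j k)"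
proof -
 have "ALL i j k. A_module N i & A_module N j & A_module N k \<longrightarrow>
    assoc E i j k : Hom_A N ((i \<otimes> j) \<otimes> k) (i \<otimes> (j \<otimes> k)) &
    unitary_op ((i \<otimes> j) \<otimes> k) (i \<otimes> (j \<otimes> k)) (assoc E i j k)"
  by (insert ext_parts(2)[unfolded associativity_constraints_def]; elim conjE; assumption)
 then show "assoc E i j k : Hom_A N ((i \<otimes> j) \<otimes> k) (i \<otimes> (j \<otimes> k))"
  and "unitary_op ((i \<otimes> j) \<otimes> k) (i \<otimes> (j \<otimes> k)) (assoc E i j k)"
  using assms by blast+
qed

lemma unit_Hom:
 assumes "A_module N i"
 shows "lunit E i \<in> Hom_A N (vac N \<otimes> i) i" "unitary_op (vac N \<otimes> i) i (lunit E i)"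
  and "runit E i \<in> Hom_A N (i \<otimes> vac N) i" "unitary_op (i \<otimes> vac N) i (runit E i)"
proof -
 have "ALL i. A_module N i \<longrightarrow>
    lunit E i : Hom_A N (vac N \<otimes> i) i & unitary_op (vac N \<otimes> i) i (lunit E i) &
    runit E i : Hom_A N (i \<otimes> vac N) i & unitary_op (i \<otimes> vac N) i (runit E i)"
  by (insert ext_parts(3)[unfolded unit_constraints_def]; elim conjE; assumption)
 then show "lunit E i : Hom_A N (vac N \<otimes> i) i" "unitary_op (vac N \<otimes> i) i (lunit E i)"
  and "runit E i : Hom_A N (i \<otimes> vac N) i" "unitary_op (i \<otimes> vac N) i (runit E i)"
  using assms by blast+
qed

lemma triangle:
 assumes i: "A_module N i" and j: "A_module N j" and v: "v \<in> carr ((i \<otimes> vac N) \<otimes> j)"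
 shows "lwhisk E i (vac N \<otimes> j) j (lunit E j) (assoc E i (vac N) j v) = rwhisk E (i \<otimes> vac N) i (runit E i) j v"
proof -
 have "ALL i j. A_module N i & A_module N j \<longrightarrow>
    compose (carr ((i \<otimes> vac N) \<otimes> j))
      (lwhisk E i (vac N \<otimes> j) j (lunit E j)) (assoc E i (vac N) j)
     = rwhisk E (i \<otimes> vac N) i (runit E i) j"
  by (insert ext_parts(3)[unfolded unit_constraints_def]; elim conjE; assumption)
 then have "compose (carr ((i \<otimes> vac N) \<otimes> j)) (lwhisk E i (vac N \<otimes> j) j (lunit E j)) (assoc E i (vac N) j) v
   = rwhisk E (i \<otimes> vac N) i (runit E i) j v" using i j by simp
 then show ?thesis using v by (simp add: compose_eq)
qed

lemma LR_loc:
 assumes "A_module N i" "A_module N k" "I \<in> \<J>" "\<xi> \<in> \<H> i I"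
 shows "Lop E i k \<xi> I \<in> Hom_loc N (iopp (fst I)) k (i \<otimes> k)"
  and "Rop E i k \<xi> I \<in> Hom_loc N (iopp (fst I)) k (k \<otimes> i)"
 using ext_parts(4) assms unfolding ext_operators_def by blast+

lemmas L_bdd = Hom_loc_bdd[OF LR_loc(1)]
lemmas R_bdd = Hom_loc_bdd[OF LR_loc(2)]

lemma isotony:
 assumes "A_module N i" "A_module N k" "I \<in> \<J>" "J \<in> \<J>" "arg_sub I J" "\<xi> \<in> \<H> i I"
 shows "Lop E i k \<xi> J = Lop E i k \<xi> I"
 using ext_parts(5) assms unfolding ext_isotony_def by blast

lemma L_natural:
 assumes "A_module N i" "A_module N k" "A_module N k'" "G \<in> Hom_A N k k'" "I \<in> \<J>"
  "\<xi> \<in> \<H> i I" "\<eta> \<in> carr k"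
 shows "lwhisk E i k k' G (Lop E i k \<xi> I \<eta>) = Lop E i k' \<xi> I (G \<eta>)"
  and "rwhisk E k k' G i (Rop E i k \<xi> I \<eta>) = Rop E i k' \<xi> I (G \<eta>)"
 using ext_parts(6) assms unfolding ext_functoriality_def by blast+

lemma state_field:
 assumes "A_module N i" "I \<in> \<J>" "\<xi> \<in> \<H> i I"
 shows "runit E i (Lop E i (vac N) \<xi> I (Omega N)) = \<xi>"
  and "lunit E i (Rop E i (vac N) \<xi> I (Omega N)) = \<xi>"
 using ext_parts(7) assms unfolding ext_state_field_def by blast+

lemma L_dense:
 assumes "A_module N i" "A_module N k" "I \<in> \<J>"
 shows "hdense (i \<otimes> k) (hspan (i \<otimes> k) {Lop E i k \<xi> I \<eta> |\<xi> \<eta>. \<xi> \<in> \<H> i I \<and> \<eta> \<in> carr k})"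
 using ext_parts(8) assms unfolding ext_density_def by blast

lemma locality:
 assumes m: "A_module N i" "A_module N j" "A_module N k" and IJ: "I \<in> \<J>" "J \<in> \<J>" "clockwise_to J I"
  and v: "\<xi> \<in> \<H> i I" "\<eta> \<in> \<H> j J"
 shows "\<psi> \<in> carr k ==> assoc E i k j (Rop E j (i \<otimes> k) \<eta> J (Lop E i k \<xi> I \<psi>)) = Lop E i (k \<otimes> j) \<xi> I (Rop E j k \<eta> J \<psi>)"
  and "\<zeta> \<in> carr (i \<otimes> k) ==> Rop E j k \<eta> J (adj k (i \<otimes> k) (Lop E i k \<xi> I) \<zeta>)
   = adj (k \<otimes> j) (i \<otimes> (k \<otimes> j)) (Lop E i (k \<otimes> j) \<xi> I) (assoc E i k j (Rop E j (i \<otimes> k) \<eta> J \<zeta>))"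
proof -
 have c: "commutes_adjointly k (k \<otimes> j) (i \<otimes> k) (i \<otimes> (k \<otimes> j))
        (Rop E j k \<eta> J) (Lop E i k \<xi> I) (Lop E i (k \<otimes> j) \<xi> I)
        (compose (carr (i \<otimes> k)) (assoc E i k j) (Rop E j (i \<otimes> k) \<eta> J))"
  using ext_parts(9) assms unfolding ext_locality_def by blast
 have Lc: "Lop E i k \<xi> I \<psi> : carr (i \<otimes> k)" if "\<psi> : carr k" for \<psi>
  by (rule op_carr[OF L_bdd[OF m(1,3) IJ(1) v(1)] that])
 show "assoc E i k j (Rop E j (i \<otimes> k) \<eta> J (Lop E i k \<xi> I \<psi>)) = Lop E i (k \<otimes> j) \<xi> I (Rop E j k \<eta> J \<psi>)" if \<psi>: "\<psi> : carr k"
  using fun_cong[OF conjunct1[OF c[unfolded commutes_adjointly_def]], of \<psi>] \<psi> Lc[OF \<psi>] by (simp add: compose_eq)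
 show "Rop E j k \<eta> J (adj k (i \<otimes> k) (Lop E i k \<xi> I) \<zeta>)
   = adj (k \<otimes> j) (i \<otimes> (k \<otimes> j)) (Lop E i (k \<otimes> j) \<xi> I) (assoc E i k j (Rop E j (i \<otimes> k) \<eta> J \<zeta>))" if \<zeta>: "\<zeta> : carr (i \<otimes> k)"
  using fun_cong[OF conjunct2[OF c[unfolded commutes_adjointly_def]], of \<zeta>] \<zeta> by (simp add: compose_eq)
qed

lemma unitary_D:
 assumes i: "A_module N i" and j: "A_module N j" and U: "unitary_op i j T"
 shows "x \<in> carr i ==> adj i j T (T x) = x" "y \<in> carr j ==> T (adj i j T y) = y"
proof -
 show "adj i j T (T x) = x" if "x : carr i"
 proof -
  have "compose (carr i) (adj i j T) T x = op_id i x" using U by (simp add: unitary_op_def)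
  then show ?thesis using that by (simp add: compose_eq op_id_def)
 qed
 show "T (adj i j T y) = y" if "y : carr j"
 proof -
  have "compose (carr j) T (adj i j T) y = op_id j y" using U by (simp add: unitary_op_def)
  then show ?thesis using that by (simp add: compose_eq op_id_def)
 qed
qed

lemma op_eq_on_L:
 assumes m: "A_module N i" "A_module N k" "complete_ips K" and I: "I \<in> \<J>"
  and ST: "S \<in> bdd_ops (i \<otimes> k) K" "T \<in> bdd_ops (i \<otimes> k) K"
  and eq: "!!\<xi> \<eta>. \<xi> \<in> \<H> i I ==> \<eta> \<in> carr k ==> S (Lop E i k \<xi> I \<eta>) = T (Lop E i k \<xi> I \<eta>)"
 shows "S = T"
proof (rule op_eq_on_total[OF cmp[OF tens_mod[OF m(1,2)]] m(3) ST L_dense[OF m(1,2) I]])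
 show "{Lop E i k \<xi> I \<eta> |\<xi> \<eta>. \<xi> : \<H> i I & \<eta> : carr k} <= carr (i \<otimes> k)"
  using op_carr[OF L_bdd[OF m(1,2) I]] by auto
qed (use eq in auto)

lemma vec_eq_on_L:
 assumes m: "A_module N i" "A_module N k" and I: "I \<in> \<J>"
  and uv: "u \<in> carr (i \<otimes> k)" "v \<in> carr (i \<otimes> k)"
  and eq: "!!\<xi> \<eta>. \<xi> \<in> \<H> i I ==> \<eta> \<in> carr k ==>
   hip (i \<otimes> k) (Lop E i k \<xi> I \<eta>) u = hip (i \<otimes> k) (Lop E i k \<xi> I \<eta>) v"
 shows "u = v"
proof -
 note K = cmp[OF tens_mod[OF m]]
 let ?D = "{Lop E i k \<xi> I \<eta> |\<xi> \<eta>. \<xi> : \<H> i I & \<eta> : carr k}"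
 have D: "?D <= carr (i \<otimes> k)" using op_carr[OF L_bdd[OF m I]] by auto
 have d: "hdiff (i \<otimes> k) u v : carr (i \<otimes> k)" using K uv by simp
 have o: "hip (i \<otimes> k) w (hdiff (i \<otimes> k) u v) = 0" if w: "w : ?D" for w
 proof -
  obtain \<xi> \<eta> where e: "w = Lop E i k \<xi> I \<eta>" "\<xi> : \<H> i I" "\<eta> : carr k" using w by blast
  have "w : carr (i \<otimes> k)" using D w by blast
  then show ?thesis using eq[OF e(2,3)] K uv by (simp add: e(1)[symmetric])
 qed
 have "hdiff (i \<otimes> k) u v = hzero (i \<otimes> k)"
  by (rule orthogonal_to_dense[OF K L_dense[OF m I] d orthogonal_to_hspan[OF K D d o]])
 then show ?thesis by (rule hdiff_eq_0[OF K uv])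
qed

text \<open>Bounded vectors are dense: \<open>L \<xi> I\<close> maps \<open>A(I) \<Omega>\<close> to bounded vectors, and \<open>A(I) \<Omega>\<close> is dense by
  the Reeh-Schlieder property.\<close>

lemma bdd_vecs_dense:
 assumes k: "A_module N k" and I: "I \<in> \<J>"
 shows "hdense k (\<H> k I)"
proof -
 note K = cmp[OF k] and fI = fst_arg_interval[OF I]
 note sub = bdd_vecs_subspace[OF N k fI]
 note kv = tens_mod[OF k vac_mod]
 note run = unit_Hom(3,4)[OF k]
 show ?thesis
 proof (rule hdense_of_total_subspace[OF K _ sub(1,2,3)])
  show "\<H> k I <= carr k" using bdd_vecs_carr[OF N] by blast
  fix x assume x: "x : carr k" and orth: "!!d. d : \<H> k I ==> hip k d x = 0"
  define u where "u = adj (k \<otimes> vac N) k (runit E k) x"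
  have u: "u : carr (k \<otimes> vac N)"
   unfolding u_def by (rule op_carr[OF adj_bdd[OF cmp[OF kv] K Hom_A_bdd[OF run(1)]] x])
  have "u = hzero (k \<otimes> vac N)"
  proof (rule vec_eq_on_L[OF k vac_mod I u])
   show "hzero (k \<otimes> vac N) : carr (k \<otimes> vac N)" using cmp[OF kv] by simp
   fix \<xi> \<eta> assume \<xi>: "\<xi> : \<H> k I" and \<eta>: "\<eta> : carr (vac N)"
   note Lb = L_bdd[OF k vac_mod I \<xi>]
   note Lc = op_carr[OF Lb]
   have Lb': "Lop E k (vac N) \<xi> I : bdd_ops N (k \<otimes> vac N)" using Lb by simp
   define w where "w = adj N (k \<otimes> vac N) (Lop E k (vac N) \<xi> I) u"
   have w: "w : carr N" unfolding w_def by (rule op_carr[OF adj_bdd[OF H0 cmp[OF kv] Lb'] u])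
   have "w = hzero N"
   proof (rule Reeh_Schlieder[OF irr fI w])
    fix S assume S: "S : alg N (fst I)"
    note SL = alg_bdd_vec[OF N fI S]
    have S\<Omega>: "S (Omega N) : carr N" using bdd_vecs_carr[OF N SL(2)] by simp
    have "compose (carr (vac N)) (Lop E k (vac N) \<xi> I) S : Hom_loc N (iopp (fst I)) (vac N) (k \<otimes> vac N)"
     by (rule Hom_loc_compose[OF vac_mod vac_mod kv iopp_in_intervals[OF fI] SL(1) LR_loc(1)[OF k vac_mod I \<xi>]])
    then have "compose (carr (vac N)) (runit E k) (compose (carr (vac N)) (Lop E k (vac N) \<xi> I) S) : Hom_loc N (iopp (fst I)) (vac N) k"
     by (rule Hom_loc_compose[OF vac_mod kv k iopp_in_intervals[OF fI] _ Hom_A_loc[OF run(1) iopp_in_intervals[OF fI]]])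
    from bdd_vecsI[OF this] have "runit E k (Lop E k (vac N) \<xi> I (S (Omega N))) : \<H> k I"
     using \<Omega> by (simp add: compose_eq)
    then have "0 = hip k (runit E k (Lop E k (vac N) \<xi> I (S (Omega N)))) x" using orth by simp
    also have "... = hip (k \<otimes> vac N) (Lop E k (vac N) \<xi> I (S (Omega N))) u"
     unfolding u_def using adj_right[OF cmp[OF kv] K Hom_A_bdd[OF run(1)] _ x] Lc S\<Omega> by simp
    also have "... = hip N (S (Omega N)) w"
     unfolding w_def using adj_right[OF H0 cmp[OF kv] Lb' S\<Omega> u] by simp
    finally show "hip N (S (Omega N)) w = 0" by simp
   qed
   then have "hip (k \<otimes> vac N) (Lop E k (vac N) \<xi> I \<eta>) u = 0"
    using adj_right[OF H0 cmp[OF kv] Lb' _ u, of \<eta>] \<eta> H0 by (simp add: w_def)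
   then show "hip (k \<otimes> vac N) (Lop E k (vac N) \<xi> I \<eta>) u = hip (k \<otimes> vac N) (Lop E k (vac N) \<xi> I \<eta>) (hzero (k \<otimes> vac N))"
    using cmp[OF kv] Lc[OF \<eta>] by simp
  qed
  then have "runit E k u = hzero k" using bdd_ops_zero[OF cmp[OF kv] K Hom_A_bdd[OF run(1)]] by simp
  then show "x = hzero k" unfolding u_def using unitary_D(2)[OF kv k run(2) x] by simp
 qed
qed

text \<open>Left and right operators are exchanged on bounded vectors of complementary intervals: this is
  locality on the vacuum, read through the unitors.\<close>

lemma L_R_exchange:
 assumes m: "A_module N i" "A_module N k" and IJ: "I \<in> \<J>" "J \<in> \<J>" "clockwise_to J I"
  and \<xi>: "\<xi> \<in> \<H> i I" and \<psi>: "\<psi> \<in> \<H> k J"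
 shows "Lop E i k \<xi> I \<psi> = Rop E k i \<psi> J \<xi>"
proof -
 note iv = tens_mod[OF m(1) vac_mod] and vk = tens_mod[OF vac_mod m(2)]
 have \<Omega>v: "Omega N : carr (vac N)" using \<Omega> by simp
 note L\<Omega> = op_carr[OF L_bdd[OF m(1) vac_mod IJ(1) \<xi>] \<Omega>v]
 note R\<Omega> = op_carr[OF R_bdd[OF m(2) vac_mod IJ(2) \<psi>] \<Omega>v]
 note RL\<Omega> = op_carr[OF R_bdd[OF m(2) iv IJ(2) \<psi>] L\<Omega>]
 have "Lop E i k \<xi> I \<psi> = Lop E i k \<xi> I (lunit E k (Rop E k (vac N) \<psi> J (Omega N)))"
  using state_field(2)[OF m(2) IJ(2) \<psi>] by simp
 also have "... = lwhisk E i (vac N \<otimes> k) k (lunit E k) (Lop E i (vac N \<otimes> k) \<xi> I (Rop E k (vac N) \<psi> J (Omega N)))"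
  using L_natural(1)[OF m(1) vk m(2) unit_Hom(1)[OF m(2)] IJ(1) \<xi> R\<Omega>] by simp
 also have "Lop E i (vac N \<otimes> k) \<xi> I (Rop E k (vac N) \<psi> J (Omega N))
   = assoc E i (vac N) k (Rop E k (i \<otimes> vac N) \<psi> J (Lop E i (vac N) \<xi> I (Omega N)))"
  using locality(1)[OF m vac_mod IJ \<xi> \<psi> \<Omega>v] by simp
 also have "lwhisk E i (vac N \<otimes> k) k (lunit E k) ...
   = rwhisk E (i \<otimes> vac N) i (runit E i) k (Rop E k (i \<otimes> vac N) \<psi> J (Lop E i (vac N) \<xi> I (Omega N)))"
  by (rule triangle[OF m RL\<Omega>])
 also have "... = Rop E k i \<psi> J (runit E i (Lop E i (vac N) \<xi> I (Omega N)))"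
  by (rule L_natural(2)[OF m(2) iv m(1) unit_Hom(3)[OF m(1)] IJ(2) \<psi> L\<Omega>])
 also have "... = Rop E k i \<psi> J \<xi>" using state_field(1)[OF m(1) IJ(1) \<xi>] by simp
 finally show ?thesis .
qed

text \<open>Hence an identity between operators on \<open>k\<close> may be tested on bounded vectors of the
  complementary interval, where \<open>L\<close> turns into \<open>R\<close>.\<close>

lemma op_eq_on_complement:
 assumes k: "A_module N k" and K: "complete_ips K" and I: "I \<in> \<J>"
  and ST: "S \<in> bdd_ops k K" "T \<in> bdd_ops k K"
  and eq: "!!J \<psi>. J \<in> \<J> ==> clockwise_to J I ==> fst J = iopp (fst I) ==> \<psi> \<in> \<H> k J ==>
   \<psi> \<in> carr k ==> S \<psi> = T \<psi>"
 shows "S = T"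
proof -
 obtain J where J: "J : \<J>" "clockwise_to J I" "fst J = iopp (fst I)"
  by (rule clockwise_complement_exists[OF I])
 show ?thesis
  by (rule op_eq_on_dense[OF cmp[OF k] K ST bdd_vecs_dense[OF k J(1)]])
   (use eq[OF J] bdd_vecs_carr[OF N] in blast)
qed

text \<open>The remaining identities for \<open>L\<close> are checked on bounded vectors of the complementary interval,
  where \<open>L(\<xi>) \<psi> = R(\<psi>) \<xi>\<close> shows the dependence on \<open>\<xi>\<close> and \<open>R\<close> commutes with \<open>L\<close> and \<open>L\<^sup>*\<close>.\<close>

lemma L_linear:
 assumes m: "A_module N i" "A_module N k" and I: "I \<in> \<J>"
  and v: "\<xi> \<in> \<H> i I" "\<eta> \<in> \<H> i I"
 shows "Lop E i k (hadd i \<xi> \<eta>) I = op_add k (i \<otimes> k) (Lop E i k \<xi> I) (Lop E i k \<eta> I)"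
  and "Lop E i k (hscale i c \<xi>) I = op_scale k (i \<otimes> k) c (Lop E i k \<xi> I)"
proof -
 note t = tens_mod[OF m] and sub = bdd_vecs_subspace[OF N m(1) fst_arg_interval[OF I]]
 note vc = bdd_vecs_carr[OF N v(1)] bdd_vecs_carr[OF N v(2)]
 show "Lop E i k (hadd i \<xi> \<eta>) I = op_add k (i \<otimes> k) (Lop E i k \<xi> I) (Lop E i k \<eta> I)"
 proof (rule op_eq_on_complement[OF m(2) cmp[OF t] I])
  show "Lop E i k (hadd i \<xi> \<eta>) I : bdd_ops k (i \<otimes> k)" by (rule L_bdd[OF m I sub(2)[OF v]])
  show "op_add k (i \<otimes> k) (Lop E i k \<xi> I) (Lop E i k \<eta> I) : bdd_ops k (i \<otimes> k)"
   by (rule op_add_bdd[OF cmp[OF m(2)] cmp[OF t] L_bdd[OF m I v(1)] L_bdd[OF m I v(2)]])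
  fix J \<psi> assume J: "J : \<J>" "clockwise_to J I" and \<psi>: "\<psi> : \<H> k J" "\<psi> : carr k"
  show "Lop E i k (hadd i \<xi> \<eta>) I \<psi> = op_add k (i \<otimes> k) (Lop E i k \<xi> I) (Lop E i k \<eta> I) \<psi>"
   using L_R_exchange[OF m I J _ \<psi>(1)] sub(2)[OF v] v bdd_opsD(3)[OF R_bdd[OF m(2,1) J(1) \<psi>(1)] vc] \<psi>(2)
   by (simp add: op_add_def)
 qed
 show "Lop E i k (hscale i c \<xi>) I = op_scale k (i \<otimes> k) c (Lop E i k \<xi> I)"
 proof (rule op_eq_on_complement[OF m(2) cmp[OF t] I])
  show "Lop E i k (hscale i c \<xi>) I : bdd_ops k (i \<otimes> k)" by (rule L_bdd[OF m I sub(3)[OF v(1)]])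
  show "op_scale k (i \<otimes> k) c (Lop E i k \<xi> I) : bdd_ops k (i \<otimes> k)"
   by (rule op_scale_bdd[OF cmp[OF m(2)] cmp[OF t] L_bdd[OF m I v(1)]])
  fix J \<psi> assume J: "J : \<J>" "clockwise_to J I" and \<psi>: "\<psi> : \<H> k J" "\<psi> : carr k"
  show "Lop E i k (hscale i c \<xi>) I \<psi> = op_scale k (i \<otimes> k) c (Lop E i k \<xi> I) \<psi>"
   using L_R_exchange[OF m I J _ \<psi>(1)] sub(3)[OF v(1), of c] v bdd_opsD(4)[OF R_bdd[OF m(2,1) J(1) \<psi>(1)] vc(1)] \<psi>(2)
   by (simp add: op_scale_def)
 qed
qed

lemma L_morphism:
 assumes m: "A_module N i" "A_module N i'" "A_module N k" and F: "F \<in> Hom_A N i i'" and I: "I \<in> \<J>"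
  and \<xi>: "\<xi> \<in> \<H> i I" and \<psi>: "\<psi> \<in> carr k"
 shows "Lop E i' k (F \<xi>) I \<psi> = rwhisk E i i' F k (Lop E i k \<xi> I \<psi>)"
proof -
 note fI = fst_arg_interval[OF I]
 have F\<xi>: "F \<xi> : \<H> i' I"
  by (rule bdd_vecs_map[OF N m(1,2) fI Hom_A_loc[OF F iopp_in_intervals[OF fI]] \<xi>])
 have "Lop E i' k (F \<xi>) I = compose (carr k) (rwhisk E i i' F k) (Lop E i k \<xi> I)"
 proof (rule op_eq_on_complement[OF m(3) cmp[OF tens_mod[OF m(2,3)]] I])
  show "Lop E i' k (F \<xi>) I : bdd_ops k (i' \<otimes> k)" by (rule L_bdd[OF m(2,3) I F\<xi>])
  show "compose (carr k) (rwhisk E i i' F k) (Lop E i k \<xi> I) : bdd_ops k (i' \<otimes> k)"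
   by (rule bdd_ops_compose[OF cmp[OF m(3)] cmp[OF tens_mod[OF m(1,3)]] cmp[OF tens_mod[OF m(2,3)]] L_bdd[OF m(1,3) I \<xi>]
     Hom_A_bdd[OF rwhisk_Hom(1)[OF m F]]])
  fix J \<psi> assume J: "J : \<J>" "clockwise_to J I" and \<psi>: "\<psi> : \<H> k J" "\<psi> : carr k"
  show "Lop E i' k (F \<xi>) I \<psi> = compose (carr k) (rwhisk E i i' F k) (Lop E i k \<xi> I) \<psi>"
   using L_R_exchange[OF m(2,3) I J F\<xi> \<psi>(1)] L_R_exchange[OF m(1,3) I J \<xi> \<psi>(1)]
    L_natural(2)[OF m(3,1,2) F J(1) \<psi>(1) bdd_vecs_carr[OF N \<xi>]] \<psi>(2) by (simp add: compose_eq)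
 qed
 then show ?thesis using \<psi> by (simp add: compose_eq)
qed

lemma L_of_L:
 assumes m: "A_module N i" "A_module N j" "A_module N k" and I: "I \<in> \<J>"
  and \<xi>: "\<xi> \<in> \<H> i I" and \<eta>: "\<eta> \<in> \<H> j I"
 shows "Lop E i j \<xi> I \<eta> \<in> \<H> (i \<otimes> j) I"
  and "\<psi> \<in> carr k ==> assoc E i j k (Lop E (i \<otimes> j) k (Lop E i j \<xi> I \<eta>) I \<psi>) = Lop E i (j \<otimes> k) \<xi> I (Lop E j k \<eta> I \<psi>)"
proof -
 note ij = tens_mod[OF m(1,2)] and jk = tens_mod[OF m(2,3)]
 show L: "Lop E i j \<xi> I \<eta> : \<H> (i \<otimes> j) I"
  by (rule bdd_vecs_map[OF N m(2) ij fst_arg_interval[OF I] LR_loc(1)[OF m(1,2) I \<xi>] \<eta>])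
 have "compose (carr k) (assoc E i j k) (Lop E (i \<otimes> j) k (Lop E i j \<xi> I \<eta>) I) = compose (carr k) (Lop E i (j \<otimes> k) \<xi> I) (Lop E j k \<eta> I)"
 proof (rule op_eq_on_complement[OF m(3) cmp[OF tens_mod[OF m(1) jk]] I])
  show "compose (carr k) (assoc E i j k) (Lop E (i \<otimes> j) k (Lop E i j \<xi> I \<eta>) I) : bdd_ops k (i \<otimes> (j \<otimes> k))"
   by (rule bdd_ops_compose[OF cmp[OF m(3)] cmp[OF tens_mod[OF ij m(3)]] cmp[OF tens_mod[OF m(1) jk]] L_bdd[OF ij m(3) I L]
     Hom_A_bdd[OF assoc_Hom(1)[OF m]]])
  show "compose (carr k) (Lop E i (j \<otimes> k) \<xi> I) (Lop E j k \<eta> I) : bdd_ops k (i \<otimes> (j \<otimes> k))"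
   by (rule bdd_ops_compose[OF cmp[OF m(3)] cmp[OF jk] cmp[OF tens_mod[OF m(1) jk]] L_bdd[OF m(2,3) I \<eta>] L_bdd[OF m(1) jk I \<xi>]])
  fix J \<psi> assume J: "J : \<J>" "clockwise_to J I" and \<psi>: "\<psi> : \<H> k J" "\<psi> : carr k"
  show "compose (carr k) (assoc E i j k) (Lop E (i \<otimes> j) k (Lop E i j \<xi> I \<eta>) I) \<psi> = compose (carr k) (Lop E i (j \<otimes> k) \<xi> I) (Lop E j k \<eta> I) \<psi>"
   using L_R_exchange[OF ij m(3) I J L \<psi>(1)] L_R_exchange[OF m(2,3) I J \<eta> \<psi>(1)]
    locality(1)[OF m(1,3,2) I J \<xi> \<psi>(1) bdd_vecs_carr[OF N \<eta>]] \<psi>(2) by (simp add: compose_eq)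
 qed
 from fun_cong[OF this, of \<psi>] show "assoc E i j k (Lop E (i \<otimes> j) k (Lop E i j \<xi> I \<eta>) I \<psi>) = Lop E i (j \<otimes> k) \<xi> I (Lop E j k \<eta> I \<psi>)" if "\<psi> : carr k"
  using that by (simp add: compose_eq)
qed

lemma L_of_adj_L:
 assumes m: "A_module N i" "A_module N j" "A_module N k" and I: "I \<in> \<J>"
  and \<eta>: "\<eta> \<in> \<H> i I" and \<zeta>: "\<zeta> \<in> \<H> (i \<otimes> j) I"
 shows "adj j (i \<otimes> j) (Lop E i j \<eta> I) \<zeta> \<in> \<H> j I"
  and "\<psi> \<in> carr k ==> Lop E j k (adj j (i \<otimes> j) (Lop E i j \<eta> I) \<zeta>) I \<psi>
   = adj (j \<otimes> k) (i \<otimes> (j \<otimes> k)) (Lop E i (j \<otimes> k) \<eta> I) (assoc E i j k (Lop E (i \<otimes> j) k \<zeta> I \<psi>))"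
proof -
 note ij = tens_mod[OF m(1,2)] and jk = tens_mod[OF m(2,3)]
 note ijk = tens_mod[OF m(1) jk] and fI = fst_arg_interval[OF I]
 let ?\<zeta> = "adj j (i \<otimes> j) (Lop E i j \<eta> I) \<zeta>"
 let ?B = "adj (j \<otimes> k) (i \<otimes> (j \<otimes> k)) (Lop E i (j \<otimes> k) \<eta> I)"
 have "adj j (i \<otimes> j) (Lop E i j \<eta> I) : Hom_loc N (iopp (fst I)) (i \<otimes> j) j"
  by (rule Hom_loc_adj[OF N m(2) ij iopp_in_intervals[OF fI] LR_loc(1)[OF m(1,2) I \<eta>]])
 then show L: "?\<zeta> : \<H> j I"
  by (rule bdd_vecs_map[OF N ij m(2) fI _ \<zeta>])
 have D: "compose (carr k) (assoc E i j k) (Lop E (i \<otimes> j) k \<zeta> I) : bdd_ops k (i \<otimes> (j \<otimes> k))"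
  by (rule bdd_ops_compose[OF cmp[OF m(3)] cmp[OF tens_mod[OF ij m(3)]] cmp[OF ijk] L_bdd[OF ij m(3) I \<zeta>] Hom_A_bdd[OF assoc_Hom(1)[OF m]]])
 have "Lop E j k ?\<zeta> I = compose (carr k) ?B (compose (carr k) (assoc E i j k) (Lop E (i \<otimes> j) k \<zeta> I))"
 proof (rule op_eq_on_complement[OF m(3) cmp[OF jk] I])
  show "Lop E j k ?\<zeta> I : bdd_ops k (j \<otimes> k)" by (rule L_bdd[OF m(2,3) I L])
  show "compose (carr k) ?B (compose (carr k) (assoc E i j k) (Lop E (i \<otimes> j) k \<zeta> I)) : bdd_ops k (j \<otimes> k)"
   by (rule bdd_ops_compose[OF cmp[OF m(3)] cmp[OF ijk] cmp[OF jk] D adj_bdd[OF cmp[OF jk] cmp[OF ijk] L_bdd[OF m(1) jk I \<eta>]]])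
  fix J \<psi> assume J: "J : \<J>" "clockwise_to J I" and \<psi>: "\<psi> : \<H> k J" "\<psi> : carr k"
  show "Lop E j k ?\<zeta> I \<psi> = compose (carr k) ?B (compose (carr k) (assoc E i j k) (Lop E (i \<otimes> j) k \<zeta> I)) \<psi>"
   using L_R_exchange[OF m(2,3) I J L \<psi>(1)] L_R_exchange[OF ij m(3) I J \<zeta> \<psi>(1)]
    locality(2)[OF m(1,3,2) I J \<eta> \<psi>(1) bdd_vecs_carr[OF N \<zeta>]] \<psi>(2) by (simp add: compose_eq)
 qed
 from fun_cong[OF this, of \<psi>] show "Lop E j k ?\<zeta> I \<psi> = ?B (assoc E i j k (Lop E (i \<otimes> j) k \<zeta> I \<psi>))" if "\<psi> : carr k"
  using that by (simp add: compose_eq)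
qed

lemma L_of_alg:
 assumes k: "A_module N k" and I: "I \<in> \<J>" and S: "S \<in> alg N (fst I)" and \<psi>: "\<psi> \<in> carr k"
 shows "lunit E k (Lop E (vac N) k (S (Omega N)) I \<psi>) = act k (fst I) S \<psi>"
proof -
 note fI = fst_arg_interval[OF I] and vk = tens_mod[OF vac_mod k]
 note v = alg_bdd_vec(2)[OF N fI S]
 have \<Omega>v: "Omega N : carr (vac N)" using \<Omega> by simp
 have "compose (carr k) (lunit E k) (Lop E (vac N) k (S (Omega N)) I) = act k (fst I) S"
 proof (rule op_eq_on_complement[OF k cmp[OF k] I])
  show "compose (carr k) (lunit E k) (Lop E (vac N) k (S (Omega N)) I) : bdd_ops k k"
   by (rule bdd_ops_compose[OF cmp[OF k] cmp[OF vk] cmp[OF k] L_bdd[OF vac_mod k I v] Hom_A_bdd[OF unit_Hom(1)[OF k]]])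
  show "act k (fst I) S : bdd_ops k k" by (rule A_module_act(1)[OF k fI S])
  fix J \<psi> assume J: "J : \<J>" "clockwise_to J I" "fst J = iopp (fst I)" and \<psi>: "\<psi> : \<H> k J" "\<psi> : carr k"
  have op: "iopp (fst J) = fst I" using J(3) iopp_iopp[OF fI] by simp
  note Rl = LR_loc(2)[OF k vac_mod J(1) \<psi>(1), unfolded op]
  note R\<Omega> = op_carr[OF R_bdd[OF k vac_mod J(1) \<psi>(1)] \<Omega>v]
  have "lunit E k (Lop E (vac N) k (S (Omega N)) I \<psi>) = lunit E k (Rop E k (vac N) \<psi> J (S (Omega N)))"
   using L_R_exchange[OF vac_mod k I J(1,2) v \<psi>(1)] by simp
  also have "Rop E k (vac N) \<psi> J (S (Omega N)) = act (vac N \<otimes> k) (fst I) S (Rop E k (vac N) \<psi> J (Omega N))"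
   using Hom_loc_act[OF vac_mod fI Rl S \<Omega>v] by (simp add: vac_act[OF S])
  also have "lunit E k ... = act k (fst I) S (lunit E k (Rop E k (vac N) \<psi> J (Omega N)))"
   by (rule Hom_loc_act[OF vk fI Hom_A_loc[OF unit_Hom(1)[OF k] fI] S R\<Omega>])
  also have "lunit E k (Rop E k (vac N) \<psi> J (Omega N)) = \<psi>" by (rule state_field(2)[OF k J(1) \<psi>(1)])
  finally show "compose (carr k) (lunit E k) (Lop E (vac N) k (S (Omega N)) I) \<psi> = act k (fst I) S \<psi>"
   using \<psi>(2) by (simp add: compose_eq)
 qed
 from fun_cong[OF this, of \<psi>] show ?thesis using \<psi> by (simp add: compose_eq)
qed

lemma L_adj_natural:
 assumes m: "A_module N i" "A_module N k" "A_module N k'" and G: "G \<in> Hom_A N k k'" and I: "I \<in> \<J>"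
  and \<xi>: "\<xi> \<in> \<H> i I" and v: "v \<in> carr (i \<otimes> k)"
 shows "G (adj k (i \<otimes> k) (Lop E i k \<xi> I) v) = adj k' (i \<otimes> k') (Lop E i k' \<xi> I) (lwhisk E i k k' G v)"
proof -
 note ik = tens_mod[OF m(1,2)] and ik' = tens_mod[OF m(1,3)]
 note Gb = Hom_A_bdd[OF G] and G' = Hom_A_adj[OF N m(2,3) G]
 note G'b = Hom_A_bdd[OF G']
 note L = L_bdd[OF m(1,2) I \<xi>] and L' = L_bdd[OF m(1,3) I \<xi>]
 note w = lwhisk_Hom[OF m G]
 note Lv = op_carr[OF adj_bdd[OF cmp[OF m(2)] cmp[OF ik] L] v]
 note wv = op_carr[OF Hom_A_bdd[OF w(1)] v]
 note L'wv = op_carr[OF adj_bdd[OF cmp[OF m(3)] cmp[OF ik'] L'] wv]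
 show ?thesis
 proof (rule hip_ext[OF cmp[OF m(3)] op_carr[OF Gb Lv] L'wv])
  fix z assume z: "z : carr k'"
  note G'z = op_carr[OF G'b z] and L'z = op_carr[OF L' z]
  have "hip k' z (G (adj k (i \<otimes> k) (Lop E i k \<xi> I) v)) = hip k (adj k k' G z) (adj k (i \<otimes> k) (Lop E i k \<xi> I) v)"
   using adj_left[OF cmp[OF m(2)] cmp[OF m(3)] Gb Lv z] by simp
  also have "... = hip (i \<otimes> k) (Lop E i k \<xi> I (adj k k' G z)) v"
   by (rule adj_right[OF cmp[OF m(2)] cmp[OF ik] L G'z v])
  also have "Lop E i k \<xi> I (adj k k' G z) = adj (i \<otimes> k) (i \<otimes> k') (lwhisk E i k k' G) (Lop E i k' \<xi> I z)"
   unfolding w(2) using L_natural(1)[OF m(1,3,2) G' I \<xi> z] by simp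
  also have "hip (i \<otimes> k) ... v = hip (i \<otimes> k') (Lop E i k' \<xi> I z) (lwhisk E i k k' G v)"
   by (rule adj_left[OF cmp[OF ik] cmp[OF ik'] Hom_A_bdd[OF w(1)] v L'z])
  also have "... = hip k' z (adj k' (i \<otimes> k') (Lop E i k' \<xi> I) (lwhisk E i k k' G v))"
   by (rule adj_right[OF cmp[OF m(3)] cmp[OF ik'] L' z wv, symmetric])
  finally show "hip k' z (G (adj k (i \<otimes> k) (Lop E i k \<xi> I) v)) = hip k' z (adj k' (i \<otimes> k') (Lop E i k' \<xi> I) (lwhisk E i k k' G v))" .
 qed
qed

end

context moebius_extension
begin

subsection \<open>Haag duality\<close>

lemma vacuum_L:
 assumes I: "I \<in> \<J>" and x: "x \<in> Hom_loc N (iopp (fst I)) (vac N) (vac N)" and v: "v \<in> carr N"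
 shows "runit E (vac N) (Lop E (vac N) (vac N) (x (Omega N)) I v) = x v"
proof -
 note fI = fst_arg_interval[OF I]
 note I' = iopp_in_intervals[OF fI] and vv = tens_mod[OF vac_mod vac_mod]
 note b = bdd_vecsI[OF x]
 have "compose (carr (vac N)) (runit E (vac N)) (Lop E (vac N) (vac N) (x (Omega N)) I) = x"
 proof (rule Hom_loc_vacuum_separating[OF irr vac_mod I' _ x])
  show "compose (carr (vac N)) (runit E (vac N)) (Lop E (vac N) (vac N) (x (Omega N)) I) : Hom_loc N (iopp (fst I)) (vac N) (vac N)"
   by (rule Hom_loc_compose[OF vac_mod vv vac_mod I' LR_loc(1)[OF vac_mod vac_mod I b] Hom_A_loc[OF unit_Hom(3)[OF vac_mod] I']])
  show "compose (carr (vac N)) (runit E (vac N)) (Lop E (vac N) (vac N) (x (Omega N)) I) (Omega N) = x (Omega N)"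
   using state_field(1)[OF vac_mod I b] \<Omega> by (simp add: compose_eq)
 qed
 from fun_cong[OF this, of v] show ?thesis using v by (simp add: compose_eq)
qed

lemma vacuum_R:
 assumes I: "I \<in> \<J>" and x: "x \<in> Hom_loc N (iopp (fst I)) (vac N) (vac N)" and v: "v \<in> carr N"
 shows "lunit E (vac N) (Rop E (vac N) (vac N) (x (Omega N)) I v) = x v"
proof -
 note fI = fst_arg_interval[OF I]
 note I' = iopp_in_intervals[OF fI] and vv = tens_mod[OF vac_mod vac_mod]
 note b = bdd_vecsI[OF x]
 have "compose (carr (vac N)) (lunit E (vac N)) (Rop E (vac N) (vac N) (x (Omega N)) I) = x"
 proof (rule Hom_loc_vacuum_separating[OF irr vac_mod I' _ x])
  show "compose (carr (vac N)) (lunit E (vac N)) (Rop E (vac N) (vac N) (x (Omega N)) I) : Hom_loc N (iopp (fst I)) (vac N) (vac N)"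
   by (rule Hom_loc_compose[OF vac_mod vv vac_mod I' LR_loc(2)[OF vac_mod vac_mod I b] Hom_A_loc[OF unit_Hom(1)[OF vac_mod] I']])
  show "compose (carr (vac N)) (lunit E (vac N)) (Rop E (vac N) (vac N) (x (Omega N)) I) (Omega N) = x (Omega N)"
   using state_field(2)[OF vac_mod I b] \<Omega> by (simp add: compose_eq)
 qed
 from fun_cong[OF this, of v] show ?thesis using v by (simp add: compose_eq)
qed

lemma lunit_eq_runit_vac:
 assumes v: "v \<in> carr (vac N \<otimes> vac N)"
 shows "lunit E (vac N) v = runit E (vac N) v"
proof -
 note vv = tens_mod[OF vac_mod vac_mod]
 have I: "arg_arc 0 1 : \<J>" using pi_gt3 by (intro arg_arc_in) auto
 let ?I = "arg_arc 0 1"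
 note fI = fst_arg_interval[OF I]
 note one = von_neumann_algebraD(4)[OF H0 moebius_netD(2)[OF N fI]]
 note oneH = alg_bdd_vec[OF N fI one]
 define u where "u = lunit E (vac N) v"
 have u: "u : carr (vac N)" unfolding u_def by (rule op_carr[OF Hom_A_bdd[OF unit_Hom(1)[OF vac_mod]] v])
 let ?w = "Lop E (vac N) (vac N) (op_id N (Omega N)) ?I u"
 have w: "?w : carr (vac N \<otimes> vac N)" by (rule op_carr[OF L_bdd[OF vac_mod vac_mod I oneH(2)] u])
 have "lunit E (vac N) ?w = u"
  unfolding L_of_alg[OF vac_mod I one u] vac_act[OF one] using u by (simp add: op_id_def)
 then have "lunit E (vac N) ?w = lunit E (vac N) v" by (simp add: u_def)
 then have wv: "?w = v"
  using unitary_D(1)[OF vv vac_mod unit_Hom(2)[OF vac_mod] w] unitary_D(1)[OF vv vac_mod unit_Hom(2)[OF vac_mod] v] by metis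
 have "runit E (vac N) ?w = u" using vacuum_L[OF I oneH(1), of u] u by (simp add: op_id_def)
 then show ?thesis using wv by (simp add: u_def)
qed

text \<open>The operators \<open>L\<close> and \<open>R\<close> realise all of \<open>A(I')'\<close> and \<open>A(I)'\<close> on the vacuum module, so locality
  says that these two algebras commute.\<close>

lemma Haag_duality:
 assumes fI: "I \<in> intervals" and x: "x \<in> Hom_loc N (iopp I) (vac N) (vac N)"
 shows "x \<in> alg N I"
proof -
 obtain I' where I': "I' : \<J>" "fst I' = I" by (rule arg_interval_exists[OF fI])
 obtain J where J: "J : \<J>" "clockwise_to J I'" "fst J = iopp (fst I')"
  by (rule clockwise_complement_exists[OF I'(1)])
 have op: "iopp (fst J) = I" using J(3) I'(2) iopp_iopp[OF fI] by simp
 have x': "x : Hom_loc N (iopp (fst I')) (vac N) (vac N)" using x I'(2) by simp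
 have xb: "x : bdd_ops N N" using Hom_loc_bdd[OF x] by simp
 note vv = tens_mod[OF vac_mod vac_mod] and bx = bdd_vecsI[OF x']
 show ?thesis
 proof (rule von_neumann_algebraD(3)[OF H0 moebius_netD(2)[OF N fI] xb])
  fix y v assume y: "y : commutant N (alg N I)" and v: "v : carr N"
  have yb: "y : bdd_ops N N" using y by (simp add: commutant_def)
  have "y (S u) = S (y u)" if S: "S : alg N I" and u: "u : carr N" for S u
  proof -
   have "compose (carr N) S y = compose (carr N) y S" using y S by (simp add: commutant_def)
   from fun_cong[OF this, of u] show ?thesis using u by (simp add: compose_eq)
  qed
  then have y': "y : Hom_loc N (iopp (fst J)) (vac N) (vac N)"
   unfolding op Hom_loc_iff[OF vac_mod fI] using yb by (simp add: vac_act)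
  note by' = bdd_vecsI[OF y']
  have xv: "x v : carr N" and yv: "y v : carr N" using op_carr[OF xb v] op_carr[OF yb v] by auto
  let ?L = "Lop E (vac N) (vac N) (x (Omega N)) I'" and ?R = "Rop E (vac N) (vac N) (y (Omega N)) J"
  have Lv: "?L v : carr (vac N \<otimes> vac N)" using op_carr[OF L_bdd[OF vac_mod vac_mod I'(1) bx]] v by simp
  have Rv: "?R v : carr (vac N \<otimes> vac N)" using op_carr[OF R_bdd[OF vac_mod vac_mod J(1) by']] v by simp
  have Rxv: "?R (x v) : carr (vac N \<otimes> vac N)" using op_carr[OF R_bdd[OF vac_mod vac_mod J(1) by']] xv by simp
  note RLv = op_carr[OF R_bdd[OF vac_mod vv J(1) by'] Lv]
  have "?R (x v) = ?R (runit E (vac N) (?L v))" using vacuum_L[OF I'(1) x' v] by simp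
  also have "... = rwhisk E (vac N \<otimes> vac N) (vac N) (runit E (vac N)) (vac N) (Rop E (vac N) (vac N \<otimes> vac N) (y (Omega N)) J (?L v))"
   using L_natural(2)[OF vac_mod vv vac_mod unit_Hom(3)[OF vac_mod] J(1) by' Lv] by simp
  also have "... = lwhisk E (vac N) (vac N \<otimes> vac N) (vac N) (lunit E (vac N))
    (assoc E (vac N) (vac N) (vac N) (Rop E (vac N) (vac N \<otimes> vac N) (y (Omega N)) J (?L v)))"
   using triangle[OF vac_mod vac_mod RLv] by simp
  also have "assoc E (vac N) (vac N) (vac N) (Rop E (vac N) (vac N \<otimes> vac N) (y (Omega N)) J (?L v))
    = Lop E (vac N) (vac N \<otimes> vac N) (x (Omega N)) I' (?R v)"
   using locality(1)[OF vac_mod vac_mod vac_mod I'(1) J(1,2) bx by'] v by simp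
  also have "lwhisk E (vac N) (vac N \<otimes> vac N) (vac N) (lunit E (vac N)) ... = ?L (lunit E (vac N) (?R v))"
   by (rule L_natural(1)[OF vac_mod vv vac_mod unit_Hom(1)[OF vac_mod] I'(1) bx Rv])
  also have "lunit E (vac N) (?R v) = y v" by (rule vacuum_R[OF J(1) y' v])
  finally have "?R (x v) = ?L (y v)" .
  then have "lunit E (vac N) (?R (x v)) = runit E (vac N) (?L (y v))"
   using lunit_eq_runit_vac[OF Rxv] by simp
  then show "y (x v) = x (y v)"
   using vacuum_R[OF J(1) y' xv] vacuum_L[OF I'(1) x' yv] by simp
 qed
qed

text \<open>On the vacuum module \<open>L(\<xi>)\<^sup>* L(\<eta>)\<close> commutes with the algebra of the complement, so by Haag duality it is a
  local operator \<open>x\<close>; the calculus of \<open>L\<close> transports this to every module.\<close>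

lemma L_adj_L:
 assumes j: "A_module N j" and I: "I \<in> \<J>"
  and \<xi>: "\<xi> \<in> \<H> j I" and \<eta>: "\<eta> \<in> \<H> j I"
 obtains x where "x \<in> alg N (fst I)"
  "!!k v. A_module N k ==> v \<in> carr k ==> adj k (j \<otimes> k) (Lop E j k \<xi> I) (Lop E j k \<eta> I v) = act k (fst I) x v"
proof -
 note fI = fst_arg_interval[OF I]
 note I' = iopp_in_intervals[OF fI] and jv = tens_mod[OF j vac_mod]
 have \<Omega>v: "Omega N : carr (vac N)" using \<Omega> by simp
 define x where "x = compose (carr (vac N)) (adj (vac N) (j \<otimes> vac N) (Lop E j (vac N) \<xi> I)) (Lop E j (vac N) \<eta> I)"
 have xH: "x : Hom_loc N (iopp (fst I)) (vac N) (vac N)"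
  unfolding x_def
  by (rule Hom_loc_compose[OF vac_mod jv vac_mod I' LR_loc(1)[OF j vac_mod I \<eta>] Hom_loc_adj[OF N vac_mod jv I' LR_loc(1)[OF j vac_mod I \<xi>]]])
 have x: "x : alg N (fst I)" by (rule Haag_duality[OF fI xH])
 have "adj k (j \<otimes> k) (Lop E j k \<xi> I) (Lop E j k \<eta> I v) = act k (fst I) x v" if k: "A_module N k" and v: "v : carr k" for k v
 proof -
  note vk = tens_mod[OF vac_mod k]
  define \<zeta> where "\<zeta> = Lop E j (vac N) \<eta> I (Omega N)"
  have \<Omega>b: "Omega N : \<H> (vac N) I"
   using alg_bdd_vec(2)[OF N fI von_neumann_algebraD(4)[OF H0 moebius_netD(2)[OF N fI]]] \<Omega> by (simp add: op_id_def)
  have \<zeta>: "\<zeta> : \<H> (j \<otimes> vac N) I"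
   unfolding \<zeta>_def by (rule L_of_L(1)[OF j vac_mod vac_mod I \<eta> \<Omega>b])
  have x\<Omega>: "x (Omega N) = adj (vac N) (j \<otimes> vac N) (Lop E j (vac N) \<xi> I) \<zeta>"
   using \<Omega> by (simp add: x_def \<zeta>_def compose_eq)
  note Lz = op_carr[OF L_bdd[OF jv k I \<zeta>] v]
  note aLz = op_carr[OF Hom_A_bdd[OF assoc_Hom(1)[OF j vac_mod k]] Lz]
  have "act k (fst I) x v = lunit E k (Lop E (vac N) k (x (Omega N)) I v)" using L_of_alg[OF k I x v] by simp
  also have "... = lunit E k (adj (vac N \<otimes> k) (j \<otimes> (vac N \<otimes> k)) (Lop E j (vac N \<otimes> k) \<xi> I)
    (assoc E j (vac N) k (Lop E (j \<otimes> vac N) k \<zeta> I v)))"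
   unfolding x\<Omega> by (simp only: L_of_adj_L(2)[OF j vac_mod k I \<xi> \<zeta> v])
  also have "... = adj k (j \<otimes> k) (Lop E j k \<xi> I) (lwhisk E j (vac N \<otimes> k) k (lunit E k)
    (assoc E j (vac N) k (Lop E (j \<otimes> vac N) k \<zeta> I v)))"
   by (rule L_adj_natural[OF j vk k unit_Hom(1)[OF k] I \<xi> aLz])
  also have "lwhisk E j (vac N \<otimes> k) k (lunit E k) (assoc E j (vac N) k (Lop E (j \<otimes> vac N) k \<zeta> I v))
    = rwhisk E (j \<otimes> vac N) j (runit E j) k (Lop E (j \<otimes> vac N) k \<zeta> I v)"
   by (rule triangle[OF j k Lz])
  also have "... = Lop E j k (runit E j \<zeta>) I v"
   by (rule L_morphism[OF jv j k unit_Hom(3)[OF j] I \<zeta> v, symmetric])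
  also have "runit E j \<zeta> = \<eta>" unfolding \<zeta>_def by (rule state_field(1)[OF j I \<eta>])
  finally show ?thesis by simp
 qed
 then show ?thesis using that x by blast
qed

end

section \<open>Positivity and normality of representations\<close>

primrec hsum :: "('v, 'a) hilb_scheme \<Rightarrow> (nat \<Rightarrow> 'v) \<Rightarrow> nat \<Rightarrow> 'v" where
 "hsum H f 0 = hzero H"
| "hsum H f (Suc n) = hadd H (hsum H f n) (f n)"

lemma hsum_carr:
 assumes H: "complete_ips H"
 shows "(!!k. k < n ==> f k \<in> carr H) ==> hsum H f n \<in> carr H"
 by (induction n) (use H in auto)

lemma hip_hsum:
 assumes H: "complete_ips H" and x: "x \<in> carr H" and f: "!!k. k < n ==> f k \<in> carr H"
 shows "hip H x (hsum H f n) = (\<Sum>k<n. hip H x (f k))" "hip H (hsum H f n) x = (\<Sum>k<n. hip H (f k) x)"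
proof -
 have "hip H x (hsum H f n) = (\<Sum>k<n. hip H x (f k)) & hip H (hsum H f n) x = (\<Sum>k<n. hip H (f k) x)"
  using f
 proof (induction n)
  case (Suc n)
  have "hsum H f n : carr H" using Suc.prems by (intro hsum_carr[OF H]) auto
  then show ?case using Suc H x by simp
 qed (use H x in simp)
 then show "hip H x (hsum H f n) = (\<Sum>k<n. hip H x (f k))" "hip H (hsum H f n) x = (\<Sum>k<n. hip H (f k) x)" by auto
qed

lemma bdd_ops_hsum:
 assumes H: "complete_ips H" and K: "complete_ips K" and T: "T \<in> bdd_ops H K"
 shows "(!!k. k < n ==> f k \<in> carr H) ==> T (hsum H f n) = hsum K (\<lambda>k. T (f k)) n"
proof (induction n)
 case (Suc n)
 have "hsum H f n : carr H" using Suc.prems by (intro hsum_carr[OF H]) auto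
 then show ?case using Suc bdd_opsD(3)[OF T, of "hsum H f n" "f n"] by simp
qed (use bdd_ops_zero[OF H K T] in simp)

text \<open>The direct sum of \<open>n\<close> copies of \<open>H\<close>, on which \<open>n \<times> n\<close> matrices of operators act.\<close>

definition dsum :: "('v, 'a) hilb_scheme \<Rightarrow> nat \<Rightarrow> (nat \<Rightarrow> 'v) hilb" where
 "dsum H n = \<lparr>carr = {..<n} \<rightarrow>\<^sub>E carr H, hzero = (\<lambda>k\<in>{..<n}. hzero H),
  hadd = (\<lambda>x y. \<lambda>k\<in>{..<n}. hadd H (x k) (y k)), hscale = (\<lambda>c x. \<lambda>k\<in>{..<n}. hscale H c (x k)),
  hip = (\<lambda>x y. \<Sum>k<n. hip H (x k) (y k))\<rparr>"

lemma dsum_simps: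
 "carr (dsum H n) = {..<n} \<rightarrow>\<^sub>E carr H" "hzero (dsum H n) = (\<lambda>k\<in>{..<n}. hzero H)"
 "hadd (dsum H n) x y = (\<lambda>k\<in>{..<n}. hadd H (x k) (y k))"
 "hscale (dsum H n) c x = (\<lambda>k\<in>{..<n}. hscale H c (x k))"
 "hip (dsum H n) x y = (\<Sum>k<n. hip H (x k) (y k))"
 "hdiff (dsum H n) x y = (\<lambda>k\<in>{..<n}. hdiff H (x k) (y k))"
 by (auto simp: dsum_def hdiff_def fun_eq_iff)

lemma dsum_comp: "x \<in> carr (dsum H n) ==> k < n ==> x k \<in> carr H"
 by (auto simp: dsum_simps)

lemma dsum_eqI: "x \<in> carr (dsum H n) ==> y \<in> carr (dsum H n) ==> (!!k. k < n ==> x k = y k) ==> x = y"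
 unfolding dsum_simps by (rule PiE_ext) auto

lemma hnorm_dsum:
 assumes H: "complete_ips H" and x: "x \<in> carr (dsum H n)"
 shows "(hnorm (dsum H n) x)\<^sup>2 = (\<Sum>k<n. (hnorm H (x k))\<^sup>2)" "k < n ==> hnorm H (x k) \<le> hnorm (dsum H n) x"
proof -
 have "Re (hip (dsum H n) x x) = (\<Sum>k<n. (hnorm H (x k))\<^sup>2)"
  using hip_self(2)[OF H dsum_comp[OF x]] by (simp add: dsum_simps)
 moreover have "(\<Sum>k<n. (hnorm H (x k))\<^sup>2) >= 0" by (simp add: sum_nonneg)
 ultimately show *: "(hnorm (dsum H n) x)\<^sup>2 = (\<Sum>k<n. (hnorm H (x k))\<^sup>2)" by (simp add: hnorm_def)
 assume k: "k < n"
 have "(hnorm H (x k))\<^sup>2 <= (hnorm (dsum H n) x)\<^sup>2"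
  unfolding * by (rule member_le_sum[of k "{..<n}"]) (use k in auto)
 then show "hnorm H (x k) <= hnorm (dsum H n) x"
  by (rule power2_le_imp_le) (simp add: hnorm_def dsum_simps, insert hip_self(2)[OF H dsum_comp[OF x]], simp add: sum_nonneg)
qed

lemma dsum_complete:
 fixes H :: "('v, 'a) hilb_scheme"
 assumes H: "complete_ips H"
 shows "complete_ips (dsum H n)"
proof -
 let ?D = "dsum H n"
 note cc = carr_closed[OF H]
 note dk = dsum_comp[of _ H n]
 have mem: "(\<lambda>k\<in>{..<n}. f k) : carr ?D" if "!!k. k < n ==> f k : carr H" for f
  unfolding dsum_simps(1) using that by (intro PiE_I) auto
 have c: "hzero ?D : carr ?D" "ALL x:carr ?D. ALL y:carr ?D. hadd ?D x y : carr ?D" "ALL c. ALL x:carr ?D. hscale ?D c x : carr ?D"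
  and dc: "!!x y. x : carr ?D ==> y : carr ?D ==> hdiff ?D x y : carr ?D"
  unfolding dsum_simps(2-6) by (intro ballI allI mem cc dk; assumption)+
 have e: "x = y" if "x : carr ?D" "y : carr ?D" "!!k z. k < n ==> z : carr H ==> hip H z (x k) = hip H z (y k)" for x y
  by (rule dsum_eqI[OF that(1,2)]) (rule hip_ext[OF H dsum_comp[OF that(1)] dsum_comp[OF that(2)] that(3)])
 have cip: "complex_inner_product_space ?D"
  unfolding complex_inner_product_space_def
 proof (intro conjI ballI allI impI)
  fix x y z assume x: "x : carr ?D" and y: "y : carr ?D" and z: "z : carr ?D"
  show "hadd ?D (hadd ?D x y) z = hadd ?D x (hadd ?D y z)"
   by (rule e) (insert x y z c dk[OF x] dk[OF y] dk[OF z] H, simp_all add: dsum_simps(3) mem)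
  show "hip ?D x (hadd ?D y z) = hip ?D x y + hip ?D x z"
   using dk[OF x] dk[OF y] dk[OF z] H by (simp add: dsum_simps sum.distrib)
 next
  fix x y assume x: "x : carr ?D" and y: "y : carr ?D"
  show "hadd ?D x y = hadd ?D y x"
   by (rule e) (insert x y c dk[OF x] dk[OF y] H, simp_all add: dsum_simps(3) mem)
  show "hip ?D x y = cnj (hip ?D y x)"
   using hip_cnj[OF H dk[OF y] dk[OF x]] by (simp add: dsum_simps)
  show "hadd ?D x y : carr ?D" using c x y by blast
  fix a
  show "hip ?D x (hscale ?D a y) = a * hip ?D x y"
   using dk[OF x] dk[OF y] H by (simp add: dsum_simps sum_distrib_left)
  show "hscale ?D a (hadd ?D x y) = hadd ?D (hscale ?D a x) (hscale ?D a y)"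
   by (rule e) (insert x y c dk[OF x] dk[OF y] H, simp_all add: dsum_simps(3,4) mem algebra_simps)
 next
  fix x assume x: "x : carr ?D"
  show "hadd ?D (hzero ?D) x = x" by (rule e) (insert x c dk[OF x] H, simp_all add: dsum_simps(2,3) mem)
  show "hdiff ?D x x = hzero ?D" by (rule e) (insert x c dc dk[OF x] H, simp_all add: dsum_simps(2,6) mem)
  show "hscale ?D 1 x = x" by (rule e) (insert x c dk[OF x] H, simp_all add: dsum_simps(4) mem)
  have s: "hip ?D x x = complex_of_real (\<Sum>k<n. (hnorm H (x k))\<^sup>2)"
   using hip_self(1)[OF H dk[OF x]] by (simp add: dsum_simps)
  show "hip ?D x x : \<real>\<^sub>\<ge>\<^sub>0" unfolding s by (simp add: complex_nonneg_Reals_iff sum_nonneg)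
  show "x = hzero ?D" if "hip ?D x x = 0"
  proof (rule dsum_eqI[OF x c(1)])
   fix k assume k: "k < n"
   have "(\<Sum>k<n. (hnorm H (x k))\<^sup>2) = 0" using that unfolding s by (simp only: of_real_eq_0_iff)
   then have "(hnorm H (x k))\<^sup>2 = 0" using k by (subst (asm) sum_nonneg_eq_0_iff) auto
   then show "x k = hzero ?D k" using hnorm_eq_0[OF H dk[OF x k]] k by (simp add: dsum_simps)
  qed
  fix a
  show "hscale ?D a x : carr ?D" using c x by blast
  fix b
  show "hscale ?D (a + b) x = hadd ?D (hscale ?D a x) (hscale ?D b x)"
   by (rule e) (insert x c dk[OF x] H, simp_all add: dsum_simps(3,4) mem algebra_simps)
  show "hscale ?D (a * b) x = hscale ?D a (hscale ?D b x)"
   by (rule e) (insert x c dk[OF x] H, simp_all add: dsum_simps(4) mem)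
 qed (rule c(1))
 have "EX x:carr ?D. (\<lambda>m. hdist ?D (X m) x) \<longlonglongrightarrow> 0"
  if X: "ALL m. X m : carr ?D" and C: "ALL e>0. EX M. ALL l>=M. ALL m>=M. hdist ?D (X l) (X m) < e" for X
 proof -
  have Xk: "X m k : carr H" if "k < n" for m k using X dk that by blast
  have "EX y:carr H. (\<lambda>m. hdist H (X m k) y) \<longlonglongrightarrow> 0" if k: "k < n" for k
  proof -
   have "hdist H (X l k) (X m k) <= hdist ?D (X l) (X m)" for l m
    using hnorm_dsum(2)[OF H dc[of "X l" "X m"] k] X k by (simp add: dsum_simps(6))
   then have "ALL e>0. EX M. ALL l>=M. ALL m>=M. hdist H (X l k) (X m k) < e"
    using C by (meson le_less_trans)
   then show ?thesis using H Xk[OF k] unfolding complete_ips_def by (elim conjE allE[of _ "\<lambda>m. X m k"]) simp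
  qed
  then obtain y where y: "!!k. k < n ==> y k : carr H" "!!k. k < n ==> (\<lambda>m. hdist H (X m k) (y k)) \<longlonglongrightarrow> 0"
   by metis
  define x where "x = restrict y {..<n}"
  have x: "x : carr ?D" using y(1) by (auto simp: x_def dsum_simps)
  have "(\<lambda>m. (hdist ?D (X m) x)\<^sup>2) \<longlonglongrightarrow> (\<Sum>k<n. 0\<^sup>2)"
  proof -
   have "(hdist ?D (X m) x)\<^sup>2 = (\<Sum>k<n. (hdist H (X m k) (y k))\<^sup>2)" for m
    using hnorm_dsum(1)[OF H dc[of "X m" x]] X x by (simp add: dsum_simps(6) x_def)
   then show ?thesis using y(2) by (simp only:) (intro tendsto_sum tendsto_power; simp)
  qed
  then have "(\<lambda>m. sqrt ((hdist ?D (X m) x)\<^sup>2)) \<longlonglongrightarrow> sqrt 0"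
   by (intro tendsto_real_sqrt) simp
  moreover have "hnorm ?D v >= 0" if "v : carr ?D" for v
   unfolding hnorm_def dsum_simps real_sqrt_ge_0_iff Re_sum
   by (rule sum_nonneg) (use hip_self(2)[OF H dk[OF that]] in simp)
  ultimately have "(\<lambda>m. hdist ?D (X m) x) \<longlonglongrightarrow> 0" using dc X x by simp
  then show ?thesis using x by blast
 qed
 then show ?thesis unfolding complete_ips_def using cip by blast
qed

text \<open>This is positivity of \<open>B\<close> at the vector \<open>x - B x / c\<close>.\<close>

lemma positive_op_square:
 assumes H: "complete_ips H" and B: "B \<in> bdd_ops H H" and sym: "!!x y. x \<in> carr H ==> y \<in> carr H ==> hip H x (B y) = hip H (B x) y"
  and pos: "!!x. x \<in> carr H ==> 0 \<le> Re (hip H x (B x))"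
  and c: "c > 0" "!!x. x \<in> carr H ==> Re (hip H x (B x)) \<le> c * (hnorm H x)\<^sup>2" and x: "x \<in> carr H"
 shows "(hnorm H (B x))\<^sup>2 \<le> c * Re (hip H x (B x))"
proof -
 note Bx = op_carr[OF B x]
 note BBx = op_carr[OF B Bx]
 let ?t = "complex_of_real (1 / c)"
 have "hip H (hdiff H x (hscale H ?t (B x))) (B (hdiff H x (hscale H ?t (B x))))
   = hip H x (B x) - ?t * hip H x (B (B x)) - ?t * hip H (B x) (B x) + ?t * ?t * hip H (B x) (B (B x))"
  using x Bx BBx H by (simp add: bdd_ops_diff[OF H B] bdd_opsD(4)[OF B] algebra_simps)
 also have "hip H x (B (B x)) = hip H (B x) (B x)" by (rule sym[OF x Bx])
 finally have "Re (hip H (hdiff H x (hscale H ?t (B x))) (B (hdiff H x (hscale H ?t (B x)))))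
   = Re (hip H x (B x)) - 2 / c * (hnorm H (B x))\<^sup>2 + 1 / c * (1 / c * Re (hip H (B x) (B (B x))))"
  using hip_self(2)[OF H Bx] by (simp add: Re_divide_of_real)
 moreover have "1 / c * Re (hip H (B x) (B (B x))) <= (hnorm H (B x))\<^sup>2"
  using c(2)[OF Bx] c(1) by (simp add: divide_le_eq mult.commute)
 then have "1 / c * (1 / c * Re (hip H (B x) (B (B x)))) <= 1 / c * (hnorm H (B x))\<^sup>2"
  using c(1) by (intro mult_left_mono) auto
 moreover have "0 <= Re (hip H (hdiff H x (hscale H ?t (B x))) (B (hdiff H x (hscale H ?t (B x)))))"
  by (rule pos) (use x Bx H in simp)
 ultimately have "0 <= Re (hip H x (B x)) - 1 / c * (hnorm H (B x))\<^sup>2" by (simp add: field_simps)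
 then show ?thesis using c(1) by (simp add: field_simps)
qed

text \<open>At the infimum of its numerical range a self-adjoint operator is not bounded below, so a negative
  infimum would contradict invertibility.\<close>

lemma positive_of_spectrum:
 assumes H: "complete_ips H" and T: "T \<in> bdd_ops H H" and sym: "!!x y. x \<in> carr H ==> y \<in> carr H ==> hip H x (T y) = hip H (T x) y"
  and inv: "!!l::real. l > 0 ==> \<exists>G\<in>bdd_ops H H. \<forall>x\<in>carr H. G (hadd H (T x) (hscale H (of_real l) x)) = x"
  and x: "x \<in> carr H"
 shows "0 \<le> Re (hip H x (T x))"
proof -
 obtain C where C: "C >= 0" "!!x. x : carr H ==> hnorm H (T x) <= C * hnorm H x" using bdd_ops_bound[OF H T] by blast
 have T_upper: "\<bar>Re (hip H x (T x))\<bar> <= C * (hnorm H x)\<^sup>2" if x: "x : carr H" for x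
 proof -
  have "\<bar>Re (hip H x (T x))\<bar> <= hnorm H x * hnorm H (T x)"
   using Cauchy_Schwarz[OF H x op_carr[OF T x]] abs_Re_le_cmod order_trans by blast
  also have "... <= hnorm H x * (C * hnorm H x)" using C(2)[OF x] hip_self(3)[OF H x] by (intro mult_left_mono)
  finally show ?thesis by (simp add: power2_eq_square mult_ac)
 qed
 define S where "S = {l. 0 <= l & (ALL x:carr H. - l * (hnorm H x)\<^sup>2 <= Re (hip H x (T x)))}"
 have CS: "C : S" using T_upper C(1) by (fastforce simp: S_def)
 have bdd: "bdd_below S" by (auto simp: S_def intro: bdd_belowI)
 define m where "m = Inf S"
 have m0: "m >= 0" unfolding m_def using CS by (intro cInf_greatest) (auto simp: S_def)
 have mS: "- m * (hnorm H x)\<^sup>2 <= Re (hip H x (T x))" if x: "x : carr H" for x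
 proof (cases "hnorm H x = 0")
  case True
  then show ?thesis using hnorm_eq_0[OF H x] H bdd_ops_zero[OF H H T] by simp
 next
  case False
  then have p: "(hnorm H x)\<^sup>2 > 0" by simp
  have "- Re (hip H x (T x)) / (hnorm H x)\<^sup>2 <= m"
   unfolding m_def
  proof (rule cInf_greatest)
   fix l assume "l : S"
   then have "- l * (hnorm H x)\<^sup>2 <= Re (hip H x (T x))" using x by (simp add: S_def)
   then show "- Re (hip H x (T x)) / (hnorm H x)\<^sup>2 <= l" unfolding pos_divide_le_eq[OF p] by linarith
  qed (use CS in auto)
  then show ?thesis unfolding pos_divide_le_eq[OF p] by linarith
 qed
 have "m = 0"
 proof (rule ccontr)
  assume "m ~= 0"
  then have mp: "m > 0" using m0 by simp
  obtain G where G: "G : bdd_ops H H" "!!x. x : carr H ==> G (hadd H (T x) (hscale H (of_real m) x)) = x" using inv[OF mp] by blast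
  obtain g where g: "g >= 0" "!!x. x : carr H ==> hnorm H (G x) <= g * hnorm H x" using bdd_ops_bound[OF H G(1)] by blast
  define B where "B = op_add H H T (op_scale H H (of_real m) (op_id H))"
  have B: "B : bdd_ops H H" unfolding B_def by (intro op_add_bdd op_scale_bdd op_id_bdd H T)
  have Bx: "B x = hadd H (T x) (hscale H (of_real m) x)" if "x : carr H" for x
   using that by (simp add: B_def op_add_def op_scale_def op_id_def)
  have ReB: "Re (hip H x (B x)) = Re (hip H x (T x)) + m * (hnorm H x)\<^sup>2" if x: "x : carr H" for x
   using x H op_carr[OF T x] hip_self(2)[OF H x] by (simp add: Bx)
  define c where "c = C + m + 1"
  have c: "c > 0" using C(1) m0 by (simp add: c_def)
  have sq: "(hnorm H (B x))\<^sup>2 <= c * Re (hip H x (B x))" if x: "x : carr H" for x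
  proof (rule positive_op_square[OF H B _ _ c _ x])
   show "hip H x (B y) = hip H (B x) y" if "x : carr H" "y : carr H" for x y
    using that H op_carr[OF T] sym[OF that] by (simp add: Bx)
   show "0 <= Re (hip H x (B x))" if "x : carr H" for x using mS[OF that] ReB[OF that] by simp
   show "Re (hip H x (B x)) <= c * (hnorm H x)\<^sup>2" if "x : carr H" for x
    using T_upper[OF that] ReB[OF that] by (simp add: c_def algebra_simps) (smt (verit) zero_le_power2)
  qed
  define e where "e = min m (1 / (c * (g\<^sup>2 + 1)))"
  have e: "e > 0" "e <= m" using mp c by (auto simp: e_def add_nonneg_pos)
  have ec: "e * (c * (g\<^sup>2 + 1)) <= 1"
  proof -
   have "e * (c * (g\<^sup>2 + 1)) <= 1 / (c * (g\<^sup>2 + 1)) * (c * (g\<^sup>2 + 1))"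
    using c by (intro mult_right_mono) (auto simp: e_def add_nonneg_pos less_imp_le)
   also have "... = 1" using c by (simp add: add_nonneg_pos less_imp_neq[symmetric])
   finally show ?thesis .
  qed
  have "m - e : S"
   unfolding S_def
  proof (intro CollectI conjI ballI)
   show "0 <= m - e" using e by simp
   fix x assume x: "x : carr H"
   note Bxc = op_carr[OF B x]
   have "hnorm H x <= g * hnorm H (B x)" using g(2)[OF Bxc] G(2)[OF x] Bx[OF x] by simp
   then have "(hnorm H x)\<^sup>2 <= (g * hnorm H (B x))\<^sup>2" using hip_self(3)[OF H x] by (intro power_mono)
   also have "... = g\<^sup>2 * (hnorm H (B x))\<^sup>2" by (simp add: power_mult_distrib)
   also have "... <= (g\<^sup>2 + 1) * (hnorm H (B x))\<^sup>2" by (intro mult_right_mono) auto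
   also have "... <= (g\<^sup>2 + 1) * (c * Re (hip H x (B x)))" using sq[OF x] by (intro mult_left_mono) auto
   finally have "e * (hnorm H x)\<^sup>2 <= e * ((g\<^sup>2 + 1) * (c * Re (hip H x (B x))))" using e by (intro mult_left_mono) auto
   also have "... = (e * (c * (g\<^sup>2 + 1))) * Re (hip H x (B x))" by simp
   also have "... <= 1 * Re (hip H x (B x))"
    using ec mS[OF x] ReB[OF x] by (intro mult_right_mono) auto
   finally show "- (m - e) * (hnorm H x)\<^sup>2 <= Re (hip H x (T x))" using ReB[OF x] by (simp add: algebra_simps)
  qed
  then have "m <= m - e" unfolding m_def by (rule cInf_lower[OF _ bdd])
  then show False using e by simp
 qed
 then show ?thesis using mS[OF x] by simp
qed

text \<open>Normal representations without the condition on suprema, which is treated separately.\<close>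

definition star_rep :: "('v, 'a) hilb_scheme \<Rightarrow> ('v \<Rightarrow> 'v) set \<Rightarrow> ('v, 'b) hilb_scheme \<Rightarrow>
  (('v \<Rightarrow> 'v) \<Rightarrow> ('v \<Rightarrow> 'v)) \<Rightarrow> bool" where
 "star_rep H M K p \<longleftrightarrow>
  p \<in> M \<rightarrow>\<^sub>E bdd_ops K K \<and>
  (\<forall>S\<in>M. \<forall>T\<in>M. p (op_add H H S T) = op_add K K (p S) (p T)) \<and>
  (\<forall>c. \<forall>S\<in>M. p (op_scale H H c S) = op_scale K K c (p S)) \<and>
  (\<forall>S\<in>M. \<forall>T\<in>M. p (compose (carr H) S T) = compose (carr K) (p S) (p T)) \<and>
  (\<forall>S\<in>M. p (adj H H S) = adj K K (p S)) \<and>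
  p (op_id H) = op_id K"

lemma star_repD:
 assumes "star_rep H M K p"
 shows "S \<in> M ==> p S \<in> bdd_ops K K"
  and "S \<in> M ==> T \<in> M ==> p (op_add H H S T) = op_add K K (p S) (p T)"
  and "S \<in> M ==> p (op_scale H H c S) = op_scale K K c (p S)"
  and "S \<in> M ==> T \<in> M ==> p (compose (carr H) S T) = compose (carr K) (p S) (p T)"
  and "S \<in> M ==> p (adj H H S) = adj K K (p S)"
  and "p (op_id H) = op_id K"
 using assms unfolding star_rep_def by auto

lemma normal_rep_star_rep: "normal_rep H M K p ==> star_rep H M K p"
 unfolding star_rep_def using normal_repD[of H M K p] by auto

lemma commutantI:
 assumes "T \<in> bdd_ops H H" "!!S x. S \<in> C ==> x \<in> carr H ==> S (T x) = T (S x)"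
 shows "T \<in> commutant H C"
 unfolding commutant_def using assms by (auto simp: compose_def fun_eq_iff)

lemma commutantD:
 assumes "T \<in> commutant H C"
 shows "T \<in> bdd_ops H H" and "S \<in> C ==> x \<in> carr H ==> S (T x) = T (S x)"
 using assms unfolding commutant_def by (auto simp: compose_def fun_eq_iff) metis

lemma commutant_algebra:
 assumes H: "complete_ips H" and C: "C \<subseteq> bdd_ops H H"
 shows "op_id H \<in> commutant H C"
  and "S \<in> commutant H C ==> T \<in> commutant H C ==> op_add H H S T \<in> commutant H C"
  and "S \<in> commutant H C ==> op_scale H H c S \<in> commutant H C"
  and "S \<in> commutant H C ==> T \<in> commutant H C ==> compose (carr H) S T \<in> commutant H C"
proof -
 have C': "r x : carr H" "r (hadd H x y) = hadd H (r x) (r y)" "r (hscale H c x) = hscale H c (r x)"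
  if "r : C" "x : carr H" "y : carr H" for r x y c
  using bdd_opsD[of r H H] that C by auto
 note D = commutantD[of _ H C]
 show "op_id H : commutant H C"
  by (rule commutantI[OF op_id_bdd[OF H]]) (insert C', auto simp: op_id_def)
 assume S: "S : commutant H C"
 note Sc = op_carr[OF D(1)[OF S]]
 show "op_scale H H c S : commutant H C"
  by (rule commutantI[OF op_scale_bdd[OF H H D(1)[OF S]]]) (insert C' Sc D(2)[OF S], auto simp: op_scale_def)
 assume T: "T : commutant H C"
 note Tc = op_carr[OF D(1)[OF T]]
 show "op_add H H S T : commutant H C"
  by (rule commutantI[OF op_add_bdd[OF H H D(1)[OF S] D(1)[OF T]]])
   (insert C' Sc Tc D(2)[OF S] D(2)[OF T], auto simp: op_add_def)
 show "compose (carr H) S T : commutant H C"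
  by (rule commutantI[OF bdd_ops_compose[OF H H H D(1)[OF T] D(1)[OF S]]])
   (insert C' Sc Tc D(2)[OF S] D(2)[OF T], auto simp: compose_eq)
qed

definition matrix_op :: "('v, 'a) hilb_scheme \<Rightarrow> nat \<Rightarrow> (nat \<Rightarrow> nat \<Rightarrow> 'v \<Rightarrow> 'v) \<Rightarrow> (nat \<Rightarrow> 'v) \<Rightarrow> nat \<Rightarrow> 'v" where
 "matrix_op H n Z = (\<lambda>x\<in>carr (dsum H n). \<lambda>k\<in>{..<n}. hsum H (\<lambda>l. Z k l (x l)) n)"

lemma hnorm_hsum:
 assumes H: "complete_ips H"
 shows "(!!k. k < n ==> f k \<in> carr H) ==> hnorm H (hsum H f n) \<le> (\<Sum>k<n. hnorm H (f k))"
proof (induction n)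
 case (Suc n)
 have "hsum H f n : carr H" using Suc.prems by (intro hsum_carr[OF H]) auto
 then show ?case using Suc hnorm_triangle[OF H, of "hsum H f n" "f n"] by (simp add: order_trans)
qed (use H in simp)

lemma matrix_op:
 assumes H: "complete_ips H" and ZA: "\<forall>k<n. \<forall>l<n. Z k l \<in> bdd_ops H H"
 shows "matrix_op H n Z \<in> bdd_ops (dsum H n) (dsum H n)"
  and "x \<in> carr (dsum H n) ==> y \<in> carr (dsum H n) ==>
   hip (dsum H n) x (matrix_op H n Z y) = (\<Sum>k<n. \<Sum>l<n. hip H (x k) (Z k l (y l)))"
  and "x \<in> carr (dsum H n) ==> k < n ==> matrix_op H n Z x k = hsum H (\<lambda>l. Z k l (x l)) n"
proof -
 let ?D = "dsum H n"
 note dk = dsum_comp[of _ H n] and Z = ZA[rule_format]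
 have D: "complete_ips ?D" by (rule dsum_complete[OF H])
 have Zc: "Z k l (x l) : carr H" if "x : carr ?D" "k < n" "l < n" for x k l
  by (rule op_carr[OF Z[OF that(2,3)] dk[OF that(1,3)]])
 have sc: "hsum H (\<lambda>l. Z k l (x l)) n : carr H" if "x : carr ?D" "k < n" for x k
  by (rule hsum_carr[OF H]) (rule Zc[OF that])
 show val: "matrix_op H n Z x k = hsum H (\<lambda>l. Z k l (x l)) n" if "x : carr ?D" "k < n" for x k
  using that by (simp add: matrix_op_def)
 have mc: "matrix_op H n Z x : carr ?D" if "x : carr ?D" for x
  using that sc[OF that] unfolding matrix_op_def by (simp add: dsum_simps(1))
 show form: "hip ?D x (matrix_op H n Z y) = (\<Sum>k<n. \<Sum>l<n. hip H (x k) (Z k l (y l)))"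
  if x: "x : carr ?D" and y: "y : carr ?D" for x y
  unfolding dsum_simps by (rule sum.cong[OF refl]) (use val[OF y] hip_hsum(1)[OF H dk[OF x] Zc[OF y]] in simp)
 have "EX c. ALL x:carr H. hnorm H (Z k l x) <= c * hnorm H x & 0 <= c" if "k < n" "l < n" for k l
  using bdd_ops_bound[OF H Z[OF that]] by metis
 then obtain c where c: "!!k l x. k < n ==> l < n ==> x : carr H ==> hnorm H (Z k l x) <= c k l * hnorm H x & 0 <= c k l"
  by metis
 show "matrix_op H n Z : bdd_ops ?D ?D"
 proof (rule bdd_opsI[where C = "\<Sum>k<n. \<Sum>l<n. c k l"])
  show "matrix_op H n Z : extensional (carr ?D)" by (simp add: matrix_op_def)
  fix x assume x: "x : carr ?D"
  show "matrix_op H n Z x : carr ?D" by (rule mc[OF x])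
  have n0: "0 <= hnorm H (matrix_op H n Z x k)" if "k < n" for k
   by (rule hip_self(3)[OF H dk[OF mc[OF x] that]])
  have "hnorm ?D (matrix_op H n Z x) = L2_set (\<lambda>k. hnorm H (matrix_op H n Z x k)) {..<n}"
   unfolding L2_set_def hnorm_dsum(1)[OF H mc[OF x], symmetric] using hip_self(3)[OF D mc[OF x]] by simp
  also have "... <= (\<Sum>k<n. hnorm H (matrix_op H n Z x k))" by (rule L2_set_le_sum) (use n0 in auto)
  also have "... <= (\<Sum>k<n. \<Sum>l<n. c k l * hnorm ?D x)"
  proof (rule sum_mono)
   fix k assume "k : {..<n}"
   then have k: "k < n" by simp
   have "hnorm H (matrix_op H n Z x k) <= (\<Sum>l<n. hnorm H (Z k l (x l)))"
    unfolding val[OF x k] by (rule hnorm_hsum[OF H Zc[OF x k]])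
   also have "... <= (\<Sum>l<n. c k l * hnorm ?D x)"
   proof (rule sum_mono)
    fix l assume "l : {..<n}"
    then have l: "l < n" by simp
    show "hnorm H (Z k l (x l)) <= c k l * hnorm ?D x"
     using c[OF k l dk[OF x l]] mult_left_mono[OF hnorm_dsum(2)[OF H x l], of "c k l"] by linarith
   qed
   finally show "hnorm H (matrix_op H n Z x k) <= (\<Sum>l<n. c k l * hnorm ?D x)" .
  qed
  finally show "hnorm ?D (matrix_op H n Z x) <= (\<Sum>k<n. \<Sum>l<n. c k l) * hnorm ?D x"
   by (simp add: sum_distrib_right)
  fix a
  have ax: "hscale ?D a x : carr ?D" using x D by simp
  show "matrix_op H n Z (hscale ?D a x) = hscale ?D a (matrix_op H n Z x)"
  proof (rule hip_ext[OF D])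
   fix z assume z: "z : carr ?D"
   have "hip ?D z (matrix_op H n Z (hscale ?D a x)) = (\<Sum>k<n. \<Sum>l<n. a * hip H (z k) (Z k l (x l)))"
    unfolding form[OF z ax]
    by (intro sum.cong refl) (insert H Zc[OF x] dk[OF x] dk[OF z] bdd_opsD(4)[OF Z], simp add: dsum_simps(4))
   also have "... = hip ?D z (hscale ?D a (matrix_op H n Z x))"
    using D z mc[OF x] form[OF z x] by (simp add: sum_distrib_left)
   finally show "hip ?D z (matrix_op H n Z (hscale ?D a x)) = hip ?D z (hscale ?D a (matrix_op H n Z x))" .
  qed (use D mc x ax in auto)
  fix y assume y: "y : carr ?D"
  have xy: "hadd ?D x y : carr ?D" using x y D by simp
  show "matrix_op H n Z (hadd ?D x y) = hadd ?D (matrix_op H n Z x) (matrix_op H n Z y)"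
  proof (rule hip_ext[OF D])
   fix z assume z: "z : carr ?D"
   have "hip ?D z (matrix_op H n Z (hadd ?D x y))
     = (\<Sum>k<n. \<Sum>l<n. hip H (z k) (Z k l (x l)) + hip H (z k) (Z k l (y l)))"
    unfolding form[OF z xy]
    by (intro sum.cong refl) (insert H Zc[OF x] Zc[OF y] dk[OF x] dk[OF y] dk[OF z] bdd_opsD(3)[OF Z], simp add: dsum_simps(3))
   also have "... = hip ?D z (hadd ?D (matrix_op H n Z x) (matrix_op H n Z y))"
    using D z mc[OF x] mc[OF y] form[OF z x] form[OF z y] by (simp add: sum.distrib)
   finally show "hip ?D z (matrix_op H n Z (hadd ?D x y)) = hip ?D z (hadd ?D (matrix_op H n Z x) (matrix_op H n Z y))" .
  qed (use D mc x y xy in auto)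
 qed
qed

lemma matrix_op_hermitian:
 assumes H: "complete_ips H" and ZA: "\<forall>k<n. \<forall>l<n. Z k l \<in> bdd_ops H H"
  and herm: "\<forall>k<n. \<forall>l<n. adj H H (Z k l) = Z l k"
  and x: "x \<in> carr (dsum H n)" and y: "y \<in> carr (dsum H n)"
 shows "hip (dsum H n) x (matrix_op H n Z y) = hip (dsum H n) (matrix_op H n Z x) y"
proof -
 let ?D = "dsum H n"
 note M = matrix_op[OF H ZA] and dk = dsum_comp[of _ H n] and Z = ZA[rule_format]
 have D: "complete_ips ?D" by (rule dsum_complete[OF H])
 have "hip ?D (matrix_op H n Z x) y = cnj (hip ?D y (matrix_op H n Z x))"
  using hip_cnj[OF D y op_carr[OF M(1) x]] by simp
 also have "... = (\<Sum>k<n. \<Sum>l<n. hip H (Z k l (x l)) (y k))"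
  unfolding M(2)[OF y x] using hip_cnj[OF H dk[OF y] op_carr[OF Z dk[OF x]]] by simp
 also have "... = (\<Sum>k<n. \<Sum>l<n. hip H (x l) (Z l k (y k)))"
  by (intro sum.cong refl) (use adj_right[OF H H Z dk[OF x] dk[OF y]] herm in simp)
 also have "... = (\<Sum>l<n. \<Sum>k<n. hip H (x l) (Z l k (y k)))" by (rule sum.swap)
 finally show ?thesis unfolding M(2)[OF x y] ..
qed

lemma star_rep_sum_of_products:
 assumes H: "complete_ips H" and K: "complete_ips K" and C: "C \<subseteq> bdd_ops H H"
  and p: "star_rep H (commutant H C) K p"
 shows "(!!l. l < n ==> A l \<in> commutant H C) ==> (!!l. l < n ==> B l \<in> commutant H C) ==>
  \<exists>S\<in>commutant H C. (\<forall>x\<in>carr H. S x = hsum H (\<lambda>l. A l (B l x)) n) \<and>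
   (\<forall>y\<in>carr K. p S y = hsum K (\<lambda>l. p (A l) (p (B l) y)) n)"
proof (induction n)
 case 0
 note alg = commutant_algebra[OF H C] and D = star_repD[OF p]
 have "p (op_scale H H 0 (op_id H)) y = hzero K" if "y : carr K" for y
  unfolding D(3)[OF alg(1)] D(6) using that K by (auto simp: op_scale_def op_id_def intro!: hip_ext[OF K])
 moreover have "op_scale H H 0 (op_id H) x = hzero H" if "x : carr H" for x
  using that H by (auto simp: op_scale_def op_id_def intro!: hip_ext[OF H])
 ultimately show ?case using alg(3)[OF alg(1), of 0] by auto
next
 case (Suc n)
 note alg = commutant_algebra[OF H C] and D = star_repD[OF p]
 obtain S where S: "S : commutant H C" "ALL x:carr H. S x = hsum H (\<lambda>l. A l (B l x)) n"
  "ALL y:carr K. p S y = hsum K (\<lambda>l. p (A l) (p (B l) y)) n" using Suc by force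
 have AB: "A n : commutant H C" "B n : commutant H C" using Suc.prems by auto
 note ABc = alg(4)[OF AB]
 show ?case
 proof (intro bexI[of _ "op_add H H S (compose (carr H) (A n) (B n))"] conjI ballI)
  fix y assume y: "y : carr K"
  show "p (op_add H H S (compose (carr H) (A n) (B n))) y = hsum K (\<lambda>l. p (A l) (p (B l) y)) (Suc n)"
   unfolding D(2)[OF S(1) ABc] D(4)[OF AB] using S(3) y by (simp add: op_add_def compose_eq)
 qed (insert S alg(2)[OF S(1) ABc], auto simp: op_add_def compose_eq)
qed

text \<open>A matrix with entries in a commutant has its inverse there, because the inverse commutes with
  the diagonal matrices that have one element of \<open>C\<close> in all diagonal entries.\<close>

lemma commutant_matrix_inverse:
 assumes H: "complete_ips H" and C: "C \<subseteq> bdd_ops H H"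
  and ZA: "\<forall>k<n. \<forall>l<n. Z k l \<in> commutant H C"
  and G: "G \<in> bdd_ops (dsum H n) (dsum H n)"
   "\<forall>x\<in>carr (dsum H n). matrix_op H n Z (G x) = x" "\<forall>x\<in>carr (dsum H n). G (matrix_op H n Z x) = x"
 shows "\<exists>Y. (\<forall>k<n. \<forall>l<n. Y k l \<in> commutant H C) \<and>
  (\<forall>k<n. \<forall>m<n. \<forall>x\<in>carr H. hsum H (\<lambda>l. Y k l (Z l m x)) n = (if k = m then x else hzero H))"
proof -
 let ?D = "dsum H n"
 note cc = carr_closed[OF H] and dk = dsum_comp[of _ H n]
 have D: "complete_ips ?D" by (rule dsum_complete[OF H])
 note Z = ZA[rule_format]
 note Zb = commutantD(1)[OF Z]
 have "ALL k<n. ALL l<n. Z k l : bdd_ops H H" using Zb by blast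
 note M = matrix_op[OF H this]
 define inj where "inj l y = (\<lambda>k\<in>{..<n}. if k = l then y else hzero H)" for l y
 have inj: "inj l y : carr ?D" if "y : carr H" for l y
  using that H by (auto simp: inj_def dsum_simps(1))
 define Y where "Y k l = (\<lambda>y\<in>carr H. G (inj l y) k)" for k l
 have inj_norm: "hnorm ?D (inj l y) <= hnorm H y" if y: "y : carr H" for l y
 proof (rule power2_le_imp_le[OF _ hip_self(3)[OF H y]])
  have "(hnorm ?D (inj l y))\<^sup>2 = (\<Sum>k<n. if k = l then (hnorm H y)\<^sup>2 else 0)"
   unfolding hnorm_dsum(1)[OF H inj[OF y]] by (rule sum.cong) (insert H, auto simp: inj_def)
  then show "(hnorm ?D (inj l y))\<^sup>2 <= (hnorm H y)\<^sup>2" by simp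
 qed
 have Gc: "G z k : carr H" if "z : carr ?D" "k < n" for z k by (rule dk[OF op_carr[OF G(1) that(1)] that(2)])
 obtain g where g: "g >= 0" "!!z. z : carr ?D ==> hnorm ?D (G z) <= g * hnorm ?D z" using bdd_ops_bound[OF D G(1)] by blast
 have Yb: "Y k l : bdd_ops H H" if k: "k < n" for k l
 proof (rule bdd_opsI[where C = g])
  fix y assume y: "y : carr H"
  show "Y k l y : carr H" using Gc[OF inj[OF y] k] y by (simp add: Y_def)
  have "hnorm H (G (inj l y) k) <= hnorm ?D (G (inj l y))"
   by (rule hnorm_dsum(2)[OF H op_carr[OF G(1) inj[OF y]] k])
  also have "... <= g * hnorm H y" using g(2)[OF inj[OF y]] mult_left_mono[OF inj_norm[OF y] g(1)] order_trans by blast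
  finally show "hnorm H (Y k l y) <= g * hnorm H y" using y by (simp add: Y_def)
  fix c
  have "inj l (hscale H c y) = hscale ?D c (inj l y)"
   using y H hip_ext[OF H, of "hzero H" "hscale H c (hzero H)"] by (auto simp: inj_def dsum_simps fun_eq_iff)
  then show "Y k l (hscale H c y) = hscale H c (Y k l y)"
   using y k H bdd_opsD(4)[OF G(1) inj[OF y]] by (simp add: Y_def dsum_simps(4))
  fix z assume z: "z : carr H"
  have "inj l (hadd H y z) = hadd ?D (inj l y) (inj l z)"
   using y z H hip_ext[OF H, of "hzero H" "hadd H (hzero H) (hzero H)"] by (auto simp: inj_def dsum_simps fun_eq_iff)
  then show "Y k l (hadd H y z) = hadd H (Y k l y) (Y k l z)"
   using y z k H bdd_opsD(3)[OF G(1) inj[OF y] inj[OF z]] by (simp add: Y_def dsum_simps(3))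
 qed (simp add: Y_def)
 have diag: "(\<lambda>k\<in>{..<n}. r (z k)) : carr ?D" if "r : C" "z : carr ?D" for r z
  using op_carr[of r H H] dk[OF that(2)] that(1) C by (auto simp: dsum_simps(1))
 have G_diag: "G (\<lambda>k\<in>{..<n}. r (w k)) = (\<lambda>k\<in>{..<n}. r (G w k))" if r: "r : C" and w: "w : carr ?D" for r w
 proof -
  have rb: "r : bdd_ops H H" using r C by auto
  let ?z = "G w"
  have z: "?z : carr ?D" by (rule op_carr[OF G(1) w])
  have "matrix_op H n Z (\<lambda>k\<in>{..<n}. r (?z k)) = (\<lambda>k\<in>{..<n}. r (matrix_op H n Z ?z k))"
  proof (rule dsum_eqI[OF op_carr[OF M(1) diag[OF r z]] diag[OF r op_carr[OF M(1) z]]])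
   fix k assume k: "k < n"
   have s: "hsum H (\<lambda>l. r (Z k l (?z l))) n : carr H"
    by (rule hsum_carr[OF H]) (rule op_carr[OF rb op_carr[OF Zb[OF k] dk[OF z]]])
   have Zr: "r (Z k l (?z l)) = Z k l (r (?z l))" if "l < n" for l
    by (rule commutantD(2)[OF Z[OF k that] r dk[OF z that]])
   have e: "hsum H (\<lambda>l. Z k l ((\<lambda>k\<in>{..<n}. r (?z k)) l)) n = hsum H (\<lambda>l. r (Z k l (?z l))) n"
   proof (rule hip_ext[OF H _ s])
    show "hsum H (\<lambda>l. Z k l ((\<lambda>k\<in>{..<n}. r (?z k)) l)) n : carr H"
     by (rule hsum_carr[OF H]) (rule op_carr[OF Zb[OF k] dk[OF diag[OF r z]]])
    fix v assume v: "v : carr H"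
    show "hip H v (hsum H (\<lambda>l. Z k l ((\<lambda>k\<in>{..<n}. r (?z k)) l)) n) = hip H v (hsum H (\<lambda>l. r (Z k l (?z l))) n)"
     using Zr hip_hsum(1)[OF H v, of n "\<lambda>l. Z k l ((\<lambda>k\<in>{..<n}. r (?z k)) l)"] hip_hsum(1)[OF H v, of n "\<lambda>l. r (Z k l (?z l))"]
      op_carr[OF Zb[OF k] dk[OF diag[OF r z]]] op_carr[OF rb op_carr[OF Zb[OF k] dk[OF z]]]
     by simp
   qed
   show "matrix_op H n Z (\<lambda>k\<in>{..<n}. r (?z k)) k = (\<lambda>k\<in>{..<n}. r (matrix_op H n Z ?z k)) k"
    using k M(3)[OF diag[OF r z] k] M(3)[OF z k] e bdd_ops_hsum[OF H H rb, of n "\<lambda>l. Z k l (?z l)"]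
     op_carr[OF Zb[OF k] dk[OF z]] by simp
  qed
  then have "matrix_op H n Z (\<lambda>k\<in>{..<n}. r (?z k)) = (\<lambda>k\<in>{..<n}. r (w k))" using G(2) w by simp
  then show ?thesis using G(3) diag[OF r z] by metis
 qed
 show ?thesis
 proof (intro exI[of _ Y] conjI allI impI ballI)
  fix k l assume k: "k < n" and l: "l < n"
  show "Y k l : commutant H C"
  proof (rule commutantI[OF Yb[OF k]])
   fix r x assume r: "r : C" and x: "x : carr H"
   have rb: "r : bdd_ops H H" using r C by auto
   have "(\<lambda>k\<in>{..<n}. r (inj l x k)) = inj l (r x)"
    using bdd_ops_zero[OF H H rb] by (auto simp: inj_def fun_eq_iff)
   then show "r (Y k l x) = Y k l (r x)"
    using fun_cong[OF G_diag[OF r inj[OF x, of l]], of k] k x op_carr[OF rb x] by (simp add: Y_def)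
  qed
 next
  fix k m x assume k: "k < n" and m: "m < n" and x: "x : carr H"
  let ?w = "matrix_op H n Z (inj m x)"
  have w: "?w : carr ?D" by (rule op_carr[OF M(1) inj[OF x]])
  have Zx: "Z l m x : carr H" if "l < n" for l by (rule op_carr[OF Zb[OF that m] x])
  have w_eq: "?w l = Z l m x" if l: "l < n" for l
  proof (rule hip_ext[OF H dk[OF w l] Zx[OF l]])
   fix v assume v: "v : carr H"
   have "hip H v (?w l) = (\<Sum>j<n. hip H v (Z l j (inj m x j)))"
    unfolding M(3)[OF inj[OF x] l] by (rule hip_hsum(1)[OF H v]) (rule op_carr[OF Zb[OF l] dk[OF inj[OF x]]])
   also have "... = (\<Sum>j<n. if j = m then hip H v (Z l m x) else 0)"
    by (rule sum.cong[OF refl]) (insert v H bdd_ops_zero[OF H H Zb[OF l]], auto simp: inj_def)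
   finally show "hip H v (?w l) = hip H v (Z l m x)" using m by simp
  qed
  have comp_hsum: "hsum ?D f j k = hsum H (\<lambda>l. f l k) j" for f j
   by (induction j) (insert k, auto simp: dsum_simps)
  have "?w = hsum ?D (\<lambda>l. inj l (?w l)) n"
  proof (rule hip_ext[OF D w])
   show "hsum ?D (\<lambda>l. inj l (?w l)) n : carr ?D" by (rule hsum_carr[OF D]) (rule inj[OF dk[OF w]])
   fix z assume z: "z : carr ?D"
   have "hip ?D z (hsum ?D (\<lambda>l. inj l (?w l)) n) = (\<Sum>l<n. hip ?D z (inj l (?w l)))"
    by (rule hip_hsum(1)[OF D z]) (rule inj[OF dk[OF w]])
   also have "... = (\<Sum>l<n. hip H (z l) (?w l))"
   proof (rule sum.cong[OF refl])
    fix l assume "l : {..<n}"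
    then have "hip ?D z (inj l (?w l)) = (\<Sum>k<n. if k = l then hip H (z l) (?w l) else 0)"
     unfolding dsum_simps by (intro sum.cong refl) (insert H dk[OF z], auto simp: inj_def)
    then show "hip ?D z (inj l (?w l)) = hip H (z l) (?w l)" using \<open>l : {..<n}\<close> by simp
   qed
   finally show "hip ?D z ?w = hip ?D z (hsum ?D (\<lambda>l. inj l (?w l)) n)" by (simp add: dsum_simps)
  qed
  then have "G ?w = hsum ?D (\<lambda>l. G (inj l (?w l))) n"
   using bdd_ops_hsum[OF D D G(1), of n "\<lambda>l. inj l (?w l)"] inj[OF dk[OF w]] by metis
  then have "inj m x k = hsum H (\<lambda>l. G (inj l (?w l)) k) n"
   using G(3) inj[OF x] comp_hsum by metis
  moreover have "hsum H (\<lambda>l. G (inj l (?w l)) k) j = hsum H (\<lambda>l. Y k l (Z l m x)) j" if "j <= n" for j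
   using that by (induction j) (insert w_eq Zx, auto simp: Y_def)
  ultimately show "hsum H (\<lambda>l. Y k l (Z l m x)) n = (if k = m then x else hzero H)"
   using k by (simp add: inj_def)
 qed
qed

lemma matrix_op_shift:
 assumes L: "complete_ips L" and VA: "\<forall>k<n. \<forall>l<n. V k l \<in> bdd_ops L L"
  and WA: "\<forall>k<n. \<forall>l<n. W k l = op_add L L (V k l) (op_scale L L (if k = l then of_real t else 0) (op_id L))"
  and x: "x \<in> carr (dsum L n)"
 shows "matrix_op L n W x = hadd (dsum L n) (matrix_op L n V x) (hscale (dsum L n) (of_real t) x)"
proof -
 note V = VA[rule_format] and W = WA[rule_format]
 have Wb: "ALL k<n. ALL l<n. W k l : bdd_ops L L"
  using W V by (simp add: op_add_bdd op_scale_bdd op_id_bdd L)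
 note LV = matrix_op[OF L VA] and LW = matrix_op[OF L Wb] and dk = dsum_comp[of _ L n]
 have DL: "complete_ips (dsum L n)" by (rule dsum_complete[OF L])
 show ?thesis
 proof (rule hip_ext[OF DL op_carr[OF LW(1) x]])
  show "hadd (dsum L n) (matrix_op L n V x) (hscale (dsum L n) (of_real t) x) : carr (dsum L n)"
   using DL x op_carr[OF LV(1) x] by simp
  fix z assume z: "z : carr (dsum L n)"
  have "hip (dsum L n) z (matrix_op L n W x)
    = (\<Sum>k<n. \<Sum>l<n. hip L (z k) (V k l (x l)) + (if k = l then of_real t * hip L (z k) (x k) else 0))"
   unfolding LW(2)[OF z x] by (intro sum.cong refl)
    (insert W L op_carr[OF V dk[OF x]] dk[OF x] dk[OF z], auto simp: op_add_def op_scale_def op_id_def)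
  also have "... = hip (dsum L n) z (matrix_op L n V x) + of_real t * hip (dsum L n) z x"
   unfolding LV(2)[OF z x] by (simp add: sum.distrib dsum_simps(5) sum_distrib_left)
  finally show "hip (dsum L n) z (matrix_op L n W x)
    = hip (dsum L n) z (hadd (dsum L n) (matrix_op L n V x) (hscale (dsum L n) (of_real t) x))"
   using DL x z op_carr[OF LV(1) x] by simp
 qed
qed

lemma if_zero_scale:
 "complete_ips L ==> x \<in> carr L ==> (if b then x else hzero L) = hscale L (if b then 1 else 0) x"
 by (auto intro!: hip_ext[of L])

text \<open>Positivity of a matrix \<open>Z\<close> means that \<open>Z + t\<close> is invertible for all \<open>t > 0\<close>. The entries of the inverse
  are in the commutant again, so the representation maps it to an inverse of the image of \<open>Z + t\<close>.\<close>

theorem star_rep_completely_positive: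
 fixes n :: nat
 assumes H: "complete_ips H" and K: "complete_ips K" and C: "C \<subseteq> bdd_ops H H"
  and p: "star_rep H (commutant H C) K p"
  and Z: "!!k l. k < n ==> l < n ==> Z k l \<in> commutant H C"
  and herm: "!!k l. k < n ==> l < n ==> adj H H (Z k l) = Z l k"
  and pos: "!!x. (!!k. k < n ==> x k \<in> carr H) ==> 0 \<le> Re (\<Sum>k<n. \<Sum>l<n. hip H (x k) (Z k l (x l)))"
  and y: "!!k. k < n ==> y k \<in> carr K"
 shows "0 \<le> Re (\<Sum>k<n. \<Sum>l<n. hip K (y k) (p (Z k l) (y l)))"
proof -
 let ?D = "dsum H n" and ?E = "dsum K n"
 have D: "complete_ips ?D" and E: "complete_ips ?E" by (rule dsum_complete[OF H], rule dsum_complete[OF K])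
 note alg = commutant_algebra[OF H C] and pD = star_repD[OF p]
 note Zb = commutantD(1)[OF Z] and pb = pD(1)[OF Z]
 have ZA: "ALL k<n. ALL l<n. Z k l : bdd_ops H H" and pA: "ALL k<n. ALL l<n. p (Z k l) : bdd_ops K K"
  using Zb pb by blast+
 note MK = matrix_op[OF K pA]
 have "0 <= Re (hip ?E (restrict y {..<n}) (matrix_op K n (\<lambda>k l. p (Z k l)) (restrict y {..<n})))"
 proof (rule positive_of_spectrum[OF E MK(1)])
  show "hip ?E x (matrix_op K n (\<lambda>k l. p (Z k l)) y) = hip ?E (matrix_op K n (\<lambda>k l. p (Z k l)) x) y"
   if "x : carr ?E" "y : carr ?E" for x y
   by (rule matrix_op_hermitian[OF K pA _ that]) (use pD(5)[OF Z] herm in metis)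
 next
  fix t :: real assume t: "t > 0"
  define Zt where "Zt k l = op_add H H (Z k l) (op_scale H H (if k = l then of_real t else 0) (op_id H))" for k l
  have Zt: "Zt k l : commutant H C" if "k < n" "l < n" for k l
   unfolding Zt_def by (rule alg(2)[OF Z[OF that] alg(3)[OF alg(1)]])
  note Ztb = commutantD(1)[OF Zt]
  have ZtZ: "ALL k<n. ALL l<n. Zt k l = op_add H H (Z k l) (op_scale H H (if k = l then of_real t else 0) (op_id H))"
   by (simp add: Zt_def)
  have ZtA: "ALL k<n. ALL l<n. Zt k l : commutant H C" "ALL k<n. ALL l<n. Zt k l : bdd_ops H H" using Zt Ztb by blast+
  note MT = matrix_op[OF H ZtA(2)]
  have adjT: "ALL k<n. ALL l<n. adj H H (Zt k l) = Zt l k"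
  proof (intro allI impI)
   fix k l assume that: "k < n" "l < n"
   show "adj H H (Zt k l) = Zt l k" unfolding Zt_def
   using adj_add[OF H H Zb[OF that] op_scale_bdd[OF H H op_id_bdd[OF H]]] adj_scale[OF H H op_id_bdd[OF H]] herm[OF that] adj_id[OF H]
    by (cases "k = l") auto
  qed
  obtain G where "G : bdd_ops ?D ?D" "!!x. x : carr ?D ==> matrix_op H n Zt (G x) = x"
   "!!x. x : carr ?D ==> G (matrix_op H n Zt x) = x"
  proof (rule coercive_inverse[OF D MT(1) _ t])
   show "adj ?D ?D (matrix_op H n Zt) = matrix_op H n Zt"
    by (rule adj_unique[OF D D MT(1) MT(1)]) (rule matrix_op_hermitian[OF H ZtA(2) adjT])
   show "t * (hnorm ?D x)\<^sup>2 <= Re (hip ?D x (matrix_op H n Zt x))" if x: "x : carr ?D" for x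
   proof -
    note MZ = matrix_op[OF H ZA]
    have "0 <= Re (hip ?D x (matrix_op H n Z x))"
     unfolding MZ(2)[OF x x] by (rule pos) (rule dsum_comp[OF x])
    then show ?thesis
     using matrix_op_shift[OF H ZA ZtZ x] D x op_carr[OF MZ(1) x] hip_self(2)[OF D x] by simp
   qed
  qed blast
  then have G: "G : bdd_ops ?D ?D" "ALL x:carr ?D. matrix_op H n Zt (G x) = x" "ALL x:carr ?D. G (matrix_op H n Zt x) = x" by auto
  obtain Y where Y0: "ALL k<n. ALL l<n. Y k l : commutant H C"
   "ALL k<n. ALL m<n. ALL x:carr H. hsum H (\<lambda>l. Y k l (Zt l m x)) n = (if k = m then x else hzero H)"
   using commutant_matrix_inverse[OF H C ZtA(1) G] by (elim exE conjE)
  note Y = Y0[rule_format]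
  have YK: "hsum K (\<lambda>l. p (Y k l) (p (Zt l m) z)) n = (if k = m then z else hzero K)"
   if k: "k < n" and m: "m < n" and z: "z : carr K" for k m z
  proof -
   obtain S where S: "S : commutant H C" "ALL x:carr H. S x = hsum H (\<lambda>l. Y k l (Zt l m x)) n"
     "ALL y:carr K. p S y = hsum K (\<lambda>l. p (Y k l) (p (Zt l m) y)) n"
    using star_rep_sum_of_products[OF H K C p, of n "Y k" "\<lambda>l. Zt l m"] Y(1)[OF k] Zt[OF _ m] by blast
   let ?c = "if k = m then 1 else 0 :: complex"
   have "S = op_scale H H ?c (op_id H)"
    using S(2) Y(2)[OF k m] if_zero_scale[OF H, of _ "k = m"]
    by (intro op_eqI[OF commutantD(1)[OF S(1)] op_scale_bdd[OF H H op_id_bdd[OF H]]]) (simp add: op_scale_def op_id_def)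
   then have "p S z = hscale K ?c z" using pD(3)[OF alg(1)] pD(6) z by (simp add: op_scale_def op_id_def)
   then show ?thesis using S(3) z if_zero_scale[OF K z, of "k = m"] by simp
  qed
  note pZt = pD(1)[OF Zt] and pY = pD(1)[OF Y(1)]
  have A: "ALL k<n. ALL l<n. p (Zt k l) : bdd_ops K K" "ALL k<n. ALL l<n. p (Y k l) : bdd_ops K K" using pZt pY by blast+
  note MKt = matrix_op[OF K A(1)] and MKY = matrix_op[OF K A(2)] and dk = dsum_comp[of _ K n]
  have "matrix_op K n (\<lambda>k l. p (Y k l)) (matrix_op K n (\<lambda>k l. p (Zt k l)) x) = x" if x: "x : carr ?E" for x
  proof (rule hip_ext[OF E op_carr[OF MKY(1) op_carr[OF MKt(1) x]] x])
   fix z assume z: "z : carr ?E"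
   let ?u = "matrix_op K n (\<lambda>k l. p (Zt k l)) x"
   note u = op_carr[OF MKt(1) x]
   have Zx: "p (Zt l m) (x m) : carr K" if "l < n" "m < n" for l m by (rule op_carr[OF pZt[OF that] dk[OF x that(2)]])
   have "hip ?E z (matrix_op K n (\<lambda>k l. p (Y k l)) ?u) = (\<Sum>k<n. \<Sum>l<n. hip K (z k) (p (Y k l) (?u l)))"
    by (rule MKY(2)[OF z u])
   also have "... = (\<Sum>k<n. \<Sum>l<n. \<Sum>m<n. hip K (z k) (p (Y k l) (p (Zt l m) (x m))))"
   proof (intro sum.cong refl)
    fix k l assume "k : {..<n}" "l : {..<n}"
    then have k: "k < n" and l: "l < n" by auto
    have e: "p (Y k l) (?u l) = hsum K (\<lambda>m. p (Y k l) (p (Zt l m) (x m))) n"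
     unfolding MKt(3)[OF x l] by (rule bdd_ops_hsum[OF K K pY[OF k l]]) (rule Zx[OF l])
    show "hip K (z k) (p (Y k l) (?u l)) = (\<Sum>m<n. hip K (z k) (p (Y k l) (p (Zt l m) (x m))))"
     unfolding e by (rule hip_hsum(1)[OF K dk[OF z k]]) (rule op_carr[OF pY[OF k l] Zx[OF l]])
   qed
   also have "... = (\<Sum>k<n. \<Sum>m<n. hip K (z k) (if k = m then x m else hzero K))"
   proof (rule sum.cong[OF refl])
    fix k assume "k : {..<n}"
    then have k: "k < n" by simp
    have "(\<Sum>l<n. \<Sum>m<n. hip K (z k) (p (Y k l) (p (Zt l m) (x m)))) = (\<Sum>m<n. \<Sum>l<n. hip K (z k) (p (Y k l) (p (Zt l m) (x m))))"
     by (rule sum.swap)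
    also have "... = (\<Sum>m<n. hip K (z k) (if k = m then x m else hzero K))"
    proof (intro sum.cong refl)
     fix m assume "m : {..<n}"
     then have m: "m < n" by simp
     have "(\<Sum>l<n. hip K (z k) (p (Y k l) (p (Zt l m) (x m)))) = hip K (z k) (hsum K (\<lambda>l. p (Y k l) (p (Zt l m) (x m))) n)"
      by (rule hip_hsum(1)[OF K dk[OF z k], symmetric]) (rule op_carr[OF pY[OF k] Zx[OF _ m]])
     then show "(\<Sum>l<n. hip K (z k) (p (Y k l) (p (Zt l m) (x m)))) = hip K (z k) (if k = m then x m else hzero K)"
      unfolding YK[OF k m dk[OF x m]] .
    qed
    finally show "(\<Sum>l<n. \<Sum>m<n. hip K (z k) (p (Y k l) (p (Zt l m) (x m)))) = (\<Sum>m<n. hip K (z k) (if k = m then x m else hzero K))" .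
   qed
   also have "... = (\<Sum>k<n. \<Sum>m<n. if k = m then hip K (z k) (x k) else 0)"
    by (intro sum.cong refl) (use K dk[OF z] in auto)
   also have "... = hip ?E z x" by (simp add: dsum_simps)
   finally show "hip ?E z (matrix_op K n (\<lambda>k l. p (Y k l)) ?u) = hip ?E z x" .
  qed
  moreover have "matrix_op K n (\<lambda>k l. p (Zt k l)) x
    = hadd ?E (matrix_op K n (\<lambda>k l. p (Z k l)) x) (hscale ?E (of_real t) x)" if x: "x : carr ?E" for x
   by (rule matrix_op_shift[OF K pA _ x]) (insert pD(2)[OF Z alg(3)[OF alg(1)]] pD(3)[OF alg(1)] pD(6), simp add: Zt_def)
  ultimately show "EX G:bdd_ops ?E ?E. ALL x:carr ?E. G (hadd ?E (matrix_op K n (\<lambda>k l. p (Z k l)) x) (hscale ?E (of_real t) x)) = x"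
   using MKY(1) by (metis (no_types, lifting))
 qed (insert y, simp add: dsum_simps(1))
 then show ?thesis
  using MK(2)[of "restrict y {..<n}" "restrict y {..<n}"] y by (simp add: dsum_simps(1))
qed

text \<open>The case of a single entry.\<close>

lemma star_rep_positive:
 assumes H: "complete_ips H" and K: "complete_ips K" and C: "C \<subseteq> bdd_ops H H"
  and p: "star_rep H (commutant H C) K p" and S: "S \<in> commutant H C" "adj H H S = S"
  and pos: "!!x. x \<in> carr H ==> 0 \<le> Re (hip H x (S x))" and y: "y \<in> carr K"
 shows "0 \<le> Re (hip K y (p S y))"
proof -
 have "0 <= Re (\<Sum>k<1::nat. \<Sum>l<1::nat. hip K y (p S y))"
 proof (rule star_rep_completely_positive[OF H K C p])
  show "0 <= Re (\<Sum>k<1::nat. \<Sum>l<1. hip H (x k) (S (x l)))" if "!!k. k < 1 ==> x k : carr H" for x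
   using pos that by simp
 qed (use S y in auto)
 then show ?thesis by simp
qed

lemma hip_rank_one_perturbation:
 fixes t :: real
 assumes H: "complete_ips H" and X: "X \<in> self_adjoint_ops H" and u: "u \<in> carr H"
 defines "Y \<equiv> \<lambda>y\<in>carr H. hadd H (X y) (hscale H (complex_of_real t * hip H u y) u)"
 shows "Y \<in> self_adjoint_ops H"
  and "y \<in> carr H ==> Re (hip H y (Y y)) = Re (hip H y (X y)) + t * (cmod (hip H u y))\<^sup>2"
proof -
 have Xb: "X : bdd_ops H H" and Xa: "adj H H X = X" using X by (auto simp: self_adjoint_ops_def)
 note Xc = op_carr[OF Xb]
 obtain c where c: "c >= 0" "!!y. y : carr H ==> hnorm H (X y) <= c * hnorm H y" using bdd_ops_bound[OF H Xb] by blast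
 have Yy: "Y y = hadd H (X y) (hscale H (of_real t * hip H u y) u)" if "y : carr H" for y using that by (simp add: Y_def)
 have Yb: "Y : bdd_ops H H"
 proof (rule bdd_opsI[where C = "c + \<bar>t\<bar> * hnorm H u * hnorm H u"])
  fix y assume y: "y : carr H"
  have "hnorm H (Y y) <= c * hnorm H y + (\<bar>t\<bar> * cmod (hip H u y)) * hnorm H u"
   unfolding Yy[OF y] using hnorm_triangle[OF H Xc[OF y], of "hscale H (of_real t * hip H u y) u"] c(2)[OF y] hnorm_scale[OF H u] H u
   by (simp add: norm_mult)
  also have "... <= c * hnorm H y + (\<bar>t\<bar> * (hnorm H u * hnorm H y)) * hnorm H u"
   using Cauchy_Schwarz[OF H u y] hip_self(3)[OF H u] by (intro add_left_mono mult_right_mono mult_left_mono) auto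
  finally show "hnorm H (Y y) <= (c + \<bar>t\<bar> * hnorm H u * hnorm H u) * hnorm H y" by (simp add: algebra_simps)
  show "Y y : carr H" using Yy[OF y] Xc[OF y] H u by simp
  fix a show "Y (hscale H a y) = hscale H a (Y y)"
   using y u H Xc[OF y] by (intro hip_ext[OF H]) (simp_all add: Yy bdd_opsD(4)[OF Xb] algebra_simps)
  fix z assume z: "z : carr H"
  show "Y (hadd H y z) = hadd H (Y y) (Y z)"
   using y z u H Xc[OF y] Xc[OF z] by (intro hip_ext[OF H]) (simp_all add: Yy bdd_opsD(3)[OF Xb] algebra_simps)
 qed (simp add: Y_def)
 have "adj H H Y = Y"
 proof (rule adj_unique[OF H H Yb Yb])
  fix x y assume x: "x : carr H" and y: "y : carr H"
  have "hip H y (X x) = hip H (X y) x" using adj_left[OF H H Xb x y] Xa by simp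
  then show "hip H y (Y x) = hip H (Y y) x"
   using x y u H Xc[OF x] Xc[OF y] hip_cnj[OF H u y] by (simp add: Yy)
 qed
 then show "Y : self_adjoint_ops H" using Yb by (simp add: self_adjoint_ops_def)
 assume y: "y : carr H"
 have "hip H u y * hip H y u = of_real ((cmod (hip H u y))\<^sup>2)"
  using hip_cnj[OF H u y] complex_norm_square[of "hip H u y"] by simp
 then have "hip H y (Y y) = hip H y (X y) + of_real (t * (cmod (hip H u y))\<^sup>2)"
  using y u H Xc[OF y] by (simp add: Yy mult.assoc)
 then show "Re (hip H y (Y y)) = Re (hip H y (X y)) + t * (cmod (hip H u y))\<^sup>2" by simp
qed

text \<open>Vigier's theorem: a directed set of self-adjoint operators converges weakly to its supremum \<open>X\<close>.
  The net \<open>(X - S) x\<close> is Cauchy, since \<open>T - S\<close> is positive for \<open>S \<le> T\<close> and so the norm of \<open>(T - S) x\<close> is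
  controlled by the increasing bounded numbers \<open>\<langle>x, S x\<rangle>\<close>. If its limit \<open>u\<close> were not orthogonal to
  \<open>z\<close>, subtracting a small multiple of the projection onto \<open>u\<close> from \<open>X\<close> would give a smaller upper
  bound.\<close>

theorem Vigier:
 fixes H :: "('v, 'a) hilb_scheme"
 assumes H: "complete_ips H" and D: "D \<noteq> {}" "D \<subseteq> self_adjoint_ops H"
  and dir: "!!S T. S \<in> D ==> T \<in> D ==> \<exists>W\<in>D. op_le H S W \<and> op_le H T W"
  and lub: "op_lub H D X" and x: "x \<in> carr H" and z: "z \<in> carr H" and e: "e > 0"
 shows "\<exists>S\<in>D. Re (hip H z (hdiff H (X x) (S x))) < e"
proof (rule ccontr)
 define q where "q S y = Re (hip H y (S y))" for S y
 assume "\<not> (EX S:D. Re (hip H z (hdiff H (X x) (S x))) < e)"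
 then have gap: "e <= Re (hip H z (hdiff H (X x) (S x)))" if "S : D" for S using that by force
 have X: "X : self_adjoint_ops H" and upper: "!!S. S : D ==> op_le H S X"
  and least: "!!Y. Y : self_adjoint_ops H ==> (!!S. S : D ==> op_le H S Y) ==> op_le H X Y"
  using lub by (auto simp: op_lub_def)
 have sb: "S : bdd_ops H H" if "S : self_adjoint_ops H" for S using that by (simp add: self_adjoint_ops_def)
 have le: "op_le H S T \<longleftrightarrow> (ALL y:carr H. q S y <= q T y)" for S T by (simp add: op_le_def q_def)
 obtain S0 where S0: "S0 : D" using D by blast
 define D0 where "D0 = {S : D. op_le H S0 S}"
 have D0: "S : D" "S : self_adjoint_ops H" "op_le H S0 S" "op_le H S X" if "S : D0" for S
  using that D upper by (auto simp: D0_def)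
 have dir0: "EX W:D0. op_le H S W & op_le H T W" if "S : D" "T : D0" for S T
  using dir[OF that(1) D0(1)[OF that(2)]] D0(3)[OF that(2)] by (fastforce simp: D0_def le)
 note S0b = sb[OF D(2)[THEN subsetD, OF S0]] and Xb = sb[OF X]
 obtain c1 c2 where c1: "c1 >= 0" "!!x. x : carr H ==> hnorm H (X x) <= c1 * hnorm H x"
  and c2: "c2 >= 0" "!!x. x : carr H ==> hnorm H (S0 x) <= c2 * hnorm H x"
  using bdd_ops_bound[OF H Xb] bdd_ops_bound[OF H S0b] by metis
 define c where "c = c1 + c2 + 1"
 have c: "c > 0" using c1 c2 by (simp add: c_def)
 have qb: "\<bar>q S y\<bar> <= k * (hnorm H y)\<^sup>2" if "S : bdd_ops H H" "hnorm H (S y) <= k * hnorm H y" "y : carr H" for S y k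
 proof -
  have "\<bar>q S y\<bar> <= hnorm H y * hnorm H (S y)"
   unfolding q_def using Cauchy_Schwarz[OF H that(3) op_carr[OF that(1,3)]] abs_Re_le_cmod order_trans by blast
  also have "... <= hnorm H y * (k * hnorm H y)" using that(2) hip_self(3)[OF H that(3)] by (intro mult_left_mono)
  finally show ?thesis by (simp add: power2_eq_square mult_ac)
 qed
 have width: "q X y - q S0 y <= c * (hnorm H y)\<^sup>2" if y: "y : carr H" for y
  using qb[OF Xb c1(2)[OF y] y] qb[OF S0b c2(2)[OF y] y] zero_le_power2[of "hnorm H y"] unfolding c_def distrib_right by linarith
 have sq: "(hdist H (T y) (S y))\<^sup>2 <= c * (q T y - q S y)"
  if ST: "S : D0" "T : D0 \<or> T = X" "op_le H S T" and y: "y : carr H" for S T y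
 proof -
  have T: "T : self_adjoint_ops H" "op_le H T X" using ST(2) D0(2,4) X by (auto simp: op_le_def)
  note S = D0(2)[OF ST(1)]
  define B where "B = op_add H H T (op_scale H H (-1) S)"
  have B: "B : bdd_ops H H" unfolding B_def by (intro op_add_bdd op_scale_bdd H sb S T)
  have By: "B y = hdiff H (T y) (S y)" if "y : carr H" for y using that by (simp add: B_def op_add_def op_scale_def hdiff_def)
  note Tc = op_carr[OF sb[OF T(1)]] and Sc = op_carr[OF sb[OF S]]
  have qB: "Re (hip H y (B y)) = q T y - q S y" if "y : carr H" for y
   using that H Tc Sc by (simp add: By q_def)
  have sym: "hip H x (R y) = hip H (R x) y" if "R : self_adjoint_ops H" "x : carr H" "y : carr H" for R x y
   using adj_left[OF H H sb[OF that(1)] that(3,2)] that(1) by (simp add: self_adjoint_ops_def)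
  have "(hnorm H (B y))\<^sup>2 <= c * Re (hip H y (B y))"
  proof (rule positive_op_square[OF H B _ _ c _ y])
   show "hip H x (B y) = hip H (B x) y" if "x : carr H" "y : carr H" for x y
    using that H Tc Sc sym[OF T(1) that] sym[OF S that] by (simp add: By)
   show "0 <= Re (hip H x (B x))" if "x : carr H" for x using qB[OF that] ST(3) that by (simp add: le)
   show "Re (hip H x (B x)) <= c * (hnorm H x)\<^sup>2" if "x : carr H" for x
    using qB[OF that] width[OF that] T(2) D0(3)[OF ST(1)] that unfolding le by fastforce
  qed
  then show ?thesis using By[OF y] qB[OF y] by simp
 qed
 define s where "s = (SUP S\<in>D0. q S x)"
 have S0D: "S0 : D0" using S0 by (simp add: D0_def op_le_def)
 have bdd: "bdd_above ((\<lambda>S. q S x) ` D0)"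
  using D0(4) x by (intro bdd_aboveI2[where M = "q X x"]) (auto simp: le)
 have "EX S:D0. s - 1 / (real n + 1) < q S x" for n
  using less_cSUP_iff[of D0 "\<lambda>S. q S x" "s - 1 / (real n + 1)"] bdd S0D unfolding s_def[symmetric] by fastforce
 then obtain F where F: "!!n. F n : D0" "!!n. s - 1 / (real n + 1) < q (F n) x" by metis
 have near: "hdist H (T x) (F n x) <= sqrt (c / (real n + 1))" if T: "T : D0" "op_le H (F n) T" for T n
 proof (rule real_le_rsqrt)
  have "q T x <= s" unfolding s_def by (rule cSUP_upper[OF T(1) bdd])
  then have "q T x - q (F n) x <= 1 / (real n + 1)" using F(2)[of n] by linarith
  then have "c * (q T x - q (F n) x) <= c / (real n + 1)" using mult_left_mono[of "q T x - q (F n) x" "1 / (real n + 1)" c] c by simp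
  then show "(hdist H (T x) (F n x))\<^sup>2 <= c / (real n + 1)"
   using sq[OF F(1) _ T(2) x] T(1) by fastforce
 qed
 have lim0: "(\<lambda>n. sqrt (c / (real n + 1))) \<longlonglongrightarrow> 0"
  using tendsto_real_sqrt[OF LIMSEQ_Suc[OF lim_const_over_n[of c]]] by (simp add: add.commute)
 note Fc = op_carr[OF sb[OF D0(2)[OF F(1)]] x]
 have "EX M. ALL m>=M. ALL n>=M. hdist H (F m x) (F n x) < r" if r: "r > 0" for r
 proof -
  obtain M where M: "!!n. n >= M ==> sqrt (c / (real n + 1)) < r / 2"
   using order_tendstoD(2)[OF lim0, of "r / 2"] r by (auto simp: eventually_sequentially)
  have "hdist H (F m x) (F n x) < r" if "m >= M" "n >= M" for m n
  proof -
   obtain W where W: "W : D0" "op_le H (F m) W" "op_le H (F n) W" using dir0[OF D0(1)[OF F(1)] F(1)] by blast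
   note Wc = op_carr[OF sb[OF D0(2)[OF W(1)]] x]
   have "hdist H (F m x) (F n x) <= hdist H (F m x) (W x) + hdist H (W x) (F n x)"
    by (rule hnorm_triangle_diff[OF H Fc Wc Fc])
   then show ?thesis using near[OF W(1,2)] near[OF W(1,3)] hnorm_swap[OF H Fc Wc, of m] M[OF that(1)] M[OF that(2)] by linarith
  qed
  then show ?thesis by blast
 qed
 then obtain v where v: "v : carr H" "(\<lambda>n. hdist H (F n x) v) \<longlonglongrightarrow> 0"
  using H Fc unfolding complete_ips_def by (elim conjE allE[of _ "\<lambda>n. F n x"]) auto
 note Xx = op_carr[OF Xb x]
 define u where "u = hdiff H (X x) v"
 have u: "u : carr H" using H Xx v by (simp add: u_def)
 have ulim: "(\<lambda>n. hip H (hdiff H (X x) (F n x)) y) \<longlonglongrightarrow> hip H u y" if y: "y : carr H" for y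
  using tendsto_diff[OF tendsto_const hip_tendsto(2)[OF H Fc v(1) y v(2)], of "hip H (X x) y"] y H Xx Fc v by (simp add: u_def)
 have uz: "e <= cmod (hip H u z)"
 proof (rule LIMSEQ_le_const[OF tendsto_norm[OF ulim[OF z]]])
  have "e <= cmod (hip H (hdiff H (X x) (F n x)) z)" for n
  proof -
   let ?d = "hdiff H (X x) (F n x)"
   have "cmod (hip H z ?d) = cmod (hip H ?d z)"
    using hip_cnj[OF H carr_closed(4)[OF H Xx Fc] z, of n] complex_mod_cnj[of "hip H ?d z"] by simp
   then show ?thesis using gap[OF D0(1)[OF F(1)], of n] complex_Re_le_cmod[of "hip H z ?d"] by linarith
  qed
  then show "EX N. ALL n>=N. e <= cmod (hip H (hdiff H (X x) (F n x)) z)" by blast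
 qed
 define M where "M = c * (hnorm H x)\<^sup>2 + 1"
 have M: "M > 0" using c by (simp add: M_def add_nonneg_pos)
 (* so that X minus the projection onto u, scaled by 1 / M, is still an upper bound *)
 have bound: "(cmod (hip H u y))\<^sup>2 <= M * (q X y - q S y)" if S: "S : D" and y: "y : carr H" for S y
 proof -
  define b where "b = sqrt (M * (q X y - q S y))"
  have b2: "0 <= M * (q X y - q S y)" using upper[OF S] y M by (simp add: le)
  have "cmod (hip H u y) <= b + 0 * hnorm H y"
  proof (rule LIMSEQ_le[OF tendsto_norm[OF ulim[OF y]] tendsto_add[OF tendsto_const tendsto_mult[OF lim0 tendsto_const]]])
   have "cmod (hip H (hdiff H (X x) (F n x)) y) <= b + sqrt (c / (real n + 1)) * hnorm H y" for n
   proof -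
    obtain T where T: "T : D0" "op_le H S T" "op_le H (F n) T" using dir0[OF S F(1)] by blast
    note Ts = D0(2)[OF T(1)]
    note Tc = op_carr[OF sb[OF Ts]] and Xc = op_carr[OF Xb]
    have "hip H (hdiff H (X x) (T x)) y = hip H x (hdiff H (X y) (T y))"
     using H x y Tc Xc adj_left[OF H H Xb y x] adj_left[OF H H sb[OF Ts] y x] X Ts by (simp add: self_adjoint_ops_def)
    then have "(cmod (hip H (hdiff H (X x) (T x)) y))\<^sup>2 <= (hnorm H x * hdist H (X y) (T y))\<^sup>2"
     using Cauchy_Schwarz[OF H x, of "hdiff H (X y) (T y)"] H y Tc Xc by (intro power_mono) auto
    also have "... <= (hnorm H x)\<^sup>2 * (c * (q X y - q T y))"
     unfolding power_mult_distrib by (rule mult_left_mono[OF sq[OF T(1) _ D0(4)[OF T(1)] y]]) auto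
    also have "... <= M * (q X y - q T y)"
     using D0(4)[OF T(1)] y by (simp add: M_def le algebra_simps)
    also have "... <= M * (q X y - q S y)" using M T(2) y by (simp add: le)
    finally have 1: "cmod (hip H (hdiff H (X x) (T x)) y) <= b" unfolding b_def by (rule real_le_rsqrt)
    have 2: "cmod (hip H (hdiff H (T x) (F n x)) y) <= sqrt (c / (real n + 1)) * hnorm H y"
     using Cauchy_Schwarz[OF H _ y, of "hdiff H (T x) (F n x)"] mult_right_mono[OF near[OF T(1,3)] hip_self(3)[OF H y]] H Tc[OF x] Fc
     by fastforce
    have "hip H (hdiff H (X x) (F n x)) y = hip H (hdiff H (X x) (T x)) y + hip H (hdiff H (T x) (F n x)) y"
     using H x y Tc Xc Fc by simp
    then show ?thesis using 1 2 norm_triangle_ineq[of "hip H (hdiff H (X x) (T x)) y" "hip H (hdiff H (T x) (F n x)) y"] by simp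
   qed
   then show "EX N. ALL n>=N. cmod (hip H (hdiff H (X x) (F n x)) y) <= b + sqrt (c / (real n + 1)) * hnorm H y" by blast
  qed
  then have "(cmod (hip H u y))\<^sup>2 <= b\<^sup>2" by (intro power_mono) auto
  then show ?thesis using b2 by (simp add: b_def)
 qed
 define Y where "Y = (\<lambda>y\<in>carr H. hadd H (X y) (hscale H (complex_of_real (- 1 / M) * hip H u y) u))"
 note Y = hip_rank_one_perturbation[where t = "- 1 / M", OF H X u, folded Y_def]
 have qY: "q Y y = q X y - (cmod (hip H u y))\<^sup>2 / M" if "y : carr H" for y using Y(2)[OF that] by (simp add: q_def)
 have "op_le H X Y"
 proof (rule least[OF Y(1)])
  fix S assume S: "S : D"
  show "op_le H S Y" unfolding le
  proof
   fix y assume y: "y : carr H"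
   have "(cmod (hip H u y))\<^sup>2 / M <= q X y - q S y"
    using bound[OF S y] M by (simp add: divide_le_eq mult.commute)
   then show "q S y <= q Y y" using qY[OF y] by simp
  qed
 qed
 then have "(cmod (hip H u z))\<^sup>2 / M <= 0" using qY[OF z] z unfolding le by fastforce
 then show False using uz e M by (simp add: divide_le_0_iff)
qed

text \<open>The operator \<open>W\<close> turns matrix coefficients of \<open>p\<close> at \<open>\<eta>\<close> into matrix coefficients of the commutant, where
  suprema are weak limits by Vigier's theorem. Density extends the inequality from \<open>V\<close> to all vectors.\<close>

lemma star_rep_normal:
 assumes H: "complete_ips H" and K: "complete_ips K" and C: "C \<subseteq> bdd_ops H H"
  and p: "star_rep H (commutant H C) K p" and V: "hdense K V"
  and W: "!!\<eta>. \<eta> \<in> V ==> \<exists>W\<in>bdd_ops H K. \<exists>e\<in>carr H. \<forall>S\<in>commutant H C. W (S e) = p S \<eta>"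
 shows "normal_rep H (commutant H C) K p"
proof -
 let ?M = "commutant H C"
 note alg = commutant_algebra[OF H C] and pD = star_repD[OF p] and cD = commutantD[of _ H C]
 have "op_lub K (p ` D) (p X)"
  if D: "D ~= {}" "D <= ?M \<inter> self_adjoint_ops H" and dir: "ALL S:D. ALL T:D. EX W:D. op_le H S W & op_le H T W"
   and X: "X : ?M" and lub: "op_lub H D X" for D X
 proof -
  have Xs: "X : self_adjoint_ops H" and upper: "!!S. S : D ==> op_le H S X" using lub by (auto simp: op_lub_def)
  have DM: "S : ?M" "adj H H S = S" if "S : D" for S using D that by (auto simp: self_adjoint_ops_def)
  have Xa: "adj H H X = X" using Xs by (simp add: self_adjoint_ops_def)
  have pX: "p X : self_adjoint_ops K" using pD(1,5)[OF X] Xa by (simp add: self_adjoint_ops_def)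
  note pXc = op_carr[OF pD(1)[OF X]]
  have pc: "p S \<eta> : carr K" if "S : D" "\<eta> : carr K" for S \<eta> by (rule op_carr[OF pD(1)[OF DM(1)[OF that(1)]] that(2)])
  have 1: "op_le K (p S) (p X)" if S: "S : D" for S
   unfolding op_le_def
  proof
   fix y assume y: "y : carr K"
   let ?B = "op_add H H X (op_scale H H (-1) S)"
   have BM: "?B : ?M" by (rule alg(2)[OF X alg(3)[OF DM(1)[OF S]]])
   have "0 <= Re (hip K y (p ?B y))"
   proof (rule star_rep_positive[OF H K C p BM _ _ y])
    show "adj H H ?B = ?B"
     using adj_add[OF H H cD(1)[OF X] op_scale_bdd[OF H H cD(1)[OF DM(1)[OF S]]]] adj_scale[OF H H cD(1)[OF DM(1)[OF S]]] Xa DM(2)[OF S] by simp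
    fix x assume x: "x : carr H"
    show "0 <= Re (hip H x (?B x))"
     using upper[OF S] x H op_carr[OF cD(1)[OF X] x] op_carr[OF cD(1)[OF DM(1)[OF S]] x]
     by (simp add: op_add_def op_scale_def op_le_def)
   qed
   then show "Re (hip K y (p S y)) <= Re (hip K y (p X y))"
    unfolding pD(2)[OF X alg(3)[OF DM(1)[OF S]]] pD(3)[OF DM(1)[OF S]]
    using y K pXc[OF y] pc[OF S y] by (simp add: op_add_def op_scale_def)
  qed
  have "op_le K (p X) Y" if Y: "Y : self_adjoint_ops K" and uY: "!!S. S : D ==> op_le K (p S) Y" for Y
  proof -
   have Yb: "Y : bdd_ops K K" using Y by (simp add: self_adjoint_ops_def)
   note Yc = op_carr[OF Yb]
   define T where "T = op_add K K Y (op_scale K K (-1) (p X))"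
   have T: "T : bdd_ops K K" unfolding T_def by (intro op_add_bdd op_scale_bdd K Yb pD(1) X)
   have Ty: "T y = hdiff K (Y y) (p X y)" if "y : carr K" for y using that by (simp add: T_def op_add_def op_scale_def hdiff_def)
   have onV: "0 <= Re (hip K \<eta> (T \<eta>))" if \<eta>V: "\<eta> : V" for \<eta>
   proof -
    have \<eta>: "\<eta> : carr K" using V \<eta>V by (auto simp: hdense_def)
    obtain W e where W: "W : bdd_ops H K" and e: "e : carr H" and We: "!!S. S : ?M ==> W (S e) = p S \<eta>" using W[OF \<eta>V] by blast
    have "W (op_id H e) = p (op_id H) \<eta>" by (rule We[OF alg(1)])
    then have We1: "W e = \<eta>" using e \<eta> pD(6) by (simp add: op_id_def)
    define z where "z = adj H K W (W e)"
    have z: "z : carr H" using adj_bdd[OF H K W] \<eta> We1 by (simp add: z_def op_carr)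
    note pull = adj_left[OF H K W _ \<eta>, folded We1, folded z_def]
    show ?thesis
    proof (rule ccontr)
     assume neg: "\<not> 0 <= Re (hip K \<eta> (T \<eta>))"
     define d where "d = - Re (hip K \<eta> (T \<eta>))"
     have d: "d > 0" using neg by (simp add: d_def)
     have Dsa: "D <= self_adjoint_ops H" using D by blast
     obtain S where S: "S : D" "Re (hip H z (hdiff H (X e) (S e))) < d"
      using Vigier[OF H D(1) Dsa dir[rule_format] lub e z d] by blast
     note Sb = cD(1)[OF DM(1)[OF S(1)]]
     have "d <= Re (hip K \<eta> (p X \<eta>)) - Re (hip K \<eta> (p S \<eta>))"
      using uY[OF S(1)] \<eta> K Yc[OF \<eta>] pXc[OF \<eta>] unfolding d_def op_le_def by (simp add: Ty)
     also have "... = Re (hip H z (hdiff H (X e) (S e)))"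
      using pull[OF op_carr[OF cD(1)[OF X] e]] pull[OF op_carr[OF Sb e]] We[OF X] We[OF DM(1)[OF S(1)]] We1
       H z op_carr[OF cD(1)[OF X] e] op_carr[OF Sb e] by simp
     finally show False using S(2) by simp
    qed
   qed
   obtain k where k: "k >= 0" "!!y. y : carr K ==> hnorm K (T y) <= k * hnorm K y" using bdd_ops_bound[OF K T] by blast
   show ?thesis
    unfolding op_le_def
   proof
    fix y assume y: "y : carr K"
    note Tc = op_carr[OF T]
    have "- (k * (2 * hnorm K y + 1)) * r <= Re (hip K y (T y))" if r: "0 < r" "r < 1" for r
    proof -
     obtain v where v: "v : V" "hdist K y v < r" using V y r(1) unfolding hdense_def by blast
     have vc: "v : carr K" using V v by (auto simp: hdense_def)
     let ?d = "hdiff K y v"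
     have d: "?d : carr K" using y vc K by simp
     have nv: "hnorm K v <= hnorm K y + 1" using hnorm_le_diff[OF K vc y] hnorm_swap[OF K vc y] v(2) r by simp
     have n0: "0 <= hnorm K y" "0 <= hnorm K v" "0 <= hnorm K ?d" by (rule hip_self(3)[OF K], fact)+
     have "cmod (hip K ?d (T y)) <= hnorm K ?d * (k * hnorm K y)"
      using Cauchy_Schwarz[OF K d Tc[OF y]] mult_left_mono[OF k(2)[OF y] n0(3)] by linarith
     also have "... <= r * (k * hnorm K y)" using v(2) k(1) n0 by (intro mult_right_mono) auto
     finally have 1: "- (r * (k * hnorm K y)) <= Re (hip K ?d (T y))"
      using abs_Re_le_cmod[of "hip K ?d (T y)"] by linarith
     have "cmod (hip K v (T ?d)) <= hnorm K v * (k * hnorm K ?d)"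
      using Cauchy_Schwarz[OF K vc Tc[OF d]] mult_left_mono[OF k(2)[OF d] n0(2)] by linarith
     also have "... <= (hnorm K y + 1) * (k * r)" using v(2) k(1) n0 nv by (intro mult_mono) (auto intro: mult_left_mono)
     finally have 2: "- ((hnorm K y + 1) * (k * r)) <= Re (hip K v (T ?d))"
      using abs_Re_le_cmod[of "hip K v (T ?d)"] by linarith
     have "hip K y (T y) = hip K v (T v) + hip K ?d (T y) + hip K v (T ?d)"
      using y vc K Tc[OF y] Tc[OF vc] bdd_ops_diff[OF K T y vc] by simp
     then show ?thesis using 1 2 onV[OF v(1)] by (simp add: algebra_simps)
    qed
    then have ev: "\<forall>\<^sub>F r in at_right 0. - (k * (2 * hnorm K y + 1)) * r <= Re (hip K y (T y))"
     by (auto simp: eventually_at_right_field intro!: exI[of _ 1])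
    have "((\<lambda>r. - (k * (2 * hnorm K y + 1)) * r) \<longlongrightarrow> - (k * (2 * hnorm K y + 1)) * 0) (at_right 0)"
     by (intro tendsto_intros)
    then have "- (k * (2 * hnorm K y + 1)) * 0 <= Re (hip K y (T y))"
     by (rule tendsto_upperbound[OF _ ev]) simp
    then show "Re (hip K y (p X y)) <= Re (hip K y (Y y))" using y K Yc[OF y] pXc[OF y] by (simp add: Ty)
   qed
  qed
  then show ?thesis unfolding op_lub_def using pX 1 by blast
 qed
 then show ?thesis unfolding normal_rep_def using p unfolding star_rep_def by blast
qed

section \<open>Fields of a C*-Frobenius algebra\<close>

text \<open>Both relations express \<open>M\<^sup>* M\<close>, which is self-adjoint, as \<open>C A\<^sup>*\<close> and as \<open>A C\<^sup>*\<close>.\<close>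

lemma adjoint_square_swap:
 assumes P: "complete_ips P" and R: "complete_ips R" and K: "complete_ips K"
  and A: "A \<in> bdd_ops P R" and C: "C \<in> bdd_ops P R" and M: "M \<in> bdd_ops R K"
  and sq: "!!w. w \<in> carr R ==> C (adj P R A w) = adj R K M (M w)" and w: "w \<in> carr R"
 shows "A (adj P R C w) = adj R K M (M w)"
proof (rule hip_ext[OF R])
 note Ac = op_carr[OF adj_bdd[OF P R A]] and Cc = op_carr[OF adj_bdd[OF P R C]] and Mc = op_carr[OF M]
 show "A (adj P R C w) : carr R" by (rule op_carr[OF A Cc[OF w]])
 show "adj R K M (M w) : carr R" by (rule op_carr[OF adj_bdd[OF R K M] Mc[OF w]])
 fix v assume v: "v : carr R"
 have "hip R v (A (adj P R C w)) = hip P (adj P R A v) (adj P R C w)" by (rule adj_left[OF P R A Cc[OF w] v, symmetric])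
 also have "... = hip R (adj R K M (M v)) w" using adj_right[OF P R C Ac[OF v] w] sq[OF v] by simp
 also have "... = hip K (M v) (M w)" by (rule adj_left[OF R K M w Mc[OF v]])
 also have "... = hip R v (adj R K M (M w))" by (rule adj_right[OF R K M v Mc[OF w], symmetric])
 finally show "hip R v (A (adj P R C w)) = hip R v (adj R K M (M w))" .
qed

locale frobenius_extension = moebius_extension N E
 for N :: "'v net" and E :: "'v cat_ext" +
 fixes Q :: "'v frob"
 assumes Q: "cstar_frobenius_algebra N E Q"
begin

abbreviation a :: "'v amod" where "a \<equiv> fobj Q"
abbreviation \<mu> :: "'v \<Rightarrow> 'v" where "\<mu> \<equiv> fmu Q"
abbreviation \<iota> :: "'v \<Rightarrow> 'v" where "\<iota> \<equiv> fiota Q"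
abbreviation e :: 'v where "e \<equiv> fiota Q (Omega N)"

text \<open>The operators \<open>\<mu>\<^sub>i L(\<xi>)\<close>; those of \<open>a\<close> itself are the elements of \<open>BQ\<close>. Acting with them on \<open>e\<close> recovers \<open>\<xi>\<close>,
  so that computations in \<open>BQ\<close> become computations with localised vectors.\<close>

definition field :: "'v amod \<Rightarrow> ('v \<Rightarrow> 'v) \<Rightarrow> argint \<Rightarrow> 'v \<Rightarrow> 'v \<Rightarrow> 'v" where
 "field i m I \<xi> = compose (carr i) m (Lop E a i \<xi> I)"

definition right_field :: "'v amod \<Rightarrow> ('v \<Rightarrow> 'v) \<Rightarrow> argint \<Rightarrow> 'v \<Rightarrow> 'v \<Rightarrow> 'v" where
 "right_field i m J \<eta> = compose (carr a) m (Rop E i a \<eta> J)"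

lemma a: "A_module N a" and \<mu>: "\<mu> \<in> Hom_A N (a \<otimes> a) a" and \<iota>: "\<iota> \<in> Hom_A N (vac N) a"
 and right_unit: "v \<in> carr (a \<otimes> vac N) ==> \<mu> (lwhisk E a (vac N) a \<iota> v) = runit E a v"
proof -
 show "A_module N a" "\<mu> : Hom_A N (a \<otimes> a) a" "\<iota> : Hom_A N (vac N) a"
  using Q unfolding cstar_frobenius_algebra_def Let_def by blast+
 assume v: "v : carr (a \<otimes> vac N)"
 have "compose (carr (a \<otimes> vac N)) \<mu> (lwhisk E a (vac N) a \<iota>) = runit E a"
  using Q unfolding cstar_frobenius_algebra_def Let_def by blast
 from fun_cong[OF this, of v] show "\<mu> (lwhisk E a (vac N) a \<iota> v) = runit E a v" using v by (simp add: compose_eq)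
qed

lemma regular_module: "(a, \<mu>) \<in> left_modules N E Q"
 using Q unfolding cstar_frobenius_algebra_def left_modules_def Let_def by blast

lemma left_moduleD:
 assumes X: "(i, m) \<in> left_modules N E Q"
 shows "A_module N i" "m \<in> Hom_A N (a \<otimes> i) i"
  and "v \<in> carr (vac N \<otimes> i) ==> m (rwhisk E (vac N) a \<iota> i v) = lunit E i v"
  and "v \<in> carr ((a \<otimes> a) \<otimes> i) ==>
   m (lwhisk E a (a \<otimes> i) i m (assoc E a a i v)) = m (rwhisk E (a \<otimes> a) a \<mu> i v)"
  and "w \<in> carr (a \<otimes> i) ==>
   lwhisk E a (a \<otimes> i) i m (assoc E a a i (rwhisk E a (a \<otimes> a) (adj (a \<otimes> a) a \<mu>) i w))
    = adj (a \<otimes> i) i m (m w)"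
proof -
 let ?P = "(a \<otimes> a) \<otimes> i" and ?R = "a \<otimes> i"
 let ?A = "compose (carr ?P) (lwhisk E a ?R i m) (assoc E a a i)" and ?C = "rwhisk E (a \<otimes> a) a \<mu> i"
 show i: "A_module N i" and m: "m : Hom_A N ?R i"
  using X unfolding left_modules_def Let_def by blast+
 have unit: "compose (carr (vac N \<otimes> i)) m (rwhisk E (vac N) a \<iota> i) = lunit E i"
  and sq: "commutes_adjointly ?P ?R ?R i ?C ?A m m"
  using X unfolding left_modules_def Let_def by blast+
 show "m (rwhisk E (vac N) a \<iota> i v) = lunit E i v" if "v : carr (vac N \<otimes> i)"
  using fun_cong[OF unit, of v] that by (simp add: compose_eq)
 show "m (lwhisk E a ?R i m (assoc E a a i v)) = m (?C v)" if v: "v : carr ?P"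
  using fun_cong[OF conjunct1[OF sq[unfolded commutes_adjointly_def]], of v] v by (simp add: compose_eq)
 assume w: "w : carr ?R"
 note aa = tens_mod[OF a a] and R = tens_mod[OF a i] and P = tens_mod[OF tens_mod[OF a a] i]
 note aR = tens_mod[OF a R]
 have mb: "m : bdd_ops ?R i" by (rule Hom_A_bdd[OF m])
 have lb: "lwhisk E a ?R i m : bdd_ops (a \<otimes> ?R) ?R" by (rule Hom_A_bdd[OF lwhisk_Hom(1)[OF a R i m]])
 have sb: "assoc E a a i : bdd_ops ?P (a \<otimes> ?R)" by (rule Hom_A_bdd[OF assoc_Hom(1)[OF a a i]])
 have Ab: "?A : bdd_ops ?P ?R" by (rule bdd_ops_compose[OF cmp[OF P] cmp[OF aR] cmp[OF R] sb lb])
 have Cb: "?C : bdd_ops ?P ?R" by (rule Hom_A_bdd[OF rwhisk_Hom(1)[OF aa a i \<mu>]])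
 have Ca: "adj ?P ?R ?C = rwhisk E a (a \<otimes> a) (adj (a \<otimes> a) a \<mu>) i" by (rule rwhisk_Hom(2)[OF aa a i \<mu>])
 have Ac: "adj ?P ?R ?C w : carr ?P" by (rule op_carr[OF adj_bdd[OF cmp[OF P] cmp[OF R] Cb] w])
 have "?A (adj ?P ?R ?C w) = adj ?R i m (m w)"
 proof (rule adjoint_square_swap[OF cmp[OF P] cmp[OF R] cmp[OF i] Ab Cb mb _ w])
  show "?C (adj ?P ?R ?A v) = adj ?R i m (m v)" if v: "v : carr ?R" for v
   using fun_cong[OF conjunct2[OF sq[unfolded commutes_adjointly_def]], of v] v by (simp add: compose_eq)
 qed
 then show "lwhisk E a ?R i m (assoc E a a i (rwhisk E a (a \<otimes> a) (adj (a \<otimes> a) a \<mu>) i w)) = adj ?R i m (m w)"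
  using Ac unfolding Ca by (simp add: compose_eq)
qed

lemma e_carr: "e \<in> carr a"
 using op_carr[OF Hom_A_bdd[OF \<iota>]] \<Omega> by simp

lemma bv_carr: "\<xi> \<in> bdd_vecs N i I ==> \<xi> \<in> carr i"
 by (rule bdd_vecs_carr[OF N])

lemma alg_vec:
 assumes I: "I \<in> \<J>" and S: "S \<in> alg N (fst I)"
 shows "\<iota> (S (Omega N)) \<in> \<H> a I" "S (Omega N) \<in> \<H> (vac N) I"
proof -
 note fI = fst_arg_interval[OF I]
 show v: "S (Omega N) : \<H> (vac N) I" by (rule alg_bdd_vec(2)[OF N fI S])
 show "\<iota> (S (Omega N)) : \<H> a I"
  by (rule bdd_vecs_map[OF N vac_mod a fI Hom_A_loc[OF \<iota> iopp_in_intervals[OF fI]] v])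
qed

lemma alg_id:
 assumes "I \<in> intervals"
 shows "op_id N \<in> alg N I"
 by (rule von_neumann_algebraD(4)[OF H0 moebius_netD(2)[OF N assms]])

lemma op_id_vacuum: "op_id N (Omega N) = Omega N"
 unfolding op_id_def using \<Omega> by simp

lemma e_bv: "I \<in> \<J> ==> e \<in> \<H> a I"
 using alg_vec(1)[of I "op_id N"] alg_id[OF fst_arg_interval] by (simp add: op_id_vacuum)

context
 fixes i m I
 assumes X: "(i, m) \<in> left_modules N E Q" and I: "I \<in> \<J>"
begin

lemmas im = left_moduleD(1)[OF X]
lemmas mm = left_moduleD(2)[OF X]
lemmas ci = cmp[OF left_moduleD(1)[OF X]]

lemma field_eq: "\<psi> \<in> carr i ==> field i m I \<xi> \<psi> = m (Lop E a i \<xi> I \<psi>)"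
 by (simp add: field_def compose_eq)

lemma field_loc:
 assumes "\<xi> \<in> \<H> a I"
 shows "field i m I \<xi> \<in> Hom_loc N (iopp (fst I)) i i"
 unfolding field_def
 using Hom_loc_compose[OF im tens_mod[OF a im] im iopp_in_intervals[OF fst_arg_interval[OF I]]
   LR_loc(1)[OF a im I assms] Hom_A_loc[OF mm iopp_in_intervals[OF fst_arg_interval[OF I]]]] .

lemma field_bdd: "\<xi> \<in> \<H> a I ==> field i m I \<xi> \<in> bdd_ops i i"
 by (rule Hom_loc_bdd[OF field_loc])

text \<open>The product of the two operators \<open>L\<close> is the operator of a vector in \<open>a \<boxtimes> a\<close>, to which associativity of
  the module applies.\<close>

lemma field_product:
 assumes \<xi>: "\<xi> \<in> \<H> a I" and \<eta>: "\<eta> \<in> \<H> a I" and \<psi>: "\<psi> \<in> carr i"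
 shows "field i m I (\<mu> (Lop E a a \<xi> I \<eta>)) \<psi> = field i m I \<xi> (field i m I \<eta> \<psi>)"
proof -
 let ?\<zeta> = "Lop E a a \<xi> I \<eta>" and ?R = "a \<otimes> i"
 note aa = tens_mod[OF a a] and R = tens_mod[OF a im]
 have \<zeta>: "?\<zeta> : \<H> (a \<otimes> a) I" by (rule L_of_L(1)[OF a a im I \<xi> \<eta>])
 have v: "Lop E (a \<otimes> a) i ?\<zeta> I \<psi> : carr ((a \<otimes> a) \<otimes> i)" by (rule op_carr[OF L_bdd[OF aa im I \<zeta>] \<psi>])
 have w: "Lop E a i \<eta> I \<psi> : carr ?R" by (rule op_carr[OF L_bdd[OF a im I \<eta>] \<psi>])
 have "field i m I (\<mu> ?\<zeta>) \<psi> = m (rwhisk E (a \<otimes> a) a \<mu> i (Lop E (a \<otimes> a) i ?\<zeta> I \<psi>))"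
  using L_morphism[OF aa a im \<mu> I \<zeta> \<psi>] \<psi> by (simp add: field_eq)
 also have "... = m (lwhisk E a ?R i m (assoc E a a i (Lop E (a \<otimes> a) i ?\<zeta> I \<psi>)))"
  using left_moduleD(4)[OF X v] by simp
 also have "... = m (lwhisk E a ?R i m (Lop E a ?R \<xi> I (Lop E a i \<eta> I \<psi>)))"
  using L_of_L(2)[OF a a im I \<xi> \<eta> \<psi>] by simp
 also have "... = m (Lop E a i \<xi> I (m (Lop E a i \<eta> I \<psi>)))"
  using L_natural(1)[OF a R im mm I \<xi> w] by simp
 finally show ?thesis
  using op_carr[OF Hom_A_bdd[OF mm] w] \<psi> by (simp add: field_eq)
qed

lemma field_alg:
 assumes S: "S \<in> alg N (fst I)"
 shows "field i m I (\<iota> (S (Omega N))) = act i (fst I) S"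
proof (rule op_eqI[OF field_bdd[OF alg_vec(1)[OF I S]] A_module_act(1)[OF im fst_arg_interval[OF I] S]])
 fix \<psi> assume \<psi>: "\<psi> : carr i"
 note v = alg_vec(2)[OF I S]
 have "Lop E (vac N) i (S (Omega N)) I \<psi> : carr (vac N \<otimes> i)" by (rule op_carr[OF L_bdd[OF vac_mod im I v] \<psi>])
 then show "field i m I (\<iota> (S (Omega N))) \<psi> = act i (fst I) S \<psi>"
  using L_morphism[OF vac_mod a im \<iota> I v \<psi>] left_moduleD(3)[OF X] L_of_alg[OF im I S \<psi>] \<psi> by (simp add: field_eq)
qed

lemma field_unit: "field i m I e = op_id i"
proof -
 note id = alg_id[OF fst_arg_interval[OF I]]
 have "normal_rep N (alg N (fst I)) i (act i (fst I))"
  using im fst_arg_interval[OF I] unfolding A_module_def by blast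
 from normal_repD(6)[OF this] field_alg[OF id] show ?thesis by (simp add: op_id_vacuum)
qed

lemma field_linear:
 assumes \<xi>: "\<xi> \<in> \<H> a I" and \<eta>: "\<eta> \<in> \<H> a I"
 shows "field i m I (hadd a \<xi> \<eta>) = op_add i i (field i m I \<xi>) (field i m I \<eta>)"
  and "field i m I (hscale a c \<xi>) = op_scale i i c (field i m I \<xi>)"
proof -
 note mb = Hom_A_bdd[OF mm] and Lc = op_carr[OF L_bdd[OF a im I]]
 show "field i m I (hadd a \<xi> \<eta>) = op_add i i (field i m I \<xi>) (field i m I \<eta>)"
  unfolding field_def L_linear(1)[OF a im I \<xi> \<eta>]
  using bdd_opsD(3)[OF mb Lc[OF \<xi>] Lc[OF \<eta>]] by (simp add: op_add_def compose_def fun_eq_iff)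
 show "field i m I (hscale a c \<xi>) = op_scale i i c (field i m I \<xi>)"
  unfolding field_def L_linear(2)[OF a im I \<xi> \<eta>]
  using bdd_opsD(4)[OF mb Lc[OF \<xi>]] by (simp add: op_scale_def compose_def fun_eq_iff)
qed

text \<open>The Frobenius relation enters through its consequence that \<open>m\<^sup>*\<close> is obtained by multiplying
  into the left leg of \<open>\<mu>\<^sup>* \<iota> \<Omega>\<close>; hence the adjoint of a field is the field of a vector that
  does not depend on the module.\<close>

lemma field_adj:
 assumes \<xi>: "\<xi> \<in> \<H> a I"
 defines "\<xi>' \<equiv> adj a (a \<otimes> a) (Lop E a a \<xi> I) (adj (a \<otimes> a) a \<mu> e)"
 shows "\<xi>' \<in> \<H> a I" "adj i i (field i m I \<xi>) = field i m I \<xi>'"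
proof -
 let ?\<zeta> = "adj (a \<otimes> a) a \<mu> e" and ?R = "a \<otimes> i"
 note aa = tens_mod[OF a a] and R = tens_mod[OF a im]
 note aR = tens_mod[OF a R]
 note \<mu>' = Hom_A_adj[OF N aa a \<mu>]
 note fI = fst_arg_interval[OF I]
 note mb = Hom_A_bdd[OF mm] and Lb = L_bdd[OF a im I \<xi>]
 have \<zeta>: "?\<zeta> : \<H> (a \<otimes> a) I"
  by (rule bdd_vecs_map[OF N a aa fI Hom_A_loc[OF \<mu>' iopp_in_intervals[OF fI]] e_bv[OF I]])
 show \<xi>': "\<xi>' : \<H> a I" unfolding \<xi>'_def by (rule L_of_adj_L(1)[OF a a im I \<xi> \<zeta>])
 show "adj i i (field i m I \<xi>) = field i m I \<xi>'"
 proof (rule op_eqI[OF adj_bdd[OF ci ci field_bdd[OF \<xi>]] field_bdd[OF \<xi>']])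
  fix \<psi> assume \<psi>: "\<psi> : carr i"
  have w: "Lop E a i e I \<psi> : carr ?R" by (rule op_carr[OF L_bdd[OF a im I e_bv[OF I]] \<psi>])
  have v: "assoc E a a i (Lop E (a \<otimes> a) i ?\<zeta> I \<psi>) : carr (a \<otimes> ?R)"
   by (rule op_carr[OF Hom_A_bdd[OF assoc_Hom(1)[OF a a im]] op_carr[OF L_bdd[OF aa im I \<zeta>] \<psi>]])
  have "field i m I \<xi>' \<psi> = m (adj ?R (a \<otimes> ?R) (Lop E a ?R \<xi> I) (assoc E a a i (Lop E (a \<otimes> a) i ?\<zeta> I \<psi>)))"
   using L_of_adj_L(2)[OF a a im I \<xi> \<zeta> \<psi>] \<psi> unfolding \<xi>'_def by (simp add: field_eq)
  also have "... = adj i ?R (Lop E a i \<xi> I) (lwhisk E a ?R i m (assoc E a a i (Lop E (a \<otimes> a) i ?\<zeta> I \<psi>)))"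
   by (rule L_adj_natural[OF a R im mm I \<xi> v])
  also have "Lop E (a \<otimes> a) i ?\<zeta> I \<psi> = rwhisk E a (a \<otimes> a) (adj (a \<otimes> a) a \<mu>) i (Lop E a i e I \<psi>)"
   by (rule L_morphism[OF a aa im \<mu>' I e_bv[OF I] \<psi>])
  also have "lwhisk E a ?R i m (assoc E a a i ...) = adj ?R i m (m (Lop E a i e I \<psi>))" by (rule left_moduleD(5)[OF X w])
  also have "m (Lop E a i e I \<psi>) = \<psi>" using fun_cong[OF field_unit, of \<psi>] \<psi> by (simp add: field_eq op_id_def)
  also have "adj i ?R (Lop E a i \<xi> I) (adj ?R i m \<psi>) = adj i i (field i m I \<xi>) \<psi>"
   unfolding field_def using adj_compose[OF ci cmp[OF R] ci Lb mb] \<psi> by (simp add: compose_eq)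
  finally show "adj i i (field i m I \<xi>) \<psi> = field i m I \<xi>' \<psi>" ..
 qed
qed

lemma right_field_bdd:
 assumes J: "J \<in> \<J>" and \<eta>: "\<eta> \<in> \<H> i J"
 shows "right_field i m J \<eta> \<in> bdd_ops a i"
 unfolding right_field_def by (rule bdd_ops_compose[OF cmp[OF a] cmp[OF tens_mod[OF a im]] ci R_bdd[OF im a J \<eta>] Hom_A_bdd[OF mm]])

text \<open>A right field exchanges the roles of vector and operator; hence it intertwines the orbit of \<open>e\<close> under
  \<open>BQ\<close> with the orbit of \<open>\<eta>\<close>.\<close>

lemma right_field_field:
 assumes J: "J \<in> \<J>" "clockwise_to J I" and \<eta>: "\<eta> \<in> \<H> i J" and \<xi>: "\<xi> \<in> \<H> a I"
 shows "right_field i m J \<eta> \<xi> = field i m I \<xi> \<eta>"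
 using L_R_exchange[OF a im I J \<xi> \<eta>] bv_carr[OF \<eta>] bv_carr[OF \<xi>] by (simp add: right_field_def field_eq compose_eq)

end

lemma field_vacuum:
 assumes I: "I \<in> \<J>" and \<xi>: "\<xi> \<in> \<H> a I"
 shows "field a \<mu> I \<xi> e = \<xi>"
proof -
 have w: "Lop E a (vac N) \<xi> I (Omega N) : carr (a \<otimes> vac N)" by (rule op_carr[OF L_bdd[OF a vac_mod I \<xi>]]) (simp add: \<Omega>)
 then show ?thesis
  using L_natural(1)[OF a vac_mod a \<iota> I \<xi>, of "Omega N"] right_unit[OF w] state_field(1)[OF a I \<xi>] e_carr \<Omega>
  by (simp add: field_eq[OF regular_module I])
qed

lemma field_mult:
 assumes I: "I \<in> \<J>" and v: "\<xi> \<in> \<H> a I" "\<eta> \<in> \<H> a I"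
 shows "field a \<mu> I \<xi> \<eta> \<in> \<H> a I"
  and "(i, m) \<in> left_modules N E Q ==> field i m I (field a \<mu> I \<xi> \<eta>) = compose (carr i) (field i m I \<xi>) (field i m I \<eta>)"
proof -
 show c: "field a \<mu> I \<xi> \<eta> : \<H> a I"
  by (rule bdd_vecs_map[OF N a a fst_arg_interval[OF I] field_loc[OF regular_module I v(1)] v(2)])
 assume X: "(i, m) : left_modules N E Q"
 note ci = cmp[OF left_moduleD(1)[OF X]] and fb = field_bdd[OF X I]
 show "field i m I (field a \<mu> I \<xi> \<eta>) = compose (carr i) (field i m I \<xi>) (field i m I \<eta>)"
  by (rule op_eqI[OF fb[OF c] bdd_ops_compose[OF ci ci ci fb[OF v(2)] fb[OF v(1)]]])
   (insert field_product[OF X I v] bv_carr[OF v(2)], simp add: compose_eq field_eq[OF regular_module I])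
qed

lemma BQ_eq: "BQ N E Q I = field a \<mu> I ` \<H> a I"
 unfolding BQ_def field_def by auto

text \<open>Commuting with the fields of \<open>a\<close> that multiply from the right and are localised in the
  complementary interval \<open>J\<close> characterises \<open>BQ\<close>; these fields include the algebra of \<open>J\<close>, so that
  the vector \<open>T e\<close> belonging to \<open>T\<close> is localised in \<open>I\<close>.\<close>

lemma BQ_commutant:
 assumes I: "I \<in> \<J>" and J: "J \<in> \<J>" "clockwise_to J I" "fst J = iopp (fst I)"
 shows "BQ N E Q I = commutant a (right_field a \<mu> J ` \<H> a J)"
proof (intro equalityI subsetI)
 note reg = regular_module
 note fb = field_bdd[OF reg I] and rb = right_field_bdd[OF reg I J(1)] and rf = right_field_field[OF reg I J(1,2)]
 note ca = cmp[OF a] and fI = fst_arg_interval[OF I] and fJ = fst_arg_interval[OF J(1)]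
 have rid: "right_field a \<mu> J \<eta> e = \<eta>" if "\<eta> : \<H> a J" for \<eta>
  using rf[OF that e_bv[OF I]] field_unit[OF reg I] bv_carr[OF that] by (simp add: op_id_def)
 {
  fix T assume "T : BQ N E Q I"
  then obtain \<xi> where \<xi>: "\<xi> : \<H> a I" "T = field a \<mu> I \<xi>" by (auto simp: BQ_eq)
  show "T : commutant a (right_field a \<mu> J ` \<H> a J)"
  proof (rule commutantI)
   show T: "T : bdd_ops a a" using fb \<xi> by simp
   fix S x assume "S : right_field a \<mu> J ` \<H> a J" and x: "x : carr a"
   then obtain \<eta> where \<eta>: "\<eta> : \<H> a J" "S = right_field a \<mu> J \<eta>" by blast
   have S: "S : bdd_ops a a" using rb \<eta> by simp
   have "compose (carr a) S T = compose (carr a) T S"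
   proof (rule op_eq_on_dense[OF ca ca bdd_ops_compose[OF ca ca ca T S] bdd_ops_compose[OF ca ca ca S T] bdd_vecs_dense[OF a I]])
    fix v assume v: "v : \<H> a I"
    have "S (T v) = field a \<mu> I (field a \<mu> I \<xi> v) \<eta>"
     unfolding \<xi> \<eta> by (rule rf[OF \<eta>(1) field_mult(1)[OF I \<xi>(1) v]])
    also have "... = T (S v)"
     unfolding field_mult(2)[OF I \<xi>(1) v reg] using rf[OF \<eta>(1) v] \<xi>(2) \<eta> bv_carr[OF \<eta>(1)] by (simp add: compose_eq)
    finally show "compose (carr a) S T v = compose (carr a) T S v" using bv_carr[OF v] by (simp add: compose_eq)
   qed
   from fun_cong[OF this, of x] show "S (T x) = T (S x)" using x by (simp add: compose_eq)
  qed
 next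
  fix T assume T: "T : commutant a (right_field a \<mu> J ` \<H> a J)"
  note Tb = commutantD(1)[OF T] and Tcomm = commutantD(2)[OF T]
  have act: "right_field a \<mu> J (\<iota> (S (Omega N))) = act a (fst J) S" if S: "S : alg N (fst J)" for S
  proof (rule op_eq_on_dense[OF ca ca rb[OF alg_vec(1)[OF J(1) S]] A_module_act(1)[OF a fJ S] bdd_vecs_dense[OF a I]])
   fix v assume v: "v : \<H> a I"
   have "\<iota> (S (Omega N)) = act a (fst J) S e"
    using Hom_loc_act[OF vac_mod fJ Hom_A_loc[OF \<iota> fJ] S, of "Omega N"] vac_act[OF S] \<Omega> by simp
   then have "right_field a \<mu> J (\<iota> (S (Omega N))) v = field a \<mu> I v (act a (fst J) S e)"
    using rf[OF alg_vec(1)[OF J(1) S] v] by simp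
   also have "... = act a (fst J) S (field a \<mu> I v e)"
    by (rule Hom_loc_act[OF a fJ _ S e_carr]) (use field_loc[OF reg I v] J(3) in simp)
   finally show "right_field a \<mu> J (\<iota> (S (Omega N))) v = act a (fst J) S v" using field_vacuum[OF I v] by simp
  qed
  have "T : Hom_loc N (iopp (fst I)) a a"
   unfolding J(3)[symmetric] Hom_loc_iff[OF a fJ]
   using Tb Tcomm act alg_vec(1)[OF J(1)] by (metis imageI)
  then have \<xi>: "T e : \<H> a I" by (rule bdd_vecs_map[OF N a a fI _ e_bv[OF I]])
  have "T = field a \<mu> I (T e)"
  proof (rule op_eq_on_dense[OF ca ca Tb fb[OF \<xi>] bdd_vecs_dense[OF a J(1)]])
   fix \<eta> assume \<eta>: "\<eta> : \<H> a J"
   have "field a \<mu> I (T e) \<eta> = right_field a \<mu> J \<eta> (T e)" using rf[OF \<eta> \<xi>] by simp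
   also have "... = T (right_field a \<mu> J \<eta> e)" by (rule Tcomm[OF imageI[OF \<eta>] e_carr])
   finally show "T \<eta> = field a \<mu> I (T e) \<eta>" using rid[OF \<eta>] by simp
  qed
  then show "T : BQ N E Q I" using \<xi> by (auto simp: BQ_eq)
 }
qed

lemma BQ_commutant_exists:
 assumes I: "I \<in> \<J>"
 obtains C where "C \<subseteq> bdd_ops a a" "BQ N E Q I = commutant a C"
proof -
 obtain J where J: "J : \<J>" "clockwise_to J I" "fst J = iopp (fst I)" by (rule clockwise_complement_exists[OF I])
 show ?thesis
  by (rule that[OF _ BQ_commutant[OF I J]]) (use right_field_bdd[OF regular_module I J(1)] in auto)
qed

text \<open>An element \<open>S\<close> of \<open>BQ\<close> is the field of \<open>S e\<close>; it acts on the module by the field of the same vector.\<close>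

definition field_rep :: "'v amod \<Rightarrow> ('v \<Rightarrow> 'v) \<Rightarrow> 'v bact" where
 "field_rep i m = (\<lambda>I\<in>\<J>. \<lambda>S\<in>BQ N E Q I. field i m I (S e))"

lemma field_rep_field:
 assumes I: "I \<in> \<J>" and \<xi>: "\<xi> \<in> \<H> a I"
 shows "field_rep i m I (field a \<mu> I \<xi>) = field i m I \<xi>"
 using assms field_vacuum[OF assms] by (simp add: field_rep_def BQ_eq)

lemma field_rep_normal:
 assumes X: "(i, m) \<in> left_modules N E Q" and I: "I \<in> \<J>"
 shows "normal_rep a (BQ N E Q I) i (field_rep i m I)"
proof -
 obtain J where J: "J : \<J>" "clockwise_to J I" "fst J = iopp (fst I)" by (rule clockwise_complement_exists[OF I])
 note reg = regular_module and im = left_moduleD(1)[OF X]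
 note ca = cmp[OF a] and ci = cmp[OF im] and fb = field_bdd[OF X I] and fa = field_bdd[OF reg I]
 let ?C = "right_field a \<mu> J ` \<H> a J" and ?p = "field_rep i m I"
 note B = BQ_commutant[OF I J]
 have C: "?C <= bdd_ops a a" using right_field_bdd[OF reg I J(1)] by auto
 note alg = commutant_algebra[OF ca C, folded B]
 have val: "?p S = field i m I (S e)" if "S : BQ N E Q I" for S using that I by (simp add: field_rep_def)
 have el: "S e : \<H> a I" "S = field a \<mu> I (S e)" if "S : BQ N E Q I" for S
  using that field_vacuum[OF I] by (auto simp: BQ_eq)
 have "star_rep a (BQ N E Q I) i ?p"
  unfolding star_rep_def
 proof (intro conjI ballI allI)
  show "?p : BQ N E Q I \<rightarrow>\<^sub>E bdd_ops i i"
   using val fb[OF el(1)] I by (auto simp: field_rep_def)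
  fix S assume S: "S : BQ N E Q I"
  show "?p (op_scale a a c S) = op_scale i i c (?p S)" for c
   using val[OF alg(3)[OF S]] val[OF S] field_linear(2)[OF X I el(1)[OF S] el(1)[OF S]] e_carr by (simp add: op_scale_def)
  note ad = field_adj(1)[OF X I el(1)[OF S]]
  have "adj a a S = field a \<mu> I (adj a (a \<otimes> a) (Lop E a a (S e) I) (adj (a \<otimes> a) a \<mu> e))"
   using field_adj(2)[OF reg I el(1)[OF S]] el(2)[OF S] by simp
  then show "?p (adj a a S) = adj i i (?p S)"
   using field_adj(2)[OF X I el(1)[OF S]] val[OF S] field_rep_field[OF I ad, of i m] by simp
  fix T assume T: "T : BQ N E Q I"
  show "?p (op_add a a S T) = op_add i i (?p S) (?p T)"
   using val[OF alg(2)[OF S T]] val[OF S] val[OF T] field_linear(1)[OF X I el(1)[OF S] el(1)[OF T]] e_carr by (simp add: op_add_def)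
  have "compose (carr a) S T e = field a \<mu> I (S e) (T e)" using el(2)[OF S] e_carr by (simp add: compose_eq)
  then show "?p (compose (carr a) S T) = compose (carr i) (?p S) (?p T)"
   using val[OF alg(4)[OF S T]] val[OF S] val[OF T] field_mult(2)[OF I el(1)[OF S] el(1)[OF T] X] by simp
 next
  show "?p (op_id a) = op_id i"
   using val[OF alg(1)] field_unit[OF X I] e_carr by (simp add: op_id_def)
 qed
 then have p: "star_rep a (commutant a ?C) i ?p" unfolding B .
 show ?thesis
  unfolding B
 proof (rule star_rep_normal[OF ca ci C p bdd_vecs_dense[OF im J(1)]])
  fix \<eta> assume \<eta>: "\<eta> : \<H> i J"
  show "EX W:bdd_ops a i. EX v:carr a. ALL S:commutant a ?C. W (S v) = ?p S \<eta>"
   unfolding B[symmetric]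
  proof (intro bexI[of _ "right_field i m J \<eta>"] bexI[of _ e] ballI)
   fix S assume S: "S : BQ N E Q I"
   show "right_field i m J \<eta> (S e) = ?p S \<eta>"
    using right_field_field[OF X I J(1,2) \<eta> el(1)[OF S]] val[OF S] by simp
  qed (use e_carr right_field_bdd[OF X I J(1) \<eta>] in auto)
 qed
qed

lemma bv_mono:
 assumes IJ: "I \<in> intervals" "J \<in> intervals" "I \<subseteq> J" and i: "A_module N i"
 shows "bdd_vecs N i I \<subseteq> bdd_vecs N i J"
proof
 fix \<xi> assume "\<xi> : bdd_vecs N i I"
 then obtain T where T: "T : Hom_loc N (iopp I) (vac N) i" "\<xi> = T (Omega N)" by (rule bdd_vecsE)
 then show "\<xi> : bdd_vecs N i J"
  using Hom_loc_mono[OF N vac_mod i iopp_in_intervals[OF IJ(2)] iopp_in_intervals[OF IJ(1)] iopp_antimono[OF IJ(3)]] by (blast intro: bdd_vecsI)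
qed

lemma field_mono:
 assumes IJ: "I \<in> \<J>" "J \<in> \<J>" "arg_sub I J" and \<xi>: "\<xi> \<in> \<H> a I" and i: "A_module N i"
 shows "\<xi> \<in> \<H> a J" "field i m J \<xi> = field i m I \<xi>"
 using bv_mono[OF fst_arg_interval fst_arg_interval _ a, of I J] isotony[OF a i IJ \<xi>] IJ \<xi> unfolding field_def arg_sub_def by auto

lemma field_rep_BA_module:
 assumes X: "(i, m) \<in> left_modules N E Q"
 shows "(i, field_rep i m) \<in> BA_modules N a (BQ N E Q)"
 unfolding BA_modules_def mem_Collect_eq case_prod_conv
proof (intro conjI ballI impI)
 note i = left_moduleD(1)[OF X]
 show "A_module N i" by (rule i)
 show "field_rep i m : extensional \<J>" by (simp add: field_rep_def)
 fix I assume I: "I : \<J>"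
 show "normal_rep a (BQ N E Q I) i (field_rep i m I)" by (rule field_rep_normal[OF X I])
 show "act i (fst I) S = field_rep i m I (act a (fst I) S)" if S: "S : alg N (fst I)" for S
  unfolding field_alg[OF X I S, symmetric] field_alg[OF regular_module I S, symmetric]
  by (rule field_rep_field[OF I alg_vec(1)[OF I S], symmetric])
 fix J S assume J: "J : \<J>" and sub: "arg_sub I J" and "S : BQ N E Q I"
 then obtain \<xi> where \<xi>: "\<xi> : \<H> a I" "S = field a \<mu> I \<xi>" by (auto simp: BQ_eq)
 note \<xi>J = field_mono(1)[OF I J sub \<xi>(1) a]
 show "field_rep i m J S = field_rep i m I S"
  using field_rep_field[OF J \<xi>J, of i m] field_rep_field[OF I \<xi>(1), of i m] \<xi>(2)
   field_mono(2)[OF I J sub \<xi>(1) a, of \<mu>] field_mono(2)[OF I J sub \<xi>(1) i, of m] by simp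
qed

lemma corresponds_iff:
 assumes X: "(i, m) \<in> left_modules N E Q"
 shows "corresponds N E Q (i, m) p \<longleftrightarrow> p = field_rep i m"
proof
 assume "p = field_rep i m"
 then show "corresponds N E Q (i, m) p"
  using field_rep_BA_module[OF X] field_rep_field[of _ _ i m] unfolding corresponds_def case_prod_conv field_def by blast
next
 assume "corresponds N E Q (i, m) p"
 then have p: "(i, p) : BA_modules N a (BQ N E Q)"
  and f: "!!I \<xi>. I : \<J> ==> \<xi> : \<H> a I ==> p I (field a \<mu> I \<xi>) = field i m I \<xi>"
  unfolding corresponds_def case_prod_conv field_def by blast+
 have ext: "p : extensional \<J>" and n: "!!I. I : \<J> ==> normal_rep a (BQ N E Q I) i (p I)"
  using p unfolding BA_modules_def by blast+
 show "p = field_rep i m"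
 proof (rule extensionalityI[OF ext])
  show "field_rep i m : extensional \<J>" by (simp add: field_rep_def)
  fix I assume I: "I : \<J>"
  show "p I = field_rep i m I"
  proof (rule extensionalityI)
   show "p I : extensional (BQ N E Q I)" using normal_repD(1)[OF n[OF I]] by (simp add: PiE_def)
   show "field_rep i m I : extensional (BQ N E Q I)" using I by (simp add: field_rep_def)
   fix S assume "S : BQ N E Q I"
   then show "p I S = field_rep i m I S" using f[OF I] field_rep_field[OF I, of _ i m] by (auto simp: BQ_eq)
  qed
 qed
qed

lemma BA_of_left_eq:
 assumes "(i, m) \<in> left_modules N E Q"
 shows "BA_of_left N E Q (i, m) = (i, field_rep i m)"
 unfolding BA_of_left_def using corresponds_iff[OF assms] by (auto intro!: the_equality)

end

section \<open>Bounded operators with prescribed values\<close>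

lemma hscale_zero:
 assumes "complete_ips H"
 shows "hscale H c (hzero H) = hzero H" "x \<in> carr H ==> hscale H 0 x = hzero H"
 using assms by (auto intro!: hip_ext[OF assms])

text \<open>The value at \<open>x\<close> is the limit of the second components along any sequence in \<open>G\<close> whose first
  components converge to \<open>x\<close>. It is determined by the bound of its distance to all second components,
  and linearity follows by approximation.\<close>

lemma bounded_extension:
 fixes H :: "('v, 'a) hilb_scheme" and K :: "('v, 'b) hilb_scheme"
 assumes H: "complete_ips H" and K: "complete_ips K"
  and G: "!!x y. (x, y) \<in> G ==> x \<in> carr H \<and> y \<in> carr K"
  and add: "!!x y u v. (x, y) \<in> G ==> (u, v) \<in> G ==> (hadd H x u, hadd K y v) \<in> G"
  and scale: "!!x y c. (x, y) \<in> G ==> (hscale H c x, hscale K c y) \<in> G"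
  and bound: "!!x y. (x, y) \<in> G ==> hnorm K y \<le> C * hnorm H x" and C: "C \<ge> 0"
  and dense: "hdense H (Domain G)"
 shows "\<exists>T\<in>bdd_ops H K. \<forall>(x, y)\<in>G. T x = y"
proof -
 have Gc: "x : carr H" "y : carr K" if "(x, y) : G" for x y using G[OF that] by auto
 have diff: "hdist K y v <= C * hdist H x u" if "(x, y) : G" "(u, v) : G" for x y u v
  using bound[OF add[OF that(1) scale[OF that(2)]], of "-1"] by (simp add: hdiff_def)
 have approx: "EX u v. (u, v) : G & hdist H x u < r" if "x : carr H" "r > 0" for x r
  using dense that unfolding hdense_def by blast
 have "EX y. y : carr K & (ALL u v. (u, v) : G \<longrightarrow> hdist K y v <= C * hdist H x u)" if x: "x : carr H" for x
 proof -
  have "EX U V. (U, V) : G & hdist H x U < 1 / (real n + 1)" for n by (rule approx[OF x]) simp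
  then obtain U V where UV: "!!n. (U n, V n) : G" "!!n. hdist H x (U n) < 1 / (real n + 1)" by metis
  have Uc: "U n : carr H" and Vc: "V n : carr K" for n using Gc[OF UV(1)] by auto
  have lim0: "(\<lambda>n. 1 / (real n + 1)) \<longlonglongrightarrow> 0" using LIMSEQ_Suc[OF lim_const_over_n[of 1]] by (simp add: add.commute)
  have U: "(\<lambda>n. hdist H (U n) x) \<longlonglongrightarrow> 0"
  proof (rule tendsto_sandwich[OF _ _ tendsto_const lim0])
   show "\<forall>\<^sub>F n in sequentially. 0 <= hdist H (U n) x" using hip_self(3)[OF H carr_closed(4)[OF H Uc x]] by simp
   show "\<forall>\<^sub>F n in sequentially. hdist H (U n) x <= 1 / (real n + 1)"
    using UV(2) by (intro always_eventually allI) (simp add: hnorm_swap[OF H Uc x] less_imp_le)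
  qed
  have "EX N. ALL m>=N. ALL n>=N. hdist K (V m) (V n) < e" if e: "e > 0" for e
  proof -
   have "e / (2 * C + 1) > 0" using e C by simp
   then obtain N where N: "!!n. n >= N ==> 1 / (real n + 1) < e / (2 * C + 1)"
    using order_tendstoD(2)[OF lim0] by (auto simp: eventually_sequentially)
   have "hdist K (V m) (V n) < e" if mn: "m >= N" "n >= N" for m n
   proof -
    have "hdist H (U m) (U n) <= hdist H (U m) x + hdist H x (U n)" by (rule hnorm_triangle_diff[OF H Uc x Uc])
    also have "... <= 2 * (e / (2 * C + 1))"
     using UV(2)[of m] UV(2)[of n] hnorm_swap[OF H x Uc[of m]] N[OF mn(1)] N[OF mn(2)] by linarith
    finally have "hdist K (V m) (V n) <= C * (2 * (e / (2 * C + 1)))"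
     using diff[OF UV(1) UV(1), of m n] mult_left_mono[OF _ C] order_trans by blast
    also have "... < e" using e C by (simp add: divide_simps)
    finally show ?thesis .
   qed
   then show ?thesis by blast
  qed
  then obtain y where y: "y : carr K" "(\<lambda>n. hdist K (V n) y) \<longlonglongrightarrow> 0"
   using K Vc unfolding complete_ips_def by (elim conjE allE[of _ V]) auto
  have "hdist K y v <= C * hdist H x u" if uv: "(u, v) : G" for u v
  proof (rule LIMSEQ_le)
   have "hdiff K (hdiff K (V n) v) (hdiff K y v) = hdiff K (V n) y" for n
    using K Vc[of n] y(1) Gc(2)[OF uv] by (intro hip_ext[OF K]) auto
   then show "(\<lambda>n. hdist K (V n) v) \<longlonglongrightarrow> hdist K y v"
    by (intro hnorm_tendsto[OF K]) (use K Vc y Gc(2)[OF uv] in auto)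
   have "hdiff H (hdiff H (U n) u) (hdiff H x u) = hdiff H (U n) x" for n
    using H Uc[of n] x Gc(1)[OF uv] by (intro hip_ext[OF H]) auto
   then show "(\<lambda>n. C * hdist H (U n) u) \<longlonglongrightarrow> C * hdist H x u"
    by (intro tendsto_mult tendsto_const hnorm_tendsto[OF H]) (use H Uc U x Gc(1)[OF uv] in auto)
   show "EX N. ALL n>=N. hdist K (V n) v <= C * hdist H (U n) u" using diff[OF UV(1) uv] by blast
  qed
  then show ?thesis using y by blast
 qed
 then obtain T where Tc: "!!x. x : carr H ==> T x : carr K"
  and T: "!!x u v. x : carr H ==> (u, v) : G ==> hdist K (T x) v <= C * hdist H x u" by metis
 have TG: "T x = y" if "(x, y) : G" for x y
 proof -
  note xy = Gc[OF that]
  have "hdiff H x x = hzero H" using xy(1) H by (intro hip_ext[OF H]) auto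
  then have "hdist K (T x) y <= 0" using T[OF xy(1) that] H by simp
  then have "hdist K (T x) y = 0" using hip_self(3)[OF K, of "hdiff K (T x) y"] Tc[OF xy(1)] xy K by simp
  then show ?thesis using hnorm_eq_0[OF K] hdiff_eq_0[OF K Tc[OF xy(1)] xy(2)] Tc[OF xy(1)] xy K by simp
 qed
 obtain x0 y0 where G0: "(x0, y0) : G" using approx[OF carr_closed(1)[OF H], of 1] by auto
 have zz: "(hzero H, hzero K) : G"
 proof -
  have "hscale H 0 x0 = hzero H" "hscale K 0 y0 = hzero K" using Gc[OF G0] hscale_zero(2)[OF H] hscale_zero(2)[OF K] by auto
  then show ?thesis using scale[OF G0, of 0] by simp
 qed
 have small: "y = z" if "y : carr K" "z : carr K" "!!r. r > 0 ==> hdist K y z <= k * r" for y z k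
 proof -
  have "hdist K y z <= 0"
  proof (rule field_le_epsilon)
   fix e :: real assume e: "e > 0"
   have "hdist K y z <= k * (e / (\<bar>k\<bar> + 1))" by (rule that(3)) (use e in simp)
   also have "... <= e" using e by (simp add: divide_simps abs_if mult_right_mono)
   finally show "hdist K y z <= 0 + e" by simp
  qed
  then have "hdist K y z = 0" using hip_self(3)[OF K, of "hdiff K y z"] that K by simp
  then show ?thesis using hnorm_eq_0[OF K] hdiff_eq_0[OF K that(1,2)] that K by simp
 qed
 have "restrict T (carr H) : bdd_ops H K"
 proof (rule bdd_opsI[where C = C])
  fix x assume x: "x : carr H"
  note Tx = Tc[OF x]
  have "hdiff K (T x) (hzero K) = T x" "hdiff H x (hzero H) = x" using Tx x H K by ((intro hip_ext[OF H]; simp add: algebra_simps; fail) | (intro hip_ext[OF K]; simp add: algebra_simps; fail))+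
  then show "hnorm K (restrict T (carr H) x) <= C * hnorm H x" using T[OF x zz] x by simp
  fix c
  have "T (hscale H c x) = hscale K c (T x)"
  proof (rule small)
   fix r :: real assume "r > 0"
   then obtain u v where uv: "(u, v) : G" "hdist H x u < r" using approx[OF x] by blast
   note c = Gc[OF uv(1)]
   have 1: "hdiff H (hscale H c x) (hscale H c u) = hscale H c (hdiff H x u)"
    "hdiff K (hscale K c v) (hscale K c (T x)) = hscale K c (hdiff K v (T x))"
    using x c Tx H K by ((intro hip_ext[OF H]; simp add: algebra_simps; fail) | (intro hip_ext[OF K]; simp add: algebra_simps; fail))+
   have "hdist K (T (hscale H c x)) (hscale K c (T x))
     <= hdist K (T (hscale H c x)) (hscale K c v) + hdist K (hscale K c v) (hscale K c (T x))"
    by (rule hnorm_triangle_diff[OF K]) (use Tc x H K c Tx in auto)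
   also have "... <= C * (cmod c * hdist H x u) + cmod c * (C * hdist H x u)"
    using T[OF carr_closed(3)[OF H x] scale[OF uv(1)], of c c] T[OF x uv(1)] hnorm_swap[OF K Tx c(2)]
     hnorm_scale[OF H carr_closed(4)[OF H x c(1)], of c] hnorm_scale[OF K carr_closed(4)[OF K c(2) Tx], of c]
    unfolding 1 by (intro add_mono) (auto intro: mult_left_mono)
   also have "... = 2 * C * cmod c * hdist H x u" by simp
   also have "... <= 2 * C * cmod c * r" using uv(2) C by (intro mult_left_mono) auto
   finally show "hdist K (T (hscale H c x)) (hscale K c (T x)) <= 2 * C * cmod c * r" .
  qed (use Tc x H K in auto)
  then show "restrict T (carr H) (hscale H c x) = hscale K c (restrict T (carr H) x)" using x H by simp
  fix z assume z: "z : carr H"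
  note Tz = Tc[OF z]
  have "T (hadd H x z) = hadd K (T x) (T z)"
  proof (rule small)
   fix r :: real assume r: "r > 0"
   obtain u v where uv: "(u, v) : G" "hdist H x u < r" using approx[OF x r] by blast
   obtain p q where pq: "(p, q) : G" "hdist H z p < r" using approx[OF z r] by blast
   note c = Gc[OF uv(1)] Gc[OF pq(1)]
   have 1: "hdiff H (hadd H x z) (hadd H u p) = hadd H (hdiff H x u) (hdiff H z p)"
    "hdiff K (hadd K v q) (hadd K (T x) (T z)) = hadd K (hdiff K v (T x)) (hdiff K q (T z))"
    using x z c Tx Tz H K by ((intro hip_ext[OF H]; simp add: algebra_simps; fail) | (intro hip_ext[OF K]; simp add: algebra_simps; fail))+
   have "hdist K (T (hadd H x z)) (hadd K (T x) (T z))
     <= hdist K (T (hadd H x z)) (hadd K v q) + hdist K (hadd K v q) (hadd K (T x) (T z))"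
    by (rule hnorm_triangle_diff[OF K]) (use Tc x z H K c Tx Tz in auto)
   also have "... <= C * (hdist H x u + hdist H z p) + (C * hdist H x u + C * hdist H z p)"
   proof (rule add_mono)
    show "hdist K (T (hadd H x z)) (hadd K v q) <= C * (hdist H x u + hdist H z p)"
     using T[OF carr_closed(2)[OF H x z] add[OF uv(1) pq(1)]]
      mult_left_mono[OF hnorm_triangle[OF H carr_closed(4)[OF H x c(1)] carr_closed(4)[OF H z c(3)]] C] unfolding 1 by linarith
    show "hdist K (hadd K v q) (hadd K (T x) (T z)) <= C * hdist H x u + C * hdist H z p"
     using hnorm_triangle[OF K carr_closed(4)[OF K c(2) Tx] carr_closed(4)[OF K c(4) Tz]] T[OF x uv(1)] T[OF z pq(1)]
      hnorm_swap[OF K Tx c(2)] hnorm_swap[OF K Tz c(4)] unfolding 1 by linarith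
   qed
   also have "... = 2 * C * hdist H x u + 2 * C * hdist H z p" by (simp add: algebra_simps)
   also have "... <= 2 * C * r + 2 * C * r" using uv(2) pq(2) C by (intro add_mono mult_left_mono) auto
   finally show "hdist K (T (hadd H x z)) (hadd K (T x) (T z)) <= 4 * C * r" by simp
  qed (use Tc x z H K in auto)
  then show "restrict T (carr H) (hadd H x z) = hadd K (restrict T (carr H) x) (restrict T (carr H) z)" using x z H by simp
 qed (use Tc in auto)
 then show ?thesis using TG Gc by (intro bexI[of _ "restrict T (carr H)"]) auto
qed

inductive_set linear_hull :: "('v, 'a) hilb_scheme \<Rightarrow> ('v, 'b) hilb_scheme \<Rightarrow> ('k \<Rightarrow> 'v) \<Rightarrow> ('k \<Rightarrow> 'v) \<Rightarrow> 'k set \<Rightarrow> ('v \<times> 'v) set"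
 for H K f g S where
 zero: "(hzero H, hzero K) \<in> linear_hull H K f g S"
| step: "(x, y) \<in> linear_hull H K f g S ==> s \<in> S ==> (hadd H x (f s), hadd K y (g s)) \<in> linear_hull H K f g S"

lemma hsum_upd: "hsum H (\<lambda>k. f ((s(n := t)) k)) n = hsum H (\<lambda>k. f (s k)) n"
proof -
 have "hsum H (\<lambda>k. f ((s(n := t)) k)) m = hsum H (\<lambda>k. f (s k)) m" if "m <= n" for m
  using that by (induction m) auto
 then show ?thesis by simp
qed

lemma linear_hull_hsum:
 assumes "(x, y) \<in> linear_hull H K f g S"
 shows "\<exists>n s. (\<forall>k<n. s k \<in> S) \<and> x = hsum H (\<lambda>k. f (s k)) n \<and> y = hsum K (\<lambda>k. g (s k)) n"
 using assms
proof induction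
 case zero
 then show ?case by (intro exI[of _ 0]) simp
next
 case (step x y t)
 then obtain n s where "ALL k<n. s k : S" "x = hsum H (\<lambda>k. f (s k)) n" "y = hsum K (\<lambda>k. g (s k)) n" by blast
 then show ?case
  using step.hyps by (intro exI[of _ "Suc n"] exI[of _ "s(n := t)"]) (simp_all only: hsum.simps hsum_upd, auto simp: less_Suc_eq)
qed

lemma hadd_laws:
 assumes "complete_ips H" "x \<in> carr H" "y \<in> carr H"
 shows "z \<in> carr H ==> hadd H x (hadd H y z) = hadd H (hadd H x y) z" "hadd H x y = hadd H y x" "hadd H x (hzero H) = x"
 using assms by (auto intro!: hip_ext[OF assms(1)])

lemma hnorm_hsum_sq:
 assumes L: "complete_ips L" and h: "!!k. k < n ==> h k \<in> carr L"
 shows "(hnorm L (hsum L h n))\<^sup>2 = Re (\<Sum>k<n. \<Sum>l<n. hip L (h k) (h l))"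
proof -
 have c: "hsum L h n : carr L" by (rule hsum_carr[OF L h])
 have "hip L (hsum L h n) (hsum L h n) = (\<Sum>k<n. hip L (h k) (hsum L h n))" by (rule hip_hsum(2)[OF L c h])
 also have "... = (\<Sum>k<n. \<Sum>l<n. hip L (h k) (h l))"
 proof (rule sum.cong[OF refl])
  fix k assume "k : {..<n}"
  then have k: "k < n" by simp
  show "hip L (h k) (hsum L h n) = (\<Sum>l<n. hip L (h k) (h l))" by (rule hip_hsum(1)[OF L h[OF k] h])
 qed
 finally show ?thesis using hip_self(2)[OF L c] by simp
qed

text \<open>The bound says that sums of the vectors \<open>g s\<close> are controlled by the same sums of the vectors \<open>f s\<close>, so
  the linear hull of the pairs is the graph of a densely defined bounded operator.\<close>

lemma operator_of_Gram_bound: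
 assumes H: "complete_ips H" and K: "complete_ips K"
  and f: "!!s. s \<in> S ==> f s \<in> carr H" and g: "!!s. s \<in> S ==> g s \<in> carr K"
  and sc: "!!s c. s \<in> S ==> \<exists>t\<in>S. f t = hscale H c (f s) \<and> g t = hscale K c (g s)"
  and dense: "hdense H (hspan H (f ` S))" and C: "C \<ge> 0"
  and Gram: "!!(n::nat) s. (\<forall>k<n. s k \<in> S) ==>
   Re (\<Sum>k<n. \<Sum>l<n. hip K (g (s k)) (g (s l))) \<le> C * Re (\<Sum>k<n. \<Sum>l<n. hip H (f (s k)) (f (s l)))"
 shows "\<exists>T\<in>bdd_ops H K. \<forall>s\<in>S. T (f s) = g s"
proof -
 let ?G = "linear_hull H K f g S"
 have Gc: "x : carr H & y : carr K" if "(x, y) : ?G" for x y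
  using that by induction (use H K f g in auto)
 have "EX T:bdd_ops H K. ALL (x, y):?G. T x = y"
 proof (rule bounded_extension[OF H K, where C = "sqrt C"])
  show "x : carr H & y : carr K" if "(x, y) : ?G" for x y by (rule Gc[OF that])
  show "(hadd H x u, hadd K y v) : ?G" if xy: "(x, y) : ?G" and uv: "(u, v) : ?G" for x y u v
   using uv
  proof induction
   case zero
   then show ?case using xy hadd_laws(3)[OF H, of x x] hadd_laws(3)[OF K, of y y] Gc[OF xy] by simp
  next
   case (step u v s)
   have "(hadd H (hadd H x u) (f s), hadd K (hadd K y v) (g s)) : ?G" by (rule linear_hull.step[OF step.IH step.hyps(2)])
   then show ?case using hadd_laws(1)[OF H] hadd_laws(1)[OF K] Gc[OF xy] Gc[OF step.hyps(1)] f g step.hyps(2) by simp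
  qed
  show "(hscale H c x, hscale K c y) : ?G" if xy: "(x, y) : ?G" for x y c
   using xy
  proof induction
   case zero
   have "hscale H c (hzero H) = hzero H" "hscale K c (hzero K) = hzero K" by (auto simp: hscale_zero[OF H] hscale_zero[OF K])
   then show ?case using linear_hull.zero[of H K f g S] by simp
  next
   case (step x y s)
   obtain t where t: "t : S" "f t = hscale H c (f s)" "g t = hscale K c (g s)" using sc[OF step.hyps(2)] by blast
   have "hscale H c (hadd H x (f s)) = hadd H (hscale H c x) (f t)" "hscale K c (hadd K y (g s)) = hadd K (hscale K c y) (g t)"
    unfolding t using Gc[OF step.hyps(1)] f[OF step.hyps(2)] g[OF step.hyps(2)] H K
    by ((intro hip_ext[OF H]; simp add: algebra_simps; fail) | (intro hip_ext[OF K]; simp add: algebra_simps; fail))+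
   then show ?case using linear_hull.step[OF step.IH t(1)] by simp
  qed
  show "hnorm K y <= sqrt C * hnorm H x" if xy: "(x, y) : ?G" for x y
  proof -
   obtain n s where s: "ALL k<n. s k : S" and x: "x = hsum H (\<lambda>k. f (s k)) n" and y: "y = hsum K (\<lambda>k. g (s k)) n"
    using linear_hull_hsum[OF xy] by blast
   have "(hnorm K y)\<^sup>2 = Re (\<Sum>k<n. \<Sum>l<n. hip K (g (s k)) (g (s l)))" unfolding y by (rule hnorm_hsum_sq[OF K]) (use s g in auto)
   also have "... <= C * Re (\<Sum>k<n. \<Sum>l<n. hip H (f (s k)) (f (s l)))" by (rule Gram[OF s])
   also have "Re (\<Sum>k<n. \<Sum>l<n. hip H (f (s k)) (f (s l))) = (hnorm H x)\<^sup>2" unfolding x by (rule hnorm_hsum_sq[OF H, symmetric]) (use s f in auto)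
   finally have "(hnorm K y)\<^sup>2 <= (sqrt C * hnorm H x)\<^sup>2" using C by (simp add: power_mult_distrib)
   then show ?thesis by (rule power2_le_imp_le) (use C hip_self(3)[OF H] Gc[OF xy] in simp)
  qed
  have sub: "f ` S <= carr H" using f by blast
  have "x : Domain ?G" if "x : hspan H (f ` S)" for x
   using that
  proof induction
   case zero
   show ?case using linear_hull.zero[of H K f g S] by blast
  next
   case (step x u c)
   then obtain s t v where t: "t : S" "f t = hscale H c x" and v: "(u, v) : ?G" using sc by (metis DomainE imageE)
   have "hadd H (hscale H c x) u = hadd H u (f t)" using hadd_laws(2)[OF H, of "f t" u] Gc[OF v] f[OF t(1)] t(2) by simp
   then show ?case using linear_hull.step[OF v t(1)] by force
  qed
  moreover have "Domain ?G <= carr H" using Gc by blast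
  ultimately show "hdense H (Domain ?G)" using dense unfolding hdense_def by (meson subsetD)
 qed (use C in simp)
 then obtain T where T1: "T : bdd_ops H K" and T2: "ALL (x, y):?G. T x = y" by (elim bexE)
 have T: "T x = y" if "(x, y) : ?G" for x y using bspec[OF T2 that] by simp
 have "T (f s) = g s" if s: "s : S" for s
  using T[OF linear_hull.step[OF linear_hull.zero s]] hadd_laws(2,3)[OF H f[OF s], of "hzero H"] hadd_laws(2,3)[OF K g[OF s], of "hzero K"] H K by simp
 then show ?thesis using T1 by blast
qed

section \<open>Left modules and modules of the extension\<close>

lemma bij_operator_category_iso:
 assumes C: "cstar_category (operator_category Ob Hm)" and D: "cstar_category (operator_category Ob' Hm')"
  and bij: "bij_betw F Ob Ob'" and F: "!!X. X \<in> Ob ==> fst (F X) = fst X"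
  and Hm: "!!X Y. X \<in> Ob ==> Y \<in> Ob ==> Hm X Y = Hm' (F X) (F Y)"
 shows "cstar_category_iso (operator_category Ob Hm) (operator_category Ob' Hm') F (\<lambda>X Y T. T)"
proof -
 define G where "G = inv_into Ob F"
 have FO: "F X : Ob'" and GF: "G (F X) = X" if "X : Ob" for X
  using bij that by (auto simp: bij_betw_def G_def)
 have GO: "G Z : Ob" and FG: "F (G Z) = Z" if "Z : Ob'" for Z
  using bij that by (auto simp: bij_betw_def G_def inv_into_into f_inv_into_f)
 have G: "fst (G Z) = fst Z" if "Z : Ob'" for Z using F[OF GO[OF that]] FG[OF that] by simp
 have HmG: "Hm (G Z) (G W) = Hm' Z W" if "Z : Ob'" "W : Ob'" for Z W
  using Hm[OF GO[OF that(1)] GO[OF that(2)]] FG that by simp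
 show ?thesis
  unfolding cstar_category_iso_def
 proof (intro conjI C D exI[of _ G] exI[of _ "\<lambda>X Y T. T"])
  show "star_functor (operator_category Ob Hm) (operator_category Ob' Hm') F (\<lambda>X Y T. T)"
   unfolding star_functor_def operator_category_simps using FO F Hm by simp
  show "star_functor (operator_category Ob' Hm') (operator_category Ob Hm) G (\<lambda>X Y T. T)"
   unfolding star_functor_def operator_category_simps using GO G HmG by simp
 qed (simp_all add: operator_category_simps GF FG)
qed

lemma Hom_BA_intertwiners:
 fixes i j :: "'v amod"
 shows "Hom_BA B (i, p) (j, q) = intertwiners i j (Sigma \<J> B) (\<lambda>s. p (fst s) (snd s)) (\<lambda>s. q (fst s) (snd s))"
proof -
 have "(compose (carr i) T R = compose (carr i) R' T) = (ALL x:carr i. T (R x) = R' (T x))" for T R R' :: "'v => 'v"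
  by (auto simp: compose_def fun_eq_iff)
 then show ?thesis unfolding Hom_BA_def intertwiners_def by simp
qed

context frobenius_extension
begin

lemma BQ_adj: "I \<in> \<J> ==> S \<in> BQ N E Q I ==> adj a a S \<in> BQ N E Q I"
 using field_adj[OF regular_module, of I] unfolding BQ_eq by auto

lemma BA_moduleD:
 assumes "(i, p) \<in> BA_modules N a (BQ N E Q)"
 shows "A_module N i" "I \<in> \<J> ==> star_rep a (BQ N E Q I) i (p I)"
  and "I \<in> \<J> ==> S \<in> alg N (fst I) ==> act i (fst I) S = p I (act a (fst I) S)"
  and "I \<in> \<J> ==> J \<in> \<J> ==> arg_sub I J ==> X \<in> BQ N E Q I ==> p J X = p I X"
 using assms unfolding BA_modules_def mem_Collect_eq case_prod_conv by (blast intro: normal_rep_star_rep)+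

lemma act_BQ: "I \<in> \<J> ==> S \<in> alg N (fst I) ==> act a (fst I) S \<in> BQ N E Q I"
 using field_alg[OF regular_module] alg_vec(1) unfolding BQ_eq by (metis imageI)

text \<open>By naturality of \<open>L\<close> a morphism of left modules commutes with fields. Conversely, the fields contain the
  local algebras, and the vectors \<open>L(\<xi>) \<psi>\<close> are total, so commuting with all fields implies both
  conditions on a morphism of left modules.\<close>

lemma Hom_left_eq_Hom_BA:
 assumes X: "(i, m) \<in> left_modules N E Q" and Y: "(j, n) \<in> left_modules N E Q"
 shows "Hom_left N E Q (i, m) (j, n) = Hom_BA (BQ N E Q) (i, field_rep i m) (j, field_rep j n)"
proof (intro equalityI subsetI)
 note im = left_moduleD(1,2)[OF X] and jm = left_moduleD(1,2)[OF Y]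
 note aj = tens_mod[OF a jm(1)] and ai = tens_mod[OF a im(1)]
 {
  fix T assume "T : Hom_left N E Q (i, m) (j, n)"
  then have T: "T : Hom_A N i j" and eq: "compose (carr (a \<otimes> i)) T m = compose (carr (a \<otimes> i)) n (lwhisk E a i j T)"
   by (auto simp: Hom_left_def)
  have Tm: "T (m v) = n (lwhisk E a i j T v)" if "v : carr (a \<otimes> i)" for v
   using fun_cong[OF eq, of v] that by (simp add: compose_eq)
  have "compose (carr i) T (field_rep i m I S) = compose (carr i) (field_rep j n I S) T"
   if I: "I : \<J>" and SB: "S : BQ N E Q I" for I S
  proof -
   obtain \<xi> where \<xi>: "\<xi> : \<H> a I" "S = field a \<mu> I \<xi>" using SB by (auto simp: BQ_eq)
   show ?thesis
    unfolding \<xi>(2) field_rep_field[OF I \<xi>(1)]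
   proof
    fix \<psi>
    show "compose (carr i) T (field i m I \<xi>) \<psi> = compose (carr i) (field j n I \<xi>) T \<psi>"
    proof (cases "\<psi> : carr i")
     case True
     note L = op_carr[OF L_bdd[OF a im(1) I \<xi>(1)] True]
     show ?thesis
      using True Tm[OF L] L_natural(1)[OF a im(1) jm(1) T I \<xi>(1) True] op_carr[OF Hom_A_bdd[OF T] True]
      by (simp add: compose_eq field_eq[OF X I] field_eq[OF Y I])
    qed (simp add: compose_def)
   qed
  qed
  then show "T : Hom_BA (BQ N E Q) (i, field_rep i m) (j, field_rep j n)" using Hom_A_bdd[OF T] by (simp add: Hom_BA_def)
 next
  fix T assume "T : Hom_BA (BQ N E Q) (i, field_rep i m) (j, field_rep j n)"
  then have Tb: "T : bdd_ops i j"
   and eq: "!!I S. I : \<J> ==> S : BQ N E Q I ==> compose (carr i) T (field_rep i m I S) = compose (carr i) (field_rep j n I S) T"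
   by (auto simp: Hom_BA_def)
  have T: "T : Hom_A N i j"
   unfolding Hom_A_iff
  proof (intro conjI Tb ballI)
   fix K assume "K : intervals"
   then obtain I where I: "I : \<J>" "fst I = K" by (rule arg_interval_exists)
   show "T : Hom_loc N K i j"
    unfolding Hom_loc_def mem_Collect_eq
   proof (intro conjI Tb ballI)
    fix S assume S: "S : alg N K"
    show "compose (carr i) T (act i K S) = compose (carr i) (act j K S) T"
     using eq[OF I(1) act_BQ[OF I(1)], of S] BA_moduleD(3)[OF field_rep_BA_module[OF X] I(1), of S]
      BA_moduleD(3)[OF field_rep_BA_module[OF Y] I(1), of S] S I(2) by simp
   qed
  qed
  obtain I where I: "I : \<J>" using clockwise_complement_exists arg_arc_in[of 0 1] pi_gt3 by fastforce
  note lT = Hom_A_bdd[OF lwhisk_Hom(1)[OF a im(1) jm(1) T]] and mb = Hom_A_bdd[OF im(2)] and nb = Hom_A_bdd[OF jm(2)]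
  have "compose (carr (a \<otimes> i)) T m = compose (carr (a \<otimes> i)) n (lwhisk E a i j T)"
  proof (rule op_eq_on_L[OF a im(1) cmp[OF jm(1)] I])
   show "compose (carr (a \<otimes> i)) T m : bdd_ops (a \<otimes> i) j" by (rule bdd_ops_compose[OF cmp[OF ai] cmp[OF im(1)] cmp[OF jm(1)] mb Tb])
   show "compose (carr (a \<otimes> i)) n (lwhisk E a i j T) : bdd_ops (a \<otimes> i) j" by (rule bdd_ops_compose[OF cmp[OF ai] cmp[OF aj] cmp[OF jm(1)] lT nb])
   fix \<xi> \<psi> assume \<xi>: "\<xi> : \<H> a I" and \<psi>: "\<psi> : carr i"
   have "field a \<mu> I \<xi> : BQ N E Q I" using \<xi> by (simp add: BQ_eq)
   from fun_cong[OF eq[OF I this], of \<psi>]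
   have "T (m (Lop E a i \<xi> I \<psi>)) = n (Lop E a j \<xi> I (T \<psi>))"
    using \<psi> op_carr[OF Tb \<psi>] by (simp add: field_rep_field[OF I \<xi>] compose_eq field_eq[OF X I] field_eq[OF Y I])
   then show "compose (carr (a \<otimes> i)) T m (Lop E a i \<xi> I \<psi>) = compose (carr (a \<otimes> i)) n (lwhisk E a i j T) (Lop E a i \<xi> I \<psi>)"
    using L_natural(1)[OF a im(1) jm(1) T I \<xi> \<psi>] op_carr[OF L_bdd[OF a im(1) I \<xi>] \<psi>] by (simp add: compose_eq)
  qed
  then show "T : Hom_left N E Q (i, m) (j, n)" using T by (simp add: Hom_left_def)
 }
qed

lemma field_determines:
 assumes i: "A_module N i" and m: "m \<in> bdd_ops (a \<otimes> i) i" "m' \<in> bdd_ops (a \<otimes> i) i" and I: "I \<in> \<J>"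
  and eq: "!!\<xi>. \<xi> \<in> \<H> a I ==> field i m I \<xi> = field i m' I \<xi>"
 shows "m = m'"
proof (rule op_eq_on_L[OF a i cmp[OF i] I m])
 fix \<xi> \<psi> assume "\<xi> : \<H> a I" "\<psi> : carr i"
 then show "m (Lop E a i \<xi> I \<psi>) = m' (Lop E a i \<xi> I \<psi>)" using fun_cong[OF eq, of \<xi> \<psi>] by (simp add: field_def compose_eq)
qed

text \<open>The multiplication of the left module belonging to \<open>p\<close> has to map \<open>L(\<xi>) \<psi>\<close> to \<open>p(b) \<psi>\<close>, where \<open>b\<close>
  is the field of \<open>\<xi>\<close>. It is bounded as \<open>p\<close> is completely positive: the matrix with the entries
  \<open>C L(\<xi>\<^sub>k)\<^sup>* L(\<xi>\<^sub>l) - b\<^sub>k\<^sup>* b\<^sub>l\<close>, where \<open>C\<close> is the square of the norm of \<open>\<mu>\<close>, is positive on \<open>a\<close>.\<close>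

lemma multiplication_exists_locally:
 assumes p: "(i, p) \<in> BA_modules N a (BQ N E Q)" and I: "I \<in> \<J>"
 shows "\<exists>m\<in>bdd_ops (a \<otimes> i) i. \<forall>\<xi>\<in>\<H> a I. field i m I \<xi> = p I (field a \<mu> I \<xi>)"
proof -
 note i = BA_moduleD(1)[OF p] and pI = BA_moduleD(2)[OF p I] and pact = BA_moduleD(3)[OF p I]
 note ca = cmp[OF a] and ci = cmp[OF i] and ai = tens_mod[OF a i] and aa = tens_mod[OF a a]
 note cai = cmp[OF ai] and caa = cmp[OF aa] and fI = fst_arg_interval[OF I]
 obtain C where C: "C <= bdd_ops a a" and B: "BQ N E Q I = commutant a C" by (rule BQ_commutant_exists[OF I])
 note alg = commutant_algebra[OF ca C, folded B] and Bb = commutantD(1)[of _ a C, folded B] and pD = star_repD[OF pI]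
 define S where "S = \<H> a I \<times> carr i"
 define f where "f = (\<lambda>(\<xi>, \<psi>). Lop E a i \<xi> I \<psi>)"
 define b where "b \<xi> = field a \<mu> I \<xi>" for \<xi>
 define g where "g = (\<lambda>(\<xi>, \<psi>). p I (b \<xi>) \<psi>)"
 have bB: "b \<xi> : BQ N E Q I" if "\<xi> : \<H> a I" for \<xi> using that by (simp add: BQ_eq b_def)
 note Lb = L_bdd[OF a i I] and La = L_bdd[OF a a I] and pb = pD(1)[OF bB]
 obtain c where c: "c >= 0" "!!v. v : carr (a \<otimes> a) ==> hnorm a (\<mu> v) <= c * hnorm (a \<otimes> a) v"
  using bdd_ops_bound[OF caa Hom_A_bdd[OF \<mu>]] by blast
 have "EX T:bdd_ops (a \<otimes> i) i. ALL s:S. T (f s) = g s"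
 proof (rule operator_of_Gram_bound[OF cai ci, where C = "c\<^sup>2"])
  show "f s : carr (a \<otimes> i)" if "s : S" for s using that op_carr[OF Lb] by (auto simp: S_def f_def)
  show "g s : carr i" if "s : S" for s using that op_carr[OF pb] by (auto simp: S_def g_def)
  show "EX t:S. f t = hscale (a \<otimes> i) z (f s) & g t = hscale i z (g s)" if "s : S" for s z
  proof -
   obtain \<xi> \<psi> where s: "s = (\<xi>, \<psi>)" "\<xi> : \<H> a I" "\<psi> : carr i" using \<open>s : S\<close> by (auto simp: S_def)
   show ?thesis
    using s(2,3) bdd_opsD(4)[OF Lb[OF s(2)] s(3)] bdd_opsD(4)[OF pb[OF s(2)] s(3)] ci
    by (intro bexI[of _ "(\<xi>, hscale i z \<psi>)"]) (auto simp: s(1) f_def g_def S_def)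
  qed
  have "f ` S = {Lop E a i \<xi> I \<psi> |\<xi> \<psi>. \<xi> : \<H> a I & \<psi> : carr i}" by (auto simp: f_def S_def)
  then show "hdense (a \<otimes> i) (hspan (a \<otimes> i) (f ` S))" using L_dense[OF a i I] by simp
  fix n :: nat and s assume s: "ALL k<n. s k : S"
  define \<xi> where "\<xi> k = fst (s k)" for k
  define \<psi> where "\<psi> k = snd (s k)" for k
  have \<xi>: "\<xi> k : \<H> a I" and \<psi>: "\<psi> k : carr i" if "k < n" for k
   using s that by (auto simp: S_def \<xi>_def \<psi>_def mem_Times_iff)
  have "EX x. x : alg N (fst I) & (ALL j v. A_module N j \<longrightarrow> v : carr j \<longrightarrow>
    adj j (a \<otimes> j) (Lop E a j (\<xi> k) I) (Lop E a j (\<xi> l) I v) = act j (fst I) x v)" if "k < n" "l < n" for k l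
   using L_adj_L[OF a I \<xi>[OF that(1)] \<xi>[OF that(2)]] by metis
  then obtain x where x: "!!k l. k < n ==> l < n ==> x k l : alg N (fst I)"
   "!!k l j v. k < n ==> l < n ==> A_module N j ==> v : carr j ==>
    adj j (a \<otimes> j) (Lop E a j (\<xi> k) I) (Lop E a j (\<xi> l) I v) = act j (fst I) (x k l) v" by metis
  have Gram: "hip j u (act j (fst I) (x k l) v) = hip (a \<otimes> j) (Lop E a j (\<xi> k) I u) (Lop E a j (\<xi> l) I v)"
   if j: "A_module N j" and kl: "k < n" "l < n" and uv: "u : carr j" "v : carr j" for j k l u v
   using adj_right[OF cmp[OF j] cmp[OF tens_mod[OF a j]] L_bdd[OF a j I \<xi>[OF kl(1)]] uv(1) op_carr[OF L_bdd[OF a j I \<xi>[OF kl(2)]] uv(2)]]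
    x(2)[OF kl j uv(2)] by simp
  define bb where "bb k l = compose (carr a) (adj a a (b (\<xi> k))) (b (\<xi> l))" for k l
  define Z where "Z k l = op_add a a (op_scale a a (of_real (c\<^sup>2)) (act a (fst I) (x k l))) (op_scale a a (-1) (bb k l))" for k l
  have bk: "b (\<xi> k) : BQ N E Q I" if "k < n" for k by (rule bB[OF \<xi>[OF that]])
  have bbB: "bb k l : BQ N E Q I" if "k < n" "l < n" for k l
   unfolding bb_def by (rule alg(4)[OF BQ_adj[OF I bk[OF that(1)]] bk[OF that(2)]])
  have aB: "act a (fst I) (x k l) : BQ N E Q I" if "k < n" "l < n" for k l by (rule act_BQ[OF I x(1)[OF that]])
  have ZB: "Z k l : BQ N E Q I" if "k < n" "l < n" for k l
   unfolding Z_def by (rule alg(2)[OF alg(3)[OF aB[OF that]] alg(3)[OF bbB[OF that]]])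
  have bbip: "hip a u (bb k l v) = hip a (b (\<xi> k) u) (b (\<xi> l) v)" if "k < n" "l < n" "u : carr a" "v : carr a" for k l u v
   using adj_right[OF ca ca Bb[OF bk[OF that(1)]] that(3) op_carr[OF Bb[OF bk[OF that(2)]] that(4)]] that by (simp add: bb_def compose_eq)
  have Zip: "hip a u (Z k l v) = of_real (c\<^sup>2) * hip (a \<otimes> a) (Lop E a a (\<xi> k) I u) (Lop E a a (\<xi> l) I v) - hip a (b (\<xi> k) u) (b (\<xi> l) v)"
   if "k < n" "l < n" "u : carr a" "v : carr a" for k l u v
   using that ca Gram[OF a that] bbip[OF that] op_carr[OF Bb[OF aB[OF that(1,2)]] that(4)] op_carr[OF Bb[OF bbB[OF that(1,2)]] that(4)]
   by (simp add: Z_def op_add_def op_scale_def)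
  have bc: "b (\<xi> k) u : carr a" "b (\<xi> k) u = \<mu> (Lop E a a (\<xi> k) I u)" "Lop E a a (\<xi> k) I u : carr (a \<otimes> a)"
   if "k < n" "u : carr a" for k u
   using op_carr[OF Bb[OF bk[OF that(1)]] that(2)] field_eq[OF regular_module I that(2)] op_carr[OF La[OF \<xi>[OF that(1)]] that(2)]
   by (simp_all add: b_def)
  have herm: "adj a a (Z k l) = Z l k" if kl: "k < n" "l < n" for k l
  proof (rule adj_unique[OF ca ca Bb[OF ZB[OF kl]] Bb[OF ZB[OF kl(2,1)]]])
   fix v u assume v: "v : carr a" and u: "u : carr a"
   have "hip a (Z l k u) v = cnj (hip a v (Z l k u))"
    using hip_cnj[OF ca v op_carr[OF Bb[OF ZB[OF kl(2,1)]] u]] by simp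
   then show "hip a u (Z k l v) = hip a (Z l k u) v"
    unfolding Zip[OF kl u v] Zip[OF kl(2,1) v u]
    using hip_cnj[OF caa bc(3)[OF kl(2) v] bc(3)[OF kl(1) u]] hip_cnj[OF ca bc(1)[OF kl(2) v] bc(1)[OF kl(1) u]] by simp
  qed
  have pos: "0 <= Re (\<Sum>k<n. \<Sum>l<n. hip a (u k) (Z k l (u l)))" if u: "!!k. k < n ==> u k : carr a" for u
  proof -
   let ?w = "hsum (a \<otimes> a) (\<lambda>k. Lop E a a (\<xi> k) I (u k)) n"
   have w: "?w : carr (a \<otimes> a)" by (rule hsum_carr[OF caa]) (rule bc(3)[OF _ u])
   have "\<mu> ?w = hsum a (\<lambda>k. \<mu> (Lop E a a (\<xi> k) I (u k))) n"
    by (rule bdd_ops_hsum[OF caa ca Hom_A_bdd[OF \<mu>]]) (rule bc(3)[OF _ u])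
   moreover have "(hnorm a (hsum a (\<lambda>k. \<mu> (Lop E a a (\<xi> k) I (u k))) n))\<^sup>2
     = Re (\<Sum>k<n. \<Sum>l<n. hip a (\<mu> (Lop E a a (\<xi> k) I (u k))) (\<mu> (Lop E a a (\<xi> l) I (u l))))"
    by (rule hnorm_hsum_sq[OF ca]) (rule op_carr[OF Hom_A_bdd[OF \<mu>] bc(3)[OF _ u]])
   moreover have "(\<Sum>k<n. \<Sum>l<n. hip a (\<mu> (Lop E a a (\<xi> k) I (u k))) (\<mu> (Lop E a a (\<xi> l) I (u l))))
     = (\<Sum>k<n. \<Sum>l<n. hip a (b (\<xi> k) (u k)) (b (\<xi> l) (u l)))"
    by (intro sum.cong refl) (use bc(2) u in simp)
   ultimately have 1: "(hnorm a (\<mu> ?w))\<^sup>2 = Re (\<Sum>k<n. \<Sum>l<n. hip a (b (\<xi> k) (u k)) (b (\<xi> l) (u l)))" by simp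
   have 2: "(hnorm (a \<otimes> a) ?w)\<^sup>2 = Re (\<Sum>k<n. \<Sum>l<n. hip (a \<otimes> a) (Lop E a a (\<xi> k) I (u k)) (Lop E a a (\<xi> l) I (u l)))"
    by (rule hnorm_hsum_sq[OF caa]) (rule bc(3)[OF _ u])
   have "(hnorm a (\<mu> ?w))\<^sup>2 <= (c * hnorm (a \<otimes> a) ?w)\<^sup>2"
    by (rule power_mono[OF c(2)[OF w] hip_self(3)[OF ca op_carr[OF Hom_A_bdd[OF \<mu>] w]]])
   then have "(hnorm a (\<mu> ?w))\<^sup>2 <= c\<^sup>2 * (hnorm (a \<otimes> a) ?w)\<^sup>2" by (simp add: power_mult_distrib)
   moreover have "(\<Sum>k<n. \<Sum>l<n. hip a (u k) (Z k l (u l)))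
     = of_real (c\<^sup>2) * (\<Sum>k<n. \<Sum>l<n. hip (a \<otimes> a) (Lop E a a (\<xi> k) I (u k)) (Lop E a a (\<xi> l) I (u l)))
      - (\<Sum>k<n. \<Sum>l<n. hip a (b (\<xi> k) (u k)) (b (\<xi> l) (u l)))"
    unfolding sum_distrib_left sum_subtractf[symmetric] by (intro sum.cong refl) (use Zip u in simp)
   ultimately show ?thesis unfolding 1 2 by (simp del: of_real_power Re_sum)
  qed
  have "0 <= Re (\<Sum>k<n. \<Sum>l<n. hip i (\<psi> k) (p I (Z k l) (\<psi> l)))"
   by (rule star_rep_completely_positive[OF ca ci C pI[unfolded B] ZB[unfolded B] herm pos \<psi>])
  also have "(\<Sum>k<n. \<Sum>l<n. hip i (\<psi> k) (p I (Z k l) (\<psi> l)))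
    = (\<Sum>k<n. \<Sum>l<n. of_real (c\<^sup>2) * hip (a \<otimes> i) (f (s k)) (f (s l)) - hip i (g (s k)) (g (s l)))"
  proof (intro sum.cong refl)
   fix k l assume "k : {..<n}" "l : {..<n}"
   then have kl: "k < n" "l < n" by auto
   have 1: "p I (bb k l) = compose (carr i) (adj i i (p I (b (\<xi> k)))) (p I (b (\<xi> l)))"
    unfolding bb_def pD(4)[OF BQ_adj[OF I bk[OF kl(1)]] bk[OF kl(2)]] pD(5)[OF bk[OF kl(1)]] ..
   have "p I (Z k l) = op_add i i (op_scale i i (of_real (c\<^sup>2)) (act i (fst I) (x k l)))
     (op_scale i i (-1) (compose (carr i) (adj i i (p I (b (\<xi> k)))) (p I (b (\<xi> l)))))"
    unfolding Z_def pD(2)[OF alg(3)[OF aB[OF kl]] alg(3)[OF bbB[OF kl]]] pD(3)[OF aB[OF kl]] pD(3)[OF bbB[OF kl]]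
     pact[OF x(1)[OF kl]] 1 ..
   moreover have "hip i (\<psi> k) (adj i i (p I (b (\<xi> k))) (p I (b (\<xi> l)) (\<psi> l))) = hip i (g (s k)) (g (s l))"
    using adj_right[OF ci ci pD(1)[OF bk[OF kl(1)]] \<psi>[OF kl(1)] op_carr[OF pD(1)[OF bk[OF kl(2)]] \<psi>[OF kl(2)]]]
    by (simp add: g_def split_beta \<xi>_def \<psi>_def)
   moreover have "hip i (\<psi> k) (act i (fst I) (x k l) (\<psi> l)) = hip (a \<otimes> i) (f (s k)) (f (s l))"
    using Gram[OF i kl \<psi>[OF kl(1)] \<psi>[OF kl(2)]] by (simp add: f_def split_beta \<xi>_def \<psi>_def)
   ultimately show "hip i (\<psi> k) (p I (Z k l) (\<psi> l)) = of_real (c\<^sup>2) * hip (a \<otimes> i) (f (s k)) (f (s l)) - hip i (g (s k)) (g (s l))"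
    using ci \<psi>[OF kl(1)] \<psi>[OF kl(2)] op_carr[OF A_module_act(1)[OF i fI x(1)[OF kl]] \<psi>[OF kl(2)]]
     op_carr[OF adj_bdd[OF ci ci pD(1)[OF bk[OF kl(1)]]] op_carr[OF pD(1)[OF bk[OF kl(2)]] \<psi>[OF kl(2)]]]
    by (simp add: op_add_def op_scale_def compose_eq)
  qed
  also have "... = of_real (c\<^sup>2) * (\<Sum>k<n. \<Sum>l<n. hip (a \<otimes> i) (f (s k)) (f (s l))) - (\<Sum>k<n. \<Sum>l<n. hip i (g (s k)) (g (s l)))"
   by (simp only: sum_distrib_left sum_subtractf)
  finally show "Re (\<Sum>k<n. \<Sum>l<n. hip i (g (s k)) (g (s l))) <= c\<^sup>2 * Re (\<Sum>k<n. \<Sum>l<n. hip (a \<otimes> i) (f (s k)) (f (s l)))"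
   by (simp del: of_real_power Re_sum)
 qed simp
 then obtain m where m: "m : bdd_ops (a \<otimes> i) i" "!!s. s : S ==> m (f s) = g s" by blast
 have "field i m I \<xi> = p I (field a \<mu> I \<xi>)" if \<xi>: "\<xi> : \<H> a I" for \<xi>
 proof (rule op_eqI[OF _ pb[OF \<xi>, unfolded b_def]])
  show "field i m I \<xi> : bdd_ops i i" unfolding field_def by (rule bdd_ops_compose[OF ci cai ci Lb[OF \<xi>] m(1)])
  fix \<psi> assume "\<psi> : carr i"
  then show "field i m I \<xi> \<psi> = p I (field a \<mu> I \<xi>) \<psi>"
   using m(2)[of "(\<xi>, \<psi>)"] \<xi> by (simp add: field_def compose_eq f_def g_def S_def b_def)
 qed
 then show ?thesis using m(1) by blast
qed

text \<open>For nested arg-valued intervals the local multiplications agree, and any two arg-valued intervals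
  are connected by nested ones.\<close>

lemma multiplication_exists:
 assumes p: "(i, p) \<in> BA_modules N a (BQ N E Q)"
 obtains m where "m \<in> bdd_ops (a \<otimes> i) i"
  "!!I \<xi>. I \<in> \<J> ==> \<xi> \<in> \<H> a I ==> field i m I \<xi> = p I (field a \<mu> I \<xi>)"
proof -
 note i = BA_moduleD(1)[OF p]
 let ?P = "\<lambda>I m. m : bdd_ops (a \<otimes> i) i & (ALL \<xi>:\<H> a I. field i m I \<xi> = p I (field a \<mu> I \<xi>))"
 define \<phi> where "\<phi> I = (SOME m. ?P I m)" for I
 have \<phi>: "?P I (\<phi> I)" if "I : \<J>" for I
 proof -
  have "EX m. ?P I m" using multiplication_exists_locally[OF p that] by blast
  then show ?thesis unfolding \<phi>_def by (rule someI_ex)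
 qed
 have step: "\<phi> I = \<phi> J" if IJ: "I : \<J>" "J : \<J>" "arg_sub I J" for I J
 proof (rule field_determines[OF i _ _ IJ(1)])
  fix \<xi> assume \<xi>: "\<xi> : \<H> a I"
  have "field a \<mu> I \<xi> : BQ N E Q I" using \<xi> by (simp add: BQ_eq)
  then have "p J (field a \<mu> I \<xi>) = p I (field a \<mu> I \<xi>)" by (rule BA_moduleD(4)[OF p IJ])
  then show "field i (\<phi> I) I \<xi> = field i (\<phi> J) I \<xi>"
   using bspec[OF conjunct2[OF \<phi>[OF IJ(1)]] \<xi>] bspec[OF conjunct2[OF \<phi>[OF IJ(2)]] field_mono(1)[OF IJ \<xi> i]]
    field_mono(2)[OF IJ \<xi> i, of "\<phi> J"] field_mono(2)[OF IJ \<xi> a, of \<mu>] by simp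
 qed (use \<phi> IJ in auto)
 have "arg_arc 0 1 : \<J>" by (rule arg_arc_in) (use pi_gt3 in auto)
 then show ?thesis
  using that[of "\<phi> (arg_arc 0 1)"] \<phi> constant_on_arg_intervals[of \<phi>, OF step] by metis
qed

text \<open>The vectors \<open>L(\<xi>) L(\<eta>) \<psi>\<close> are total in \<open>a \<boxtimes> (a \<boxtimes> i)\<close>, which the associator identifies with the
  domain of \<open>S\<close> and \<open>T\<close>.\<close>

lemma op_eq_on_LL:
 assumes i: "A_module N i" and K: "complete_ips K" and I: "I \<in> \<J>"
  and S: "S \<in> bdd_ops ((a \<otimes> a) \<otimes> i) K" and T: "T \<in> bdd_ops ((a \<otimes> a) \<otimes> i) K"
  and eq: "!!\<xi> \<eta> \<psi>. \<xi> \<in> \<H> a I ==> \<eta> \<in> \<H> a I ==> \<psi> \<in> carr i ==>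
   S (Lop E (a \<otimes> a) i (Lop E a a \<xi> I \<eta>) I \<psi>) = T (Lop E (a \<otimes> a) i (Lop E a a \<xi> I \<eta>) I \<psi>)"
 shows "S = T"
proof -
 let ?P = "(a \<otimes> a) \<otimes> i" and ?R = "a \<otimes> i"
 note R = tens_mod[OF a i] and aa = tens_mod[OF a a]
 note P = tens_mod[OF aa i] and aR = tens_mod[OF a R]
 let ?s = "assoc E a a i" let ?t = "adj ?P (a \<otimes> ?R) ?s"
 have sb: "?s : bdd_ops ?P (a \<otimes> ?R)" by (rule Hom_A_bdd[OF assoc_Hom(1)[OF a a i]])
 note tb = adj_bdd[OF cmp[OF P] cmp[OF aR] sb] and ts = unitary_D[OF P aR assoc_Hom(2)[OF a a i]]
 note cc = bdd_ops_compose[OF cmp[OF aR] cmp[OF P] K tb]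
 have "compose (carr (a \<otimes> ?R)) S ?t = compose (carr (a \<otimes> ?R)) T ?t"
 proof (rule op_eq_on_L[OF a R K I cc[OF S] cc[OF T]])
  fix \<xi> w assume \<xi>: "\<xi> : \<H> a I" and w: "w : carr ?R"
  note L = L_bdd[OF a R I \<xi>]
  note dd = bdd_ops_compose[OF cmp[OF R] cmp[OF aR] K L]
  have "compose (carr ?R) (compose (carr (a \<otimes> ?R)) S ?t) (Lop E a ?R \<xi> I)
    = compose (carr ?R) (compose (carr (a \<otimes> ?R)) T ?t) (Lop E a ?R \<xi> I)"
  proof (rule op_eq_on_L[OF a i K I dd[OF cc[OF S]] dd[OF cc[OF T]]])
   fix \<eta> \<psi> assume \<eta>: "\<eta> : \<H> a I" and \<psi>: "\<psi> : carr i"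
   have v: "Lop E a i \<eta> I \<psi> : carr ?R" by (rule op_carr[OF L_bdd[OF a i I \<eta>] \<psi>])
   have "Lop E (a \<otimes> a) i (Lop E a a \<xi> I \<eta>) I \<psi> : carr ?P"
    by (rule op_carr[OF L_bdd[OF aa i I L_of_L(1)[OF a a i I \<xi> \<eta>]] \<psi>])
   then have "?t (Lop E a ?R \<xi> I (Lop E a i \<eta> I \<psi>)) = Lop E (a \<otimes> a) i (Lop E a a \<xi> I \<eta>) I \<psi>"
    using L_of_L(2)[OF a a i I \<xi> \<eta> \<psi>] ts(1) by metis
   then show "compose (carr ?R) (compose (carr (a \<otimes> ?R)) S ?t) (Lop E a ?R \<xi> I) (Lop E a i \<eta> I \<psi>)
     = compose (carr ?R) (compose (carr (a \<otimes> ?R)) T ?t) (Lop E a ?R \<xi> I) (Lop E a i \<eta> I \<psi>)"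
    using v op_carr[OF L v] eq[OF \<xi> \<eta> \<psi>] by (simp add: compose_eq)
  qed
  from fun_cong[OF this, of w]
  show "compose (carr (a \<otimes> ?R)) S ?t (Lop E a ?R \<xi> I w) = compose (carr (a \<otimes> ?R)) T ?t (Lop E a ?R \<xi> I w)"
   using w by (simp add: compose_eq)
 qed
 note eq' = this
 show ?thesis
 proof (rule op_eqI[OF S T])
  fix v assume v: "v : carr ?P"
  show "S v = T v" using fun_cong[OF eq', of "?s v"] op_carr[OF sb v] ts(1)[OF v] by (simp add: compose_eq)
 qed
qed

text \<open>\<open>m\<close> intertwines the algebra of \<open>K\<close>: test on fields of an interval \<open>I\<close> that is disjoint from \<open>K\<close>, but
  lies with \<open>K\<close> in a common arg-valued interval, whose representation \<open>p\<close> sees both to commute. The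
  Frobenius relation holds as both sides have the matrix elements \<open>\<langle>p(b\<^sub>\<eta>) \<theta>, p(b\<^sub>\<xi>) \<psi>\<rangle>\<close> between \<open>L(\<eta>) \<theta>\<close> and
  \<open>L(\<xi>) \<psi>\<close>, because \<open>L(\<eta>)\<^sup>* \<mu>\<^sup>* \<xi>\<close> is \<open>b\<^sub>\<eta>\<^sup>* \<xi>\<close>.\<close>

lemma multiplication_left_module:
 assumes p: "(i, p) \<in> BA_modules N a (BQ N E Q)" and mb: "m \<in> bdd_ops (a \<otimes> i) i"
  and fp: "!!I \<xi>. I \<in> \<J> ==> \<xi> \<in> \<H> a I ==> field i m I \<xi> = p I (field a \<mu> I \<xi>)"
 shows "(i, m) \<in> left_modules N E Q"
proof -
 let ?P = "(a \<otimes> a) \<otimes> i" and ?R = "a \<otimes> i"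
 note i = BA_moduleD(1)[OF p] and pact = BA_moduleD(3)[OF p] and reg = regular_module
 note R = tens_mod[OF a i] and aa = tens_mod[OF a a]
 note P = tens_mod[OF aa i] and aR = tens_mod[OF a R] and vi = tens_mod[OF vac_mod i]
 note ca = cmp[OF a] and ci = cmp[OF i] and cR = cmp[OF R] and cP = cmp[OF P]
 have mL: "m (Lop E a i \<xi> I \<psi>) = p I (field a \<mu> I \<xi>) \<psi>" if "I : \<J>" "\<xi> : \<H> a I" "\<psi> : carr i" for I \<xi> \<psi>
  using fun_cong[OF fp[OF that(1,2)], of \<psi>] that(3) by (simp add: field_def compose_eq)
 have fB: "field a \<mu> I \<xi> : BQ N E Q I" if "\<xi> : \<H> a I" for I \<xi> using that by (simp add: BQ_eq)
 have m: "m : Hom_A N ?R i"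
  unfolding Hom_A_iff
 proof (intro conjI mb ballI)
  fix K assume K: "K : intervals"
  obtain I M where I: "I : \<J>" and M: "M : \<J>" and IM: "arg_sub I M" and KM: "K <= fst M" and dis: "fst I \<inter> K = {}"
   by (rule disjoint_neighbour_exists[OF K])
  note fI = fst_arg_interval[OF I] and fM = fst_arg_interval[OF M]
  have KI: "K <= iopp (fst I)" by (rule subset_iopp_of_disjoint) (use K fI dis in auto)
  show "m : Hom_loc N K ?R i"
   unfolding Hom_loc_def mem_Collect_eq
  proof (intro conjI mb ballI)
   fix S assume S: "S : alg N K"
   have SM: "S : alg N (fst M)" using moebius_netD(3)[OF N K fM KM] S by blast
   have actM: "act j K S = act j (fst M) S" if "A_module N j" for j using A_module_act(3)[OF that K S fM KM] by simp
   note Sb = A_module_act(1)[OF R K S] and Si = A_module_act(1)[OF i K S] and Sa = A_module_act(1)[OF a K S]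
   have loc: "T : Hom_loc N K j k" if "T : Hom_loc N (iopp (fst I)) j k" "A_module N j" "A_module N k" for T j k
    by (rule Hom_loc_mono[OF N that(2,3) K iopp_in_intervals[OF fI] KI that(1)])
   show "compose (carr ?R) m (act ?R K S) = compose (carr ?R) (act i K S) m"
   proof (rule op_eq_on_L[OF a i ci I bdd_ops_compose[OF cR cR ci Sb mb] bdd_ops_compose[OF cR ci ci mb Si]])
    fix \<xi> \<psi> assume \<xi>: "\<xi> : \<H> a I" and \<psi>: "\<psi> : carr i"
    note \<xi>M = field_mono(1)[OF I M IM \<xi> a]
    let ?b = "field a \<mu> I \<xi>"
    have bM: "field a \<mu> M \<xi> = ?b" by (rule field_mono(2)[OF I M IM \<xi> a])
    have BM: "?b : BQ N E Q M" using fB[OF \<xi>M] bM by simp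
    have pb: "p M ?b = p I ?b" by (rule BA_moduleD(4)[OF p I M IM fB[OF \<xi>]])
    note bb = field_bdd[OF reg I \<xi>]
    have comm: "compose (carr a) ?b (act a K S) = compose (carr a) (act a K S) ?b"
     using loc[OF field_loc[OF reg I \<xi>] a a] S unfolding Hom_loc_def by blast
    note AM = act_BQ[OF M SM, folded actM[OF a]]
    note pM = star_repD(4)[OF BA_moduleD(2)[OF p M]]
    have pact': "p M (act a K S) = act i K S" using pact[OF M SM] actM[OF a] actM[OF i] by simp
    have "compose (carr i) (p I ?b) (act i K S) = compose (carr i) (act i K S) (p I ?b)"
     using pM[OF BM AM] pM[OF AM BM] comm unfolding pact' pb by simp
    from fun_cong[OF this, of \<psi>] have c: "p I ?b (act i K S \<psi>) = act i K S (p I ?b \<psi>)" using \<psi> by (simp add: compose_eq)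
    have L: "Lop E a i \<xi> I \<psi> : carr ?R" by (rule op_carr[OF L_bdd[OF a i I \<xi>] \<psi>])
    have "act ?R K S (Lop E a i \<xi> I \<psi>) = Lop E a i \<xi> I (act i K S \<psi>)"
     using Hom_loc_act[OF i K loc[OF LR_loc(1)[OF a i I \<xi>] i R] S \<psi>] by simp
    then show "compose (carr ?R) m (act ?R K S) (Lop E a i \<xi> I \<psi>) = compose (carr ?R) (act i K S) m (Lop E a i \<xi> I \<psi>)"
     using L c mL[OF I \<xi> \<psi>] mL[OF I \<xi> op_carr[OF Si \<psi>]] by (simp add: compose_eq)
   qed
  qed
 qed
 have I: "arg_arc 0 1 : \<J>" by (rule arg_arc_in) (use pi_gt3 in auto)
 define I where "I = arg_arc 0 1"
 note I = I[folded I_def]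
 note fI = fst_arg_interval[OF I] and mL = mL[OF I] and pD = star_repD[OF BA_moduleD(2)[OF p I]]
 have unit: "compose (carr (vac N \<otimes> i)) m (rwhisk E (vac N) a \<iota> i) = lunit E i"
 proof (rule op_eq_on_L[OF vac_mod i ci I])
  have rb: "rwhisk E (vac N) a \<iota> i : bdd_ops (vac N \<otimes> i) ?R" by (rule Hom_A_bdd[OF rwhisk_Hom(1)[OF vac_mod a i \<iota>]])
  show "compose (carr (vac N \<otimes> i)) m (rwhisk E (vac N) a \<iota> i) : bdd_ops (vac N \<otimes> i) i"
   by (rule bdd_ops_compose[OF cmp[OF vi] cR ci rb mb])
  show "lunit E i : bdd_ops (vac N \<otimes> i) i" by (rule Hom_A_bdd[OF unit_Hom(1)[OF i]])
  fix \<zeta> \<psi> assume \<zeta>: "\<zeta> : \<H> (vac N) I" and \<psi>: "\<psi> : carr i"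
  obtain x where x: "x : alg N (fst I)" "\<zeta> = x (Omega N)" using \<zeta> Haag_duality[OF fI] by (metis bdd_vecsE)
  have L: "Lop E (vac N) i \<zeta> I \<psi> : carr (vac N \<otimes> i)" by (rule op_carr[OF L_bdd[OF vac_mod i I \<zeta>] \<psi>])
  have "rwhisk E (vac N) a \<iota> i (Lop E (vac N) i \<zeta> I \<psi>) = Lop E a i (\<iota> (x (Omega N))) I \<psi>"
   using L_morphism[OF vac_mod a i \<iota> I \<zeta> \<psi>] x by simp
  then have "m (rwhisk E (vac N) a \<iota> i (Lop E (vac N) i \<zeta> I \<psi>)) = act i (fst I) x \<psi>"
   using mL[OF alg_vec(1)[OF I x(1)] \<psi>] field_alg[OF reg I x(1)] pact[OF I x(1)] by simp
  then show "compose (carr (vac N \<otimes> i)) m (rwhisk E (vac N) a \<iota> i) (Lop E (vac N) i \<zeta> I \<psi>) = lunit E i (Lop E (vac N) i \<zeta> I \<psi>)"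
   using L L_of_alg[OF i I x(1) \<psi>] x(2) by (simp add: compose_eq)
 qed
 let ?A = "compose (carr ?P) (lwhisk E a ?R i m) (assoc E a a i)" and ?C = "rwhisk E (a \<otimes> a) a \<mu> i"
 have lb: "lwhisk E a ?R i m : bdd_ops (a \<otimes> ?R) ?R" by (rule Hom_A_bdd[OF lwhisk_Hom(1)[OF a R i m]])
 have sb: "assoc E a a i : bdd_ops ?P (a \<otimes> ?R)" by (rule Hom_A_bdd[OF assoc_Hom(1)[OF a a i]])
 have Ab: "?A : bdd_ops ?P ?R" by (rule bdd_ops_compose[OF cP cmp[OF aR] cR sb lb])
 have Cb: "?C : bdd_ops ?P ?R" by (rule Hom_A_bdd[OF rwhisk_Hom(1)[OF aa a i \<mu>]])
 have assoc: "compose (carr ?P) m ?A = compose (carr ?P) m ?C"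
 proof (rule op_eq_on_LL[OF i ci I bdd_ops_compose[OF cP cR ci Ab mb] bdd_ops_compose[OF cP cR ci Cb mb]])
  fix \<xi> \<eta> \<psi> assume \<xi>: "\<xi> : \<H> a I" and \<eta>: "\<eta> : \<H> a I" and \<psi>: "\<psi> : carr i"
  let ?v = "Lop E (a \<otimes> a) i (Lop E a a \<xi> I \<eta>) I \<psi>"
  note \<zeta> = L_of_L(1)[OF a a i I \<xi> \<eta>]
  have v: "?v : carr ?P" by (rule op_carr[OF L_bdd[OF aa i I \<zeta>] \<psi>])
  have w: "Lop E a i \<eta> I \<psi> : carr ?R" by (rule op_carr[OF L_bdd[OF a i I \<eta>] \<psi>])
  have "m (?A ?v) = m (Lop E a i \<xi> I (m (Lop E a i \<eta> I \<psi>)))"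
   using L_of_L(2)[OF a a i I \<xi> \<eta> \<psi>] L_natural(1)[OF a R i m I \<xi> w] v by (simp add: compose_eq)
  also have "... = p I (field a \<mu> I \<xi>) (p I (field a \<mu> I \<eta>) \<psi>)"
   unfolding mL[OF \<eta> \<psi>] by (rule mL[OF \<xi> op_carr[OF pD(1)[OF fB[OF \<eta>]] \<psi>]])
  also have "... = p I (field a \<mu> I (field a \<mu> I \<xi> \<eta>)) \<psi>"
   unfolding field_mult(2)[OF I \<xi> \<eta> reg] pD(4)[OF fB[OF \<xi>] fB[OF \<eta>]] using \<psi> by (simp add: compose_eq)
  also have "... = m (Lop E a i (field a \<mu> I \<xi> \<eta>) I \<psi>)" by (rule mL[OF field_mult(1)[OF I \<xi> \<eta>] \<psi>, symmetric])
  also have "Lop E a i (field a \<mu> I \<xi> \<eta>) I \<psi> = ?C ?v"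
   using L_morphism[OF aa a i \<mu> I \<zeta> \<psi>] field_eq[OF reg I bv_carr[OF \<eta>]] by simp
  finally show "compose (carr ?P) m ?A ?v = compose (carr ?P) m ?C ?v" using v by (simp add: compose_eq)
 qed
 have Ca: "adj ?P ?R ?C = rwhisk E a (a \<otimes> a) (adj (a \<otimes> a) a \<mu>) i" by (rule rwhisk_Hom(2)[OF aa a i \<mu>])
 note \<mu>' = Hom_A_adj[OF N aa a \<mu>] and Cab = adj_bdd[OF cP cR Cb] and mab = adj_bdd[OF cR ci mb]
 have "compose (carr ?R) ?A (adj ?P ?R ?C) = compose (carr ?R) (adj ?R i m) m"
 proof (rule op_eq_on_L[OF a i cR I bdd_ops_compose[OF cR cP cR Cab Ab] bdd_ops_compose[OF cR ci cR mb mab]])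
  fix \<xi> \<psi> assume \<xi>: "\<xi> : \<H> a I" and \<psi>: "\<psi> : carr i"
  let ?\<zeta> = "adj (a \<otimes> a) a \<mu> \<xi>" and ?w = "Lop E a i \<xi> I \<psi>"
  have \<zeta>: "?\<zeta> : \<H> (a \<otimes> a) I"
   by (rule bdd_vecs_map[OF N a aa fI Hom_A_loc[OF \<mu>' iopp_in_intervals[OF fI]] \<xi>])
  have w: "?w : carr ?R" by (rule op_carr[OF L_bdd[OF a i I \<xi>] \<psi>])
  let ?v = "Lop E (a \<otimes> a) i ?\<zeta> I \<psi>"
  have v: "?v : carr ?P" by (rule op_carr[OF L_bdd[OF aa i I \<zeta>] \<psi>])
  have Cw: "adj ?P ?R ?C ?w = ?v" unfolding Ca using L_morphism[OF a aa i \<mu>' I \<xi> \<psi>] by simp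
  have "?A ?v = adj ?R i m (m ?w)"
  proof (rule vec_eq_on_L[OF a i I op_carr[OF Ab v] op_carr[OF mab op_carr[OF mb w]]])
   fix \<eta> \<theta> assume \<eta>: "\<eta> : \<H> a I" and \<theta>: "\<theta> : carr i"
   note Lb = L_bdd[OF a i I \<eta>] and b\<eta> = field_bdd[OF reg I \<eta>] and p\<eta> = pD(1)[OF fB[OF \<eta>]] and p\<xi> = pD(1)[OF fB[OF \<xi>]]
   have sv: "assoc E a a i ?v : carr (a \<otimes> ?R)" by (rule op_carr[OF sb v])
   let ?\<eta>' = "adj a (a \<otimes> a) (Lop E a a \<eta> I) ?\<zeta>"
   have \<eta>': "?\<eta>' : \<H> a I" by (rule L_of_adj_L(1)[OF a a i I \<eta> \<zeta>])
   have Av: "?A ?v : carr ?R" by (rule op_carr[OF Ab v])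
   have "hip ?R (Lop E a i \<eta> I \<theta>) (?A ?v) = hip i \<theta> (adj i ?R (Lop E a i \<eta> I) (?A ?v))"
    by (rule adj_right[OF ci cR Lb \<theta> Av, symmetric])
   also have "adj i ?R (Lop E a i \<eta> I) (?A ?v) = m (adj ?R (a \<otimes> ?R) (Lop E a ?R \<eta> I) (assoc E a a i ?v))"
    using L_adj_natural[OF a R i m I \<eta> sv] v by (simp add: compose_eq)
   also have "... = m (Lop E a i ?\<eta>' I \<psi>)" using L_of_adj_L(2)[OF a a i I \<eta> \<zeta> \<psi>] by simp
   also have "... = p I (field a \<mu> I ?\<eta>') \<psi>" by (rule mL[OF \<eta>' \<psi>])
   also have "?\<eta>' = adj a a (field a \<mu> I \<eta>) \<xi>"
    unfolding field_def using adj_compose[OF ca cmp[OF aa] ca L_bdd[OF a a I \<eta>] Hom_A_bdd[OF \<mu>]] bv_carr[OF \<xi>] by (simp add: compose_eq)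
   also have "field a \<mu> I (adj a a (field a \<mu> I \<eta>) \<xi>) = compose (carr a) (adj a a (field a \<mu> I \<eta>)) (field a \<mu> I \<xi>)"
   proof -
    note ad = field_adj[OF reg I \<eta>]
    show ?thesis unfolding ad(2) by (rule field_mult(2)[OF I ad(1) \<xi> reg])
   qed
   also have "p I (compose (carr a) (adj a a (field a \<mu> I \<eta>)) (field a \<mu> I \<xi>)) \<psi> = adj i i (p I (field a \<mu> I \<eta>)) (p I (field a \<mu> I \<xi>) \<psi>)"
    unfolding pD(4)[OF BQ_adj[OF I fB[OF \<eta>]] fB[OF \<xi>]] pD(5)[OF fB[OF \<eta>]] using \<psi> by (simp add: compose_eq)
   also have "hip i \<theta> ... = hip i (p I (field a \<mu> I \<eta>) \<theta>) (p I (field a \<mu> I \<xi>) \<psi>)"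
    by (rule adj_right[OF ci ci p\<eta> \<theta> op_carr[OF p\<xi> \<psi>]])
   also have "... = hip i (m (Lop E a i \<eta> I \<theta>)) (m ?w)" unfolding mL[OF \<eta> \<theta>] mL[OF \<xi> \<psi>] ..
   also have "... = hip ?R (Lop E a i \<eta> I \<theta>) (adj ?R i m (m ?w))"
    by (rule adj_right[OF cR ci mb op_carr[OF Lb \<theta>] op_carr[OF mb w], symmetric])
   finally show "hip ?R (Lop E a i \<eta> I \<theta>) (?A ?v) = hip ?R (Lop E a i \<eta> I \<theta>) (adj ?R i m (m ?w))" .
  qed
  then show "compose (carr ?R) ?A (adj ?P ?R ?C) ?w = compose (carr ?R) (adj ?R i m) m ?w" using w Cw v by (simp add: compose_eq)
 qed
 note AC = this
 have "?C (adj ?P ?R ?A w) = adj ?R i m (m w)" if w: "w : carr ?R" for w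
 proof (rule adjoint_square_swap[OF cP cR ci Cb Ab mb _ w])
  show "?A (adj ?P ?R ?C v) = adj ?R i m (m v)" if "v : carr ?R" for v using fun_cong[OF AC, of v] that by (simp add: compose_eq)
 qed
 then have "compose (carr ?R) ?C (adj ?P ?R ?A) = compose (carr ?R) (adj ?R i m) m" by (simp add: compose_def fun_eq_iff)
 then have "commutes_adjointly ?P ?R ?R i ?C ?A m m" using assoc unfolding commutes_adjointly_def by blast
 then show ?thesis using i m unit unfolding left_modules_def Let_def mem_Collect_eq case_prod_conv by blast
qed

lemma BA_of_left_bij: "bij_betw (BA_of_left N E Q) (left_modules N E Q) (BA_modules N a (BQ N E Q))"
 unfolding bij_betw_def
proof (intro conjI inj_onI equalityI subsetI)
 have I: "arg_arc 0 1 : \<J>" by (rule arg_arc_in) (use pi_gt3 in auto)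
 fix X Y assume XY: "X : left_modules N E Q" "Y : left_modules N E Q" and eq: "BA_of_left N E Q X = BA_of_left N E Q Y"
 obtain i m j n where *: "X = (i, m)" "Y = (j, n)" by (metis surj_pair)
 note X = XY(1)[unfolded *] and Y = XY(2)[unfolded *]
 have ij: "j = i" and r: "field_rep i m = field_rep j n" using eq BA_of_left_eq[OF X] BA_of_left_eq[OF Y] by (auto simp: *)
 have "m = n"
  by (rule field_determines[OF left_moduleD(1)[OF X] Hom_A_bdd[OF left_moduleD(2)[OF X]] Hom_A_bdd[OF left_moduleD(2)[OF Y], unfolded ij] I])
   (use field_rep_field[OF I, of _ i] r ij in metis)
 then show "X = Y" using ij * by simp
next
 fix Z assume "Z : BA_of_left N E Q ` left_modules N E Q"
 then show "Z : BA_modules N a (BQ N E Q)" using BA_of_left_eq field_rep_BA_module by fastforce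
next
 fix Z assume Z: "Z : BA_modules N a (BQ N E Q)"
 obtain i p where ip: "Z = (i, p)" by (cases Z)
 note p = Z[unfolded ip]
 obtain m where m: "m : bdd_ops (a \<otimes> i) i"
  "!!I \<xi>. I : \<J> ==> \<xi> : \<H> a I ==> field i m I \<xi> = p I (field a \<mu> I \<xi>)"
  using multiplication_exists[OF p] by blast
 have X: "(i, m) : left_modules N E Q" by (rule multiplication_left_module[OF p m])
 have "corresponds N E Q (i, m) p"
  unfolding corresponds_def case_prod_conv using p m(2) by (simp add: field_def)
 then have "BA_of_left N E Q (i, m) = Z" using corresponds_iff[OF X] BA_of_left_eq[OF X] ip by simp
 then show "Z : BA_of_left N E Q ` left_modules N E Q" using X by (metis imageI)
qed

lemma Hom_left_Hom_BA:
 assumes "X \<in> left_modules N E Q" "Y \<in> left_modules N E Q"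
 shows "Hom_left N E Q X Y = Hom_BA (BQ N E Q) (BA_of_left N E Q X) (BA_of_left N E Q Y)"
proof -
 obtain i m j n where *: "X = (i, m)" "Y = (j, n)" by (metis surj_pair)
 show ?thesis using assms Hom_left_eq_Hom_BA BA_of_left_eq unfolding * by simp
qed

lemma Rep_BA_cstar_category: "cstar_category (Rep_BA N a (BQ N E Q))"
 unfolding Rep_BA_def
proof (rule cstar_category_intertwiners[where S = "Sigma \<J> (BQ N E Q)"
   and \<rho> = "\<lambda>X s. snd X (fst s) (snd s)" and star = "\<lambda>s. (fst s, adj a a (snd s))"])
 fix X assume "X : BA_modules N a (BQ N E Q)"
 then have X: "(fst X, snd X) : BA_modules N a (BQ N E Q)" by simp
 show "complete_ips (fst X)" by (rule cmp[OF BA_moduleD(1)[OF X]])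
 fix s assume "s : Sigma \<J> (BQ N E Q)"
 then have s: "fst s : \<J>" "snd s : BQ N E Q (fst s)" by auto
 note r = star_repD[OF BA_moduleD(2)[OF X s(1)]]
 show "snd X (fst s) (snd s) : bdd_ops (fst X) (fst X)" by (rule r(1)[OF s(2)])
 show "snd X (fst (fst s, adj a a (snd s))) (snd (fst s, adj a a (snd s))) = adj (fst X) (fst X) (snd X (fst s) (snd s))"
  using r(5)[OF s(2)] by simp
next
 fix s assume "s : Sigma \<J> (BQ N E Q)"
 then show "(fst s, adj a a (snd s)) : Sigma \<J> (BQ N E Q)" using BQ_adj by auto
next
 fix X Y :: "'v amod \<times> 'v bact"
 show "Hom_BA (BQ N E Q) X Y = intertwiners (fst X) (fst Y) (Sigma \<J> (BQ N E Q))
   (\<lambda>s. snd X (fst s) (snd s)) (\<lambda>s. snd Y (fst s) (snd s))"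
  using Hom_BA_intertwiners[of "BQ N E Q" "fst X" "snd X" "fst Y" "snd Y"] by simp
qed

lemma Rep_left_cstar_category: "cstar_category (Rep_left N E Q)"
 unfolding Rep_left_def
proof (rule cstar_category_intertwiners[where S = "Sigma \<J> (BQ N E Q)"
   and \<rho> = "\<lambda>X s. field_rep (fst X) (snd X) (fst s) (snd s)" and star = "\<lambda>s. (fst s, adj a a (snd s))"])
 fix X assume "X : left_modules N E Q"
 then have X: "(fst X, snd X) : left_modules N E Q" by simp
 show "complete_ips (fst X)" by (rule cmp[OF left_moduleD(1)[OF X]])
 fix s assume "s : Sigma \<J> (BQ N E Q)"
 then have s: "fst s : \<J>" "snd s : BQ N E Q (fst s)" by auto
 note r = star_repD[OF BA_moduleD(2)[OF field_rep_BA_module[OF X] s(1)]]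
 show "field_rep (fst X) (snd X) (fst s) (snd s) : bdd_ops (fst X) (fst X)" by (rule r(1)[OF s(2)])
 show "field_rep (fst X) (snd X) (fst (fst s, adj a a (snd s))) (snd (fst s, adj a a (snd s))) = adj (fst X) (fst X) (field_rep (fst X) (snd X) (fst s) (snd s))"
  using r(5)[OF s(2)] by simp
next
 fix s assume "s : Sigma \<J> (BQ N E Q)"
 then show "(fst s, adj a a (snd s)) : Sigma \<J> (BQ N E Q)" using BQ_adj by auto
next
 fix X Y assume XY: "X : left_modules N E Q" "Y : left_modules N E Q"
 then have "Hom_left N E Q (fst X, snd X) (fst Y, snd Y) = Hom_BA (BQ N E Q) (fst X, field_rep (fst X) (snd X)) (fst Y, field_rep (fst Y) (snd Y))"
  by (intro Hom_left_eq_Hom_BA) simp_all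
 then show "Hom_left N E Q X Y = intertwiners (fst X) (fst Y) (Sigma \<J> (BQ N E Q))
   (\<lambda>s. field_rep (fst X) (snd X) (fst s) (snd s)) (\<lambda>s. field_rep (fst Y) (snd Y) (fst s) (snd s))"
  unfolding Hom_BA_intertwiners by simp
qed

lemma cstar_iso: "cstar_category_iso (Rep_left N E Q) (Rep_BA N a (BQ N E Q)) (BA_of_left N E Q) (\<lambda>X Y T. T)"
 unfolding Rep_left_def Rep_BA_def
proof (rule bij_operator_category_iso[OF Rep_left_cstar_category[unfolded Rep_left_def] Rep_BA_cstar_category[unfolded Rep_BA_def] BA_of_left_bij])
 show "fst (BA_of_left N E Q X) = fst X" for X by (simp add: BA_of_left_def)
qed (rule Hom_left_Hom_BA)

end

theorem theorem1:
  fixes N :: "'v net" and E :: "'v cat_ext" and Q :: "'v frob"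
  assumes "irreducible_moebius_net N"
    and "categorical_extension N E"
    and "cstar_frobenius_algebra N E Q"
  shows "(\<forall>X\<in>left_modules N E Q. \<exists>!p. corresponds N E Q X p) \<and>
         (\<forall>X\<in>left_modules N E Q. \<forall>Y\<in>left_modules N E Q.
            Hom_left N E Q X Y = Hom_BA (BQ N E Q) (BA_of_left N E Q X) (BA_of_left N E Q Y)) \<and>
         cstar_category_iso (Rep_left N E Q) (Rep_BA N (fobj Q) (BQ N E Q))
           (BA_of_left N E Q) (\<lambda>X Y T. T)"
proof -
  interpret frobenius_extension N E Q by unfold_locales (rule assms)+
  have "\<exists>!p. corresponds N E Q X p" if "X \<in> left_modules N E Q" for X
    using corresponds_iff[of "fst X" "snd X"] that by auto
  then show ?thesis using Hom_left_Hom_BA cstar_iso by blast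
qed

end
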